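(* For every $R>0$ there exists $\alpha=\alpha(R)>0$ such that the following holds. Let $k\ge 2$, let $f\in C^k(\mathbb{R}^{n\times 2})$ be a real-valued function with $$\|f-\mathcal{A}\|_{C^2(B_{2R}(0))}\le\alpha,$$ and let $\mathcal{U}:\Omega\to\mathbb{R}^{2n+2}$ be a Lipschitz map with $\|D\mathcal{U}\|_{L^\infty(\Omega)}\le R$ and $$D\mathcal{U}(x)\in C_f\quad\text{for a.e. }x\in\Omega.$$ Then $\mathcal{U}\in C^{k-1,\rho}_{\mathrm{loc}}(\Omega)$ for some $\rho$ with $0<\rho<1$.
   Context: Throughout, $n\ge 1$ is fixed and $\Omega\subset\mathbb{R}^2$ is a bounded, convex, open set. $\|\cdot\|$ denotes the Euclidean (Hilbert–Schmidt) norm on matrices, and $B_r(0)$ is the open ball of radius $r$ centered at $0$ in $\mathbb{R}^{n\times 2}$. For $X\in\mathbb{R}^{n\times 2}$, $X^{ab}$ is the $2\times 2$ submatrix of $X$ formed by its $a$-th and $b$-th rows. The area function $\mathcal{A}:\mathbb{R}^{n\times 2}\to\mathbb{R}$ is $$\mathcal{A}(X)=\sqrt{1+\|X\|^2+\sum_{1\le a\le b\le n}\det(X^{ab})^2}.$$ Put $J=\begin{pmatrix}0&1\\ -1&0\end{pmatrix}$. For a $C^1$ function $f:\mathbb{R}^{n\times 2}\to\mathbb{R}$ with gradient $Df(X)\in\mathbb{R}^{n\times 2}$, $$C_f=\left\{\begin{pmatrix}X\\ Df(X)J\\ X^TDf(X)J-f(X)J\end{pmatrix}: X\in\mathbb{R}^{n\times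 2}\right\}\subset\mathbb{R}^{(2n+2)\times 2}.$$ *)

theory Defs
  imports "HOL-Analysis.Analysis" "HOL-Probability.Essential_Supremum"
begin

text \<open>
  An \<open>n \<times> 2\<close> matrix is an element of \<^typ>\<open>real^2^'n\<close> (index type = rows). The library norm and
  inner product on this type are the Hilbert--Schmidt ones. The row index type carries a linear
  order so that pairs of rows \<open>a \<le> b\<close> make sense. The \<open>2n + 2\<close> coordinates of the target
  space are indexed by the sum type \<open>'n + 'n + 2\<close>.
\<close>

definition row_pair :: "real^2^'n \<Rightarrow> 'n \<Rightarrow> 'n \<Rightarrow> real^2^2" where
  "row_pair X a b = vector [X $ a, X $ b]"

definition area :: "real^2^('n::{finite,linorder}) \<Rightarrow> real" where
  "area X = sqrt (1 + (norm X)\<^sup>2 + (\<Sum>(a, b)\<in>{(a, b). a \<le> b}. (det (row_pair X a b))\<^sup>2))"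

definition J_mat :: "real^2^2" where
  "J_mat = vector [vector [0, 1], vector [-1, 0]]"

text \<open>The gradient as the matrix of partial derivatives with respect to the entries.\<close>

definition mat_grad :: "(real^2^'n \<Rightarrow> real) \<Rightarrow> real^2^'n \<Rightarrow> real^2^'n" where
  "mat_grad f X = (\<chi> i j. frechet_derivative f (at X) (axis i (axis j 1)))"

definition stack3 :: "real^2^'n \<Rightarrow> real^2^'n \<Rightarrow> real^2^2 \<Rightarrow> real^2^('n + 'n + 2)" where
  "stack3 X Y Z =
     (\<chi> r. case r of Inl a \<Rightarrow> X $ a | Inr (Inl b) \<Rightarrow> Y $ b | Inr (Inr c) \<Rightarrow> Z $ c)"

definition C_set :: "(real^2^('n::finite) \<Rightarrow> real) \<Rightarrow> (real^2^('n + 'n + 2)) set" where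
  "C_set f = {stack3 X (mat_grad f X ** J_mat)
                (transpose X ** mat_grad f X ** J_mat - f X *\<^sub>R J_mat) | X. True}"

text \<open>
  Iterated partial derivatives. A list of standard basis vectors plays the role of a multi-index;
  its last entry is differentiated first.
\<close>

primrec iter_deriv ::
  "('a::euclidean_space \<Rightarrow> 'b::real_normed_vector) \<Rightarrow> 'a list \<Rightarrow> 'a \<Rightarrow> 'b" where
  "iter_deriv g [] = g"
| "iter_deriv g (v # vs) = (\<lambda>x. frechet_derivative (iter_deriv g vs) (at x) v)"

text \<open>
  \<open>Ck_on k S g\<close>: the map \<open>g\<close> is of class \<open>C\<^sup>k\<close> on \<open>S\<close>. In this and the next two definitions,
  \<open>S\<close> is meant to be open.
\<close>

definition Ck_on ::
  "nat \<Rightarrow> ('a::euclidean_space) set \<Rightarrow> ('a \<Rightarrow> 'b::real_normed_vector) \<Rightarrow> bool" where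
  "Ck_on k S g \<longleftrightarrow>
     (\<forall>vs. set vs \<subseteq> Basis \<and> length vs < k \<longrightarrow> (\<forall>x\<in>S. iter_deriv g vs differentiable (at x))) \<and>
     (\<forall>vs. set vs \<subseteq> Basis \<and> length vs \<le> k \<longrightarrow> continuous_on S (iter_deriv g vs))"

text \<open>
  The \<open>C\<^sup>k(S)\<close> norm: the largest supremum over \<open>S\<close> of a partial derivative of order at most \<open>k\<close>.
  It takes values in the extended nonnegative reals, so an unbounded derivative gives \<open>\<infinity>\<close>.
\<close>

definition Ck_norm ::
  "nat \<Rightarrow> ('a::euclidean_space) set \<Rightarrow> ('a \<Rightarrow> 'b::real_normed_vector) \<Rightarrow> ennreal" where
  "Ck_norm k S g =
     (SUP vs\<in>{vs. set vs \<subseteq> Basis \<and> length vs \<le> k}. SUP x\<in>S. ennreal (norm (iter_deriv g vs x)))"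

text \<open>
  The local Hoelder class \<open>C\<^sup>k\<^sup>,\<^sup>\<rho>\<close>: only the derivatives of top order need a Hoelder condition,
  since the lower ones are of class \<open>C\<^sup>1\<close> and hence Lipschitz on compact subsets.
\<close>

definition Ck_holder_loc ::
  "nat \<Rightarrow> real \<Rightarrow> ('a::euclidean_space) set \<Rightarrow> ('a \<Rightarrow> 'b::real_normed_vector) \<Rightarrow> bool" where
  "Ck_holder_loc k \<rho> S g \<longleftrightarrow>
     Ck_on k S g \<and>
     (\<forall>K vs. compact K \<and> K \<subseteq> S \<and> set vs \<subseteq> Basis \<and> length vs = k \<longrightarrow>
        (\<exists>C. \<forall>x\<in>K. \<forall>y\<in>K. norm (iter_deriv g vs x - iter_deriv g vs y) \<le> C * dist x y powr \<rho>))"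

text \<open>
  The \<open>L\<^sup>\<infinity>(S)\<close> norm. It is extended-real-valued; on a null set \<open>S\<close> the library's essential
  supremum is \<open>-\<infinity>\<close>, which is harmless for upper bounds.
\<close>

definition Linf_norm ::
  "('a::euclidean_space) set \<Rightarrow> ('a \<Rightarrow> 'b::real_normed_vector) \<Rightarrow> ereal" where
  "Linf_norm S g = esssup (lebesgue_on S) (\<lambda>x. ereal (norm (g x)))"

end

theory Submission
  imports Defs
begin

text \<open>
  Write the inclusion as \<open>\<nabla>U = \<Phi>(\<nabla>U)\<close>, where \<open>\<Phi>\<close> depends on the block \<open>X\<close> only. There is an
  antisymmetric form \<open>B\<close> such that \<open>Q z = B z\<^sub>1 z\<^sub>2\<close> is coercive on differences of elements of \<open>C\<^sub>f\<close>:
  for the area function, the lowest block is \<open>- h J\<close> with \<open>h\<close> positive definite of determinant 1, so the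
  determinant of its increment is at most \<open>- c |\<Delta>h|\<^sup>2\<close>, and a large multiple of it absorbs the terms which
  spoil the positivity of the inner product of \<open>\<Delta>X\<close> and \<open>\<Delta>D\<A>(X)\<close>. The increments of \<open>\<Phi>\<close> dominate those
  of \<open>X\<close>, so coercivity survives a small \<open>C\<^sup>2\<close> perturbation of the area.

  Since \<open>Q(\<nabla>V)\<close> is a null Lagrangian, coercivity applied to \<open>V = U(\<cdot> + s) - U - P s\<close> yields a Caccioppoli
  inequality without further structure of the equation. Hole filling turns it into a decay of the
  translates of \<open>\<nabla>U\<close>, hence of its mean oscillation, at a rate better than \<open>r\<^sup>2\<close>, which is the condition of
  Campanato for Hoelder continuity of \<open>\<nabla>U\<close>. The same argument, with error terms, applies to difference
  quotients and to the linearised equation \<open>\<nabla>Z = T(x) \<nabla>Z + G(x)\<close> of the derivatives, and induction on the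
  order of differentiability concludes.
\<close>

section \<open>Locally bounded functions and their integrals\<close>

text \<open>The area is in general not convex, so the inner product of the increments of X and of
  its gradient has no sign; the third block is there to repair this. Its source is the matrix h =
  area * (I + X^T X)^(-1): the gradient of the area is X h, and the increment of X h has a good part
  \<Delta>X h and a bad part X \<Delta>h, which the determinant of the lowest block controls. The
  gradient of \<open>U\<close> exists only almost everywhere, with no regularity beyond boundedness.
  Therefore everything is done with translates and finite differences of Lipschitz functions, and
  all integrands are locally bounded Borel functions on bounded sets; neither Sobolev spaces nor
  mollifiers enter. The estimates are later applied to difference quotients, whose Lipschitz
  constants blow up as the step shrinks. This dictates the order of quantifiers: constants may
  depend on bounds of the function and on coercivity, never on its Lipschitz constant. The Hoelder
  exponent shrinks from one stage to the next, which is harmless because only some exponent is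
  claimed.\<close>

definition lbm :: "('a::euclidean_space \<Rightarrow> 'b::euclidean_space) \<Rightarrow> bool" where
  "lbm f \<longleftrightarrow> f \<in> borel_measurable borel \<and> (\<forall>r. \<exists>M. \<forall>x. norm x \<le> r \<longrightarrow> norm (f x) \<le> M)"

lemma lbm_measurable: "lbm f \<Longrightarrow> f \<in> borel_measurable borel"
  by (simp add: lbm_def)

lemma lbm_bound:
  assumes "lbm f" "bounded S"
  obtains M where "\<And>x. x \<in> S \<Longrightarrow> norm (f x) \<le> M" "M \<ge> 0"
proof -
  obtain r where r: "\<And>x. x \<in> S \<Longrightarrow> norm x \<le> r" using assms(2) by (auto simp: bounded_iff)
  obtain M where "\<And>x. norm x \<le> r \<Longrightarrow> norm (f x) \<le> M" using assms(1) unfolding lbm_def by metis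
  then show ?thesis using r that[of "max M 0"] by (meson max.cobounded2 max.coboundedI1)
qed

lemma lbm_I:
  assumes "f \<in> borel_measurable borel" "\<And>r. \<exists>M. \<forall>x. norm x \<le> r \<longrightarrow> norm (f x) \<le> M"
  shows "lbm f"
  using assms by (simp add: lbm_def)

lemma lbm_bounded:
  assumes "f \<in> borel_measurable borel" "\<And>x. norm (f x) \<le> M"
  shows "lbm f"
  using assms by (auto simp: lbm_def)

lemma lbm_continuous:
  assumes "continuous_on UNIV f" shows "lbm f"
proof (rule lbm_I)
  show "f \<in> borel_measurable borel" using assms by (rule borel_measurable_continuous_onI)
  fix r
  have "compact (f ` cball 0 r)"
    using assms by (intro compact_continuous_image) (auto intro: continuous_on_subset)
  then have "bounded (f ` cball 0 r)" by (rule compact_imp_bounded)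
  then show "\<exists>M. \<forall>x. norm x \<le> r \<longrightarrow> norm (f x) \<le> M"
    unfolding bounded_iff by (metis imageI mem_cball_0)
qed

lemma lbm_const [intro, simp]: "lbm (\<lambda>x. c)"
  by (auto simp: lbm_def)

text \<open>A continuous function is bounded on a product of closed balls. Hence the class is closed
  under all pointwise operations below, and integrability over bounded sets becomes a syntactic
  check.\<close>

lemma lbm_binop:
  assumes f: "lbm f" and g: "lbm g"
    and h: "continuous_on UNIV (\<lambda>(x, y). h x y)"
  shows "lbm (\<lambda>x. h (f x) (g x))"
proof (rule lbm_I)
  have [measurable]: "f \<in> borel_measurable borel" "g \<in> borel_measurable borel"
    using f g by (auto simp: lbm_measurable)
  have "(\<lambda>x. (\<lambda>(x, y). h x y) (f x, g x)) \<in> borel_measurable borel"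
    by (rule borel_measurable_continuous_on[OF h]) simp
  then show "(\<lambda>x. h (f x) (g x)) \<in> borel_measurable borel" by simp
  fix r
  obtain M1 where M1: "\<And>x. x \<in> cball 0 r \<Longrightarrow> norm (f x) \<le> M1" using lbm_bound[OF f bounded_cball] by metis
  obtain M2 where M2: "\<And>x. x \<in> cball 0 r \<Longrightarrow> norm (g x) \<le> M2" using lbm_bound[OF g bounded_cball] by metis
  have "compact ((\<lambda>(x, y). h x y) ` (cball 0 M1 \<times> cball 0 M2))"
    by (intro compact_continuous_image continuous_on_subset[OF h] compact_Times) auto
  then have "bounded ((\<lambda>(x, y). h x y) ` (cball 0 M1 \<times> cball 0 M2))" by (rule compact_imp_bounded)
  then obtain M where "\<And>a b. norm a \<le> M1 \<Longrightarrow> norm b \<le> M2 \<Longrightarrow> norm (h a b) \<le> M"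
    unfolding bounded_iff by force
  then show "\<exists>M. \<forall>x. norm x \<le> r \<longrightarrow> norm (h (f x) (g x)) \<le> M"
    using M1 M2 by (intro exI[of _ M]) auto
qed

lemma lbm_unop:
  assumes f: "lbm f" and h: "continuous_on UNIV h"
  shows "lbm (\<lambda>x. h (f x))"
  using lbm_binop[OF f f, of "\<lambda>x y. h x"] h
  by (simp add: case_prod_unfold continuous_on_compose2[OF h continuous_on_fst[OF continuous_on_id]])

lemma lbm_add: "lbm f \<Longrightarrow> lbm g \<Longrightarrow> lbm (\<lambda>x. f x + g x)"
  by (rule lbm_binop) (auto simp: case_prod_unfold intro!: continuous_intros)
lemma lbm_diff: "lbm f \<Longrightarrow> lbm g \<Longrightarrow> lbm (\<lambda>x. f x - g x)"
  by (rule lbm_binop) (auto simp: case_prod_unfold intro!: continuous_intros)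
lemma lbm_scaleR: "lbm f \<Longrightarrow> lbm g \<Longrightarrow> lbm (\<lambda>x. f x *\<^sub>R g x)"
  by (rule lbm_binop) (auto simp: case_prod_unfold intro!: continuous_intros)
lemma lbm_mult: "lbm f \<Longrightarrow> lbm g \<Longrightarrow> lbm (\<lambda>x. f x * g x :: real)"
  by (rule lbm_binop) (auto simp: case_prod_unfold intro!: continuous_intros)
lemma lbm_inner: "lbm f \<Longrightarrow> lbm g \<Longrightarrow> lbm (\<lambda>x. f x \<bullet> g x :: real)"
  by (rule lbm_binop) (auto simp: case_prod_unfold intro!: continuous_intros)
lemma lbm_Pair: "lbm f \<Longrightarrow> lbm g \<Longrightarrow> lbm (\<lambda>x. (f x, g x))"
  by (rule lbm_binop) (auto simp: case_prod_unfold intro!: continuous_intros)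
lemma lbm_fst: "lbm f \<Longrightarrow> lbm (\<lambda>x. fst (f x))"
  by (rule lbm_unop) (auto intro!: continuous_intros)
lemma lbm_snd: "lbm f \<Longrightarrow> lbm (\<lambda>x. snd (f x))"
  by (rule lbm_unop) (auto intro!: continuous_intros)
lemma lbm_norm: "lbm f \<Longrightarrow> lbm (\<lambda>x. norm (f x))"
  by (rule lbm_unop) (auto intro!: continuous_intros)
lemma lbm_power: "lbm f \<Longrightarrow> lbm (\<lambda>x. f x ^ n :: real)"
  by (rule lbm_unop) (auto intro!: continuous_intros)
lemma lbm_abs: "lbm f \<Longrightarrow> lbm (\<lambda>x. \<bar>f x\<bar> :: real)"
  by (rule lbm_unop) (auto intro!: continuous_intros)
lemma lbm_bilinear:
  assumes "bounded_bilinear B" "lbm f" "lbm g" shows "lbm (\<lambda>x. B (f x) (g x))"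
  by (rule lbm_binop[OF assms(2,3)])
    (auto simp: case_prod_unfold intro!: bounded_bilinear.continuous_on[OF assms(1)] continuous_intros)
lemma lbm_shift:
  assumes "lbm f" shows "lbm (\<lambda>x. f (x + s))"
proof (rule lbm_I)
  have [measurable]: "f \<in> borel_measurable borel" using assms by (simp add: lbm_measurable)
  show "(\<lambda>x. f (x + s)) \<in> borel_measurable borel" by measurable
  fix r
  obtain M where "\<And>x. x \<in> cball 0 (r + norm s) \<Longrightarrow> norm (f x) \<le> M" using lbm_bound[OF assms bounded_cball] by metis
  then have "\<forall>x. norm x \<le> r \<longrightarrow> norm (f (x + s)) \<le> M"
    by (metis add_right_mono mem_cball_0 norm_triangle_le)
  then show "\<exists>M. \<forall>x. norm x \<le> r \<longrightarrow> norm (f (x + s)) \<le> M" ..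
qed

lemmas lbm_intros = lbm_const lbm_add lbm_diff lbm_scaleR lbm_mult lbm_inner lbm_Pair lbm_fst lbm_snd
  lbm_norm lbm_power lbm_abs

section \<open>Integration over bounded Borel sets\<close>

definition bset :: "('a::euclidean_space) set \<Rightarrow> bool" where
  "bset A \<longleftrightarrow> bounded A \<and> A \<in> sets borel"

lemma bset_Int [intro]: "bset A \<Longrightarrow> bset B \<Longrightarrow> bset (A \<inter> B)"
  by (auto simp: bset_def intro: bounded_subset)
lemma bset_Un [intro]: "bset A \<Longrightarrow> bset B \<Longrightarrow> bset (A \<union> B)"
  by (auto simp: bset_def)
lemma bset_Diff [intro]: "bset A \<Longrightarrow> bset B \<Longrightarrow> bset (A - B)"
  by (auto simp: bset_def intro: bounded_subset)
lemma bset_cbox [intro, simp]: "bset (cbox a b)"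
  by (auto simp: bset_def)
lemma bset_compact: "compact K \<Longrightarrow> bset K"
  by (auto simp: bset_def compact_imp_bounded compact_imp_closed borel_closed)

lemma bset_shift [intro]:
  fixes A :: "('a::euclidean_space) set"
  assumes "bset A" shows "bset ((+) s ` A)"
proof -
  have "(+) s ` A = (\<lambda>x. x - s) -` A \<inter> space borel" by force
  moreover have "(\<lambda>x. x - s) -` A \<inter> space borel \<in> sets borel"
    using assms by (intro measurable_sets[of _ borel borel]) (auto simp: bset_def)
  ultimately show ?thesis using assms bounded_translation[of A s] by (simp add: bset_def)
qed

abbreviation ig :: "('a::euclidean_space) set \<Rightarrow> ('a \<Rightarrow> 'b::euclidean_space) \<Rightarrow> 'b" where
  "ig A f \<equiv> set_lebesgue_integral lborel A f"

lemma ig_integrable: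
  assumes "bset A" "lbm f" shows "set_integrable lborel A f"
proof -
  obtain M where M: "\<And>x. x \<in> A \<Longrightarrow> norm (f x) \<le> M" "M \<ge> 0" using lbm_bound[of f A] assms by (auto simp: bset_def)
  have [measurable]: "f \<in> borel_measurable borel" "A \<in> sets borel" using assms by (auto simp: lbm_measurable bset_def)
  have "emeasure lborel A < \<infinity>" using assms(1) unfolding bset_def by (blast intro: emeasure_bounded_finite)
  note fin = this
  show ?thesis unfolding set_integrable_def
    apply (rule Bochner_Integration.integrable_bound[of lborel "\<lambda>x. M * indicator A x"])
    subgoal by (intro integrable_mult_right integrable_real_indicator) (use fin in auto)
    subgoal by measurable
    subgoal using M by (auto simp: indicator_def)
    done
qed

lemma ig_mono_AE:
  fixes f g :: "'a::euclidean_space \<Rightarrow> real"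
  assumes "bset A" "lbm f" "lbm g" "AE x in lborel. x \<in> A \<longrightarrow> f x \<le> g x"
  shows "ig A f \<le> ig A g"
  using assms by (intro set_integral_mono_AE ig_integrable) auto

lemma ig_mono:
  fixes f g :: "'a::euclidean_space \<Rightarrow> real"
  assumes "bset A" "lbm f" "lbm g" "\<And>x. x \<in> A \<Longrightarrow> f x \<le> g x"
  shows "ig A f \<le> ig A g"
  using assms by (intro ig_mono_AE) auto

lemma ig_nonneg:
  fixes f :: "'a::euclidean_space \<Rightarrow> real"
  assumes "\<And>x. x \<in> A \<Longrightarrow> 0 \<le> f x"
  shows "0 \<le> ig A f"
  unfolding set_lebesgue_integral_def by (rule integral_nonneg_AE) (use assms in \<open>auto simp: indicator_def\<close>)

lemma ig_add: "bset A \<Longrightarrow> lbm f \<Longrightarrow> lbm g \<Longrightarrow> ig A (\<lambda>x. f x + g x) = ig A f + ig A g"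
  by (rule set_integral_add) (auto intro: ig_integrable)
lemma ig_diff: "bset A \<Longrightarrow> lbm f \<Longrightarrow> lbm g \<Longrightarrow> ig A (\<lambda>x. f x - g x) = ig A f - ig A g"
  by (rule set_integral_diff) (auto intro: ig_integrable)
lemma ig_cmult: fixes f :: "'a::euclidean_space \<Rightarrow> real" shows "ig A (\<lambda>x. c * f x) = c * ig A f"
  by (rule set_integral_mult_right)
lemma ig_const: "bset A \<Longrightarrow> ig A (\<lambda>x. c) = measure lborel A *\<^sub>R c"
  unfolding bset_def by (subst set_integral_const) (use emeasure_bounded_finite[of A] in \<open>auto simp: less_top\<close>)

lemma ig_mono_set:
  fixes f :: "'a::euclidean_space \<Rightarrow> real"
  assumes "bset A" "bset B" "lbm f" "\<And>x. 0 \<le> f x" "A \<subseteq> B"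
  shows "ig A f \<le> ig B f"
  unfolding set_lebesgue_integral_def
  using ig_integrable[OF assms(1,3)] ig_integrable[OF assms(2,3)] assms(4,5)
  by (intro integral_mono) (auto simp: set_integrable_def indicator_def)

lemma ig_Diff:
  fixes f :: "'a::euclidean_space \<Rightarrow> real"
  assumes "bset A" "bset B" "lbm f" "A \<subseteq> B"
  shows "ig (B - A) f = ig B f - ig A f"
proof -
  have "ig (A \<union> (B - A)) f = ig A f + ig (B - A) f"
    using assms by (intro set_integral_Un) (auto intro: ig_integrable)
  moreover have "A \<union> (B - A) = B" using assms(4) by auto
  ultimately show ?thesis by simp
qed

lemma ig_Un_le:
  fixes f :: "'a::euclidean_space \<Rightarrow> real"
  assumes "bset A" "bset B" "lbm f" "\<And>x. 0 \<le> f x"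
  shows "ig (A \<union> B) f \<le> ig A f + ig B f"
proof -
  have "ig (A \<union> (B - A)) f = ig A f + ig (B - A) f"
    using assms by (intro set_integral_Un) (auto intro: ig_integrable)
  also have "ig (B - A) f \<le> ig B f" using assms by (intro ig_mono_set) auto
  finally show ?thesis by (simp add: Un_Diff_cancel)
qed

lemma lborel_integral_shift:
  fixes f :: "'a::euclidean_space \<Rightarrow> 'b::euclidean_space"
  assumes "f \<in> borel_measurable borel"
  shows "(\<integral>x. f (x + s) \<partial>lborel) = (\<integral>x. f x \<partial>lborel)"
proof -
  have "(\<integral>x. f x \<partial>lborel) = (\<integral>x. f x \<partial>distr lborel borel ((+) s))"
    by (simp add: lborel_distr_plus)
  also have "\<dots> = (\<integral>x. f (s + x) \<partial>lborel)"
    using assms by (intro integral_distr) auto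
  finally show ?thesis by (simp add: add.commute)
qed

lemma AE_lborel_shift:
  fixes s :: "'a::euclidean_space"
  assumes "AE x in lborel. P x" shows "AE x in lborel. P (x + s)"
proof -
  have "AE x in distr lborel borel ((+) s). P x" unfolding lborel_distr_plus by (rule assms)
  then have "AE x in lborel. P (s + x)" by (rule AE_distrD[rotated]) simp
  then show ?thesis by (simp add: add.commute)
qed

lemma ig_shift:
  fixes f :: "'a::euclidean_space \<Rightarrow> 'b::euclidean_space"
  assumes "bset A" "lbm f"
  shows "ig ((+) s ` A) f = ig A (\<lambda>x. f (x + s))"
proof -
  have [measurable]: "f \<in> borel_measurable borel" "(+) s ` A \<in> sets borel"
    using assms bset_shift[OF assms(1)] by (auto simp: lbm_measurable bset_def)
  have "indicator ((+) s ` A) (x + s) = (indicator A x :: real)" for x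
    by (auto simp: indicator_def image_iff add.commute)
  then have "ig A (\<lambda>x. f (x + s)) = (\<integral>x. indicator ((+) s ` A) (x + s) *\<^sub>R f (x + s) \<partial>lborel)"
    by (simp add: set_lebesgue_integral_def)
  also have "\<dots> = (\<integral>x. indicator ((+) s ` A) x *\<^sub>R f x \<partial>lborel)"
    by (rule lborel_integral_shift[of "\<lambda>x. indicator ((+) s ` A) x *\<^sub>R f x"]) measurable
  finally show ?thesis by (simp add: set_lebesgue_integral_def)
qed

lemma ig_DCT:
  fixes f :: "'a::euclidean_space \<Rightarrow> 'b::euclidean_space"
  assumes A: "bset A" and f: "lbm f" and F: "\<And>n. lbm (F n)"
    and lim: "AE x in lborel. x \<in> A \<longrightarrow> (\<lambda>n. F n x) \<longlonglongrightarrow> f x"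
    and bd: "\<And>n x. x \<in> A \<Longrightarrow> norm (F n x) \<le> M"
  shows "(\<lambda>n. ig A (F n)) \<longlonglongrightarrow> ig A f"
  unfolding set_lebesgue_integral_def
proof (rule integral_dominated_convergence[where w="\<lambda>x. indicator A x * M"])
  have [measurable]: "A \<in> sets borel" "f \<in> borel_measurable borel" "\<And>n. F n \<in> borel_measurable borel"
    using assms by (auto simp: bset_def lbm_measurable)
  show "(\<lambda>x. indicat_real A x *\<^sub>R f x) \<in> borel_measurable lborel"
    "\<And>i. (\<lambda>x. indicat_real A x *\<^sub>R F i x) \<in> borel_measurable lborel" by measurable
  show "integrable lborel (\<lambda>x. indicator A x * M)"
    using ig_integrable[OF A lbm_const[of M]] by (simp add: set_integrable_def)
  show "AE x in lborel. (\<lambda>i. indicat_real A x *\<^sub>R F i x) \<longlonglongrightarrow> indicat_real A x *\<^sub>R f x"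
    using lim by eventually_elim (auto simp: indicator_def)
  show "AE x in lborel. norm (indicat_real A x *\<^sub>R F i x) \<le> indicat_real A x * M" for i
    using bd by (auto simp: indicator_def)
qed

lemma ig_measure_finite: "bset A \<Longrightarrow> emeasure lborel A < \<infinity>"
  unfolding bset_def by (blast intro: emeasure_bounded_finite)

section \<open>Null Lagrangians\<close>

abbreviation e1 :: "real^2" where "e1 \<equiv> axis 1 1"
abbreviation e2 :: "real^2" where "e2 \<equiv> axis 2 1"

text \<open>A linear map on the plane is stored as the pair of its values at \<open>e1\<close> and \<open>e2\<close>.\<close>

definition dmap :: "'b::euclidean_space \<times> 'b \<Rightarrow> real^2 \<Rightarrow> 'b" where
  "dmap z v = v $ 1 *\<^sub>R fst z + v $ 2 *\<^sub>R snd z"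

lemma dmap_e [simp]: "dmap z e1 = fst z" "dmap z e2 = snd z"
  by (auto simp: dmap_def axis_def)

lemma norm_real2: "norm (v::real^2) = sqrt ((v $ 1)\<^sup>2 + (v $ 2)\<^sup>2)"
  by (simp add: norm_vec_def L2_set_def UNIV_2)

lemma norm_dmap_le: "norm (dmap z v) \<le> norm v * norm z"
proof -
  have "norm (dmap z v) \<le> \<bar>v $ 1\<bar> * norm (fst z) + \<bar>v $ 2\<bar> * norm (snd z)"
    unfolding dmap_def by (rule order.trans[OF norm_triangle_ineq]) simp
  also have "\<dots> = (\<bar>v $ 1\<bar>, \<bar>v $ 2\<bar>) \<bullet> (norm (fst z), norm (snd z))" by simp
  also have "\<dots> \<le> norm (\<bar>v $ 1\<bar>, \<bar>v $ 2\<bar>) * norm (norm (fst z), norm (snd z))"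
    by (rule norm_cauchy_schwarz)
  also have "\<dots> = norm v * norm z"
    by (simp add: norm_Pair norm_real2 norm_prod_def)
  finally show ?thesis .
qed

lemma bounded_linear_dmap: "bounded_linear (dmap z)"
proof (rule bounded_linear_intro[where K="norm z"])
  show "dmap z (x + y) = dmap z x + dmap z y" for x y
    by (simp add: dmap_def scaleR_add_left)
  show "dmap z (r *\<^sub>R x) = r *\<^sub>R dmap z x" for r x
    by (simp add: dmap_def scaleR_add_right)
qed (rule norm_dmap_le)

lemma dmap_add: "dmap (y + z) v = dmap y v + dmap z v"
  and dmap_diff: "dmap (y - z) v = dmap y v - dmap z v"
  and dmap_scaleR: "dmap (c *\<^sub>R z) v = c *\<^sub>R dmap z v"
  and dmap_0 [simp]: "dmap 0 v = 0"
  by (auto simp: dmap_def algebra_simps)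

lemma dmap_diff_right: "dmap z (u - v) = dmap z u - dmap z v"
  and dmap_add_right: "dmap z (u + v) = dmap z u + dmap z v"
  and dmap_scaleR_right: "dmap z (c *\<^sub>R v) = c *\<^sub>R dmap z v"
  by (auto simp: dmap_def algebra_simps)

lemma linear_eq_dmap:
  assumes "linear T" shows "T = dmap (T e1, T e2)"
proof
  fix v :: "real^2"
  have "v = v $ 1 *\<^sub>R e1 + v $ 2 *\<^sub>R e2"
    by (simp add: vec_eq_iff axis_def forall_2)
  then have "T v = T (v $ 1 *\<^sub>R e1 + v $ 2 *\<^sub>R e2)" by (rule arg_cong)
  also have "\<dots> = dmap (T e1, T e2) v"
    by (simp add: dmap_def linear_add[OF assms] linear_cmul[OF assms])
  finally show "T v = dmap (T e1, T e2) v" .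
qed

lemma dmap_inj: "dmap y = dmap z \<Longrightarrow> y = z"
  by (metis dmap_e prod_eq_iff)

lemma lbm_dmap:
  assumes "lbm g" shows "lbm (\<lambda>x. dmap (g x) v)"
  unfolding dmap_def by (intro lbm_intros assms)

section \<open>Difference quotients of Lipschitz functions\<close>

lemma diff_quot_tendsto:
  fixes W :: "real^2 \<Rightarrow> 'b::euclidean_space"
  assumes "(W has_derivative dmap z) (at x)"
  shows "(\<lambda>n. real (Suc n) *\<^sub>R (W (x + inverse (real (Suc n)) *\<^sub>R u) - W x)) \<longlonglongrightarrow> dmap z u"
proof (rule metric_LIMSEQ_I)
  fix e :: real assume "e > 0"
  define e' where "e' = e / (2 * (norm u + 1))"
  have "e' > 0" using \<open>e > 0\<close> by (simp add: e'_def add_nonneg_pos)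
  then obtain d where d: "d > 0" "\<And>y. norm (y - x) < d \<Longrightarrow> norm (W y - W x - dmap z (y - x)) \<le> e' * norm (y - x)"
    using assms unfolding has_derivative_at_alt by metis
  have "(\<lambda>n. inverse (real (Suc n)) * norm u) \<longlonglongrightarrow> 0 * norm u"
    by (intro tendsto_intros LIMSEQ_inverse_real_of_nat)
  then have "\<forall>\<^sub>F n in sequentially. inverse (real (Suc n)) * norm u < d"
    using d(1) by (auto dest: order_tendstoD(2)[of _ _ _ d])
  then obtain N where N: "\<And>n. n \<ge> N \<Longrightarrow> inverse (real (Suc n)) * norm u < d"
    unfolding eventually_sequentially by auto
  have "dist (real (Suc n) *\<^sub>R (W (x + inverse (real (Suc n)) *\<^sub>R u) - W x)) (dmap z u) < e" if "n \<ge> N" for n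
  proof -
    define m where "m = real (Suc n)"
    have m: "m > 0" by (simp add: m_def)
    let ?y = "x + inverse m *\<^sub>R u"
    have ny: "norm (?y - x) = inverse m * norm u" using m by simp
    have "m *\<^sub>R (W ?y - W x) - dmap z u = m *\<^sub>R (W ?y - W x - dmap z (?y - x))"
      using m by (simp add: dmap_scaleR_right scaleR_diff_right)
    then have "norm (m *\<^sub>R (W ?y - W x) - dmap z u) = m * norm (W ?y - W x - dmap z (?y - x))"
      using m by simp
    also have "\<dots> \<le> m * (e' * (inverse m * norm u))"
      using d(2)[of ?y] N[OF that] m unfolding ny m_def[symmetric] by (intro mult_left_mono) auto
    also have "\<dots> = e' * norm u" using m by simp
    also have "\<dots> < e" unfolding e'_def using \<open>e > 0\<close>
      by (simp add: divide_simps add_nonneg_pos)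
    finally show ?thesis by (simp add: dist_norm m_def)
  qed
  then show "\<exists>N. \<forall>n\<ge>N. dist (real (Suc n) *\<^sub>R (W (x + inverse (real (Suc n)) *\<^sub>R u) - W x)) (dmap z u) < e"
    by blast
qed

lemma lipschitz_quot_bound:
  fixes W :: "'a::real_normed_vector \<Rightarrow> 'b::real_normed_vector"
  assumes "L-lipschitz_on UNIV W" "m > 0"
  shows "norm (m *\<^sub>R (W (x + inverse m *\<^sub>R u) - W x)) \<le> L * norm u"
proof -
  have "norm (W (x + inverse m *\<^sub>R u) - W x) \<le> L * norm (inverse m *\<^sub>R u)"
    using lipschitz_onD[OF assms(1), of "x + inverse m *\<^sub>R u" x] by (simp add: dist_norm)
  then have "m * norm (W (x + inverse m *\<^sub>R u) - W x) \<le> m * (L * norm (inverse m *\<^sub>R u))"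
    using assms(2) by (intro mult_left_mono) auto
  moreover have "norm (m *\<^sub>R (W (x + inverse m *\<^sub>R u) - W x)) = m * norm (W (x + inverse m *\<^sub>R u) - W x)"
    using assms(2) by simp
  moreover have "m * (L * norm (inverse m *\<^sub>R u)) = L * norm u" using assms(2) by simp
  ultimately show ?thesis by linarith
qed

text \<open>Central quotients are chosen because the discrete identity of
  \<open>null_lagrangian_cdq\<close> is then exact: the relative shifts occurring in its two halves
  are the same up to order, which fails for one-sided quotients.\<close>

definition cdq :: "(real^2 \<Rightarrow> 'b::euclidean_space) \<Rightarrow> real^2 \<Rightarrow> nat \<Rightarrow> real^2 \<Rightarrow> 'b" where
  "cdq W u n x = (real (Suc n) / 2) *\<^sub>R (W (x + inverse (real (Suc n)) *\<^sub>R u) - W (x - inverse (real (Suc n)) *\<^sub>R u))"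

lemma cdq_tendsto:
  assumes "(W has_derivative dmap z) (at x)"
  shows "(\<lambda>n. cdq W u n x) \<longlonglongrightarrow> dmap z u"
proof -
  have "(\<lambda>n. (1/2) *\<^sub>R (real (Suc n) *\<^sub>R (W (x + inverse (real (Suc n)) *\<^sub>R u) - W x)
      - real (Suc n) *\<^sub>R (W (x + inverse (real (Suc n)) *\<^sub>R (- u)) - W x))) \<longlonglongrightarrow> (1/2) *\<^sub>R (dmap z u - dmap z (- u))"
    by (intro tendsto_intros diff_quot_tendsto assms)
  moreover have "(1/2) *\<^sub>R (dmap z u - dmap z (- u)) = dmap z u"
    using dmap_scaleR_right[of z "-1" u] by (simp add: scaleR_add_left[symmetric] flip: scaleR_scaleR)
  moreover have "(1/2) *\<^sub>R (real (Suc n) *\<^sub>R (W (x + inverse (real (Suc n)) *\<^sub>R u) - W x)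
      - real (Suc n) *\<^sub>R (W (x + inverse (real (Suc n)) *\<^sub>R (- u)) - W x)) = cdq W u n x" for n
    by (simp add: cdq_def scaleR_diff_right[symmetric])
  ultimately show ?thesis by simp
qed

lemma cdq_bound:
  assumes "L-lipschitz_on UNIV W" 
  shows "norm (cdq W u n x) \<le> L * norm u"
proof -
  define m where "m = real (Suc n)"
  have m: "m > 0" by (simp add: m_def)
  have "norm (W (x + inverse m *\<^sub>R u) - W (x - inverse m *\<^sub>R u)) \<le> L * (2 * inverse m * norm u)"
    using lipschitz_onD[OF assms, of "x + inverse m *\<^sub>R u" "x - inverse m *\<^sub>R u"] m
    by (simp add: dist_norm flip: scaleR_add_left)
  then have "m / 2 * norm (W (x + inverse m *\<^sub>R u) - W (x - inverse m *\<^sub>R u)) \<le> m / 2 * (L * (2 * inverse m * norm u))"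
    using m by (intro mult_left_mono) auto
  moreover have "m / 2 * (L * (2 * inverse m * norm u)) = L * norm u" using m by simp
  moreover have "norm (cdq W u n x) = m / 2 * norm (W (x + inverse m *\<^sub>R u) - W (x - inverse m *\<^sub>R u))"
    unfolding cdq_def m_def[symmetric] using m by simp
  ultimately show ?thesis by linarith
qed

lemma lbm_lipschitz: 
  fixes W :: "'a::euclidean_space \<Rightarrow> 'b::euclidean_space"
  shows "L-lipschitz_on UNIV W \<Longrightarrow> lbm W"
  by (intro lbm_continuous lipschitz_on_continuous_on)

lemma lbm_cdq: "lbm W \<Longrightarrow> lbm (cdq W u n)"
  unfolding cdq_def using lbm_shift[of W "- (inverse (real (Suc n)) *\<^sub>R u)"]
  by (intro lbm_scaleR lbm_const lbm_diff lbm_shift) simp_all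

lemma integrable_lbm_support:
  fixes f :: "'a::euclidean_space \<Rightarrow> 'b::euclidean_space"
  assumes "lbm f" "bset A" "\<And>x. x \<notin> A \<Longrightarrow> f x = 0"
  shows "integrable lborel f" "(\<integral>x. f x \<partial>lborel) = ig A f"
proof -
  have "(\<lambda>x. indicator A x *\<^sub>R f x) = f" using assms(3) by (auto simp: indicator_def)
  then show "integrable lborel f" "(\<integral>x. f x \<partial>lborel) = ig A f"
    using ig_integrable[OF assms(2,1)] by (auto simp: set_integrable_def set_lebesgue_integral_def)
qed

text \<open>Discrete integration by parts. Translation invariance reduces the integral of each
  product of shifted functions to the correlation of \<phi> and W at the difference of the two
  shifts, and the eight correlations cancel in pairs.\<close>

lemma null_lagrangian_cdq:
  fixes \<phi> W :: "real^2 \<Rightarrow> 'b::euclidean_space" and B :: "'b \<Rightarrow> 'b \<Rightarrow> real"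
  assumes B: "bounded_bilinear B" and \<phi>: "lbm \<phi>" and W: "lbm W"
    and supp: "\<And>x. norm x > r \<Longrightarrow> \<phi> x = 0"
  shows "(\<integral>x. B (cdq \<phi> e1 n x) (cdq W e2 n x) - B (cdq \<phi> e2 n x) (cdq W e1 n x) \<partial>lborel) = 0"
proof -
  interpret bounded_bilinear B by fact
  define h where "h = inverse (real (Suc n))"
  have int: "integrable lborel (\<lambda>x. B (\<phi> (x + a)) (W (x + b)))" for a b
  proof (rule integrable_lbm_support(1))
    show "lbm (\<lambda>x. B (\<phi> (x + a)) (W (x + b)))"
      by (intro lbm_bilinear[OF B] lbm_shift \<phi> W)
    show "bset (cball 0 (r + norm a))" by (auto intro: bset_compact)
    show "B (\<phi> (x + a)) (W (x + b)) = 0" if "x \<notin> cball 0 (r + norm a)" for x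
    proof -
      have "norm (x + a) > r" using that norm_triangle_ineq4[of "x + a" a] by simp
      then show ?thesis by (simp add: supp zero_left)
    qed
  qed
  define J where "J b = (\<integral>x. B (\<phi> x) (W (x + b)) \<partial>lborel)" for b
  have J: "(\<integral>x. B (\<phi> (x + a)) (W (x + b)) \<partial>lborel) = J (b - a)" for a b
  proof -
    have "(\<integral>x. (\<lambda>x. B (\<phi> x) (W (x + (b - a)))) (x + a) \<partial>lborel) = J (b - a)"
      unfolding J_def by (rule lborel_integral_shift)
        (intro lbm_measurable lbm_bilinear[OF B] lbm_shift \<phi> W)
    then show ?thesis by (simp add: algebra_simps)
  qed
  define c where "c = (real (Suc n) / 2)\<^sup>2"
  define T where "T a b x = B (\<phi> (x + a)) (W (x + b))" for a b x
  have T: "integrable lborel (T a b)" "(\<integral>x. T a b x \<partial>lborel) = J (b - a)" for a b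
    using int J unfolding T_def by auto
  let ?p = "h *\<^sub>R e1" and ?q = "h *\<^sub>R e2"
  have "B (cdq \<phi> e1 n x) (cdq W e2 n x) - B (cdq \<phi> e2 n x) (cdq W e1 n x) =
    c * (T ?p ?q x - T ?p (- ?q) x - T (- ?p) ?q x + T (- ?p) (- ?q) x
     - (T ?q ?p x - T ?q (- ?p) x - T (- ?q) ?p x + T (- ?q) (- ?p) x))" for x
    unfolding cdq_def c_def T_def h_def[symmetric]
    by (simp add: scaleR_left scaleR_right diff_left diff_right power2_eq_square algebra_simps del: of_nat_Suc)
  then have "(\<integral>x. B (cdq \<phi> e1 n x) (cdq W e2 n x) - B (cdq \<phi> e2 n x) (cdq W e1 n x) \<partial>lborel) =
    (\<integral>x. c * (T ?p ?q x - T ?p (- ?q) x - T (- ?p) ?q x + T (- ?p) (- ?q) x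
     - (T ?q ?p x - T ?q (- ?p) x - T (- ?q) ?p x + T (- ?q) (- ?p) x)) \<partial>lborel)" by simp
  also have "\<dots> = c * (J (?q - ?p) - J (- ?q - ?p) - J (?q + ?p) + J (- ?q + ?p)
     - (J (?p - ?q) - J (- ?p - ?q) - J (?p + ?q) + J (- ?p + ?q)))"
    using T by (simp add: Bochner_Integration.integral_add Bochner_Integration.integral_diff)
  also have "\<dots> = 0"
  proof -
    have "J (- ?p - ?q) = J (- ?q - ?p)" "J (- ?p + ?q) = J (?q - ?p)" "J (- ?q + ?p) = J (?p - ?q)"
      "J (?p + ?q) = J (?q + ?p)"
      by (simp_all add: add.commute minus_diff_commute)
    then show ?thesis by (auto simp: algebra_simps)
  qed
  finally show ?thesis .
qed

text \<open>The exact discrete identity survives the limit by dominated convergence, since the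
  Lipschitz constants bound all quotients. The divergence structure is thus obtained for functions
  that are differentiable only almost everywhere.\<close>

lemma null_lagrangian:
  fixes \<phi> W :: "real^2 \<Rightarrow> 'b::euclidean_space" and B :: "'b \<Rightarrow> 'b \<Rightarrow> real"
  assumes B: "bounded_bilinear B" and \<phi>: "M-lipschitz_on UNIV \<phi>" and W: "L-lipschitz_on UNIV W"
    and K: "compact K" "\<And>x. x \<notin> K \<Longrightarrow> \<phi> x = 0" "\<And>x. x \<notin> K \<Longrightarrow> g\<phi> x = 0"
    and g: "lbm g\<phi>" "lbm gW"
    and d\<phi>: "AE x in lborel. x \<in> K \<longrightarrow> (\<phi> has_derivative dmap (g\<phi> x)) (at x)"
    and dW: "AE x in lborel. x \<in> K \<longrightarrow> (W has_derivative dmap (gW x)) (at x)"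
  shows "ig K (\<lambda>x. B (fst (g\<phi> x)) (snd (gW x)) - B (snd (g\<phi> x)) (fst (gW x))) = 0"
proof -
  interpret bounded_bilinear B by fact
  obtain r where r: "\<And>x. x \<in> K \<Longrightarrow> norm x \<le> r" using compact_imp_bounded[OF K(1)] by (auto simp: bounded_iff)
  obtain C where C: "\<And>a b. norm (B a b) \<le> norm a * norm b * C" "C > 0" using pos_bounded by metis
  define F where "F n x = B (cdq \<phi> e1 n x) (cdq W e2 n x) - B (cdq \<phi> e2 n x) (cdq W e1 n x)" for n x
  define f where "f x = B (fst (g\<phi> x)) (snd (gW x)) - B (snd (g\<phi> x)) (fst (gW x))" for x
  have lf: "lbm f" unfolding f_def by (intro lbm_diff lbm_bilinear[OF B] lbm_fst lbm_snd g)
  have lF: "lbm (F n)" for n unfolding F_def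
    by (intro lbm_diff lbm_bilinear[OF B] lbm_cdq lbm_lipschitz[OF W] lbm_lipschitz[OF \<phi>])
  have A: "bset (cball (0::real^2) (r + 1))" by (auto intro: bset_compact)
  have F0: "F n x = 0" if x: "x \<notin> cball 0 (r + 1)" for n x
  proof -
    have "norm (inverse (real (Suc n)) *\<^sub>R axis i (1::real)) \<le> 1" for i :: 2
      by (simp add: norm_axis_1 divide_simps)
    then have "norm (x + inverse (real (Suc n)) *\<^sub>R axis i 1) > r" "norm (x - inverse (real (Suc n)) *\<^sub>R axis i 1) > r" for i
      using x norm_triangle_ineq4[of "x + inverse (real (Suc n)) *\<^sub>R axis i 1" "inverse (real (Suc n)) *\<^sub>R axis i 1"]
        norm_triangle_ineq[of "x - inverse (real (Suc n)) *\<^sub>R axis i 1" "inverse (real (Suc n)) *\<^sub>R axis i 1"]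
      by (auto simp del: norm_scaleR of_nat_Suc) (smt (verit))+
    then have "\<phi> (x + inverse (real (Suc n)) *\<^sub>R axis i 1) = 0" "\<phi> (x - inverse (real (Suc n)) *\<^sub>R axis i 1) = 0" for i
      using K(2) r by (meson not_less)+
    then show ?thesis by (simp add: F_def cdq_def zero_left)
  qed
  have "(\<lambda>n. ig (cball 0 (r + 1)) (F n)) \<longlonglongrightarrow> ig (cball 0 (r + 1)) f"
  proof (rule ig_DCT[OF A lf lF])
    show "AE x in lborel. x \<in> cball 0 (r + 1) \<longrightarrow> (\<lambda>n. F n x) \<longlonglongrightarrow> f x"
      using d\<phi> dW
    proof eventually_elim
      fix x assume x: "x \<in> K \<longrightarrow> (\<phi> has_derivative dmap (g\<phi> x)) (at x)" "x \<in> K \<longrightarrow> (W has_derivative dmap (gW x)) (at x)"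
      show "x \<in> cball 0 (r + 1) \<longrightarrow> (\<lambda>n. F n x) \<longlonglongrightarrow> f x"
      proof (cases "x \<in> K")
        case True
        then have d: "(\<phi> has_derivative dmap (g\<phi> x)) (at x)" "(W has_derivative dmap (gW x)) (at x)" using x by auto
        have "(\<lambda>n. F n x) \<longlonglongrightarrow> B (dmap (g\<phi> x) e1) (dmap (gW x) e2) - B (dmap (g\<phi> x) e2) (dmap (gW x) e1)"
          unfolding F_def by (intro tendsto_intros tendsto cdq_tendsto d)
        then show ?thesis by (simp add: f_def)
      next
        case False
        \<comment> \<open>No derivative is given outside \<open>K\<close>. There the integrand is 0
          for all large \<open>n\<close>, because \<open>K\<close> is closed and \<phi> vanishes
          near \<open>x\<close>.\<close>
        have op: "open (- K)" using K(1) by (simp add: compact_imp_closed open_Compl)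
        then obtain d where d: "d > 0" "ball x d \<subseteq> - K" using False by (meson ComplI open_contains_ball)
        have "\<forall>\<^sub>F n in sequentially. inverse (real (Suc n)) < d"
          using order_tendstoD(2)[OF LIMSEQ_inverse_real_of_nat d(1)] .
        then have "\<forall>\<^sub>F n in sequentially. F n x = 0"
        proof eventually_elim
          case (elim n)
          then have "x + inverse (real (Suc n)) *\<^sub>R axis i 1 \<in> ball x d" "x - inverse (real (Suc n)) *\<^sub>R axis i 1 \<in> ball x d" for i
            by (auto simp: dist_norm norm_axis_1)
          then have "\<phi> (x + inverse (real (Suc n)) *\<^sub>R axis i 1) = 0" "\<phi> (x - inverse (real (Suc n)) *\<^sub>R axis i 1) = 0" for i
            using d(2) K(2) by blast+
          then show ?case by (simp add: F_def cdq_def zero_left)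
        qed
        then have "(\<lambda>n. F n x) \<longlonglongrightarrow> 0" by (rule tendsto_eventually)
        moreover have "f x = 0" using K(3)[OF False] by (simp add: f_def zero_left)
        ultimately show ?thesis by simp
      qed
    qed
    show "norm (F n x) \<le> 2 * (M * L * C)" for n x
    proof -
      have "M \<ge> 0" "L \<ge> 0" using \<phi> W by (auto dest: lipschitz_on_nonneg)
      have "norm (B (cdq \<phi> u n x) (cdq W v n x)) \<le> M * L * C" if "norm u = 1" "norm v = 1" for u v
      proof -
        have "norm (B (cdq \<phi> u n x) (cdq W v n x)) \<le> norm (cdq \<phi> u n x) * norm (cdq W v n x) * C" by (rule C)
        also have "\<dots> \<le> (M * norm u) * (L * norm v) * C"
          using C(2) \<open>M \<ge> 0\<close> \<open>L \<ge> 0\<close> by (intro mult_mono cdq_bound[OF \<phi>] cdq_bound[OF W]) auto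
        finally show ?thesis using that by simp
      qed
      from this[of e1 e2] this[of e2 e1] show ?thesis
        unfolding F_def by (intro order.trans[OF norm_triangle_ineq4]) (simp add: norm_axis_1)
    qed
  qed
  moreover have "ig (cball 0 (r + 1)) (F n) = 0" for n
    using integrable_lbm_support(2)[OF lF A F0] null_lagrangian_cdq[OF B lbm_lipschitz[OF \<phi>] lbm_lipschitz[OF W], of r n] K(2) r
    unfolding F_def by (metis not_less)
  ultimately have "ig (cball 0 (r + 1)) f = 0" by (simp add: LIMSEQ_const_iff)
  moreover have "f x = 0" if "x \<notin> K" for x using K(3)[OF that] by (simp add: f_def zero_left)
  then have "ig K f = (\<integral>x. f x \<partial>lborel)" "ig (cball 0 (r + 1)) f = (\<integral>x. f x \<partial>lborel)"
    using integrable_lbm_support(2)[OF lf bset_compact[OF K(1)]] integrable_lbm_support(2)[OF lf A] r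
    by (auto simp: subset_eq) (smt (verit) mem_cball_0)
  ultimately show ?thesis unfolding f_def by simp
qed

section \<open>The Caccioppoli inequality\<close>

text \<open>Closed squares of half side \<open>r\<close> replace discs: their measure is explicit,
  and a square annulus is a union of rectangles, on which a Poincare inequality is
  available.\<close>

definition Sq :: "real^2 \<Rightarrow> real \<Rightarrow> (real^2) set" where
  "Sq x r = {y. \<forall>i. \<bar>y $ i - x $ i\<bar> \<le> r}"

lemma Sq_cbox: "Sq x r = cbox (\<chi> i. x $ i - r) (\<chi> i. x $ i + r)"
  by (auto simp: Sq_def mem_box_cart abs_le_iff algebra_simps)

lemma mem_Sq: "y \<in> Sq x r \<longleftrightarrow> \<bar>y $ 1 - x $ 1\<bar> \<le> r \<and> \<bar>y $ 2 - x $ 2\<bar> \<le> r"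
  by (simp add: Sq_def forall_2)

lemma lbm_indicator: "bset A \<Longrightarrow> lbm (\<lambda>y. indicat_real A y)"
proof (rule lbm_bounded[where M=1])
  show "bset A \<Longrightarrow> indicat_real A \<in> borel_measurable borel"
    by (intro borel_measurable_indicator) (simp add: bset_def)
qed (simp add: indicator_def)

lemma bset_Sq [simp, intro]: "bset (Sq x r)" by (simp add: Sq_cbox)
lemma compact_Sq [simp, intro]: "compact (Sq x r)" by (simp add: Sq_cbox compact_cbox)
lemma convex_Sq [simp, intro]: "convex (Sq x r)" by (simp add: Sq_cbox convex_box)
lemma Sq_mono: "r \<le> s \<Longrightarrow> Sq x r \<subseteq> Sq x s" by (auto simp: mem_Sq)
lemma center_Sq [simp]: "r \<ge> 0 \<Longrightarrow> x \<in> Sq x r" by (simp add: mem_Sq)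
lemma measure_Sq: "r \<ge> 0 \<Longrightarrow> measure lborel (Sq x r) = 4 * r\<^sup>2"
  unfolding Sq_cbox by (subst content_cbox_cart) (auto simp: interval_ne_empty_cart UNIV_2 power2_eq_square)

section \<open>Cutoff functions adapted to squares\<close>

lemma has_real_derivative_max0_sq:
  "((\<lambda>s::real. (max 0 s)\<^sup>2) has_real_derivative 2 * max 0 s) (at s)"
proof -
  consider "s > 0" | "s < 0" | "s = 0" by linarith
  then show ?thesis
  proof cases
    case 1
    have "((\<lambda>s::real. s\<^sup>2) has_real_derivative 2 * s) (at s)" by (auto intro!: derivative_eq_intros)
    then have "((\<lambda>s::real. (max 0 s)\<^sup>2) has_real_derivative 2 * s) (at s)"
      by (rule DERIV_cong_ev[THEN iffD1, rotated 3, OF _ refl])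
        (use 1 in \<open>auto intro!: eventually_mono[OF eventually_nhds_in_open[of "{0<..}" s]]\<close>)
    then show ?thesis using 1 by simp
  next
    case 2
    have "((\<lambda>s::real. 0) has_real_derivative 0) (at s)" by simp
    then have "((\<lambda>s::real. (max 0 s)\<^sup>2) has_real_derivative 0) (at s)"
      by (rule DERIV_cong_ev[THEN iffD1, rotated 3, OF _ refl])
        (use 2 in \<open>auto intro!: eventually_mono[OF eventually_nhds_in_open[of "{..<0}" s]]\<close>)
    then show ?thesis using 2 by simp
  next
    case 3
    have "((\<lambda>h::real. ((max 0 (0 + h))\<^sup>2 - (max 0 0)\<^sup>2) / h) \<longlongrightarrow> 0) (at 0)"
    proof (rule Lim_null_comparison)
      show "\<forall>\<^sub>F h::real in at 0. norm (((max 0 (0 + h))\<^sup>2 - (max 0 0)\<^sup>2) / h) \<le> \<bar>h\<bar>"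
        by (rule always_eventually) (auto simp: max_def power2_eq_square)
      show "((\<lambda>h::real. \<bar>h\<bar>) \<longlongrightarrow> 0) (at 0)" by (rule tendsto_eq_intros) (auto intro!: tendsto_eq_intros)
    qed
    then show ?thesis using 3 unfolding DERIV_def by simp
  qed
qed

text \<open>A C^1 cutoff made of squared positive parts: \<open>bump s\<close> equals (1 - (|s| -
  1)_+^2)_+^2, hence is 1 for |s| <= 1 and 0 for |s| >= 2. The factor 4 in \<open>bump'\<close>
  comes from the two squarings and is also its bound, as the other two factors are at most 1 in
  absolute value where |s| < 2.\<close>

definition bump0 :: "real \<Rightarrow> real" where
  "bump0 s = (max 0 (s - 1))\<^sup>2 + (max 0 (- s - 1))\<^sup>2"
definition bump :: "real \<Rightarrow> real" where
  "bump s = (max 0 (1 - bump0 s))\<^sup>2"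
definition bump' :: "real \<Rightarrow> real" where
  "bump' s = - 4 * max 0 (1 - bump0 s) * (max 0 (s - 1) - max 0 (- s - 1))"

lemma bump_deriv: "(bump has_real_derivative bump' s) (at s)"
proof -
  have 1: "((\<lambda>s. (max 0 (s - 1))\<^sup>2) has_real_derivative 2 * max 0 (s - 1) * 1) (at s)"
    by (rule DERIV_chain2[OF has_real_derivative_max0_sq]) (auto intro!: derivative_eq_intros)
  have 2: "((\<lambda>s. (max 0 (- s - 1))\<^sup>2) has_real_derivative 2 * max 0 (- s - 1) * - 1) (at s)"
    by (rule DERIV_chain2[OF has_real_derivative_max0_sq]) (auto intro!: derivative_eq_intros)
  have 3: "((\<lambda>s. 1 - bump0 s) has_real_derivative - (2 * max 0 (s - 1) * 1 + 2 * max 0 (- s - 1) * - 1)) (at s)"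
    unfolding bump0_def using DERIV_diff[OF DERIV_const[of 1] DERIV_add[OF 1 2]] by simp
  have "((\<lambda>s. (max 0 (1 - bump0 s))\<^sup>2) has_real_derivative
      2 * max 0 (1 - bump0 s) * - (2 * max 0 (s - 1) * 1 + 2 * max 0 (- s - 1) * - 1)) (at s)"
    by (rule DERIV_chain2[OF has_real_derivative_max0_sq 3])
  moreover have "2 * max 0 (1 - bump0 s) * - (2 * max 0 (s - 1) * 1 + 2 * max 0 (- s - 1) * - 1) = bump' s"
    by (simp add: bump'_def algebra_simps)
  ultimately show ?thesis by (simp add: bump_def[abs_def])
qed

lemma bump_props:
  shows "0 \<le> bump s" "bump s \<le> 1" "\<bar>s\<bar> \<le> 1 \<Longrightarrow> bump s = 1" "\<bar>s\<bar> \<ge> 2 \<Longrightarrow> bump s = 0"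
    "\<bar>s\<bar> \<le> 1 \<Longrightarrow> bump' s = 0" "\<bar>s\<bar> \<ge> 2 \<Longrightarrow> bump' s = 0" "\<bar>bump' s\<bar> \<le> 4"
proof -
  have n0: "bump0 s \<ge> 0" by (simp add: bump0_def)
  show "0 \<le> bump s" by (simp add: bump_def)
  show "bump s \<le> 1" unfolding bump_def using n0 by (intro power_le_one) auto
  show "\<bar>s\<bar> \<le> 1 \<Longrightarrow> bump s = 1" by (auto simp: bump_def bump0_def max_def)
  show "\<bar>s\<bar> \<le> 1 \<Longrightarrow> bump' s = 0" by (auto simp: bump'_def max_def)
  have ge: "bump0 s \<ge> 1" if "\<bar>s\<bar> \<ge> 2"
  proof (cases "s \<ge> 0")
    case True
    then have "(max 0 (s - 1))\<^sup>2 \<ge> 1" using that by (intro one_le_power) auto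
    then show ?thesis unfolding bump0_def by (smt (verit) zero_le_power2)
  next
    case False
    then have "(max 0 (- s - 1))\<^sup>2 \<ge> 1" using that by (intro one_le_power) auto
    then show ?thesis unfolding bump0_def by (smt (verit) zero_le_power2)
  qed
  show c0: "\<bar>s\<bar> \<ge> 2 \<Longrightarrow> bump s = 0" using ge by (auto simp: bump_def)
  show d0: "\<bar>s\<bar> \<ge> 2 \<Longrightarrow> bump' s = 0" using ge by (auto simp: bump'_def)
  show "\<bar>bump' s\<bar> \<le> 4"
  proof (cases "\<bar>s\<bar> \<ge> 2")
    case True then show ?thesis using d0 by simp
  next
    case False
    have "\<bar>max 0 (1 - bump0 s)\<bar> \<le> 1" using n0 by auto
    moreover have "\<bar>max 0 (s - 1) - max 0 (- s - 1)\<bar> \<le> 1" using False by auto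
    ultimately have "\<bar>max 0 (1 - bump0 s)\<bar> * \<bar>max 0 (s - 1) - max 0 (- s - 1)\<bar> \<le> 1 * 1"
      by (intro mult_mono) auto
    then show ?thesis by (simp add: bump'_def abs_mult)
  qed
qed

lemma bump_continuous: "continuous_on UNIV bump" "continuous_on UNIV bump'"
  unfolding bump_def[abs_def] bump'_def[abs_def] bump0_def by (intro continuous_intros)+

definition cutoff :: "real^2 \<Rightarrow> real \<Rightarrow> real^2 \<Rightarrow> real" where
  "cutoff x r y = bump ((y $ 1 - x $ 1) / r) * bump ((y $ 2 - x $ 2) / r)"
definition cutoff_grad :: "real^2 \<Rightarrow> real \<Rightarrow> real^2 \<Rightarrow> real \<times> real" where
  "cutoff_grad x r y = (bump' ((y $ 1 - x $ 1) / r) / r * bump ((y $ 2 - x $ 2) / r),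
     bump ((y $ 1 - x $ 1) / r) * (bump' ((y $ 2 - x $ 2) / r) / r))"

lemma cutoff_deriv: "(cutoff x r has_derivative dmap (cutoff_grad x r y)) (at y)"
proof -
  have c: "((\<lambda>y::real^2. bump ((y $ i - x $ i) / r)) has_derivative (\<lambda>v. bump' ((y $ i - x $ i) / r) * (v $ i / r))) (at y)" for i
  proof -
    have "((\<lambda>y::real^2. (y $ i - x $ i) / r) has_derivative (\<lambda>v. v $ i / r)) (at y)"
      by (auto intro!: derivative_eq_intros bounded_linear_imp_has_derivative simp: divide_inverse)
    from has_derivative_compose[OF this, of bump "(*) (bump' ((y $ i - x $ i) / r))"] show ?thesis
      using bump_deriv by (simp add: has_field_derivative_def)
  qed
  show ?thesis unfolding cutoff_def[abs_def]
    by (rule has_derivative_eq_rhs[OF has_derivative_mult[OF c c]])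
      (auto simp: cutoff_grad_def dmap_def fun_eq_iff algebra_simps)
qed

lemma cutoff_props:
  assumes "r > 0"
  shows "0 \<le> cutoff x r y" "cutoff x r y \<le> 1"
    "y \<in> Sq x r \<Longrightarrow> cutoff x r y = 1" "y \<notin> Sq x (2 * r) \<Longrightarrow> cutoff x r y = 0"
    "y \<in> Sq x r \<Longrightarrow> cutoff_grad x r y = 0" "y \<notin> Sq x (2 * r) \<Longrightarrow> cutoff_grad x r y = 0"
    "\<bar>fst (cutoff_grad x r y)\<bar> \<le> 4 / r" "\<bar>snd (cutoff_grad x r y)\<bar> \<le> 4 / r"
    "lbm (cutoff x r)" "lbm (cutoff_grad x r)"
proof -
  show "0 \<le> cutoff x r y" by (simp add: cutoff_def bump_props)
  show "cutoff x r y \<le> 1" unfolding cutoff_def by (intro mult_le_one bump_props)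
  show "y \<in> Sq x r \<Longrightarrow> cutoff x r y = 1"
    using assms by (simp add: mem_Sq cutoff_def bump_props(3))
  show "y \<in> Sq x r \<Longrightarrow> cutoff_grad x r y = 0"
    using assms by (simp add: mem_Sq cutoff_grad_def bump_props(5) zero_prod_def)
  have out: "\<bar>(y $ 1 - x $ 1) / r\<bar> \<ge> 2 \<or> \<bar>(y $ 2 - x $ 2) / r\<bar> \<ge> 2" if "y \<notin> Sq x (2 * r)"
    using that assms by (auto simp: mem_Sq abs_divide pos_le_divide_eq)
  show "y \<notin> Sq x (2 * r) \<Longrightarrow> cutoff x r y = 0"
    using out by (auto simp: cutoff_def bump_props(4))
  show "y \<notin> Sq x (2 * r) \<Longrightarrow> cutoff_grad x r y = 0"
    using out bump_props(4) bump_props(6) by (metis cutoff_grad_def div_0 mult_zero_left mult_zero_right zero_prod_def)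
  have "\<bar>bump' s / r * bump t\<bar> \<le> 4 / r" for s t
  proof -
    have "\<bar>bump' s / r * bump t\<bar> = \<bar>bump' s\<bar> / r * bump t" using assms bump_props(1)[of t] by (simp add: abs_mult)
    also have "\<dots> \<le> 4 / r * 1" using assms by (intro mult_mono divide_right_mono bump_props) auto
    finally show ?thesis by simp
  qed
  then show "\<bar>fst (cutoff_grad x r y)\<bar> \<le> 4 / r" "\<bar>snd (cutoff_grad x r y)\<bar> \<le> 4 / r"
    unfolding cutoff_grad_def fst_conv snd_conv by (metis mult.commute)+
  note cc = continuous_on_compose2[OF bump_continuous(1)] continuous_on_compose2[OF bump_continuous(2)]
  show "lbm (cutoff x r)" unfolding cutoff_def[abs_def]
    by (rule lbm_continuous) (use assms in \<open>auto intro!: continuous_intros cc\<close>)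
  show "lbm (cutoff_grad x r)" unfolding cutoff_grad_def[abs_def]
    by (rule lbm_continuous) (use assms in \<open>auto intro!: continuous_intros cc\<close>)
qed

lemma norm_real_prod: "norm (z :: real \<times> real) \<le> \<bar>fst z\<bar> + \<bar>snd z\<bar>"
  by (cases z) (simp add: norm_Pair_le[THEN order.trans])

lemma lipschitz_cutoff:
  assumes "r > 0" shows "(8 / r)-lipschitz_on UNIV (cutoff x r)"
proof (rule bounded_derivative_imp_lipschitz[OF cutoff_deriv])
  fix y
  have "norm (cutoff_grad x r y) \<le> 8 / r"
    using norm_real_prod[of "cutoff_grad x r y"] cutoff_props(7,8)[OF assms, of x y] by simp
  then show "onorm (dmap (cutoff_grad x r y)) \<le> 8 / r"
    by (intro onorm_le order.trans[OF norm_dmap_le])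
      (metis mult.commute mult_right_mono norm_ge_zero)
qed (use assms in auto)

text \<open>The coercivity constant \<open>c\<close> is fixed here although \<open>B\<close> does not involve it: it enters the
  constants of all estimates. By \<open>null_lagrangian\<close>, \<open>B (\<partial>\<^sub>1V) (\<partial>\<^sub>2V)\<close> integrates to lower order terms, so a
  pointwise bound \<open>B (\<partial>\<^sub>1V) (\<partial>\<^sub>2V) \<ge> c |\<nabla>V|\<^sup>2 - e\<close> plays the role of an elliptic equation for \<open>V\<close>.\<close>

locale null_form =
  fixes B :: "'b::euclidean_space \<Rightarrow> 'b \<Rightarrow> real" and c :: real
  assumes bil: "bounded_bilinear B" and anti: "B p q = - B q p" and c_pos: "c > 0"
begin

sublocale B: bounded_bilinear B by (rule bil)

text \<open>A bound of \<open>B\<close> fixed once and for all, so that the constants built from it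
  depend on \<open>B\<close> and \<open>c\<close> alone.\<close>

definition \<beta> :: real where "\<beta> = (SOME K. K > 0 \<and> (\<forall>a b. \<bar>B a b\<bar> \<le> norm a * norm b * K))"

lemma beta: "\<beta> > 0" "\<bar>B a b\<bar> \<le> \<beta> * norm a * norm b"
proof -
  have "\<exists>K. K > 0 \<and> (\<forall>a b. \<bar>B a b\<bar> \<le> norm a * norm b * K)"
    using B.pos_bounded by auto
  from someI_ex[OF this] have "\<beta> > 0 \<and> (\<forall>a b. \<bar>B a b\<bar> \<le> norm a * norm b * \<beta>)" by (simp add: \<beta>_def)
  then show "\<beta> > 0" "\<bar>B a b\<bar> \<le> \<beta> * norm a * norm b" by (auto simp: mult_ac)
qed

definition Q :: "'b \<times> 'b \<Rightarrow> real" where "Q z = B (fst z) (snd z)"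

lemma lbm_B [intro]: "lbm f \<Longrightarrow> lbm g \<Longrightarrow> lbm (\<lambda>x. B (f x) (g x))"
  by (rule lbm_bilinear[OF bil])

lemma lbm_Q: "lbm g \<Longrightarrow> lbm (\<lambda>x. Q (g x))"
  unfolding Q_def by (intro lbm_B lbm_intros)

text \<open>The null Lagrangian identity is tested with z^2 (V - c0). By antisymmetry the terms in
  which the derivative falls on \<open>V\<close> add up to 2 z^2 \<open>Q (g y)\<close>; the others
  carry the gradient of the cutoff.\<close>

lemma caccioppoli_identity:
  assumes V: "L-lipschitz_on UNIV V" and g: "lbm g" and r: "r > 0"
    and dV: "AE y in lborel. y \<in> Sq x (2 * r) \<longrightarrow> (V has_derivative dmap (g y)) (at y)"
  defines "z \<equiv> cutoff x r" and "dz \<equiv> cutoff_grad x r"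
  shows "ig (Sq x (2 * r)) (\<lambda>y. (z y)\<^sup>2 * Q (g y)) =
    - ig (Sq x (2 * r)) (\<lambda>y. z y * (fst (dz y) * B (V y - c0) (snd (g y)) - snd (dz y) * B (V y - c0) (fst (g y))))"
    (is "?l = - ig ?K ?f")
proof -
  define \<phi> where "\<phi> y = (z y)\<^sup>2 *\<^sub>R (V y - c0)" for y
  define g\<phi> where "g\<phi> y = (z y)\<^sup>2 *\<^sub>R g y + (2 * z y) *\<^sub>R (fst (dz y) *\<^sub>R (V y - c0), snd (dz y) *\<^sub>R (V y - c0))" for y
  note zp = cutoff_props[OF r, where x=x, folded z_def dz_def]
  have lV: "lbm V" by (rule lbm_lipschitz[OF V])
  have l\<phi>: "lbm g\<phi>" unfolding g\<phi>_def by (intro lbm_intros zp lV g)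
  obtain M where M: "\<And>y. y \<in> ?K \<Longrightarrow> norm (V y - c0) \<le> M" "M \<ge> 0"
  proof -
    have 1: "lbm (\<lambda>y. V y - c0)" by (intro lbm_intros lV)
    have 2: "bounded ?K" by (rule compact_imp_bounded[OF compact_Sq])
    show ?thesis by (rule lbm_bound[OF 1 2]) (rule that)
  qed
  have L0: "L \<ge> 0" using V by (rule lipschitz_on_nonneg)
  have zl: "\<bar>z y - z y'\<bar> \<le> 8 / r * dist y y'" for y y'
    using lipschitz_onD[OF lipschitz_cutoff[OF r, of x], of y y'] by (simp add: z_def dist_real_def)
  \<comment> \<open>\<open>V - c0\<close> is bounded on the support of the cutoff, not globally.
    Expanding the increment so that this factor is evaluated at \<open>y\<close>, a point of the
    square, leaves \<open>y'\<close> arbitrary.\<close>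
  have lip1: "norm (\<phi> y - \<phi> y') \<le> (L + 2 * (8 / r) * M) * dist y y'" if y: "y \<in> ?K" for y y'
  proof -
    have "\<phi> y - \<phi> y' = (z y')\<^sup>2 *\<^sub>R (V y - V y') + ((z y + z y') * (z y - z y')) *\<^sub>R (V y - c0)"
      by (simp add: \<phi>_def algebra_simps power2_eq_square)
    also have "norm \<dots> \<le> (z y')\<^sup>2 * norm (V y - V y') + \<bar>(z y + z y') * (z y - z y')\<bar> * norm (V y - c0)"
      by (rule order.trans[OF norm_triangle_ineq]) simp
    also have "\<dots> \<le> 1 * (L * dist y y') + (2 * (8 / r * dist y y')) * M"
    proof (intro add_mono mult_mono)
      show "(z y')\<^sup>2 \<le> 1" using zp(1,2) by (intro power_le_one) auto
      show "norm (V y - V y') \<le> L * dist y y'" using lipschitz_onD[OF V, of y y'] by (simp add: dist_norm)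
      show "\<bar>(z y + z y') * (z y - z y')\<bar> \<le> 2 * (8 / r * dist y y')"
        unfolding abs_mult using zp(1,2)[of y] zp(1,2)[of y'] zl by (intro mult_mono) auto
    qed (use M y r in auto)
    finally show ?thesis by (simp add: algebra_simps)
  qed
  have \<phi>0: "\<phi> y = 0" if "y \<notin> ?K" for y using zp(4)[OF that] by (simp add: \<phi>_def)
  have lip: "(L + 2 * (8 / r) * M)-lipschitz_on UNIV \<phi>"
  proof (rule lipschitz_onI)
    fix y y'
    show "dist (\<phi> y) (\<phi> y') \<le> (L + 2 * (8 / r) * M) * dist y y'"
    proof (cases "y \<in> ?K \<or> y' \<in> ?K")
      case True
      then show ?thesis using lip1[of y y'] lip1[of y' y] by (auto simp: dist_norm norm_minus_commute)
    next
      case False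
      then show ?thesis using \<phi>0 L0 M r by simp
    qed
  qed (use L0 M r in simp)
  have d\<phi>: "AE y in lborel. y \<in> ?K \<longrightarrow> (\<phi> has_derivative dmap (g\<phi> y)) (at y)"
    using dV
  proof eventually_elim
    fix y assume *: "y \<in> ?K \<longrightarrow> (V has_derivative dmap (g y)) (at y)"
    have dz': "(z has_derivative dmap (dz y)) (at y)" unfolding z_def dz_def by (rule cutoff_deriv)
    show "y \<in> ?K \<longrightarrow> (\<phi> has_derivative dmap (g\<phi> y)) (at y)"
    proof
      assume "y \<in> ?K"
      with * have V': "(V has_derivative dmap (g y)) (at y)" by simp
      have "((\<lambda>y. (z y)\<^sup>2) has_derivative (\<lambda>v. dmap (dz y) v * (2 * z y))) (at y)"
        using has_derivative_power[OF dz', of 2] by (simp add: mult_ac)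
      moreover have "((\<lambda>y. V y - c0) has_derivative dmap (g y)) (at y)"
        using has_derivative_diff[OF V' has_derivative_const[of c0]] by simp
      ultimately have "((\<lambda>y. (z y)\<^sup>2 *\<^sub>R (V y - c0)) has_derivative
          (\<lambda>v. (z y)\<^sup>2 *\<^sub>R dmap (g y) v + (dmap (dz y) v * (2 * z y)) *\<^sub>R (V y - c0))) (at y)"
        by (rule has_derivative_scaleR)
      moreover have "(\<lambda>v. (z y)\<^sup>2 *\<^sub>R dmap (g y) v + (dmap (dz y) v * (2 * z y)) *\<^sub>R (V y - c0)) = dmap (g\<phi> y)"
        unfolding g\<phi>_def by (simp add: fun_eq_iff dmap_def algebra_simps)
      ultimately show "(\<phi> has_derivative dmap (g\<phi> y)) (at y)" by (simp add: \<phi>_def[abs_def])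
    qed
  qed
  have "ig ?K (\<lambda>y. B (fst (g\<phi> y)) (snd (g y)) - B (snd (g\<phi> y)) (fst (g y))) = 0"
    by (rule null_lagrangian[OF bil lip V _ _ _ l\<phi> g d\<phi> dV])
      (use \<phi>0 zp(4,6) in \<open>auto simp: g\<phi>_def zero_prod_def\<close>)
  moreover have "B (fst (g\<phi> y)) (snd (g y)) - B (snd (g\<phi> y)) (fst (g y)) = 2 * ((z y)\<^sup>2 * Q (g y)) + 2 * ?f y" for y
    using anti[of "snd (g y)" "fst (g y)"]
    by (simp add: g\<phi>_def Q_def B.add_left B.diff_left B.scaleR_left algebra_simps)
  ultimately have "0 = ig ?K (\<lambda>y. 2 * ((z y)\<^sup>2 * Q (g y)) + 2 * ?f y)" by simp
  also have "\<dots> = ig ?K (\<lambda>y. 2 * ((z y)\<^sup>2 * Q (g y))) + ig ?K (\<lambda>y. 2 * ?f y)"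
    by (intro ig_add bset_Sq lbm_intros lbm_Q lbm_B zp lV g)
  also have "\<dots> = 2 * ?l + 2 * ig ?K ?f" unfolding ig_cmult by simp
  finally show ?thesis by linarith
qed

text \<open>First entry: both partial derivatives of the cutoff are at most 4 / r, which gives 8
  \<beta> / r in total; Young's inequality spends half of \<open>c\<close>, and division by the
  remaining half yields 64 \<beta>^2 / c^2. Second entry: the same division applied to the error
  \<open>e\<close>.\<close>

definition Ccac :: real where "Ccac = max (64 * \<beta>\<^sup>2 / c\<^sup>2) (2 / c)"

lemma Ccac_pos: "Ccac > 0" using c_pos by (simp add: Ccac_def less_max_iff_disj)

text \<open>Coercivity bounds c z^2 |g|^2 by z^2 \<open>Q (g y)\<close> + \<open>e y\<close>, and
  the identity above moves the integral of z^2 \<open>Q (g y)\<close> onto the gradient of the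
  cutoff. That gradient vanishes on the inner square, so \<open>V\<close> enters through the annulus
  only, as hole filling requires; the constant \<open>c0\<close> is left free for the Poincare
  inequality.\<close>

lemma caccioppoli:
  assumes V: "L-lipschitz_on UNIV V" and g: "lbm g" and e: "lbm e" "\<And>y. e y \<ge> 0" and r: "r > 0"
    and dV: "AE y in lborel. y \<in> Sq x (2 * r) \<longrightarrow> (V has_derivative dmap (g y)) (at y)"
    and co: "AE y in lborel. y \<in> Sq x (2 * r) \<longrightarrow> Q (g y) \<ge> c * (norm (g y))\<^sup>2 - e y"
  shows "ig (Sq x r) (\<lambda>y. (norm (g y))\<^sup>2) \<le>
    Ccac * (1 / r\<^sup>2 * ig (Sq x (2 * r) - Sq x r) (\<lambda>y. (norm (V y - c0))\<^sup>2) + ig (Sq x (2 * r)) e)"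
proof -
  define z where "z = cutoff x r"
  define dz where "dz = cutoff_grad x r"
  let ?K = "Sq x (2 * r)" and ?A = "Sq x (2 * r) - Sq x r"
  note zp = cutoff_props[OF r, where x=x, folded z_def dz_def]
  have lV: "lbm V" by (rule lbm_lipschitz[OF V])
  have A: "bset ?A" by (intro bset_Diff bset_Sq)
  define k where "k = 32 * \<beta>\<^sup>2 / (c * r\<^sup>2)"
  have k0: "k \<ge> 0" using c_pos by (simp add: k_def)
  define f where "f y = z y * (fst (dz y) * B (V y - c0) (snd (g y)) - snd (dz y) * B (V y - c0) (fst (g y)))" for y
  define G where "G y = (z y)\<^sup>2 * (norm (g y))\<^sup>2" for y
  define u where "u y = indicator ?A y * (norm (V y - c0))\<^sup>2" for y
  have lu: "lbm u"
  proof -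
    have "lbm (\<lambda>y. indicat_real ?A y)" by (rule lbm_indicator[OF A])
    then show ?thesis unfolding u_def by (intro lbm_intros lV)
  qed
  have lG: "lbm G" unfolding G_def by (intro lbm_intros zp g)
  have lf: "lbm f" unfolding f_def by (intro lbm_intros lbm_B zp g lV)
  have fb: "- f y \<le> c / 2 * G y + k * u y" for y
  proof (cases "y \<in> ?A")
    case True
    have "\<bar>f y\<bar> \<le> z y * (4 / r * (\<beta> * norm (V y - c0) * norm (g y)) + 4 / r * (\<beta> * norm (V y - c0) * norm (g y)))"
    proof -
      have n: "norm (fst (g y)) \<le> norm (g y)" "norm (snd (g y)) \<le> norm (g y)"
        by (metis norm_fst_le prod.collapse) (metis norm_snd_le prod.collapse)
      have "\<bar>fst (dz y) * B (V y - c0) (snd (g y))\<bar> \<le> 4 / r * (\<beta> * norm (V y - c0) * norm (g y))"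
        unfolding abs_mult using zp(7)[of y] beta r n
        by (intro mult_mono order.trans[OF beta(2)] mult_left_mono) (auto intro!: mult_nonneg_nonneg less_imp_le)
      moreover have "\<bar>snd (dz y) * B (V y - c0) (fst (g y))\<bar> \<le> 4 / r * (\<beta> * norm (V y - c0) * norm (g y))"
        unfolding abs_mult using zp(8)[of y] beta r n
        by (intro mult_mono order.trans[OF beta(2)] mult_left_mono) (auto intro!: mult_nonneg_nonneg less_imp_le)
      ultimately have "\<bar>fst (dz y) * B (V y - c0) (snd (g y)) - snd (dz y) * B (V y - c0) (fst (g y))\<bar>
          \<le> 4 / r * (\<beta> * norm (V y - c0) * norm (g y)) + 4 / r * (\<beta> * norm (V y - c0) * norm (g y))"
        by linarith
      from mult_left_mono[OF this zp(1)[of y]] show ?thesis unfolding f_def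
        using zp(1)[of y] by (simp add: abs_mult)
    qed
    also have "\<dots> = (z y * norm (g y)) * (8 * \<beta> / r * norm (V y - c0))" by (simp add: field_simps)
    also have "\<dots> \<le> c / 2 * (z y * norm (g y))\<^sup>2 + (8 * \<beta> / r * norm (V y - c0))\<^sup>2 / (2 * c)"
    proof -
      have "a * b \<le> c / 2 * a\<^sup>2 + b\<^sup>2 / (2 * c)" for a b :: real
      proof -
        have "0 \<le> (c * a - b)\<^sup>2 / (2 * c)" using c_pos by simp
        also have "\<dots> = c / 2 * a\<^sup>2 + b\<^sup>2 / (2 * c) - a * b"
          using c_pos by (simp add: power2_eq_square field_simps)
        finally show ?thesis by simp
      qed
      then show ?thesis .
    qed
    also have "\<dots> = c / 2 * G y + k * u y"
      using True c_pos r by (simp add: G_def u_def k_def power_mult_distrib power_divide field_simps)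
    finally show ?thesis by linarith
  next
    case False
    then have "f y = 0" using zp(4,5,6) by (cases "y \<in> Sq x r") (auto simp: f_def)
    moreover have "G y \<ge> 0" "u y \<ge> 0" by (auto simp: G_def u_def)
    ultimately show ?thesis using c_pos k0 by simp
  qed
  have "c * ig ?K G = ig ?K (\<lambda>y. c * G y)" by (simp add: ig_cmult)
  also have "\<dots> \<le> ig ?K (\<lambda>y. (z y)\<^sup>2 * Q (g y) + e y)"
  proof (rule ig_mono_AE)
    show "AE y in lborel. y \<in> ?K \<longrightarrow> c * G y \<le> (z y)\<^sup>2 * Q (g y) + e y"
      using co
    proof eventually_elim
      fix y assume *: "y \<in> ?K \<longrightarrow> c * (norm (g y))\<^sup>2 - e y \<le> Q (g y)"
      have z1: "(z y)\<^sup>2 \<le> 1" using zp(1,2) by (intro power_le_one) auto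
      show "y \<in> ?K \<longrightarrow> c * G y \<le> (z y)\<^sup>2 * Q (g y) + e y"
      proof
        assume "y \<in> ?K"
        then have "(z y)\<^sup>2 * (c * (norm (g y))\<^sup>2 - e y) \<le> (z y)\<^sup>2 * Q (g y)"
          using * by (intro mult_left_mono) auto
        moreover have "(z y)\<^sup>2 * e y \<le> 1 * e y" using z1 e(2) by (intro mult_right_mono) auto
        ultimately show "c * G y \<le> (z y)\<^sup>2 * Q (g y) + e y" by (simp add: G_def algebra_simps)
      qed
    qed
  qed (intro bset_Sq lbm_intros lbm_Q zp g e lG)+
  also have "\<dots> = ig ?K (\<lambda>y. (z y)\<^sup>2 * Q (g y)) + ig ?K e"
    by (intro ig_add bset_Sq lbm_intros lbm_Q zp g e)
  also have "ig ?K (\<lambda>y. (z y)\<^sup>2 * Q (g y)) = ig ?K (\<lambda>y. (- 1) * f y)"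
    unfolding ig_cmult using caccioppoli_identity[OF V g r dV, of c0] by (simp add: f_def z_def dz_def)
  also have "\<dots> \<le> ig ?K (\<lambda>y. c / 2 * G y + k * u y)"
    using fb by (intro ig_mono bset_Sq lbm_intros lf lG lu) auto
  also have "\<dots> = ig ?K (\<lambda>y. c / 2 * G y) + ig ?K (\<lambda>y. k * u y)"
    by (intro ig_add bset_Sq lbm_intros lG lu)
  also have "\<dots> = c / 2 * ig ?K G + k * ig ?K u" by (simp only: ig_cmult)
  also have "ig ?K u = ig ?A (\<lambda>y. (norm (V y - c0))\<^sup>2)"
    unfolding set_lebesgue_integral_def u_def
    by (rule Bochner_Integration.integral_cong) (auto simp: indicator_def)
  finally have *: "c / 2 * ig ?K G \<le> k * ig ?A (\<lambda>y. (norm (V y - c0))\<^sup>2) + ig ?K e" by simp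
  have "ig (Sq x r) (\<lambda>y. (norm (g y))\<^sup>2) = ig (Sq x r) G"
    by (rule set_lebesgue_integral_cong) (use zp(3) bset_Sq[unfolded bset_def] in \<open>auto simp: G_def\<close>)
  also have "\<dots> \<le> ig ?K G"
    using r by (intro ig_mono_set bset_Sq lG Sq_mono) (auto simp: G_def)
  also have "\<dots> \<le> 2 / c * (k * ig ?A (\<lambda>y. (norm (V y - c0))\<^sup>2) + ig ?K e)"
    using mult_left_mono[OF *, of "2 / c"] c_pos by simp
  also have "\<dots> = 64 * \<beta>\<^sup>2 / c\<^sup>2 * (1 / r\<^sup>2 * ig ?A (\<lambda>y. (norm (V y - c0))\<^sup>2)) + 2 / c * ig ?K e"
    using c_pos r by (simp add: k_def field_simps power2_eq_square)
  also have "\<dots> \<le> Ccac * (1 / r\<^sup>2 * ig ?A (\<lambda>y. (norm (V y - c0))\<^sup>2)) + Ccac * ig ?K e"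
    by (intro add_mono mult_right_mono mult_nonneg_nonneg ig_nonneg) (auto simp: Ccac_def e)
  finally show ?thesis by (simp add: algebra_simps)
qed

end

section \<open>Translations and mean oscillation\<close>

lemma norm_sum_sq_le:
  fixes a :: "nat \<Rightarrow> 'a::real_normed_vector"
  shows "(norm (\<Sum>j<m. a j))\<^sup>2 \<le> real m * (\<Sum>j<m. (norm (a j))\<^sup>2)"
proof -
  have "(norm (\<Sum>j<m. a j))\<^sup>2 \<le> (\<Sum>j<m. norm (a j))\<^sup>2"
    by (intro power_mono norm_sum) auto
  also have "\<dots> \<le> (\<Sum>j<m. (norm (a j))\<^sup>2) * card {..<m}"
    by (rule sum_squared_le_sum_of_squares)
  finally show ?thesis by (simp add: mult.commute)
qed

lemma ig_sum:
  fixes f :: "'i \<Rightarrow> 'a::euclidean_space \<Rightarrow> real"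
  assumes "bset A" "finite I" "\<And>i. i \<in> I \<Longrightarrow> lbm (f i)"
  shows "ig A (\<lambda>x. \<Sum>i\<in>I. f i x) = (\<Sum>i\<in>I. ig A (f i))"
  using assms(2,3)
proof (induction I)
  case (insert i I)
  have "lbm (\<lambda>x. \<Sum>i\<in>I. f i x)" using insert(1,4)
    by (induction I) (auto intro!: lbm_add)
  then show ?case using insert assms(1) by (simp add: ig_add)
qed (simp)

text \<open>The increment is telescoped into m steps of length |s| / m. Cauchy-Schwarz costs a
  factor m, and each translated integral is at most the one over \<open>D\<close>, so that squared
  quotients with step s / m appear. Letting m tend to infinity avoids integrating the derivative
  along single segments, where it need not exist.\<close>

lemma translation_estimate:
  fixes W :: "real^2 \<Rightarrow> 'b::euclidean_space"
  assumes W: "L-lipschitz_on UNIV W" and g: "lbm g"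
    and dW: "AE y in lborel. y \<in> D \<longrightarrow> (W has_derivative dmap (g y)) (at y)"
    and D: "bset D" and P: "bset P"
    and PD: "\<And>x \<tau>. x \<in> P \<Longrightarrow> 0 \<le> \<tau> \<Longrightarrow> \<tau> \<le> 1 \<Longrightarrow> x + \<tau> *\<^sub>R s \<in> D"
  shows "ig P (\<lambda>x. (norm (W (x + s) - W x))\<^sup>2) \<le> (norm s)\<^sup>2 * ig D (\<lambda>x. (norm (g x))\<^sup>2)"
proof -
  have lW: "lbm W" by (rule lbm_lipschitz[OF W])
  define F where "F n y = (norm (real (Suc n) *\<^sub>R (W (y + inverse (real (Suc n)) *\<^sub>R s) - W y)))\<^sup>2" for n y
  have lF: "lbm (F n)" for n unfolding F_def by (intro lbm_intros lbm_shift lW)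
  have le: "ig P (\<lambda>x. (norm (W (x + s) - W x))\<^sup>2) \<le> ig D (F n)" for n
  proof -
    define m where "m = Suc n"
    define t where "t = inverse (real m) *\<^sub>R s"
    define G where "G y = (norm (W (y + t) - W y))\<^sup>2" for y
    have lG: "lbm G" unfolding G_def by (intro lbm_intros lbm_shift lW)
    have m0: "real m > 0" by (simp add: m_def)
    have mt: "real m *\<^sub>R t = s" using m0 by (simp add: t_def)
    have "ig P (\<lambda>x. (norm (W (x + s) - W x))\<^sup>2) \<le> ig P (\<lambda>x. real m * (\<Sum>j<m. G (x + real j *\<^sub>R t)))"
    proof (rule ig_mono)
      fix x
      have eq: "W (x + s) - W x = (\<Sum>j<m. W (x + real (Suc j) *\<^sub>R t) - W (x + real j *\<^sub>R t))"
        by (subst sum_lessThan_telescope[where f="\<lambda>j. W (x + real j *\<^sub>R t)"]) (simp add: mt)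
      have "(norm (W (x + s) - W x))\<^sup>2 \<le> real m * (\<Sum>j<m. (norm (W (x + real (Suc j) *\<^sub>R t) - W (x + real j *\<^sub>R t)))\<^sup>2)"
        unfolding eq by (rule norm_sum_sq_le)
      also have "\<dots> = real m * (\<Sum>j<m. G (x + real j *\<^sub>R t))"
        by (simp add: G_def scaleR_add_left add_ac)
      finally show "(norm (W (x + s) - W x))\<^sup>2 \<le> real m * (\<Sum>j<m. G (x + real j *\<^sub>R t))" .
    next
      have "lbm (\<lambda>x. \<Sum>j<k. G (x + real j *\<^sub>R t))" for k
        by (induction k) (auto intro!: lbm_add lbm_shift lG)
      then show "lbm (\<lambda>x. real m * (\<Sum>j<m. G (x + real j *\<^sub>R t)))" by (intro lbm_intros)
    qed (intro P lbm_intros lbm_shift lW)+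
    also have "\<dots> = real m * (\<Sum>j<m. ig P (\<lambda>x. G (x + real j *\<^sub>R t)))"
      unfolding ig_cmult by (subst ig_sum) (auto intro!: P lbm_shift lG)
    also have "\<dots> \<le> real m * (\<Sum>j<m. ig D G)"
    proof (intro mult_left_mono sum_mono)
      fix j assume "j \<in> {..<m}"
      then have j: "0 \<le> real j * inverse (real m)" "real j * inverse (real m) \<le> 1"
        using m0 by (auto simp: divide_simps)
      have "ig P (\<lambda>x. G (x + real j *\<^sub>R t)) = ig ((+) (real j *\<^sub>R t) ` P) G"
        by (rule ig_shift[symmetric, OF P lG])
      also have "\<dots> \<le> ig D G"
      proof (rule ig_mono_set)
        show "(+) (real j *\<^sub>R t) ` P \<subseteq> D"
          using PD[OF _ j] by (auto simp: t_def add.commute)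
      qed (auto intro: bset_shift P D lG simp: G_def)
      finally show "ig P (\<lambda>x. G (x + real j *\<^sub>R t)) \<le> ig D G" .
    qed simp
    also have "\<dots> = ig D (\<lambda>y. (real m)\<^sup>2 * G y)" by (simp add: ig_cmult power2_eq_square)
    also have "(\<lambda>y. (real m)\<^sup>2 * G y) = F n"
      unfolding F_def G_def t_def m_def by (simp add: fun_eq_iff power_mult_distrib del: of_nat_Suc)
    finally show ?thesis .
  qed
  have "(\<lambda>n. ig D (F n)) \<longlonglongrightarrow> ig D (\<lambda>y. (norm (dmap (g y) s))\<^sup>2)"
  proof (rule ig_DCT[OF D _ lF])
    show "lbm (\<lambda>y. (norm (dmap (g y) s))\<^sup>2)" by (intro lbm_intros lbm_dmap g)
    show "AE x in lborel. x \<in> D \<longrightarrow> (\<lambda>n. F n x) \<longlonglongrightarrow> (norm (dmap (g x) s))\<^sup>2"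
      using dW
    proof eventually_elim
      fix x assume "x \<in> D \<longrightarrow> (W has_derivative dmap (g x)) (at x)"
      then show "x \<in> D \<longrightarrow> (\<lambda>n. F n x) \<longlonglongrightarrow> (norm (dmap (g x) s))\<^sup>2"
        unfolding F_def by (intro impI tendsto_power tendsto_norm diff_quot_tendsto) blast
    qed
    show "norm (F n x) \<le> (L * norm s)\<^sup>2" for n x
      unfolding F_def using lipschitz_quot_bound[OF W, of "real (Suc n)" x s]
      by (simp only: real_norm_def abs_power2) (intro power_mono, auto simp del: of_nat_Suc)
  qed
  then have "ig P (\<lambda>x. (norm (W (x + s) - W x))\<^sup>2) \<le> ig D (\<lambda>y. (norm (dmap (g y) s))\<^sup>2)"
    using le by (intro LIMSEQ_le_const) auto
  also have "\<dots> \<le> ig D (\<lambda>y. (norm s)\<^sup>2 * (norm (g y))\<^sup>2)"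
  proof (rule ig_mono)
    fix y show "(norm (dmap (g y) s))\<^sup>2 \<le> (norm s)\<^sup>2 * (norm (g y))\<^sup>2"
      unfolding power_mult_distrib[symmetric] by (intro power_mono norm_dmap_le) simp
  qed (intro D lbm_intros lbm_dmap g)+
  finally show ?thesis by (simp add: ig_cmult)
qed

section \<open>Mean values and mean oscillation\<close>

lemma lbm_compose_cont:
  fixes f :: "'a::euclidean_space \<Rightarrow> 'b::euclidean_space" and h :: "'c::euclidean_space \<Rightarrow> 'a"
  assumes f: "lbm f" and h: "continuous_on UNIV h"
  shows "lbm (\<lambda>x. f (h x))"
proof (rule lbm_I)
  have [measurable]: "f \<in> borel_measurable borel" "h \<in> borel_measurable borel"
    using f h by (auto simp: lbm_measurable borel_measurable_continuous_onI)
  show "(\<lambda>x. f (h x)) \<in> borel_measurable borel" by measurable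
  fix r
  have "compact (h ` cball 0 r)"
    using h by (intro compact_continuous_image) (auto intro: continuous_on_subset)
  then obtain M where "\<And>y. y \<in> h ` cball 0 r \<Longrightarrow> norm (f y) \<le> M"
    using lbm_bound[OF f compact_imp_bounded] by metis
  then show "\<exists>M. \<forall>x. norm x \<le> r \<longrightarrow> norm (f (h x)) \<le> M"
    by (metis imageI mem_cball_0)
qed

definition mean :: "('a::euclidean_space) set \<Rightarrow> ('a \<Rightarrow> 'b::euclidean_space) \<Rightarrow> 'b" where
  "mean D f = (1 / measure lborel D) *\<^sub>R ig D f"

lemma ig_scaleR_const:
  assumes "bset D" "lbm f"
  shows "ig D (\<lambda>y. f y \<bullet> v) = ig D f \<bullet> v"
proof -
  have "integrable lborel (\<lambda>x. indicat_real D x *\<^sub>R f x)"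
    using ig_integrable[OF assms] by (simp add: set_integrable_def)
  from integral_inner_left[OF this, of v] show ?thesis
    by (simp add: set_lebesgue_integral_def)
qed

lemma ig_norm_diff_sq:
  fixes f :: "'a::euclidean_space \<Rightarrow> 'b::euclidean_space"
  assumes D: "bset D" and f: "lbm f"
  shows "ig D (\<lambda>y. (norm (f y - v))\<^sup>2) = ig D (\<lambda>y. (norm (f y))\<^sup>2) - 2 * (ig D f \<bullet> v) + measure lborel D * (norm v)\<^sup>2"
proof -
  have "ig D (\<lambda>y. (norm (f y - v))\<^sup>2) = ig D (\<lambda>y. (norm (f y))\<^sup>2 - 2 * (f y \<bullet> v) + (norm v)\<^sup>2)"
    by (simp add: power2_norm_eq_inner inner_diff inner_commute algebra_simps)
  also have "\<dots> = ig D (\<lambda>y. (norm (f y))\<^sup>2 - 2 * (f y \<bullet> v)) + ig D (\<lambda>y. (norm v)\<^sup>2)"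
    by (intro ig_add D lbm_intros f)
  also have "ig D (\<lambda>y. (norm (f y))\<^sup>2 - 2 * (f y \<bullet> v)) = ig D (\<lambda>y. (norm (f y))\<^sup>2) - ig D (\<lambda>y. 2 * (f y \<bullet> v))"
    by (intro ig_diff D lbm_intros f)
  finally show ?thesis using ig_const[OF D, of "(norm v)\<^sup>2"] by (simp add: ig_cmult ig_scaleR_const[OF D f])
qed

text \<open>Pythagoras in L^2: \<open>f - mean D f\<close> is orthogonal to the constants.\<close>

lemma mean_minimal:
  fixes f :: "'a::euclidean_space \<Rightarrow> 'b::euclidean_space"
  assumes D: "bset D" and f: "lbm f" and v: "measure lborel D > 0"
  shows "ig D (\<lambda>y. (norm (f y - w))\<^sup>2) = ig D (\<lambda>y. (norm (f y - mean D f))\<^sup>2) + measure lborel D * (norm (mean D f - w))\<^sup>2"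
proof -
  have m: "ig D f = measure lborel D *\<^sub>R mean D f" using v by (simp add: mean_def)
  show ?thesis unfolding ig_norm_diff_sq[OF D f] m
    by (simp add: power2_norm_eq_inner inner_diff inner_commute algebra_simps)
qed

lemma mean_le:
  fixes f :: "'a::euclidean_space \<Rightarrow> 'b::euclidean_space"
  assumes D: "bset D" and f: "lbm f" and v: "measure lborel D > 0"
  shows "ig D (\<lambda>y. (norm (f y - mean D f))\<^sup>2) \<le> ig D (\<lambda>y. (norm (f y - w))\<^sup>2)"
  unfolding mean_minimal[OF assms, of w] by simp

lemma ig_double:
  fixes f :: "'a::euclidean_space \<Rightarrow> 'b::euclidean_space"
  assumes D: "bset D" and f: "lbm f" and v: "measure lborel D > 0"
  shows "ig D (\<lambda>x. ig D (\<lambda>y. (norm (f y - f x))\<^sup>2)) = 2 * measure lborel D * ig D (\<lambda>y. (norm (f y - mean D f))\<^sup>2)"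
proof -
  let ?v = "measure lborel D" and ?S = "ig D (\<lambda>y. (norm (f y - mean D f))\<^sup>2)"
  have "ig D (\<lambda>y. (norm (f y - f x))\<^sup>2) = ?S + ?v * (norm (f x - mean D f))\<^sup>2" for x
    using mean_minimal[OF assms, of "f x"] by (simp add: norm_minus_commute[of "f x"])
  then have "ig D (\<lambda>x. ig D (\<lambda>y. (norm (f y - f x))\<^sup>2)) = ig D (\<lambda>x. ?S + ?v * (norm (f x - mean D f))\<^sup>2)"
    by simp
  also have "\<dots> = ig D (\<lambda>x. ?S) + ig D (\<lambda>x. ?v * (norm (f x - mean D f))\<^sup>2)"
    by (intro ig_add D lbm_intros f)
  also have "\<dots> = 2 * ?v * ?S" using ig_const[OF D, of ?S] by (simp add: ig_cmult)
  finally show ?thesis .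
qed

text \<open>The double integral of |f y - f x|^2 over pairs in \<open>D\<close> is twice the measure
  of \<open>D\<close> times the mean oscillation. Substituting y = x + s and exchanging the
  integrals makes the inner one an integral over the points of \<open>D\<close> that stay in
  \<open>D\<close> under the shift s, bounded by \<open>K\<close>. The set \<open>E\<close> of
  shifts has at most four times the measure of \<open>D\<close>, whence the factor 2.\<close>

lemma mean_osc_le_translates:
  fixes f :: "'a::euclidean_space \<Rightarrow> 'b::euclidean_space"
  assumes D: "bset D" and E: "bset E" and f: "lbm f" and v: "measure lborel D > 0"
    and DE: "\<And>x y. x \<in> D \<Longrightarrow> y \<in> D \<Longrightarrow> y - x \<in> E" and vE: "measure lborel E \<le> 4 * measure lborel D"
    and K: "\<And>s. s \<in> E \<Longrightarrow> ig (D \<inter> (+) (- s) ` D) (\<lambda>x. (norm (f (x + s) - f x))\<^sup>2) \<le> K"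
    and K0: "K \<ge> 0"
  shows "ig D (\<lambda>y. (norm (f y - mean D f))\<^sup>2) \<le> 2 * K"
proof -
  let ?v = "measure lborel D"
  define H where "H x s = indicat_real D x * (indicat_real D (x + s) * (norm (f (x + s) - f x))\<^sup>2)" for x s
  have cb: "bset (D \<times> E)" using D E by (auto simp: bset_def bounded_Times borel_Times)
  have lH: "lbm (\<lambda>p. H (fst p) (snd p))"
    unfolding H_def
    by (intro lbm_intros lbm_compose_cont[OF lbm_indicator[OF D]] lbm_compose_cont[OF f] continuous_intros)
  have "integrable lborel (\<lambda>p. H (fst p) (snd p))"
  proof (rule integrable_lbm_support(1)[OF lH cb])
    fix p :: "'a \<times> 'a" assume "p \<notin> D \<times> E"
    then have "fst p \<notin> D \<or> fst p + snd p \<notin> D" using DE[of "fst p" "fst p + snd p"] by (cases p) auto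
    then show "H (fst p) (snd p) = 0" by (auto simp: H_def)
  qed
  then have intH: "integrable (lborel \<Otimes>\<^sub>M lborel) (\<lambda>(x, s). H x s)"
    by (simp add: lborel_prod case_prod_unfold)
  have inner: "ig D (\<lambda>y. (norm (f y - f x))\<^sup>2) * indicat_real D x = (\<integral>s. H x s \<partial>lborel)" for x
  proof -
    have "(\<integral>s. H x s \<partial>lborel) = (\<integral>s. (\<lambda>y. indicat_real D x * (indicat_real D y * (norm (f y - f x))\<^sup>2)) (s + x) \<partial>lborel)"
      by (simp add: H_def add.commute)
    also have "\<dots> = (\<integral>y. indicat_real D x * (indicat_real D y * (norm (f y - f x))\<^sup>2) \<partial>lborel)"
      by (rule lborel_integral_shift) (intro lbm_measurable lbm_intros lbm_indicator D f)
    finally show ?thesis by (simp add: set_lebesgue_integral_def)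
  qed
  have "2 * ?v * ig D (\<lambda>y. (norm (f y - mean D f))\<^sup>2) = ig D (\<lambda>x. ig D (\<lambda>y. (norm (f y - f x))\<^sup>2))"
    by (rule ig_double[OF D f v, symmetric])
  also have "\<dots> = (\<integral>x. (\<integral>s. H x s \<partial>lborel) \<partial>lborel)"
    unfolding inner[symmetric] by (simp add: set_lebesgue_integral_def mult.commute)
  also have "\<dots> = (\<integral>s. (\<integral>x. H x s \<partial>lborel) \<partial>lborel)"
    by (rule lborel_pair.Fubini_integral[OF intH, symmetric])
  also have "\<dots> \<le> (\<integral>s. K * indicat_real E s \<partial>lborel)"
  proof (rule integral_mono)
    show "integrable lborel (\<lambda>s. \<integral>x. H x s \<partial>lborel)"
      by (rule lborel_pair.integrable_snd[OF intH])
    show "integrable lborel (\<lambda>s. K * indicat_real E s)"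
      using ig_measure_finite[OF E] E by (intro integrable_mult_right integrable_real_indicator) (auto simp: bset_def)
    fix s
    have H: "H x s = indicator (D \<inter> (+) (- s) ` D) x *\<^sub>R (norm (f (x + s) - f x))\<^sup>2" for x
    proof -
      have "x \<in> (+) (- s) ` D \<longleftrightarrow> x + s \<in> D" by (force simp: image_iff)
      then show ?thesis by (auto simp: H_def indicator_def)
    qed
    show "(\<integral>x. H x s \<partial>lborel) \<le> K * indicat_real E s"
    proof (cases "s \<in> E")
      case True
      then show ?thesis using K[OF True] by (simp add: H set_lebesgue_integral_def)
    next
      case False
      then have "H x s = 0" for x using DE[of x "x + s"] by (auto simp: H_def indicator_def)
      then show ?thesis using False by simp
    qed
  qed
  also have "\<dots> = K * measure lborel E" using ig_measure_finite[OF E] E by (simp add: bset_def)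
  also have "\<dots> \<le> K * (4 * ?v)" using vE K0 by (rule mult_left_mono)
  finally show ?thesis using v by (simp add: field_simps)
qed

section \<open>Hole filling\<close>

lemma measure_cbox2:
  fixes a b :: "real^2"
  assumes "a $ 1 \<le> b $ 1" "a $ 2 \<le> b $ 2"
  shows "measure lborel (cbox a b) = (b $ 1 - a $ 1) * (b $ 2 - a $ 2)"
  using assms by (subst content_cbox_cart) (auto simp: interval_ne_empty_cart UNIV_2 forall_2)

lemma translate_Int_convex:
  fixes D :: "(real^2) set"
  assumes "convex D" "x \<in> D \<inter> (+) (- s) ` D" "0 \<le> \<tau>" "\<tau> \<le> 1"
  shows "x + \<tau> *\<^sub>R s \<in> D"
proof -
  have x: "x \<in> D" "x + s \<in> D" using assms(2) by (auto simp: image_iff)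
  have "x + \<tau> *\<^sub>R s = (1 - \<tau>) *\<^sub>R x + \<tau> *\<^sub>R (x + s)" by (simp add: algebra_simps)
  then show ?thesis using convexD_alt[OF assms(1) x assms(3,4)] by simp
qed

lemma mean_osc_cbox:
  fixes f :: "real^2 \<Rightarrow> 'b::euclidean_space" and a b :: "real^2"
  defines "D \<equiv> cbox a b"
  assumes f: "lbm f" and ab: "a $ 1 < b $ 1" "a $ 2 < b $ 2"
    and K: "\<And>s. \<bar>s $ 1\<bar> \<le> b $ 1 - a $ 1 \<Longrightarrow> \<bar>s $ 2\<bar> \<le> b $ 2 - a $ 2 \<Longrightarrow>
      ig (D \<inter> (+) (- s) ` D) (\<lambda>x. (norm (f (x + s) - f x))\<^sup>2) \<le> K"
  shows "ig D (\<lambda>y. (norm (f y - mean D f))\<^sup>2) \<le> 2 * K"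
proof (rule mean_osc_le_translates[where E="cbox (a - b) (b - a)"])
  have v: "measure lborel D = (b $ 1 - a $ 1) * (b $ 2 - a $ 2)"
    unfolding D_def using ab by (intro measure_cbox2) auto
  have "measure lborel (cbox (a - b) (b - a)) = ((b - a) $ 1 - (a - b) $ 1) * ((b - a) $ 2 - (a - b) $ 2)"
    using ab by (intro measure_cbox2) auto
  also have "\<dots> = 4 * measure lborel D" unfolding v by (simp add: algebra_simps)
  finally show "measure lborel (cbox (a - b) (b - a)) \<le> 4 * measure lborel D" by simp
  show "0 < measure lborel D" unfolding v using ab by simp
  show "y - x \<in> cbox (a - b) (b - a)" if "x \<in> D" "y \<in> D" for x y
    using that unfolding D_def by (simp add: mem_box_cart forall_2)
  show 1: "ig (D \<inter> (+) (- s) ` D) (\<lambda>x. (norm (f (x + s) - f x))\<^sup>2) \<le> K" if "s \<in> cbox (a - b) (b - a)" for s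
    using that by (intro K) (auto simp: mem_box_cart forall_2)
  have "0 \<le> ig (D \<inter> (+) (- 0) ` D) (\<lambda>x. (norm (f (x + 0) - f x))\<^sup>2)" by (rule ig_nonneg) simp
  also have "\<dots> \<le> K" by (rule 1) (use ab in \<open>auto simp: mem_box_cart forall_2\<close>)
  finally show "0 \<le> K" .
qed (auto simp: D_def f)

text \<open>Poincare inequality by translations: only shifts up to the side lengths matter, and
  convexity keeps the segment from x to x + s inside the box. The constant is twice the squared
  diagonal.\<close>

lemma poincare_cbox:
  fixes W :: "real^2 \<Rightarrow> 'b::euclidean_space" and a b :: "real^2"
  defines "D \<equiv> cbox a b"
  assumes W: "L-lipschitz_on UNIV W" and g: "lbm g"
    and dW: "AE y in lborel. y \<in> D \<longrightarrow> (W has_derivative dmap (g y)) (at y)"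
    and ab: "a $ 1 < b $ 1" "a $ 2 < b $ 2"
  shows "ig D (\<lambda>y. (norm (W y - mean D W))\<^sup>2) \<le>
    2 * ((b $ 1 - a $ 1)\<^sup>2 + (b $ 2 - a $ 2)\<^sup>2) * ig D (\<lambda>y. (norm (g y))\<^sup>2)"
proof -
  let ?E = "ig D (\<lambda>y. (norm (g y))\<^sup>2)"
  have E: "?E \<ge> 0" by (rule ig_nonneg) simp
  have "ig D (\<lambda>y. (norm (W y - mean D W))\<^sup>2) \<le> 2 * (((b $ 1 - a $ 1)\<^sup>2 + (b $ 2 - a $ 2)\<^sup>2) * ?E)"
  proof (rule mean_osc_cbox[OF lbm_lipschitz[OF W] ab, folded D_def])
    fix s :: "real^2" assume s: "\<bar>s $ 1\<bar> \<le> b $ 1 - a $ 1" "\<bar>s $ 2\<bar> \<le> b $ 2 - a $ 2"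
    have "ig (D \<inter> (+) (- s) ` D) (\<lambda>x. (norm (W (x + s) - W x))\<^sup>2) \<le> (norm s)\<^sup>2 * ?E"
    proof (rule translation_estimate[OF W g dW])
      show "bset D" "bset (D \<inter> (+) (- s) ` D)"
        unfolding D_def by (intro bset_cbox bset_Int bset_shift)+
      show "x + \<tau> *\<^sub>R s \<in> D" if "x \<in> D \<inter> (+) (- s) ` D" "0 \<le> \<tau>" "\<tau> \<le> 1" for x \<tau>
        by (rule translate_Int_convex[OF _ that]) (simp add: D_def convex_box)
    qed
    also have "\<dots> \<le> ((b $ 1 - a $ 1)\<^sup>2 + (b $ 2 - a $ 2)\<^sup>2) * ?E"
    proof (rule mult_right_mono[OF _ E])
      have "(s $ 1)\<^sup>2 \<le> (b $ 1 - a $ 1)\<^sup>2" "(s $ 2)\<^sup>2 \<le> (b $ 2 - a $ 2)\<^sup>2"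
        using s by (metis abs_ge_zero power2_abs power_mono)+
      then show "(norm s)\<^sup>2 \<le> (b $ 1 - a $ 1)\<^sup>2 + (b $ 2 - a $ 2)\<^sup>2" by (simp add: norm_real2)
    qed
    finally show "ig (D \<inter> (+) (- s) ` D) (\<lambda>x. (norm (W (x + s) - W x))\<^sup>2) \<le> \<dots>" .
  qed
  then show ?thesis by (simp only: mult.assoc)
qed

text \<open>Gluing across an overlap: on \<open>N\<close> both constants approximate
  \<open>W\<close>, so |c1 - c2|^2 times the measure of \<open>N\<close> is at most 2 K1 + 2 K2.
  Replacing \<open>c2\<close> by \<open>c1\<close> on \<open>A2\<close> then costs the ratio 4 of
  the measures; 18 is the largest coefficient that arises.\<close>

lemma osc_union:
  fixes W :: "real^2 \<Rightarrow> 'b::euclidean_space"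
  assumes W: "lbm W" and A: "bset A1" "bset A2" and N: "bset N" "N \<subseteq> A1" "N \<subseteq> A2" "measure lborel N > 0"
    and A2: "measure lborel A2 \<le> 4 * measure lborel N"
    and K: "ig A1 (\<lambda>y. (norm (W y - c1))\<^sup>2) \<le> K1" "ig A2 (\<lambda>y. (norm (W y - c2))\<^sup>2) \<le> K2"
  shows "ig (A1 \<union> A2) (\<lambda>y. (norm (W y - c1))\<^sup>2) \<le> 18 * (K1 + K2)"
proof -
  have l: "lbm (\<lambda>y. (norm (W y - v))\<^sup>2)" for v by (intro lbm_intros W)
  have tri: "(norm (p + q))\<^sup>2 \<le> 2 * (norm p)\<^sup>2 + 2 * (norm q)\<^sup>2" for p q :: 'b
  proof -
    have "(norm (p + q))\<^sup>2 \<le> (norm p + norm q)\<^sup>2" by (intro power_mono norm_triangle_ineq) simp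
    also have "\<dots> \<le> 2 * (norm p)\<^sup>2 + 2 * (norm q)\<^sup>2" using sum_squares_bound[of "norm p" "norm q"]
      by (simp add: power2_sum)
    finally show ?thesis .
  qed
  have K0: "K1 \<ge> 0" "K2 \<ge> 0"
    by (rule order.trans[OF ig_nonneg K(1)], simp, rule order.trans[OF ig_nonneg K(2)], simp)
  have "measure lborel N * (norm (c1 - c2))\<^sup>2 = ig N (\<lambda>y. (norm (c1 - c2))\<^sup>2)"
    using ig_const[OF N(1), of "(norm (c1 - c2))\<^sup>2"] by simp
  also have "\<dots> \<le> ig N (\<lambda>y. 2 * (norm (W y - c1))\<^sup>2 + 2 * (norm (W y - c2))\<^sup>2)"
  proof (rule ig_mono)
    fix y show "(norm (c1 - c2))\<^sup>2 \<le> 2 * (norm (W y - c1))\<^sup>2 + 2 * (norm (W y - c2))\<^sup>2"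
      using tri[of "c1 - W y" "W y - c2"] by (simp add: norm_minus_commute)
  qed (intro N lbm_intros l W)+
  also have "\<dots> = 2 * ig N (\<lambda>y. (norm (W y - c1))\<^sup>2) + 2 * ig N (\<lambda>y. (norm (W y - c2))\<^sup>2)"
    unfolding ig_cmult[symmetric] by (intro ig_add N lbm_intros l W)
  also have "\<dots> \<le> 2 * K1 + 2 * K2"
    using K ig_mono_set[OF N(1) A(1) l _ N(2), of c1] ig_mono_set[OF N(1) A(2) l _ N(3), of c2] by simp
  finally have n: "measure lborel N * (norm (c1 - c2))\<^sup>2 \<le> 2 * K1 + 2 * K2" .
  have "ig A2 (\<lambda>y. (norm (W y - c1))\<^sup>2) \<le> ig A2 (\<lambda>y. 2 * (norm (W y - c2))\<^sup>2 + 2 * (norm (c1 - c2))\<^sup>2)"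
  proof (rule ig_mono)
    fix y show "(norm (W y - c1))\<^sup>2 \<le> 2 * (norm (W y - c2))\<^sup>2 + 2 * (norm (c1 - c2))\<^sup>2"
      using tri[of "W y - c2" "c2 - c1"] by (simp add: norm_minus_commute)
  qed (intro A lbm_intros l W)+
  also have "\<dots> = 2 * ig A2 (\<lambda>y. (norm (W y - c2))\<^sup>2) + measure lborel A2 * (2 * (norm (c1 - c2))\<^sup>2)"
    using ig_const[OF A(2), of "2 * (norm (c1 - c2))\<^sup>2"] 
    by (subst ig_add) (auto intro!: A lbm_intros l W simp: ig_cmult)
  also have "\<dots> \<le> 2 * K2 + (4 * measure lborel N) * (2 * (norm (c1 - c2))\<^sup>2)"
    using K(2) A2 by (intro add_mono mult_right_mono) auto
  also have "\<dots> \<le> 2 * K2 + 8 * (2 * K1 + 2 * K2)" using n by simp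
  finally have a2: "ig A2 (\<lambda>y. (norm (W y - c1))\<^sup>2) \<le> 16 * K1 + 18 * K2" by simp
  have "ig (A1 \<union> A2) (\<lambda>y. (norm (W y - c1))\<^sup>2) \<le> ig A1 (\<lambda>y. (norm (W y - c1))\<^sup>2) + ig A2 (\<lambda>y. (norm (W y - c1))\<^sup>2)"
    by (rule ig_Un_le[OF A l]) simp
  then show ?thesis using K(1) a2 K0 by simp
qed

text \<open>The inner boundary is included, so that the set is exactly the union of four closed
  rectangles with sides 4 r and r, neighbours overlapping in corner squares of side r.\<close>

definition annulus :: "real^2 \<Rightarrow> real \<Rightarrow> (real^2) set" where
  "annulus x r = {y \<in> Sq x (2 * r). r \<le> \<bar>y $ 1 - x $ 1\<bar> \<or> r \<le> \<bar>y $ 2 - x $ 2\<bar>}"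

definition box4 :: "real^2 \<Rightarrow> real \<Rightarrow> real \<Rightarrow> real \<Rightarrow> real \<Rightarrow> (real^2) set" where
  "box4 x p q u v = cbox (vector [x $ 1 + p, x $ 2 + u]) (vector [x $ 1 + q, x $ 2 + v])"

lemma mem_box4: "y \<in> box4 x p q u v \<longleftrightarrow>
    p \<le> y $ 1 - x $ 1 \<and> y $ 1 - x $ 1 \<le> q \<and> u \<le> y $ 2 - x $ 2 \<and> y $ 2 - x $ 2 \<le> v"
  by (auto simp: box4_def mem_box_cart forall_2)

lemma measure_box4: "p \<le> q \<Longrightarrow> u \<le> v \<Longrightarrow> measure lborel (box4 x p q u v) = (q - p) * (v - u)"
  unfolding box4_def by (subst measure_cbox2) auto

lemma bset_box4 [simp]: "bset (box4 x p q u v)" by (simp add: box4_def)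

lemma annulus_eq: "r > 0 \<Longrightarrow> annulus x r = ((box4 x (-2*r) (2*r) r (2*r) \<union> box4 x r (2*r) (-2*r) (2*r))
    \<union> box4 x (-2*r) (2*r) (-2*r) (-r)) \<union> box4 x (-2*r) (-r) (-2*r) (2*r)"
  by (auto simp: annulus_def mem_Sq mem_box4)

text \<open>The annulus is not convex, so translation along segments does not apply to it directly.
  Each of the four rectangles has squared diagonal 17 r^2; \<open>osc_union\<close> attaches them
  one by one, always through a corner square of a quarter of the area, and keeps the constant of the
  top rectangle.\<close>

lemma poincare_annulus:
  fixes W :: "real^2 \<Rightarrow> 'b::euclidean_space"
  assumes W: "L-lipschitz_on UNIV W" and g: "lbm g" and r: "r > 0"
    and dW: "AE y in lborel. y \<in> Sq x (2 * r) \<longrightarrow> (W has_derivative dmap (g y)) (at y)"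
  shows "\<exists>c0. ig (annulus x r) (\<lambda>y. (norm (W y - c0))\<^sup>2) \<le> 10^6 * r\<^sup>2 * ig (annulus x r) (\<lambda>y. (norm (g y))\<^sup>2)"
proof -
  let ?A = "annulus x r"
  let ?E = "ig ?A (\<lambda>y. (norm (g y))\<^sup>2)"
  have lg: "lbm (\<lambda>y. (norm (g y))\<^sup>2)" by (intro lbm_intros g)
  have lW: "lbm W" by (rule lbm_lipschitz[OF W])
  have bA: "bset ?A" unfolding annulus_eq[OF r] by (intro bset_Un bset_box4)
  have E: "?E \<ge> 0" by (rule ig_nonneg) simp
  have P: "\<exists>m. ig (box4 x p q u v) (\<lambda>y. (norm (W y - m))\<^sup>2) \<le> 34 * r\<^sup>2 * ?E"
    if "p < q" "u < v" "box4 x p q u v \<subseteq> ?A" "(q - p)\<^sup>2 + (v - u)\<^sup>2 = 17 * r\<^sup>2" for p q u v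
  proof -
    let ?D = "box4 x p q u v"
    have "AE y in lborel. y \<in> ?D \<longrightarrow> (W has_derivative dmap (g y)) (at y)"
      using dW by eventually_elim (use that(3) in \<open>auto simp: annulus_def\<close>)
    then have "ig ?D (\<lambda>y. (norm (W y - mean ?D W))\<^sup>2) \<le> 2 * ((q - p)\<^sup>2 + (v - u)\<^sup>2) * ig ?D (\<lambda>y. (norm (g y))\<^sup>2)"
      using poincare_cbox[OF W g, of "vector [x $ 1 + p, x $ 2 + u]" "vector [x $ 1 + q, x $ 2 + v]"] that(1,2)
      by (simp add: box4_def)
    also have "\<dots> \<le> 2 * ((q - p)\<^sup>2 + (v - u)\<^sup>2) * ?E"
      by (intro mult_left_mono ig_mono_set bA lg that bset_box4) auto
    finally show ?thesis unfolding that(4) by auto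
  qed
  let ?T = "box4 x (-2*r) (2*r) r (2*r)" and ?R = "box4 x r (2*r) (-2*r) (2*r)"
  let ?B = "box4 x (-2*r) (2*r) (-2*r) (-r)" and ?L = "box4 x (-2*r) (-r) (-2*r) (2*r)"
  have sub: "?T \<subseteq> ?A" "?R \<subseteq> ?A" "?B \<subseteq> ?A" "?L \<subseteq> ?A" unfolding annulus_eq[OF r] by auto
  let ?k = "34 * r\<^sup>2 * ?E"
  obtain c1 where c1: "ig ?T (\<lambda>y. (norm (W y - c1))\<^sup>2) \<le> ?k"
    using P[of "-2*r" "2*r" r "2*r"] sub r by (auto simp: power2_eq_square)
  obtain c2 where c2: "ig ?R (\<lambda>y. (norm (W y - c2))\<^sup>2) \<le> ?k"
    using P[of r "2*r" "-2*r" "2*r"] sub r by (auto simp: power2_eq_square)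
  obtain c3 where c3: "ig ?B (\<lambda>y. (norm (W y - c3))\<^sup>2) \<le> ?k"
    using P[of "-2*r" "2*r" "-2*r" "-r"] sub r by (auto simp: power2_eq_square)
  obtain c4 where c4: "ig ?L (\<lambda>y. (norm (W y - c4))\<^sup>2) \<le> ?k"
    using P[of "-2*r" "-r" "-2*r" "2*r"] sub r by (auto simp: power2_eq_square)
  have u1: "ig (?T \<union> ?R) (\<lambda>y. (norm (W y - c1))\<^sup>2) \<le> 18 * (?k + ?k)"
    by (rule osc_union[OF lW _ _ _ _ _ _ _ c1 c2, of "box4 x r (2*r) r (2*r)"])
      (use r in \<open>auto simp: mem_box4 measure_box4 power2_eq_square intro!: bset_Un\<close>)
  have u2: "ig (?T \<union> ?R \<union> ?B) (\<lambda>y. (norm (W y - c1))\<^sup>2) \<le> 18 * (18 * (?k + ?k) + ?k)"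
    by (rule osc_union[OF lW _ _ _ _ _ _ _ u1 c3, of "box4 x r (2*r) (-2*r) (-r)"])
      (use r in \<open>auto simp: mem_box4 measure_box4 power2_eq_square intro!: bset_Un\<close>)
  have u3: "ig (?T \<union> ?R \<union> ?B \<union> ?L) (\<lambda>y. (norm (W y - c1))\<^sup>2) \<le> 18 * (18 * (18 * (?k + ?k) + ?k) + ?k)"
    by (rule osc_union[OF lW _ _ _ _ _ _ _ u2 c4, of "box4 x (-2*r) (-r) r (2*r)"])
      (use r in \<open>auto simp: mem_box4 measure_box4 power2_eq_square intro!: bset_Un\<close>)
  \<comment> \<open>The three gluings give 18 * (18 * (18 * 2 + 1) + 1) = 12006, and 34 * 12006 =
    408204 is rounded up.\<close>
  also have "\<dots> \<le> 10^6 * r\<^sup>2 * ?E" using E r by simp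
  finally show ?thesis unfolding annulus_eq[OF r] by blast
qed

context null_form
begin

text \<open>With k = \<open>Ccac\<close> * 10^6, an inequality E(r) <= k (E(4 r) - E(r)) gives E(r)
  <= k / (1 + k) * E(4 r); 10^6 is the Poincare constant of the annulus.\<close>

definition \<theta> :: real where "\<theta> = Ccac * 10^6 / (1 + Ccac * 10^6)"

lemma theta: "0 < \<theta>" "\<theta> < 1"
  using Ccac_pos by (auto simp: \<theta>_def divide_simps)

text \<open>Caccioppoli is used between the radii 2 r and 4 r and Poincare on that annulus, so the
  inner energy is at most k times the energy of the annulus, up to the error. The annulus avoids
  \<open>Sq x r\<close>, and adding k times the inner energy to both sides fills the hole. The
  powers of r cancel, which makes \<theta> independent of the scale.\<close>

lemma hole_filling:
  assumes V: "L-lipschitz_on UNIV V" and g: "lbm g" and e: "lbm e" "\<And>y. e y \<ge> 0" and r: "r > 0"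
    and dV: "AE y in lborel. y \<in> Sq x (4 * r) \<longrightarrow> (V has_derivative dmap (g y)) (at y)"
    and co: "AE y in lborel. y \<in> Sq x (4 * r) \<longrightarrow> Q (g y) \<ge> c * (norm (g y))\<^sup>2 - e y"
  shows "ig (Sq x r) (\<lambda>y. (norm (g y))\<^sup>2) \<le> \<theta> * ig (Sq x (4 * r)) (\<lambda>y. (norm (g y))\<^sup>2) + Ccac * ig (Sq x (4 * r)) e"
proof -
  let ?G = "\<lambda>y. (norm (g y))\<^sup>2"
  have lV: "lbm V" by (rule lbm_lipschitz[OF V])
  have lG: "lbm ?G" by (intro lbm_intros g)
  define A where "A = annulus x (2 * r)"
  have bA: "bset A" unfolding A_def using r by (subst annulus_eq) (simp, intro bset_Un bset_box4)
  obtain c0 where c0: "ig A (\<lambda>y. (norm (V y - c0))\<^sup>2) \<le> 10^6 * (2 * r)\<^sup>2 * ig A ?G"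
    using poincare_annulus[OF V g, of "2 * r" x] r dV by (auto simp: A_def)
  have "ig (Sq x r) ?G \<le> ig (Sq x (2 * r)) ?G"
    using r by (intro ig_mono_set lG Sq_mono) auto
  also have "\<dots> \<le> Ccac * (1 / (2 * r)\<^sup>2 * ig (Sq x (2 * (2 * r)) - Sq x (2 * r)) (\<lambda>y. (norm (V y - c0))\<^sup>2) + ig (Sq x (2 * (2 * r))) e)"
    by (rule caccioppoli[OF V g e]) (use r dV co in auto)
  also have "\<dots> \<le> Ccac * (1 / (2 * r)\<^sup>2 * ig A (\<lambda>y. (norm (V y - c0))\<^sup>2) + ig (Sq x (4 * r)) e)"
  proof -
    have "ig (Sq x (2 * (2 * r)) - Sq x (2 * r)) (\<lambda>y. (norm (V y - c0))\<^sup>2) \<le> ig A (\<lambda>y. (norm (V y - c0))\<^sup>2)"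
      by (intro ig_mono_set bA lbm_intros lV bset_Diff bset_Sq) (auto simp: A_def annulus_def mem_Sq)
    then show ?thesis using Ccac_pos by (intro mult_left_mono add_mono) auto
  qed
  also have "\<dots> \<le> Ccac * (1 / (2 * r)\<^sup>2 * (10^6 * (2 * r)\<^sup>2 * ig A ?G) + ig (Sq x (4 * r)) e)"
    using c0 Ccac_pos by (intro mult_left_mono add_mono) auto
  also have "\<dots> = Ccac * 10^6 * ig A ?G + Ccac * ig (Sq x (4 * r)) e"
    using r by (simp add: field_simps)
  finally have 1: "ig (Sq x r) ?G \<le> Ccac * 10^6 * ig A ?G + Ccac * ig (Sq x (4 * r)) e" .
  have "ig A ?G \<le> ig (Sq x (4 * r) - Sq x r) ?G"
    using r by (intro ig_mono_set bA lG bset_Diff bset_Sq) (auto simp: A_def annulus_def mem_Sq)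
  also have "\<dots> = ig (Sq x (4 * r)) ?G - ig (Sq x r) ?G"
    using r by (intro ig_Diff lG Sq_mono) auto
  finally have 2: "ig A ?G \<le> ig (Sq x (4 * r)) ?G - ig (Sq x r) ?G" .
  define k where "k = Ccac * 10^6"
  have k: "k > 0" using Ccac_pos by (simp add: k_def)
  have e0: "ig (Sq x (4 * r)) e \<ge> 0" using e(2) by (rule ig_nonneg)
  have "ig (Sq x r) ?G \<le> k * (ig (Sq x (4 * r)) ?G - ig (Sq x r) ?G) + Ccac * ig (Sq x (4 * r)) e"
    using 1 mult_left_mono[OF 2 less_imp_le[OF k]] unfolding k_def by linarith
  then have "(1 + k) * ig (Sq x r) ?G \<le> k * ig (Sq x (4 * r)) ?G + Ccac * ig (Sq x (4 * r)) e"
    by (simp add: algebra_simps)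
  then have "ig (Sq x r) ?G \<le> (k * ig (Sq x (4 * r)) ?G + Ccac * ig (Sq x (4 * r)) e) / (1 + k)"
    using k by (simp add: pos_le_divide_eq mult.commute)
  also have "\<dots> = \<theta> * ig (Sq x (4 * r)) ?G + Ccac * ig (Sq x (4 * r)) e / (1 + k)"
    unfolding \<theta>_def k_def[symmetric] by (simp add: add_divide_distrib)
  also have "Ccac * ig (Sq x (4 * r)) e / (1 + k) \<le> Ccac * ig (Sq x (4 * r)) e / 1"
    using k e0 Ccac_pos by (intro divide_left_mono) auto
  finally show ?thesis by simp
qed

end

section \<open>Decay of the mean oscillation\<close>

lemma has_derivative_shift_diff:
  assumes "(W has_derivative dmap a) (at (y + s))" "(W has_derivative dmap b) (at y)"
  shows "((\<lambda>y. W (y + s) - W y - v) has_derivative dmap (a - b)) (at y)"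
proof -
  have "((\<lambda>y. W (y + s)) has_derivative (\<lambda>u. dmap a u)) (at y)"
    by (rule has_derivative_compose[of "\<lambda>y. y + s" "\<lambda>u. u" y UNIV W]) (auto intro!: derivative_eq_intros assms)
  then have "((\<lambda>y. W (y + s) - W y - v) has_derivative (\<lambda>u. dmap a u - dmap b u - 0)) (at y)"
    by (intro has_derivative_diff assms has_derivative_const)
  moreover have "(\<lambda>u. dmap a u - dmap b u - 0) = dmap (a - b)" by (simp add: fun_eq_iff dmap_diff)
  ultimately show ?thesis by simp
qed

lemma lipschitz_shift_diff:
  fixes W :: "'a::real_normed_vector \<Rightarrow> 'b::real_normed_vector"
  assumes "L-lipschitz_on UNIV W"
  shows "(L + L)-lipschitz_on UNIV (\<lambda>y. W (y + s) - W y - v)"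
proof (rule lipschitz_onI)
  fix x y
  have "dist (W (x + s) - W x - v) (W (y + s) - W y - v) = norm ((W (x + s) - W (y + s)) - (W x - W y))"
    by (simp add: dist_norm algebra_simps)
  also have "\<dots> \<le> dist (W (x + s)) (W (y + s)) + dist (W x) (W y)"
    by (simp add: dist_norm norm_triangle_ineq4)
  also have "\<dots> \<le> L * dist (x + s) (y + s) + L * dist x y"
    by (intro add_mono lipschitz_onD[OF assms]) auto
  finally show "dist (W (x + s) - W x - v) (W (y + s) - W y - v) \<le> (L + L) * dist x y"
    by (simp add: algebra_simps)
qed (use lipschitz_on_nonneg[OF assms] in simp)

context null_form
begin

text \<open>The exponent \<open>\<rho>\<close> measures how far the coercivity of translates is from being exact: \<open>K = 0\<close> for
  autonomous inclusions, \<open>\<rho> > 0\<close> for coefficients that are Hoelder continuous in \<open>y\<close>.\<close>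

definition admissible ::
  "(real^2 \<Rightarrow> 'b) \<Rightarrow> real \<Rightarrow> (real^2 \<Rightarrow> 'b \<times> 'b) \<Rightarrow> (real^2) set \<Rightarrow> real \<Rightarrow> real \<Rightarrow> bool" where
  "admissible W L g S K \<rho> \<longleftrightarrow> L-lipschitz_on UNIV W \<and> lbm g \<and>
    (AE y in lborel. y \<in> S \<longrightarrow> (W has_derivative dmap (g y)) (at y)) \<and>
    (\<forall>s. AE y in lborel. y \<in> S \<and> y + s \<in> S \<longrightarrow>
      Q (g (y + s) - g y) \<ge> c * (norm (g (y + s) - g y))\<^sup>2 - K * norm s powr (2 * \<rho>) * ((norm (g y))\<^sup>2 + 1))"

text \<open>Hole filling gains a factor \<open>\<theta>\<close> at each of the \<open>j\<close> scales; the affine function with gradient \<open>P\<close> is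
  subtracted before the Caccioppoli inequality is applied at the largest scale.\<close>

lemma translate_energy:
  assumes ad: "admissible W L g S K \<rho>" and K: "K \<ge> 0"
    and r: "r > 0" and s: "\<bar>s $ 1\<bar> \<le> r" "\<bar>s $ 2\<bar> \<le> r" and S: "Sq x (3 * r) \<subseteq> S"
  shows "ig (Sq x (r / 4 ^ j)) (\<lambda>y. (norm (g (y + s) - g y))\<^sup>2) \<le>
    \<theta> ^ j * Ccac * ((norm s)\<^sup>2 / r\<^sup>2) * ig (Sq x (3 * r)) (\<lambda>y. (norm (g y - P))\<^sup>2)
    + (1 + real j) * Ccac * (K * norm s powr (2 * \<rho>)) * ig (Sq x (3 * r)) (\<lambda>y. (norm (g y))\<^sup>2 + 1)"
proof -
  have W: "L-lipschitz_on UNIV W" and g: "lbm g"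
    and dW: "AE y in lborel. y \<in> S \<longrightarrow> (W has_derivative dmap (g y)) (at y)"
    and co: "AE y in lborel. y \<in> S \<and> y + s \<in> S \<longrightarrow>
      Q (g (y + s) - g y) \<ge> c * (norm (g (y + s) - g y))\<^sup>2 - K * norm s powr (2 * \<rho>) * ((norm (g y))\<^sup>2 + 1)"
    using ad unfolding admissible_def by blast+
  \<comment> \<open>Subtracting the constant \<open>dmap P s\<close> does not affect the derivative
    of \<open>V\<close>, but makes \<open>V\<close> the increment of \<open>W\<close> minus the
    linear map \<open>dmap P\<close>; its size is then governed by \<open>g - P\<close> instead of
    \<open>g\<close>.\<close>
  define V where "V y = W (y + s) - W y - dmap P s" for y
  define G where "G y = g (y + s) - g y" for y
  define k where "k = K * norm s powr (2 * \<rho>)"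
  have k0: "k \<ge> 0" using K by (simp add: k_def)
  define e where "e y = k * ((norm (g y))\<^sup>2 + 1)" for y
  have V: "(L + L)-lipschitz_on UNIV V" unfolding V_def by (rule lipschitz_shift_diff[OF W])
  have G: "lbm G" unfolding G_def by (intro lbm_intros lbm_shift g)
  have e: "lbm e" "\<And>y. e y \<ge> 0" unfolding e_def using k0 by (auto intro!: lbm_intros g)
  \<comment> \<open>Caccioppoli at radius r looks at \<open>Sq x (2 * r)\<close>, and the shift by
    \<open>s\<close> adds at most r in each coordinate: hence the radius 3 r of the data.\<close>
  have in2: "y \<in> Sq x (2 * r) \<Longrightarrow> y \<in> S \<and> y + s \<in> S" for y
    using s r by (intro conjI subsetD[OF S]) (auto simp: mem_Sq)
  have dV: "AE y in lborel. y \<in> Sq x (2 * r) \<longrightarrow> (V has_derivative dmap (G y)) (at y)"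
    using dW AE_lborel_shift[OF dW, of s]
    by eventually_elim (use in2 in \<open>auto simp: V_def[abs_def] G_def intro!: has_derivative_shift_diff\<close>)
  have coV: "AE y in lborel. y \<in> Sq x (2 * r) \<longrightarrow> Q (G y) \<ge> c * (norm (G y))\<^sup>2 - e y"
    using co by eventually_elim (use in2 in \<open>auto simp: G_def e_def k_def\<close>)
  let ?I = "ig (Sq x (3 * r)) (\<lambda>y. (norm (g y))\<^sup>2 + 1)"
  have ie: "ig (Sq x t) e \<le> k * ?I" if "t \<le> 3 * r" for t
  proof -
    have "ig (Sq x t) e = k * ig (Sq x t) (\<lambda>y. (norm (g y))\<^sup>2 + 1)" unfolding e_def ig_cmult ..
    also have "\<dots> \<le> k * ?I"
      using that k0 by (intro mult_left_mono ig_mono_set lbm_intros g Sq_mono) auto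
    finally show ?thesis .
  qed
  define E where "E t = ig (Sq x t) (\<lambda>y. (norm (G y))\<^sup>2)" for t
  let ?X = "ig (Sq x (3 * r)) (\<lambda>y. (norm (g y - P))\<^sup>2)"
  have X0: "?X \<ge> 0" by (rule ig_nonneg) simp
  have top: "E r \<le> Ccac * ((norm s)\<^sup>2 / r\<^sup>2 * ?X + k * ?I)"
  proof -
    have "E r \<le> Ccac * (1 / r\<^sup>2 * ig (Sq x (2 * r) - Sq x r) (\<lambda>y. (norm (V y - 0))\<^sup>2) + ig (Sq x (2 * r)) e)"
      unfolding E_def by (rule caccioppoli[OF V G e r dV coV])
    also have "\<dots> \<le> Ccac * (1 / r\<^sup>2 * ((norm s)\<^sup>2 * ?X) + k * ?I)"
    proof (intro mult_left_mono add_mono)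
      have "ig (Sq x (2 * r) - Sq x r) (\<lambda>y. (norm (V y - 0))\<^sup>2) \<le> ig (Sq x (2 * r)) (\<lambda>y. (norm (V y - 0))\<^sup>2)"
        by (intro ig_mono_set lbm_intros lbm_lipschitz[OF V] bset_Diff bset_Sq) auto
      also have "\<dots> = ig (Sq x (2 * r)) (\<lambda>y. (norm ((W (y + s) - dmap P (y + s)) - (W y - dmap P y)))\<^sup>2)"
        by (simp add: V_def dmap_add_right algebra_simps)
      also have "\<dots> \<le> (norm s)\<^sup>2 * ?X"
      proof (rule translation_estimate[where L="L + norm P"])
        show "(L + norm P)-lipschitz_on UNIV (\<lambda>y. W y - dmap P y)"
        proof (rule lipschitz_onI)
          fix y z
          have "dist (W y - dmap P y) (W z - dmap P z) = norm ((W y - W z) - dmap P (y - z))"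
            by (simp add: dist_norm dmap_diff_right algebra_simps)
          also have "\<dots> \<le> dist (W y) (W z) + norm (y - z) * norm P"
            using norm_triangle_ineq4[of "W y - W z" "dmap P (y - z)"] norm_dmap_le[of P "y - z"]
            by (simp add: dist_norm)
          also have "\<dots> \<le> L * dist y z + norm (y - z) * norm P"
            by (intro add_mono lipschitz_onD[OF W]) auto
          finally show "dist (W y - dmap P y) (W z - dmap P z) \<le> (L + norm P) * dist y z"
            by (simp add: dist_norm algebra_simps)
        qed (use lipschitz_on_nonneg[OF W] in simp)
        show "AE y in lborel. y \<in> Sq x (3 * r) \<longrightarrow> ((\<lambda>y. W y - dmap P y) has_derivative dmap (g y - P)) (at y)"
          using dW
        proof eventually_elim
          fix y assume *: "y \<in> S \<longrightarrow> (W has_derivative dmap (g y)) (at y)"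
          show "y \<in> Sq x (3 * r) \<longrightarrow> ((\<lambda>y. W y - dmap P y) has_derivative dmap (g y - P)) (at y)"
          proof
            assume "y \<in> Sq x (3 * r)"
            then have "(W has_derivative dmap (g y)) (at y)" using * S by auto
            then have "((\<lambda>y. W y - dmap P y) has_derivative (\<lambda>u. dmap (g y) u - dmap P u)) (at y)"
              by (intro has_derivative_diff bounded_linear_imp_has_derivative bounded_linear_dmap)
            then show "((\<lambda>y. W y - dmap P y) has_derivative dmap (g y - P)) (at y)"
              by (simp add: dmap_diff[abs_def])
          qed
        qed
        show "y + \<tau> *\<^sub>R s \<in> Sq x (3 * r)" if "y \<in> Sq x (2 * r)" "0 \<le> \<tau>" "\<tau> \<le> 1" for y \<tau>
        proof -
          have "\<bar>\<tau> * s $ i\<bar> \<le> r" if "\<bar>s $ i\<bar> \<le> r" for i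
            using mult_mono[of \<tau> 1 "\<bar>s $ i\<bar>" r] that \<open>0 \<le> \<tau>\<close> \<open>\<tau> \<le> 1\<close> r by (simp add: abs_mult)
          then show ?thesis using that(1) s by (auto simp: mem_Sq) (smt (verit))+
        qed
      qed (intro lbm_intros g bset_Sq)+
      finally show "ig (Sq x (2 * r) - Sq x r) (\<lambda>y. (norm (V y - 0))\<^sup>2) \<le> (norm s)\<^sup>2 * ?X" .
    qed (use r ie[of "2 * r"] Ccac_pos in auto)
    finally show ?thesis by simp
  qed
  have I0: "k * ?I \<ge> 0" using k0 by (intro mult_nonneg_nonneg ig_nonneg) auto
  have "E (r / 4 ^ j) \<le> \<theta> ^ j * Ccac * ((norm s)\<^sup>2 / r\<^sup>2) * ?X + (1 + real j) * Ccac * (k * ?I)"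
  proof (induction j)
    case 0
    then show ?case using top by (simp add: algebra_simps)
  next
    case (Suc j)
    have r4: "4 * (r / 4 ^ Suc j) = r / 4 ^ j" by simp
    have "r / 4 ^ j \<le> r" using r by (simp add: divide_le_eq mult_le_cancel_left1)
    then have sub: "Sq x (r / 4 ^ j) \<subseteq> Sq x (2 * r)" and le: "r / 4 ^ j \<le> 3 * r" using r by (auto intro!: Sq_mono)
    have "E (r / 4 ^ Suc j) \<le> \<theta> * ig (Sq x (4 * (r / 4 ^ Suc j))) (\<lambda>y. (norm (G y))\<^sup>2) + Ccac * ig (Sq x (4 * (r / 4 ^ Suc j))) e"
      unfolding E_def
    proof (rule hole_filling[OF V G e])
      show "0 < r / 4 ^ Suc j" using r by simp
      show "AE y in lborel. y \<in> Sq x (4 * (r / 4 ^ Suc j)) \<longrightarrow> (V has_derivative dmap (G y)) (at y)"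
        unfolding r4 using dV by eventually_elim (use sub in auto)
      show "AE y in lborel. y \<in> Sq x (4 * (r / 4 ^ Suc j)) \<longrightarrow> Q (G y) \<ge> c * (norm (G y))\<^sup>2 - e y"
        unfolding r4 using coV by eventually_elim (use sub in auto)
    qed
    also have "\<dots> = \<theta> * E (r / 4 ^ j) + Ccac * ig (Sq x (r / 4 ^ j)) e" unfolding r4 E_def ..
    also have "\<dots> \<le> \<theta> * (\<theta> ^ j * Ccac * ((norm s)\<^sup>2 / r\<^sup>2) * ?X + (1 + real j) * Ccac * (k * ?I)) + Ccac * (k * ?I)"
      using Suc theta Ccac_pos ie[OF le] by (intro add_mono mult_left_mono) auto
    \<comment> \<open>The errors of the scales are merely counted: estimating \<theta> by 1 in front
      of them produces the factor 1 + j, harmless because j will be fixed.\<close>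
    also have "\<dots> \<le> \<theta> ^ Suc j * Ccac * ((norm s)\<^sup>2 / r\<^sup>2) * ?X + (1 + real (Suc j)) * Ccac * (k * ?I)"
    proof -
      have "\<theta> * ((1 + real j) * Ccac * (k * ?I)) \<le> 1 * ((1 + real j) * Ccac * (k * ?I))"
        using theta Ccac_pos by (intro mult_right_mono mult_nonneg_nonneg[OF _ I0]) auto
      then show ?thesis by (simp add: algebra_simps)
    qed
    finally show ?case .
  qed
  then show ?thesis unfolding E_def G_def k_def by (simp only: mult.assoc)
qed

text \<open>Neither this quantity nor \<open>energy\<close> is divided by the area of the square. A
  bounded \<open>g\<close> thus has rate r^2, and Hoelder continuity with exponent \<mu> corresponds
  to the rate 2 + 2 \<mu> of \<open>osc\<close>.\<close>

definition osc :: "(real^2 \<Rightarrow> 'b \<times> 'b) \<Rightarrow> real^2 \<Rightarrow> real \<Rightarrow> real" where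
  "osc g x r = ig (Sq x r) (\<lambda>y. (norm (g y - mean (Sq x r) g))\<^sup>2)"
definition energy :: "(real^2 \<Rightarrow> 'b \<times> 'b) \<Rightarrow> real^2 \<Rightarrow> real \<Rightarrow> real" where
  "energy g x r = ig (Sq x r) (\<lambda>y. (norm (g y))\<^sup>2)"

text \<open>A square of half side q = r / (3 * 4^j) involves only shifts with |s|^2 <= 8 q^2, which
  contributes 16^(-j), while hole filling over j scales contributes \<theta>^j. Taking the mean over
  \<open>Sq x r\<close> for \<open>P\<close> makes the right-hand side an oscillation again. The 3
  is the ratio of radii in \<open>translate_energy\<close>, and j >= 1 makes the shifts admissible
  there.\<close>

lemma osc_decay:
  assumes ad: "admissible W L g S K \<rho>" and K: "K \<ge> 0" and \<rho>: "0 < \<rho>" "\<rho> \<le> 1"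
    and r: "r > 0" and S: "Sq x r \<subseteq> S" and j: "j \<ge> 1"
  shows "osc g x (r / (3 * 4 ^ j)) \<le> 16 * Ccac * (\<theta> / 16) ^ j * osc g x r
    + 64 * (1 + real j) * Ccac * K * r powr (2 * \<rho>) * (energy g x r + r\<^sup>2)"
proof -
  have g: "lbm g" using ad by (simp add: admissible_def)
  define p where "p = r / 3"
  have p: "p > 0" "3 * p = r" using r by (auto simp: p_def)
  define q where "q = p / 4 ^ j"
  have q: "q > 0" "q \<le> p / 4" using p j by (auto simp: q_def divide_simps intro!: self_le_power)
  define D where "D = Sq x q"
  have cb: "D = cbox (\<chi> i. x $ i - q) (\<chi> i. x $ i + q)" by (simp add: D_def Sq_cbox)
  define M1 where "M1 = \<theta> ^ j * Ccac * (8 / 16 ^ j) * osc g x r"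
  define M2 where "M2 = (1 + real j) * Ccac * (K * (8 * r powr (2 * \<rho>))) * (energy g x r + 4 * r\<^sup>2)"
  have osc0: "osc g x r \<ge> 0" unfolding osc_def by (rule ig_nonneg) simp
  have en0: "energy g x r \<ge> 0" unfolding energy_def by (rule ig_nonneg) simp
  have "osc g x q \<le> 2 * (M1 + M2)"
    unfolding osc_def D_def[symmetric]
  proof (rule mean_osc_cbox[OF g, where a="\<chi> i. x $ i - q" and b="\<chi> i. x $ i + q", folded cb])
    fix s :: "real^2"
    assume "\<bar>s $ 1\<bar> \<le> (\<chi> i. x $ i + q) $ 1 - (\<chi> i. x $ i - q) $ 1" "\<bar>s $ 2\<bar> \<le> (\<chi> i. x $ i + q) $ 2 - (\<chi> i. x $ i - q) $ 2"
    then have s: "\<bar>s $ 1\<bar> \<le> 2 * q" "\<bar>s $ 2\<bar> \<le> 2 * q" by auto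
    have "(s $ 1)\<^sup>2 \<le> (2 * q)\<^sup>2" "(s $ 2)\<^sup>2 \<le> (2 * q)\<^sup>2"
      using s by (metis abs_ge_zero power2_abs power_mono)+
    then have ns: "(norm s)\<^sup>2 \<le> 8 * q\<^sup>2" by (simp add: norm_real2 power_mult_distrib)
    have A: "\<theta> ^ j * Ccac * ((norm s)\<^sup>2 / p\<^sup>2) * osc g x r \<le> M1"
    proof -
      have "(norm s)\<^sup>2 / p\<^sup>2 \<le> 8 / 16 ^ j"
      proof -
        have "(norm s)\<^sup>2 / p\<^sup>2 \<le> 8 * q\<^sup>2 / p\<^sup>2" using ns by (intro divide_right_mono) auto
        also have "\<dots> = 8 / (4 ^ j)\<^sup>2" using p by (simp add: q_def power_divide)
        also have "((4::real) ^ j)\<^sup>2 = 16 ^ j" by (simp add: power2_eq_square flip: power_mult_distrib)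
        finally show ?thesis .
      qed
      then show ?thesis unfolding M1_def
        using theta Ccac_pos osc0 by (intro mult_right_mono mult_left_mono) auto
    qed
    have A2: "(1 + real j) * Ccac * (K * norm s powr (2 * \<rho>)) * (energy g x r + 4 * r\<^sup>2) \<le> M2"
    proof -
      have "norm s powr (2 * \<rho>) \<le> 8 * r powr (2 * \<rho>)"
      proof -
        have "q \<le> r / 4" using q p by simp
        then have "q\<^sup>2 \<le> (r / 4)\<^sup>2" using q by (intro power_mono) auto
        then have "q\<^sup>2 \<le> r\<^sup>2 / 16" by (simp add: power_divide)
        then have "(norm s)\<^sup>2 \<le> r\<^sup>2" using ns zero_le_power2[of q] by linarith
        then have "norm s \<le> r" using r by (simp add: power2_le_iff_abs_le)
        then have "norm s powr (2 * \<rho>) \<le> r powr (2 * \<rho>)" using \<rho> by (intro powr_mono2) auto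
        then show ?thesis using powr_ge_zero[of r "2 * \<rho>"] by linarith
      qed
      then show ?thesis unfolding M2_def
        using Ccac_pos en0 K by (intro mult_right_mono mult_left_mono mult_nonneg_nonneg add_nonneg_nonneg) auto
    qed
    have "ig (D \<inter> (+) (- s) ` D) (\<lambda>y. (norm (g (y + s) - g y))\<^sup>2) \<le> ig D (\<lambda>y. (norm (g (y + s) - g y))\<^sup>2)"
      unfolding D_def by (intro ig_mono_set lbm_intros lbm_shift g bset_Int bset_shift bset_Sq) auto
    also have "\<dots> \<le> \<theta> ^ j * Ccac * ((norm s)\<^sup>2 / p\<^sup>2) * ig (Sq x (3 * p)) (\<lambda>y. (norm (g y - mean (Sq x r) g))\<^sup>2)
      + (1 + real j) * Ccac * (K * norm s powr (2 * \<rho>)) * ig (Sq x (3 * p)) (\<lambda>y. (norm (g y))\<^sup>2 + 1)"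
      unfolding D_def q_def
      by (rule translate_energy[OF ad K]) (use p q s S in auto)
    also have "ig (Sq x (3 * p)) (\<lambda>y. (norm (g y - mean (Sq x r) g))\<^sup>2) = osc g x r" by (simp add: p osc_def)
    also have "ig (Sq x (3 * p)) (\<lambda>y. (norm (g y))\<^sup>2 + 1) = energy g x r + 4 * r\<^sup>2"
      using ig_const[OF bset_Sq, of x r "1::real"] r measure_Sq[of r x]
      by (subst ig_add) (auto simp: p energy_def intro!: lbm_intros g)
    finally show "ig (D \<inter> (+) (- s) ` D) (\<lambda>y. (norm (g (y + s) - g y))\<^sup>2) \<le> M1 + M2" using A A2 by linarith
  qed (use q in auto)
  also have "2 * (M1 + M2) \<le> 16 * Ccac * (\<theta> / 16) ^ j * osc g x r
    + 64 * (1 + real j) * Ccac * K * r powr (2 * \<rho>) * (energy g x r + r\<^sup>2)"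
  proof -
    have "2 * M1 = 16 * Ccac * (\<theta> / 16) ^ j * osc g x r" by (simp add: M1_def power_divide)
    moreover have "2 * M2 \<le> 64 * (1 + real j) * Ccac * K * r powr (2 * \<rho>) * (energy g x r + r\<^sup>2)"
    proof -
      have "2 * M2 = 16 * (1 + real j) * Ccac * K * r powr (2 * \<rho>) * (energy g x r + 4 * r\<^sup>2)" by (simp add: M2_def)
      also have "\<dots> \<le> 16 * (1 + real j) * Ccac * K * r powr (2 * \<rho>) * (4 * (energy g x r + r\<^sup>2))"
        using Ccac_pos en0 K by (intro mult_left_mono mult_nonneg_nonneg) auto
      finally show ?thesis by (simp only: mult_ac distrib_left)
    qed
    ultimately show ?thesis by simp
  qed
  also have "q = r / (3 * 4 ^ j)" by (simp add: q_def p_def)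
  finally show ?thesis .
qed

text \<open>In the plane the volume factor \<open>16 ^ - j\<close> alone gives the borderline rate \<open>r\<^sup>2\<close>, and \<open>\<theta> < 1\<close> improves it.\<close>

lemma decay_parameters:
  "\<exists>j \<kappa>. j \<ge> (1::nat) \<and> 0 < \<kappa> \<and> \<kappa> \<le> 1 \<and> 16 * Ccac * (\<theta> / 16) ^ j \<le> (1 / (3 * 4 ^ j)) powr (2 + \<kappa>)"
proof -
  \<comment> \<open>Chosen so that 4^\<kappa> is at most \<theta>^(-1/2); then \<theta> 4^\<kappa>
    is at most the square root of \<theta> and hence below 1.\<close>
  define \<kappa> where "\<kappa> = min 1 (- ln \<theta> / (2 * ln 4))"
  have lt: "ln \<theta> < 0" using theta by simp
  have k: "0 < \<kappa>" "\<kappa> \<le> 1" using lt divide_neg_pos[OF lt, of "2 * ln 4"] by (auto simp: \<kappa>_def)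
  have "\<kappa> * ln 4 \<le> - ln \<theta> / (2 * ln 4) * ln 4" by (intro mult_right_mono) (auto simp: \<kappa>_def)
  then have kl: "\<kappa> * ln 4 \<le> - ln \<theta> / 2" by simp
  define \<mu> where "\<mu> = \<theta> * 4 powr \<kappa>"
  have mu0: "\<mu> > 0" using theta by (simp add: \<mu>_def)
  have "ln \<mu> = ln \<theta> + \<kappa> * ln 4" using theta by (simp add: \<mu>_def ln_mult ln_powr)
  then have "ln \<mu> < 0" using kl lt by simp
  then have mu1: "\<mu> < 1" using mu0 by (simp add: ln_less_zero_iff)
  \<comment> \<open>432 = 16 * 27, where 27 bounds 3^(2 + \<kappa>) because \<kappa> is at most
    1.\<close>
  have "(\<lambda>n. (432 * Ccac) * \<mu> ^ n) \<longlonglongrightarrow> (432 * Ccac) * 0"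
    using mu0 mu1 by (intro tendsto_intros LIMSEQ_realpow_zero) auto
  then have "\<forall>\<^sub>F n in sequentially. (432 * Ccac) * \<mu> ^ n < 1"
    by (auto dest: order_tendstoD(2)[of _ _ _ 1])
  then obtain j where j: "j \<ge> 1" "432 * Ccac * \<mu> ^ j < 1"
    unfolding eventually_sequentially by (metis nat_le_linear)
  define X where "X = (3 * 4 ^ j :: real)"
  have X: "X > 0" by (simp add: X_def)
  have "X powr (2 + \<kappa>) \<le> 27 * 16 ^ j * (4 powr \<kappa>) ^ j"
  proof -
    have "X powr (2 + \<kappa>) = 3 powr (2 + \<kappa>) * (4 ^ j) powr (2 + \<kappa>)"
      by (simp add: X_def powr_mult)
    also have "(4 ^ j) powr (2 + \<kappa>) = 16 ^ j * (4 powr \<kappa>) ^ j"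
    proof -
      have "(4 ^ j) powr (2 + \<kappa>) = (4 powr (2 + \<kappa>)) ^ j"
        by (simp add: powr_realpow[symmetric] powr_powr mult.commute)
      also have "4 powr (2 + \<kappa>) = 16 * 4 powr \<kappa>" by (simp add: powr_add)
      finally show ?thesis by (simp add: power_mult_distrib)
    qed
    also have "3 powr (2 + \<kappa>) * (16 ^ j * (4 powr \<kappa>) ^ j) \<le> 27 * (16 ^ j * (4 powr \<kappa>) ^ j)"
    proof (intro mult_right_mono)
      have "(3::real) powr (2 + \<kappa>) \<le> 3 powr 3" using k by (intro powr_mono) auto
      then show "(3::real) powr (2 + \<kappa>) \<le> 27" by simp
    qed auto
    finally show ?thesis by simp
  qed
  then have "16 * Ccac * (\<theta> / 16) ^ j * X powr (2 + \<kappa>) \<le> 16 * Ccac * (\<theta> / 16) ^ j * (27 * 16 ^ j * (4 powr \<kappa>) ^ j)"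
    using Ccac_pos theta by (intro mult_left_mono) auto
  also have "\<dots> = 432 * Ccac * \<mu> ^ j" by (simp add: \<mu>_def power_divide power_mult_distrib)
  finally have "16 * Ccac * (\<theta> / 16) ^ j * X powr (2 + \<kappa>) \<le> 1" using j(2) by linarith
  then have "16 * Ccac * (\<theta> / 16) ^ j \<le> 1 / X powr (2 + \<kappa>)"
    using X by (simp add: pos_le_divide_eq)
  also have "\<dots> = (1 / X) powr (2 + \<kappa>)" using X by (simp add: powr_divide)
  finally show ?thesis using j k unfolding X_def by blast
qed

end

section \<open>Iteration over scales\<close>

lemma Sq_subset:
  assumes "y \<in> Sq x s" "s + r \<le> t" shows "Sq y r \<subseteq> Sq x t"
proof
  fix z assume "z \<in> Sq y r"
  then have a: "\<bar>z $ i - y $ i\<bar> \<le> r \<and> \<bar>y $ i - x $ i\<bar> \<le> s" for i using assms(1) by (auto simp: Sq_def)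
  have "\<bar>z $ i - x $ i\<bar> \<le> t" for i using assms(2) a[of i] by linarith
  then show "z \<in> Sq x t" by (simp add: Sq_def)
qed

text \<open>\<open>M\<close> makes M r^b a supersolution of the recursion: it dominates at r1 and
  satisfies A M + D <= M \<tau>^b. The strict inequality between \<open>A\<close> and \<tau>^b
  leaves room for an inhomogeneity of the same order r^b. Radii between two scales are reached by
  monotonicity, at the price \<tau>^(-b).\<close>

lemma iterate_decay:
  fixes h :: "real \<Rightarrow> real"
  assumes \<tau>: "0 < \<tau>" "\<tau> < 1" and r1: "r1 > 0"
    and mono: "\<And>r s. 0 < r \<Longrightarrow> r \<le> s \<Longrightarrow> s \<le> r1 \<Longrightarrow> h r \<le> h s"
    and rec: "\<And>r. 0 < r \<Longrightarrow> r \<le> r1 \<Longrightarrow> h (\<tau> * r) \<le> A * h r + D * r powr b"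
    and A: "0 \<le> A" "A < \<tau> powr b" and D: "D \<ge> 0" and b: "b > 0" and H: "h r1 \<le> H" "0 \<le> H"
    and r: "0 < r" "r \<le> r1"
  shows "h r \<le> (H / r1 powr b + D / (\<tau> powr b - A)) / \<tau> powr b * r powr b"
proof -
  define M where "M = H / r1 powr b + D / (\<tau> powr b - A)"
  have M1: "H \<le> M * r1 powr b"
  proof -
    have "M * r1 powr b = H + D / (\<tau> powr b - A) * r1 powr b" using r1 by (simp add: M_def distrib_right)
    then show ?thesis using A D by (simp add: divide_nonneg_pos)
  qed
  have M2: "D \<le> M * (\<tau> powr b - A)"
  proof -
    have "M * (\<tau> powr b - A) = H / r1 powr b * (\<tau> powr b - A) + D" using A by (simp add: M_def distrib_right)
    then show ?thesis using A H(2) by simp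
  qed
  have M0: "M \<ge> 0" using A D H by (simp add: M_def)
  have it: "h (\<tau> ^ n * r1) \<le> M * (\<tau> ^ n * r1) powr b" for n
  proof (induction n)
    case 0 then show ?case using H M1 by simp
  next
    case (Suc n)
    let ?s = "\<tau> ^ n * r1"
    have s: "0 < ?s" "?s \<le> r1" using \<tau> r1 by (auto simp: mult_le_cancel_right1 power_le_one)
    have "h (\<tau> ^ Suc n * r1) = h (\<tau> * ?s)" by (simp add: mult.assoc)
    also have "\<dots> \<le> A * h ?s + D * ?s powr b" by (rule rec[OF s])
    also have "\<dots> \<le> A * (M * ?s powr b) + M * (\<tau> powr b - A) * ?s powr b"
      using Suc A M2 by (intro add_mono mult_left_mono mult_right_mono) auto
    also have "\<dots> = M * (\<tau> powr b * ?s powr b)" by (simp add: algebra_simps)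
    also have "\<tau> powr b * ?s powr b = (\<tau> * ?s) powr b" using \<tau> s by (simp add: powr_mult)
    finally show ?case by (simp add: mult.assoc)
  qed
  have "\<exists>n. \<tau> ^ Suc n * r1 < r"
  proof -
    have "(\<lambda>n. \<tau> ^ n * r1) \<longlonglongrightarrow> 0 * r1" using \<tau> by (intro tendsto_intros LIMSEQ_realpow_zero) auto
    then have "\<forall>\<^sub>F n in sequentially. \<tau> ^ n * r1 < r" using r(1) by (auto dest: order_tendstoD(2)[of _ _ _ r])
    then show ?thesis unfolding eventually_sequentially by (meson le_SucI order_refl)
  qed
  then obtain n where n: "\<tau> ^ Suc n * r1 < r" "\<And>m. m < n \<Longrightarrow> \<not> \<tau> ^ Suc m * r1 < r"
    using exists_least_iff[of "\<lambda>n. \<tau> ^ Suc n * r1 < r"] by blast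
  have le: "r \<le> \<tau> ^ n * r1"
  proof (cases n)
    case 0 then show ?thesis using r by simp
  next
    case (Suc m) then show ?thesis using n(2)[of m] by simp
  qed
  have "h r \<le> h (\<tau> ^ n * r1)" using r \<tau> r1 by (intro mono le) (auto simp: mult_le_cancel_right1 power_le_one)
  also have "\<dots> \<le> M * (\<tau> ^ n * r1) powr b" by (rule it)
  also have "\<dots> \<le> M * (r / \<tau>) powr b"
  proof (intro mult_left_mono powr_mono2 M0)
    show "\<tau> ^ n * r1 \<le> r / \<tau>" using n(1) \<tau> by (simp add: pos_le_divide_eq mult_ac)
  qed (use b \<tau> r1 in auto)
  also have "\<dots> = M / \<tau> powr b * r powr b" using \<tau> r by (simp add: powr_divide)
  finally show ?thesis by (simp add: M_def)
qed

context null_form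
begin

lemma measure_Sq_pos: "r > 0 \<Longrightarrow> measure lborel (Sq x r) > 0"
  by (simp add: measure_Sq)

lemma osc_mono: "lbm g \<Longrightarrow> 0 < r \<Longrightarrow> r \<le> s \<Longrightarrow> osc g x r \<le> osc g x s"
  unfolding osc_def
  by (rule order.trans[OF mean_le ig_mono_set]) (auto intro!: lbm_intros Sq_mono simp: measure_Sq_pos)

lemma energy_mono: "lbm g \<Longrightarrow> r \<le> s \<Longrightarrow> energy g x r \<le> energy g x s"
  unfolding energy_def by (rule ig_mono_set) (auto intro!: lbm_intros Sq_mono)

lemma osc_nonneg: "osc g x r \<ge> 0"
  unfolding osc_def by (auto intro!: ig_nonneg)

lemma osc_le_energy: "lbm g \<Longrightarrow> 0 < r \<Longrightarrow> osc g x r \<le> energy g x r"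
  unfolding osc_def energy_def using mean_le[of "Sq x r" g 0] by (simp add: measure_Sq_pos)

text \<open>On the smaller square the mean over the larger one is a constant whose contribution
  scales like the area, that is, by \<tau>^2; what remains is the oscillation on the larger
  square.\<close>

lemma energy_step:
  assumes g: "lbm g" and r: "r > 0" and \<tau>: "0 < \<tau>" "\<tau> \<le> 1"
  shows "energy g x (\<tau> * r) \<le> 2 * \<tau>\<^sup>2 * energy g x r + 2 * osc g x r"
proof -
  let ?m = "mean (Sq x r) g"
  have sub: "Sq x (\<tau> * r) \<subseteq> Sq x r" using r \<tau> by (intro Sq_mono) (simp add: mult_le_cancel_right1)
  have tri: "(norm p)\<^sup>2 \<le> 2 * (norm (p - q))\<^sup>2 + 2 * (norm q)\<^sup>2" for p q :: "'b \<times> 'b"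
  proof -
    have "norm p \<le> norm (p - q) + norm q" using norm_triangle_ineq[of "p - q" q] by simp
    then have "(norm p)\<^sup>2 \<le> (norm (p - q) + norm q)\<^sup>2" by (intro power_mono) auto
    also have "\<dots> \<le> 2 * (norm (p - q))\<^sup>2 + 2 * (norm q)\<^sup>2"
      using sum_squares_bound[of "norm (p - q)" "norm q"] by (simp add: power2_sum)
    finally show ?thesis .
  qed
  have "energy g x (\<tau> * r) \<le> ig (Sq x (\<tau> * r)) (\<lambda>y. 2 * (norm (g y - ?m))\<^sup>2 + 2 * (norm ?m)\<^sup>2)"
    unfolding energy_def by (intro ig_mono bset_Sq lbm_intros g tri)
  also have "\<dots> = ig (Sq x (\<tau> * r)) (\<lambda>y. 2 * (norm (g y - ?m))\<^sup>2) + ig (Sq x (\<tau> * r)) (\<lambda>y. 2 * (norm ?m)\<^sup>2)"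
    by (intro ig_add bset_Sq lbm_intros g)
  also have "ig (Sq x (\<tau> * r)) (\<lambda>y. 2 * (norm ?m)\<^sup>2) = 2 * \<tau>\<^sup>2 * (4 * r\<^sup>2 * (norm ?m)\<^sup>2)"
    using ig_const[OF bset_Sq, of x "\<tau> * r" "2 * (norm ?m)\<^sup>2"] measure_Sq[of "\<tau> * r" x] r \<tau>
    by (simp add: power_mult_distrib)
  also have "ig (Sq x (\<tau> * r)) (\<lambda>y. 2 * (norm (g y - ?m))\<^sup>2) \<le> 2 * osc g x r"
    unfolding ig_cmult osc_def by (intro mult_left_mono ig_mono_set sub bset_Sq lbm_intros g) auto
  finally have 1: "energy g x (\<tau> * r) \<le> 2 * osc g x r + 2 * \<tau>\<^sup>2 * (4 * r\<^sup>2 * (norm ?m)\<^sup>2)" by simp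
  have "4 * r\<^sup>2 * (norm ?m)\<^sup>2 \<le> energy g x r"
    using mean_minimal[OF bset_Sq g measure_Sq_pos[OF r], of x 0] measure_Sq[of r x] r osc_nonneg[of g x r]
    by (simp add: energy_def osc_def)
  then have "2 * \<tau>\<^sup>2 * (4 * r\<^sup>2 * (norm ?m)\<^sup>2) \<le> 2 * \<tau>\<^sup>2 * energy g x r" by (rule mult_left_mono) simp
  then show ?thesis using 1 by linarith
qed

text \<open>Below the critical rate 2 the energy inherits the decay rate of the oscillation. At rate
  2 the coefficient 2 \<tau>^2 of the recursion could no longer be smaller than
  \<tau>^\<mu>.\<close>

lemma energy_growth:
  assumes \<mu>: "0 < \<mu>" "\<mu> < 2" and r1: "0 < r1" and H: "H \<ge> 0" "C \<ge> 0"
  shows "\<exists>C'\<ge>0. \<forall>g x. lbm g \<and> energy g x r1 \<le> H \<and> (\<forall>r. 0 < r \<and> r \<le> r1 \<longrightarrow> osc g x r \<le> C * r powr \<mu>) \<longrightarrow>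
    (\<forall>r. 0 < r \<and> r \<le> r1 \<longrightarrow> energy g x r \<le> C' * r powr \<mu>)"
proof -
  \<comment> \<open>Solves \<tau>^(2 - \<mu>) = 1/4, so that the coefficient 2 \<tau>^2 of
    \<open>energy_step\<close> is half of \<tau>^\<mu>.\<close>
  define \<tau> where "\<tau> = (1 / 4 :: real) powr (1 / (2 - \<mu>))"
  have \<tau>: "0 < \<tau>" "\<tau> < 1" using \<mu> powr_less_mono2[of "1 / (2 - \<mu>)" "1 / 4" 1] by (auto simp: \<tau>_def)
  have t2: "\<tau>\<^sup>2 = \<tau> powr \<mu> * (1 / 4)"
  proof -
    have "\<tau> powr (2 - \<mu>) = 1 / 4" using \<mu> by (simp add: \<tau>_def powr_powr)
    then have "\<tau> powr \<mu> * (1 / 4) = \<tau> powr (\<mu> + (2 - \<mu>))" by (simp only: powr_add)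
    then show ?thesis using \<tau> by (simp add: powr_numeral)
  qed
  define C' where "C' = (H / r1 powr \<mu> + 2 * C / (\<tau> powr \<mu> - 2 * \<tau>\<^sup>2)) / \<tau> powr \<mu>"
  have lt: "2 * \<tau>\<^sup>2 < \<tau> powr \<mu>" using \<tau> by (simp add: t2)
  show ?thesis
  proof (intro exI[of _ C'] conjI allI impI)
    show "0 \<le> C'" using H lt by (simp add: C'_def)
    fix g x r assume *: "lbm g \<and> energy g x r1 \<le> H \<and> (\<forall>r. 0 < r \<and> r \<le> r1 \<longrightarrow> osc g x r \<le> C * r powr \<mu>)" "0 < r \<and> r \<le> r1"
    show "energy g x r \<le> C' * r powr \<mu>"
      unfolding C'_def
    proof (rule iterate_decay[OF \<tau> r1])
      show "energy g x r \<le> energy g x s" if "0 < r" "r \<le> s" "s \<le> r1" for r s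
        using that * by (intro energy_mono) auto
      show "energy g x (\<tau> * r) \<le> 2 * \<tau>\<^sup>2 * energy g x r + 2 * C * r powr \<mu>" if "0 < r" "r \<le> r1" for r
      proof -
        have "energy g x (\<tau> * r) \<le> 2 * \<tau>\<^sup>2 * energy g x r + 2 * osc g x r"
          using * that \<tau> by (intro energy_step) auto
        moreover have "osc g x r \<le> C * r powr \<mu>" using * that by auto
        ultimately show ?thesis by simp
      qed
    qed (use * H \<mu> lt in auto)
  qed
qed

text \<open>A growth rate e of the energy makes the error in \<open>osc_decay\<close> of order r^(2
  \<rho> + e). The homogeneous part decays like r^(2 + \<kappa>), so the iteration yields any rate b
  strictly below 2 + \<kappa> and at most 2 \<rho> + e.\<close>

lemma osc_growth:
  assumes \<rho>: "0 < \<rho>" "\<rho> \<le> 1" and r1: "0 < r1" "r1 \<le> 1" and H: "H \<ge> 0" "C \<ge> 0" "K \<ge> 0" and b: "0 < b" "b < 2 + \<kappa>" "b \<le> 2 * \<rho> + e" "e \<le> 2"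
    and j: "j \<ge> 1" "16 * Ccac * (\<theta> / 16) ^ j \<le> (1 / (3 * 4 ^ j)) powr (2 + \<kappa>)"
  shows "\<exists>C'\<ge>0. \<forall>W L g S x. admissible W L g S K \<rho> \<and> Sq x r1 \<subseteq> S \<and> energy g x r1 \<le> H \<and>
      (\<forall>r. 0 < r \<and> r \<le> r1 \<longrightarrow> energy g x r \<le> C * r powr e) \<longrightarrow>
    (\<forall>r. 0 < r \<and> r \<le> r1 \<longrightarrow> osc g x r \<le> C' * r powr b)"
proof -
  define \<tau> where "\<tau> = (1 / (3 * 4 ^ j) :: real)"
  have "(1::real) \<le> 4 ^ j" by simp
  then have "(1::real) < 3 * 4 ^ j" by linarith
  then have \<tau>: "0 < \<tau>" "\<tau> < 1" by (auto simp: \<tau>_def divide_simps)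
  define A where "A = 16 * Ccac * (\<theta> / 16) ^ j"
  define D where "D = 64 * (1 + real j) * Ccac * K * (C + 1)"
  have A0: "A \<ge> 0" using Ccac_pos theta by (simp add: A_def)
  have "A \<le> \<tau> powr (2 + \<kappa>)" using j by (simp add: A_def \<tau>_def)
  also have "\<dots> < \<tau> powr b" using \<tau> b by (intro powr_less_mono') auto
  finally have A: "A < \<tau> powr b" .
  have D0: "D \<ge> 0" using Ccac_pos H by (simp add: D_def)
  define C' where "C' = (H / r1 powr b + D / (\<tau> powr b - A)) / \<tau> powr b"
  show ?thesis
  proof (intro exI[of _ C'] conjI allI impI)
    show "0 \<le> C'" using H D0 A by (simp add: C'_def)
    fix W L g S x r
    assume *: "admissible W L g S K \<rho> \<and> Sq x r1 \<subseteq> S \<and> energy g x r1 \<le> H \<and>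
      (\<forall>r. 0 < r \<and> r \<le> r1 \<longrightarrow> energy g x r \<le> C * r powr e)" "0 < r \<and> r \<le> r1"
    then have g: "lbm g" by (simp add: admissible_def)
    show "osc g x r \<le> C' * r powr b"
      unfolding C'_def
    proof (rule iterate_decay[OF \<tau> r1(1) _ _ A0 A D0 b(1)])
      show "osc g x r \<le> osc g x s" if "0 < r" "r \<le> s" "s \<le> r1" for r s
        using that by (intro osc_mono g) auto
      show "osc g x (\<tau> * r) \<le> A * osc g x r + D * r powr b" if r: "0 < r" "r \<le> r1" for r
      proof -
        have "osc g x (r / (3 * 4 ^ j)) \<le> A * osc g x r + 64 * (1 + real j) * Ccac * K * r powr (2 * \<rho>) * (energy g x r + r\<^sup>2)"
          unfolding A_def using * r H
          by (intro osc_decay[of W L g S K \<rho>] \<rho> j subset_trans[OF Sq_mono[of r r1]]) auto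
        also have "r / (3 * 4 ^ j) = \<tau> * r" by (simp add: \<tau>_def)
        also have "64 * (1 + real j) * Ccac * K * r powr (2 * \<rho>) * (energy g x r + r\<^sup>2)
          \<le> 64 * (1 + real j) * Ccac * K * r powr (2 * \<rho>) * ((C + 1) * r powr e)"
        proof (intro mult_left_mono)
          have "energy g x r \<le> C * r powr e" using * r by auto
          moreover have "r\<^sup>2 \<le> r powr e"
            using r r1 b powr_mono'[of e 2 r] by (simp add: powr_numeral)
          ultimately show "energy g x r + r\<^sup>2 \<le> (C + 1) * r powr e" by (simp add: distrib_right)
        qed (use Ccac_pos H in auto)
        also have "\<dots> = D * r powr (2 * \<rho> + e)" by (simp add: D_def powr_add)
        also have "\<dots> \<le> D * r powr b"
          using r r1 b D0 by (intro mult_left_mono powr_mono') auto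
        finally show ?thesis by simp
      qed
      show "osc g x r1 \<le> H" using * osc_le_energy[OF g r1(1), of x] by linarith
    qed (use * H in auto)
  qed
qed

text \<open>Each step raises the growth rate of the energy by \<open>2 \<rho>\<close>. With \<open>\<rho> = 2 / (2 N + 1)\<close> the rates stay below
  the critical rate 2 for \<open>N\<close> steps and exceed it at the next one, without ever being equal to it.\<close>

lemma energy_iterate:
  fixes N :: nat
  assumes r1: "0 < r1" "r1 \<le> 1" and H: "H \<ge> 0" "K \<ge> 0"
  defines "\<rho> \<equiv> 2 / (2 * real N + 1)"
  assumes N: "N \<ge> 1" and i: "i \<le> N"
  shows "\<exists>C\<ge>0. \<forall>W L g S x. admissible W L g S K \<rho> \<and> Sq x r1 \<subseteq> S \<and> energy g x r1 \<le> H \<longrightarrow>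
    (\<forall>r. 0 < r \<and> r \<le> r1 \<longrightarrow> energy g x r \<le> C * r powr (2 * real i * \<rho>))"
  using i
proof (induction i)
  case 0
  show ?case
  proof (intro exI[of _ H] conjI allI impI H)
    fix W L g S x r assume *: "admissible W L g S K \<rho> \<and> Sq x r1 \<subseteq> S \<and> energy g x r1 \<le> H" "0 < r \<and> r \<le> r1"
    then have "energy g x r \<le> energy g x r1" by (intro energy_mono) (auto simp: admissible_def)
    then show "energy g x r \<le> H * r powr (2 * real 0 * \<rho>)" using * by simp
  qed
next
  case (Suc i)
  obtain j \<kappa> where j: "j \<ge> 1" "0 < \<kappa>" "16 * Ccac * (\<theta> / 16) ^ j \<le> (1 / (3 * 4 ^ j)) powr (2 + \<kappa>)"
    using decay_parameters by blast
  obtain C where C: "C \<ge> 0" "\<And>W L g S x r. admissible W L g S K \<rho> \<Longrightarrow> Sq x r1 \<subseteq> S \<Longrightarrow> energy g x r1 \<le> H \<Longrightarrow>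
    0 < r \<Longrightarrow> r \<le> r1 \<Longrightarrow> energy g x r \<le> C * r powr (2 * real i * \<rho>)"
    using Suc by (auto simp: Suc_le_eq)
  define b where "b = 2 * real (Suc i) * \<rho>"
  have \<rho>: "0 < \<rho>" "\<rho> \<le> 1" using N by (auto simp: \<rho>_def divide_simps)
  have "real (Suc i) * \<rho> \<le> real N * \<rho>" using Suc(2) \<rho> by (intro mult_right_mono) auto
  also have "\<dots> < 1" by (simp add: \<rho>_def divide_simps)
  finally have lt: "real (Suc i) * \<rho> < 1" .
  have b3: "b = 2 * \<rho> + 2 * real i * \<rho>" by (simp add: b_def algebra_simps)
  have b: "0 < b" "b < 2" "b \<le> 2 * \<rho> + 2 * real i * \<rho>" "2 * real i * \<rho> \<le> 2"
  proof -
    have p: "0 \<le> real i * \<rho>" "real (Suc i) * \<rho> = \<rho> + real i * \<rho>" "2 * real i * \<rho> = 2 * (real i * \<rho>)"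
      using \<rho> by (auto simp: distrib_right)
    show "0 < b" "b < 2" "b \<le> 2 * \<rho> + 2 * real i * \<rho>" "2 * real i * \<rho> \<le> 2"
      using lt \<rho> b3 p by linarith+
  qed
  have b2: "b < 2 + \<kappa>" using b j(2) by simp
  obtain C1 where C1: "C1 \<ge> 0" "\<And>W L g S x r. admissible W L g S K \<rho> \<Longrightarrow> Sq x r1 \<subseteq> S \<Longrightarrow> energy g x r1 \<le> H \<Longrightarrow>
      (\<And>r. 0 < r \<Longrightarrow> r \<le> r1 \<Longrightarrow> energy g x r \<le> C * r powr (2 * real i * \<rho>)) \<Longrightarrow> 0 < r \<Longrightarrow> r \<le> r1 \<Longrightarrow> osc g x r \<le> C1 * r powr b"
    using osc_growth[OF \<rho> r1 H(1) C(1) H(2) b(1) b2 b(3,4) j(1,3)] by metis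
  obtain C2 where C2: "C2 \<ge> 0" "\<And>g x r. lbm g \<Longrightarrow> energy g x r1 \<le> H \<Longrightarrow> (\<And>r. 0 < r \<Longrightarrow> r \<le> r1 \<Longrightarrow> osc g x r \<le> C1 * r powr b) \<Longrightarrow>
    0 < r \<Longrightarrow> r \<le> r1 \<Longrightarrow> energy g x r \<le> C2 * r powr b"
    using energy_growth[OF b(1,2) r1(1) H(1) C1(1)] by metis
  show ?case
  proof (intro exI[of _ C2] conjI allI impI C2(1))
    fix W L g S x r assume *: "admissible W L g S K \<rho> \<and> Sq x r1 \<subseteq> S \<and> energy g x r1 \<le> H" "0 < r \<and> r \<le> r1"
    then have "lbm g" by (simp add: admissible_def)
    then show "energy g x r \<le> C2 * r powr (2 * real (Suc i) * \<rho>)"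
      using * C(2)[of W L g S x] C1(2)[of W L g S x] C2(2)[of g x r] by (simp add: b_def)
  qed
qed

text \<open>One constant \<open>C\<close> is to serve all \<open>W\<close>, \<open>L\<close>,
  \<open>g\<close> and \<open>x0\<close>. Its independence of \<open>L\<close> is decisive:
  \<open>W\<close> will be a difference quotient, for which only a Lipschitz constant of order 1 / h
  is at hand.\<close>

definition osc_bound :: "nat \<Rightarrow> real \<Rightarrow> real \<Rightarrow> real \<Rightarrow> real \<Rightarrow> bool" where
  "osc_bound N \<mu> K R C \<longleftrightarrow> (\<forall>W L g x0. admissible W L g (Sq x0 R) K (2 / (2 * real N + 1)) \<and>
      (AE y in lborel. y \<in> Sq x0 R \<longrightarrow> Q (g y) \<ge> c * (norm (g y))\<^sup>2 - K) \<and> (\<forall>y\<in>Sq x0 R. norm (W y) \<le> K) \<longrightarrow>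
      (\<forall>x\<in>Sq x0 (R / 2). \<forall>r. 0 < r \<and> r \<le> R / 4 \<longrightarrow> osc g x r \<le> C * r powr (2 + 2 * \<mu>)))"

text \<open>After N steps of \<open>energy_iterate\<close> the energy has rate 2 N \<rho> = 2 -
  \<rho>, still subcritical; one more application of \<open>osc_growth\<close> reaches 2 N \<rho> +
  2 \<rho> = 2 + \<rho>, which exceeds 2.\<close>

lemma campanato_bound:
  assumes N: "N \<ge> 1"
  shows "\<exists>\<mu>. 0 < \<mu> \<and> \<mu> \<le> 1 / 2 \<and> (\<forall>K R. 0 \<le> K \<and> 0 < R \<and> R \<le> 1 \<longrightarrow> (\<exists>C\<ge>0. osc_bound N \<mu> K R C))"
proof -
  obtain j \<kappa> where j: "j \<ge> 1" "0 < \<kappa>" "\<kappa> \<le> 1" "16 * Ccac * (\<theta> / 16) ^ j \<le> (1 / (3 * 4 ^ j)) powr (2 + \<kappa>)"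
    using decay_parameters by blast
  define \<rho> where "\<rho> = 2 / (2 * real N + 1)"
  have \<rho>: "0 < \<rho>" "\<rho> \<le> 1" using N by (auto simp: \<rho>_def divide_simps)
  \<comment> \<open>Half of the minimum, so that 2 + 2 \<mu> is at most 2 + \<rho> and strictly
    below 2 + \<kappa>.\<close>
  define \<mu> where "\<mu> = min \<rho> (\<kappa> / 2) / 2"
  have \<mu>: "0 < \<mu>" "\<mu> \<le> 1 / 2" using \<rho> j by (auto simp: \<mu>_def)
  have e: "2 * real N * \<rho> \<le> 2" by (simp add: \<rho>_def divide_simps)
  have b: "0 < 2 + 2 * \<mu>" "2 + 2 * \<mu> < 2 + \<kappa>" "2 + 2 * \<mu> \<le> 2 * \<rho> + 2 * real N * \<rho>"
  proof -
    have "2 * real N + 1 \<noteq> 0" using of_nat_0_le_iff[of N, where 'a=real] by linarith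
    then have "\<rho> * (2 * real N + 1) = 2"
      using eq_divide_eq[of \<rho> 2 "2 * real N + 1"] by (simp only: \<rho>_def if_False simp_thms)
    then have "2 * \<rho> + 2 * real N * \<rho> = 2 + \<rho>" by (simp add: algebra_simps)
    then show "2 + 2 * \<mu> \<le> 2 * \<rho> + 2 * real N * \<rho>" by (simp add: \<mu>_def)
  qed (use \<mu> j in \<open>auto simp: \<mu>_def\<close>)
  have "\<exists>C\<ge>0. \<forall>W L g x0. admissible W L g (Sq x0 R) K \<rho> \<and>
      (AE y in lborel. y \<in> Sq x0 R \<longrightarrow> Q (g y) \<ge> c * (norm (g y))\<^sup>2 - K) \<and> (\<forall>y\<in>Sq x0 R. norm (W y) \<le> K) \<longrightarrow>
      (\<forall>x\<in>Sq x0 (R / 2). \<forall>r. 0 < r \<and> r \<le> R / 4 \<longrightarrow> osc g x r \<le> C * r powr (2 + 2 * \<mu>))"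
    if K: "0 \<le> K" and R: "0 < R" "R \<le> 1" for K R
  proof -
    define r1 where "r1 = R / 4"
    have r1: "0 < r1" "r1 \<le> 1" using R by (auto simp: r1_def)
    \<comment> \<open>The a priori energy bound: Caccioppoli with |W| <= K and error K on a square
      of area 16 r1^2. The Lipschitz constant of \<open>W\<close> does not enter.\<close>
    define H where "H = Ccac * (1 / r1\<^sup>2 * (16 * r1\<^sup>2 * K\<^sup>2) + 16 * r1\<^sup>2 * K)"
    have H: "H \<ge> 0" using Ccac_pos K by (simp add: H_def)
    obtain C where C: "C \<ge> 0" "\<And>W L g S x r. admissible W L g S K \<rho> \<Longrightarrow> Sq x r1 \<subseteq> S \<Longrightarrow> energy g x r1 \<le> H \<Longrightarrow>
      0 < r \<Longrightarrow> r \<le> r1 \<Longrightarrow> energy g x r \<le> C * r powr (2 * real N * \<rho>)"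
      using energy_iterate[OF r1 H K N order_refl] unfolding \<rho>_def by metis
    obtain C1 where C1: "C1 \<ge> 0" "\<And>W L g S x r. admissible W L g S K \<rho> \<Longrightarrow> Sq x r1 \<subseteq> S \<Longrightarrow> energy g x r1 \<le> H \<Longrightarrow>
      (\<And>r. 0 < r \<Longrightarrow> r \<le> r1 \<Longrightarrow> energy g x r \<le> C * r powr (2 * real N * \<rho>)) \<Longrightarrow> 0 < r \<Longrightarrow> r \<le> r1 \<Longrightarrow>
      osc g x r \<le> C1 * r powr (2 + 2 * \<mu>)"
      using osc_growth[OF \<rho> r1 H C(1) K b e j(1,4)] by metis
    show ?thesis
    proof (intro exI[of _ C1] conjI allI impI ballI C1(1))
      fix W L g x0 x r
      assume *: "admissible W L g (Sq x0 R) K \<rho> \<and>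
        (AE y in lborel. y \<in> Sq x0 R \<longrightarrow> Q (g y) \<ge> c * (norm (g y))\<^sup>2 - K) \<and> (\<forall>y\<in>Sq x0 R. norm (W y) \<le> K)"
        and x: "x \<in> Sq x0 (R / 2)" and r: "0 < r \<and> r \<le> R / 4"
      have W: "L-lipschitz_on UNIV W" and g: "lbm g"
        and dW: "AE y in lborel. y \<in> Sq x0 R \<longrightarrow> (W has_derivative dmap (g y)) (at y)"
        using * unfolding admissible_def by blast+
      have sub: "Sq x (2 * r1) \<subseteq> Sq x0 R" using Sq_subset[OF x] by (simp add: r1_def)
      have "energy g x r1 \<le> Ccac * (1 / r1\<^sup>2 * ig (Sq x (2 * r1) - Sq x r1) (\<lambda>y. (norm (W y - 0))\<^sup>2) + ig (Sq x (2 * r1)) (\<lambda>y. K))"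
        unfolding energy_def
      proof (rule caccioppoli[OF W g])
        show "AE y in lborel. y \<in> Sq x (2 * r1) \<longrightarrow> (W has_derivative dmap (g y)) (at y)"
          using dW by eventually_elim (use sub in auto)
        have "AE y in lborel. y \<in> Sq x0 R \<longrightarrow> Q (g y) \<ge> c * (norm (g y))\<^sup>2 - K" using * by blast
        then show "AE y in lborel. y \<in> Sq x (2 * r1) \<longrightarrow> Q (g y) \<ge> c * (norm (g y))\<^sup>2 - K"
          by eventually_elim (use sub in auto)
      qed (use K r1 in auto)
      also have "\<dots> \<le> H" unfolding H_def
      proof (intro mult_left_mono add_mono)
        have m: "measure lborel (Sq x (2 * r1)) = 16 * r1\<^sup>2" using r1 by (simp add: measure_Sq)
        have "ig (Sq x (2 * r1) - Sq x r1) (\<lambda>y. (norm (W y - 0))\<^sup>2) \<le> ig (Sq x (2 * r1)) (\<lambda>y. (norm (W y - 0))\<^sup>2)"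
          by (intro ig_mono_set lbm_intros lbm_lipschitz[OF W] bset_Diff bset_Sq) auto
        also have "\<dots> \<le> ig (Sq x (2 * r1)) (\<lambda>y. K\<^sup>2)"
          using * sub by (intro ig_mono lbm_intros lbm_lipschitz[OF W] bset_Sq power_mono) auto
        also have "\<dots> = 16 * r1\<^sup>2 * K\<^sup>2" using ig_const[OF bset_Sq, of x "2 * r1" "K\<^sup>2"] m by simp
        finally show "ig (Sq x (2 * r1) - Sq x r1) (\<lambda>y. (norm (W y - 0))\<^sup>2) \<le> 16 * r1\<^sup>2 * K\<^sup>2" .
        show "ig (Sq x (2 * r1)) (\<lambda>y. K) \<le> 16 * r1\<^sup>2 * K"
          using ig_const[OF bset_Sq, of x "2 * r1" K] m by simp
      qed (use Ccac_pos in auto)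
      finally have en: "energy g x r1 \<le> H" .
      have sub1: "Sq x r1 \<subseteq> Sq x0 R" using sub Sq_mono[of r1 "2 * r1" x] r1 by auto
      have ad: "admissible W L g (Sq x0 R) K \<rho>" using * by blast
      show "osc g x r \<le> C1 * r powr (2 + 2 * \<mu>)"
        using r by (intro C1(2)[OF ad sub1 en] C(2)[OF ad sub1 en]) (auto simp: r1_def)
    qed
  qed
  then have "\<forall>K R. 0 \<le> K \<and> 0 < R \<and> R \<le> 1 \<longrightarrow> (\<exists>C\<ge>0. osc_bound N \<mu> K R C)"
    unfolding \<rho>_def osc_bound_def by blast
  with \<mu> show ?thesis by blast
qed

end

section \<open>Campanato's criterion\<close>

lemma geometric_limit:
  fixes a :: "nat \<Rightarrow> 'a::banach"
  assumes q: "0 \<le> q" "q < 1" and K: "K \<ge> 0" and step: "\<And>n. norm (a (Suc n) - a n) \<le> K * q ^ n"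
  shows "\<exists>l. a \<longlonglongrightarrow> l \<and> (\<forall>n. norm (a n - l) \<le> K / (1 - q) * q ^ n)"
proof -
  have bd: "norm (a (n + k) - a n) \<le> K / (1 - q) * (q ^ n - q ^ (n + k))" for n k
  proof (induction k)
    case (Suc k)
    have "norm (a (n + Suc k) - a n) \<le> norm (a (Suc (n + k)) - a (n + k)) + norm (a (n + k) - a n)"
      using norm_triangle_ineq[of "a (Suc (n + k)) - a (n + k)" "a (n + k) - a n"] by simp
    also have "\<dots> \<le> K * q ^ (n + k) + K / (1 - q) * (q ^ n - q ^ (n + k))"
      by (intro add_mono step Suc)
    also have "\<dots> = K / (1 - q) * (q ^ n - q ^ (n + Suc k))" using q by (simp add: field_simps)
    finally show ?case .
  qed simp
  have bd': "norm (a (n + k) - a n) \<le> K / (1 - q) * q ^ n" for n k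
  proof -
    have "K / (1 - q) * (q ^ n - q ^ (n + k)) \<le> K / (1 - q) * q ^ n"
      using q K by (intro mult_left_mono) auto
    then show ?thesis using bd[of n k] by linarith
  qed
  have "Cauchy a"
  proof (rule metric_CauchyI)
    fix e :: real assume "e > 0"
    have "(\<lambda>n. K / (1 - q) * q ^ n) \<longlonglongrightarrow> K / (1 - q) * 0" using q by (intro tendsto_intros LIMSEQ_realpow_zero)
    then have "\<forall>\<^sub>F n in sequentially. K / (1 - q) * q ^ n < e / 2" using \<open>e > 0\<close> by (auto dest: order_tendstoD(2)[of _ _ _ "e / 2"])
    then obtain N where N: "K / (1 - q) * q ^ N < e / 2" unfolding eventually_sequentially by auto
    have *: "norm (a m - a N) < e / 2" if "m \<ge> N" for m
      using bd'[of N "m - N"] N le_add_diff_inverse[OF that] by (metis le_less_trans)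
    have "dist (a m) (a n) < e" if "m \<ge> N" "n \<ge> N" for m n
    proof -
      have "dist (a m) (a n) \<le> dist (a m) (a N) + dist (a n) (a N)" by (rule dist_triangle2)
      then show ?thesis using *[OF that(1)] *[OF that(2)] by (simp add: dist_norm)
    qed
    then show "\<exists>M. \<forall>m\<ge>M. \<forall>n\<ge>M. dist (a m) (a n) < e" by blast
  qed
  then obtain l where l: "a \<longlonglongrightarrow> l" using Cauchy_convergent convergent_def by blast
  have "norm (a n - l) \<le> K / (1 - q) * q ^ n" for n
  proof (rule LIMSEQ_le_const2)
    show "(\<lambda>k. norm (a n - a (k + n))) \<longlonglongrightarrow> norm (a n - l)"
      by (intro tendsto_intros LIMSEQ_ignore_initial_segment l)
    show "\<exists>N. \<forall>k\<ge>N. norm (a n - a (k + n)) \<le> K / (1 - q) * q ^ n"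
      using bd'[of n] by (auto simp: add.commute norm_minus_commute)
  qed
  with l show ?thesis by blast
qed

section \<open>Differentiation of averages over squares\<close>

lemma ig_bounded_linear:
  assumes "bounded_linear T" "bset D" "lbm f"
  shows "ig D (\<lambda>x. T (f x)) = T (ig D f)"
proof -
  interpret bounded_linear T by fact
  have "integrable lborel (\<lambda>x. indicat_real D x *\<^sub>R f x)"
    using ig_integrable[OF assms(2,3)] by (simp add: set_integrable_def)
  from integral_bounded_linear[OF assms(1) this] show ?thesis
    by (simp add: set_lebesgue_integral_def scaleR)
qed

lemma bounded_linear_dmap_left: "bounded_linear (\<lambda>z. dmap z v)"
  by (rule bounded_linear_intro[where K="norm v"])
    (auto simp: dmap_add dmap_scaleR mult.commute intro: norm_dmap_le[THEN order.trans])

lemma norm_ig_le: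
  assumes "bset D" "lbm f"
  shows "norm (ig D f) \<le> ig D (\<lambda>x. norm (f x))"
proof -
  have "norm (ig D f) \<le> (\<integral>x. norm (indicat_real D x *\<^sub>R f x) \<partial>lborel)"
    unfolding set_lebesgue_integral_def by (rule integral_norm_bound)
  then show ?thesis by (simp add: set_lebesgue_integral_def)
qed

text \<open>Differentiation under the integral: the Lipschitz constant of \<open>W\<close> and a
  bound of \<open>g\<close> dominate the difference quotients, so differentiability at almost every
  point is enough.\<close>

lemma has_derivative_ig:
  fixes W :: "real^2 \<Rightarrow> 'b::euclidean_space"
  assumes W: "L-lipschitz_on UNIV W" and g: "lbm g" and D: "bset D"
    and dW: "AE z in lborel. z \<in> D \<longrightarrow> (W has_derivative dmap (g (z + x))) (at (z + x))"
  shows "((\<lambda>x. ig D (\<lambda>z. W (z + x))) has_derivative dmap (ig D (\<lambda>z. g (z + x)))) (at x)"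
proof -
  have lW: "lbm W" by (rule lbm_lipschitz[OF W])
  have L0: "L \<ge> 0" by (rule lipschitz_on_nonneg[OF W])
  have gx: "lbm (\<lambda>z. g (z + x))" by (rule lbm_shift[OF g])
  have Wx: "lbm (\<lambda>z. W (z + y))" for y by (rule lbm_shift[OF lW])
  obtain M where M: "\<And>z. z \<in> D \<Longrightarrow> norm (g (z + x)) \<le> M" "M \<ge> 0"
    using lbm_bound[OF gx, of D] D by (auto simp: bset_def)
  show ?thesis
    unfolding has_derivative_iff_norm
  proof (intro conjI bounded_linear_dmap)
    show "((\<lambda>y. norm (ig D (\<lambda>z. W (z + y)) - ig D (\<lambda>z. W (z + x)) - dmap (ig D (\<lambda>z. g (z + x))) (y - x)) / norm (y - x)) \<longlongrightarrow> 0) (at x)"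
      unfolding tendsto_at_iff_sequentially
    proof (intro allI impI)
      fix X :: "nat \<Rightarrow> real^2" assume X: "\<forall>i. X i \<in> UNIV - {x}" "X \<longlonglongrightarrow> x"
      define F where "F n z = norm (W (z + X n) - W (z + x) - dmap (g (z + x)) (X n - x)) / norm (X n - x)" for n z
      have F_alt: "F n = (\<lambda>z. inverse (norm (X n - x)) * norm (W (z + X n) - W (z + x) - dmap (g (z + x)) (X n - x)))" for n
        by (simp add: F_def fun_eq_iff divide_inverse mult.commute)
      have lF: "lbm (F n)" for n unfolding F_alt by (intro lbm_intros lbm_dmap gx Wx)
      have "(\<lambda>n. ig D (F n)) \<longlonglongrightarrow> ig D (\<lambda>z. 0)"
      proof (rule ig_DCT[OF D _ lF])
        show "AE z in lborel. z \<in> D \<longrightarrow> (\<lambda>n. F n z) \<longlonglongrightarrow> 0"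
          using dW
        proof eventually_elim
          fix z assume *: "z \<in> D \<longrightarrow> (W has_derivative dmap (g (z + x))) (at (z + x))"
          show "z \<in> D \<longrightarrow> (\<lambda>n. F n z) \<longlonglongrightarrow> 0"
          proof
            assume "z \<in> D"
            then have "((\<lambda>y. norm (W y - W (z + x) - dmap (g (z + x)) (y - (z + x))) / norm (y - (z + x))) \<longlongrightarrow> 0) (at (z + x))"
              using * unfolding has_derivative_iff_norm by blast
            moreover have "(\<lambda>n. z + X n) \<longlonglongrightarrow> z + x" by (intro tendsto_intros X)
            ultimately have "((\<lambda>y. norm (W y - W (z + x) - dmap (g (z + x)) (y - (z + x))) / norm (y - (z + x))) \<circ> (\<lambda>n. z + X n)) \<longlonglongrightarrow> 0"
              unfolding tendsto_at_iff_sequentially using X by simp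
            then show "(\<lambda>n. F n z) \<longlonglongrightarrow> 0" by (simp add: F_def o_def)
          qed
        qed
        show "norm (F n z) \<le> L + M" if "z \<in> D" for n z
        proof -
          have nz: "norm (X n - x) > 0" using X by auto
          have "norm (W (z + X n) - W (z + x) - dmap (g (z + x)) (X n - x)) \<le> L * norm (X n - x) + norm (X n - x) * M"
          proof (rule order.trans[OF norm_triangle_ineq4 add_mono])
            show "norm (W (z + X n) - W (z + x)) \<le> L * norm (X n - x)"
              using lipschitz_onD[OF W, of "z + X n" "z + x"] by (simp add: dist_norm)
            show "norm (dmap (g (z + x)) (X n - x)) \<le> norm (X n - x) * M"
              using M(1)[OF that] by (intro order.trans[OF norm_dmap_le] mult_left_mono) auto
          qed
          then show ?thesis using nz by (simp add: F_def pos_divide_le_eq algebra_simps)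
        qed
      qed simp
      then have lim: "(\<lambda>n. ig D (F n)) \<longlonglongrightarrow> 0" by simp
      have le: "norm (ig D (\<lambda>z. W (z + X n)) - ig D (\<lambda>z. W (z + x)) - dmap (ig D (\<lambda>z. g (z + x))) (X n - x)) / norm (X n - x) \<le> ig D (F n)" for n
      proof -
        have "ig D (\<lambda>z. W (z + X n)) - ig D (\<lambda>z. W (z + x)) - dmap (ig D (\<lambda>z. g (z + x))) (X n - x)
          = ig D (\<lambda>z. W (z + X n) - W (z + x)) - ig D (\<lambda>z. dmap (g (z + x)) (X n - x))"
          by (simp add: ig_diff[OF D Wx Wx] ig_bounded_linear[OF bounded_linear_dmap_left D gx])
        also have "\<dots> = ig D (\<lambda>z. W (z + X n) - W (z + x) - dmap (g (z + x)) (X n - x))"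
          by (rule ig_diff[symmetric, OF D]) (intro lbm_intros lbm_dmap gx Wx)+
        finally have "norm (ig D (\<lambda>z. W (z + X n)) - ig D (\<lambda>z. W (z + x)) - dmap (ig D (\<lambda>z. g (z + x))) (X n - x))
          \<le> ig D (\<lambda>z. norm (W (z + X n) - W (z + x) - dmap (g (z + x)) (X n - x)))"
          using norm_ig_le[OF D, of "\<lambda>z. W (z + X n) - W (z + x) - dmap (g (z + x)) (X n - x)"]
          by (simp add: lbm_diff lbm_dmap gx Wx)
        moreover have "ig D (F n) = inverse (norm (X n - x)) * ig D (\<lambda>z. norm (W (z + X n) - W (z + x) - dmap (g (z + x)) (X n - x)))"
          unfolding F_alt ig_cmult ..
        ultimately show ?thesis by (simp add: divide_inverse mult.commute mult_left_mono)
      qed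
      show "((\<lambda>y. norm (ig D (\<lambda>z. W (z + y)) - ig D (\<lambda>z. W (z + x)) - dmap (ig D (\<lambda>z. g (z + x))) (y - x)) / norm (y - x)) \<circ> X) \<longlonglongrightarrow> 0"
        by (rule tendsto_sandwich[OF _ _ tendsto_const lim]) (use le in \<open>auto simp: o_def\<close>)
    qed
  qed
qed

lemma Sq_translate: "Sq x r = (+) x ` Sq 0 r"
proof -
  have "y \<in> Sq x r \<longleftrightarrow> y - x \<in> Sq 0 r" for y by (simp add: mem_Sq)
  moreover have "y \<in> (+) x ` Sq 0 r \<longleftrightarrow> y - x \<in> Sq 0 r" for y by (force simp: image_iff)
  ultimately show ?thesis by blast
qed

lemma mean_Sq:
  assumes "lbm f" shows "mean (Sq x r) f = (1 / measure lborel (Sq x r)) *\<^sub>R ig (Sq 0 r) (\<lambda>z. f (z + x))"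
  unfolding mean_def using ig_shift[OF bset_Sq assms, of x 0 r] by (simp add: Sq_translate[symmetric])

lemma has_derivative_mean:
  fixes W :: "real^2 \<Rightarrow> 'b::euclidean_space"
  assumes W: "L-lipschitz_on UNIV W" and g: "lbm g" and r: "r > 0"
    and dW: "AE z in lborel. z \<in> Sq x r \<longrightarrow> (W has_derivative dmap (g z)) (at z)"
  shows "((\<lambda>x. mean (Sq x r) W) has_derivative dmap (mean (Sq x r) g)) (at x)"
proof -
  have "AE z in lborel. z \<in> Sq 0 r \<longrightarrow> (W has_derivative dmap (g (z + x))) (at (z + x))"
    using AE_lborel_shift[OF dW, of x] by eventually_elim (auto simp: mem_Sq)
  from has_derivative_ig[OF W g bset_Sq this]
  have "((\<lambda>x. (1 / (4 * r\<^sup>2)) *\<^sub>R ig (Sq 0 r) (\<lambda>z. W (z + x))) has_derivative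
    (\<lambda>v. (1 / (4 * r\<^sup>2)) *\<^sub>R dmap (ig (Sq 0 r) (\<lambda>z. g (z + x))) v)) (at x)"
    by (rule has_derivative_scaleR_right)
  then show ?thesis
    unfolding mean_Sq[OF g] mean_Sq[OF lbm_lipschitz[OF W]] using r by (simp add: measure_Sq dmap_scaleR[abs_def])
qed

lemma mem_Sq_norm: "norm (y - x) \<le> r \<Longrightarrow> y \<in> Sq x r"
  using component_le_norm_cart[of "y - x" 1] component_le_norm_cart[of "y - x" 2] by (auto simp: mem_Sq)

lemma norm_le_Sq: "y \<in> Sq x r \<Longrightarrow> norm (y - x) \<le> 2 * r"
  unfolding norm_real2 mem_Sq by (rule order.trans[OF sqrt_sum_squares_le_sum_abs]) auto

lemma mean_Sq_tendsto:
  assumes W: "L-lipschitz_on UNIV W" and r: "\<And>n. r n > 0" "r \<longlonglongrightarrow> 0"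
  shows "(\<lambda>n. mean (Sq x (r n)) W) \<longlonglongrightarrow> W x"
proof -
  have lW: "lbm W" by (rule lbm_lipschitz[OF W])
  have "norm (mean (Sq x (r n)) W - W x) \<le> L * (2 * r n)" for n
  proof -
    have m: "measure lborel (Sq x (r n)) = 4 * (r n)\<^sup>2" using r(1)[of n] by (simp add: measure_Sq)
    have "mean (Sq x (r n)) W - W x = (1 / (4 * (r n)\<^sup>2)) *\<^sub>R ig (Sq x (r n)) (\<lambda>y. W y - W x)"
      using r(1)[of n] ig_const[OF bset_Sq, of x "r n" "W x"]
      by (simp add: mean_def m ig_diff[OF bset_Sq lW] scaleR_diff_right)
    then have "norm (mean (Sq x (r n)) W - W x) = (1 / (4 * (r n)\<^sup>2)) * norm (ig (Sq x (r n)) (\<lambda>y. W y - W x))" by simp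
    also have "\<dots> \<le> (1 / (4 * (r n)\<^sup>2)) * ig (Sq x (r n)) (\<lambda>y. norm (W y - W x))"
      by (intro mult_left_mono norm_ig_le bset_Sq lbm_intros lW) simp
    also have "\<dots> \<le> (1 / (4 * (r n)\<^sup>2)) * ig (Sq x (r n)) (\<lambda>y. L * (2 * r n))"
    proof (intro mult_left_mono ig_mono bset_Sq lbm_intros lW)
      fix y assume "y \<in> Sq x (r n)"
      then show "norm (W y - W x) \<le> L * (2 * r n)"
        using lipschitz_onD[OF W, of y x] norm_le_Sq[of y x "r n"] lipschitz_on_nonneg[OF W]
        by (simp add: dist_norm) (meson mult_left_mono order.trans)
    qed simp
    also have "ig (Sq x (r n)) (\<lambda>y. L * (2 * r n)) = 4 * (r n)\<^sup>2 * (L * (2 * r n))"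
      unfolding ig_const[OF bset_Sq] m by simp
    also have "(1 / (4 * (r n)\<^sup>2)) * (4 * (r n)\<^sup>2 * (L * (2 * r n))) = L * (2 * r n)"
      using r(1)[of n] by simp
    finally show ?thesis .
  qed
  then have "\<forall>\<^sub>F n in sequentially. norm (mean (Sq x (r n)) W - W x) \<le> L * (2 * r n)"
    by (intro always_eventually allI)
  moreover have "(\<lambda>n. L * (2 * r n)) \<longlonglongrightarrow> 0"
    using tendsto_mult_left[OF tendsto_mult_left[OF r(2)], of L 2] by simp
  ultimately have "(\<lambda>n. mean (Sq x (r n)) W - W x) \<longlonglongrightarrow> 0" by (rule Lim_null_comparison)
  then show ?thesis by (simp add: LIM_zero_iff)
qed

context null_form
begin

text \<open>The distance of the means is measured on the smaller square, whose area 4 s^2 is at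
  least r^2. This serves both concentric squares of half the size and squares around a nearby
  point.\<close>

lemma mean_compare:
  assumes g: "lbm g" and s: "s > 0" and sub: "Sq y s \<subseteq> Sq x r" and C: "C \<ge> 0" "osc g x r \<le> C * r powr (2 + 2 * \<mu>)" and r: "r > 0"
    and sr: "r \<le> 2 * s"
  shows "norm (mean (Sq y s) g - mean (Sq x r) g) \<le> sqrt C * r powr \<mu>"
proof -
  let ?m = "mean (Sq x r) g"
  have "4 * s\<^sup>2 * (norm (mean (Sq y s) g - ?m))\<^sup>2 \<le> ig (Sq y s) (\<lambda>z. (norm (g z - ?m))\<^sup>2)"
    using mean_minimal[OF bset_Sq g measure_Sq_pos[OF s], of y ?m] measure_Sq[of s y] s
      ig_nonneg[of "Sq y s" "\<lambda>z. (norm (g z - mean (Sq y s) g))\<^sup>2"] by simp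
  also have "\<dots> \<le> osc g x r" unfolding osc_def by (intro ig_mono_set sub bset_Sq lbm_intros g) auto
  also have "\<dots> \<le> C * r powr (2 + 2 * \<mu>)" by (rule C)
  also have "\<dots> = r\<^sup>2 * (sqrt C * r powr \<mu>)\<^sup>2"
    using r C by (simp add: powr_add powr_numeral power_mult_distrib powr_power mult.commute)
  also have "\<dots> \<le> 4 * s\<^sup>2 * (sqrt C * r powr \<mu>)\<^sup>2"
  proof (rule mult_right_mono)
    have "r\<^sup>2 \<le> (2 * s)\<^sup>2" using sr r by (intro power_mono) auto
    then show "r\<^sup>2 \<le> 4 * s\<^sup>2" by (simp add: power_mult_distrib)
  qed simp
  finally have "(norm (mean (Sq y s) g - ?m))\<^sup>2 \<le> (sqrt C * r powr \<mu>)\<^sup>2" using s by simp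
  then show ?thesis using C by (simp add: power2_le_iff_abs_le)
qed

text \<open>Means of \<open>g\<close> over dyadic squares converge at a geometric rate to a limit
  \<open>G\<close>, which is Hoelder continuous by comparing means at the scale of |x - y|. That
  \<open>G\<close> is the derivative of \<open>W\<close> at every point, not only almost everywhere,
  comes from averaging \<open>W\<close> itself: the averages have the means of \<open>g\<close> as
  derivatives, and these converge uniformly.\<close>

lemma campanato:
  assumes W: "L-lipschitz_on UNIV W" and g: "lbm g" and R: "0 < R" and \<mu>: "0 < \<mu>" and C: "C \<ge> 0"
    and dW: "AE z in lborel. z \<in> Sq x0 R \<longrightarrow> (W has_derivative dmap (g z)) (at z)"
    and osc: "\<And>x r. x \<in> Sq x0 (R / 2) \<Longrightarrow> 0 < r \<Longrightarrow> r \<le> R / 4 \<Longrightarrow> osc g x r \<le> C * r powr (2 + 2 * \<mu>)"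
  shows "\<exists>G. (\<forall>x\<in>Sq x0 (R / 64). (W has_derivative dmap (G x)) (at x)) \<and>
    (\<forall>x\<in>Sq x0 (R / 64). \<forall>y\<in>Sq x0 (R / 64). norm (G x - G y) \<le> (1 + 2 / (1 - 2 powr (-\<mu>))) * sqrt C * 4 powr \<mu> * norm (x - y) powr \<mu>)"
proof -
  define r1 where "r1 = R / 4"
  have r1: "r1 > 0" using R by (simp add: r1_def)
  define r where "r n = r1 / 2 ^ n" for n
  have r: "r n > 0" "r n \<le> r1" for n using r1 by (auto simp: r_def divide_le_eq mult_le_cancel_left1)
  have rS: "r (Suc n) = r n / 2" for n by (simp add: r_def)
  define q where "q = (2::real) powr (-\<mu>)"
  have q: "0 < q" "q < 1" using \<mu> powr_less_cancel_iff[of 2 "-\<mu>" 0] by (auto simp: q_def)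
  have rmu: "r n powr \<mu> = r1 powr \<mu> * q ^ n" for n
  proof -
    have "r n powr \<mu> = r1 powr \<mu> / (2 ^ n) powr \<mu>" using r1 by (simp add: r_def powr_divide)
    also have "(2 ^ n) powr \<mu> = (2 powr \<mu>) ^ n" by (simp add: powr_realpow[symmetric] powr_powr mult.commute)
    finally show ?thesis by (simp add: q_def powr_minus divide_inverse power_inverse)
  qed
  define m where "m x n = mean (Sq x (r n)) g" for x n
  have "\<exists>l. m x \<longlonglongrightarrow> l \<and> (\<forall>n. norm (m x n - l) \<le> sqrt C * r1 powr \<mu> / (1 - q) * q ^ n)" if "x \<in> Sq x0 (R / 2)" for x
  proof (rule geometric_limit)
    fix n
    have "norm (m x (Suc n) - m x n) \<le> sqrt C * r n powr \<mu>"
      unfolding m_def using r[of n] that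
      by (intro mean_compare[OF g] C osc Sq_mono) (auto simp: rS r1_def)
    then show "norm (m x (Suc n) - m x n) \<le> sqrt C * r1 powr \<mu> * q ^ n" by (simp add: rmu mult.assoc)
  qed (use q C in auto)
  then obtain G where G: "\<And>x. x \<in> Sq x0 (R / 2) \<Longrightarrow> m x \<longlonglongrightarrow> G x"
    "\<And>x n. x \<in> Sq x0 (R / 2) \<Longrightarrow> norm (m x n - G x) \<le> sqrt C * r1 powr \<mu> / (1 - q) * q ^ n"
    by metis
  have Gn: "norm (m x n - G x) \<le> sqrt C * r n powr \<mu> / (1 - q)" if "x \<in> Sq x0 (R / 2)" for x n
    using G(2)[OF that, of n] by (simp add: rmu mult_ac)
  have r0: "r \<longlonglongrightarrow> 0"
  proof -
    have "(\<lambda>n. r1 * (1/2) ^ n) \<longlonglongrightarrow> r1 * 0" by (intro tendsto_intros LIMSEQ_realpow_zero) auto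
    then show ?thesis by (simp add: r_def[abs_def] power_divide)
  qed
  have hol: "norm (G x - G y) \<le> (1 + 2 / (1 - q)) * sqrt C * 4 powr \<mu> * norm (x - y) powr \<mu>"
    if x: "x \<in> Sq x0 (R / 32)" and y: "y \<in> Sq x0 (R / 32)" for x y
  proof (cases "x = y")
    case True then show ?thesis using C q by simp
  next
    case False
    have xy2: "x \<in> Sq x0 (R / 2)" "y \<in> Sq x0 (R / 2)" using x y R by (auto simp: mem_Sq)
    have "x0 \<in> Sq x (R / 32)" using x by (simp add: mem_Sq abs_minus_commute)
    then have "y \<in> Sq x (R / 16)" using Sq_subset[of x0 x "R / 32" "R / 32" "R / 16"] y by auto
    then have nd: "norm (y - x) \<le> r1 / 2" using norm_le_Sq[of y x "R / 16"] by (simp add: r1_def)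
    define d where "d = norm (y - x)"
    have d: "d > 0" using False by (simp add: d_def)
    have "\<forall>\<^sub>F n in sequentially. r n < 2 * d" using r0 d by (auto dest: order_tendstoD(2)[of _ _ _ "2 * d"])
    then have "\<exists>n. r n < 2 * d" unfolding eventually_sequentially by auto
    \<comment> \<open>At the first scale below 2 d the preceding one satisfies 2 d <= r k < 4 d, and
      the square of half side r k / 2 around \<open>y\<close> lies in the one of half side r k
      around \<open>x\<close>. A preceding scale exists because \<open>x\<close> and
      \<open>y\<close> are close compared with \<open>r1\<close>.\<close>
    then obtain n where n: "r n < 2 * d" "\<And>k. k < n \<Longrightarrow> \<not> r k < 2 * d"
      using exists_least_iff[of "\<lambda>n. r n < 2 * d"] by blast
    have "n \<noteq> 0" using n(1) nd by (intro notI) (simp add: r_def d_def)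
    then obtain k where k: "n = Suc k" by (cases n) auto
    have rk: "2 * d \<le> r k" "r k < 4 * d" using n(1) n(2)[of k] by (auto simp: k rS)
    have "Sq y (r n) \<subseteq> Sq x (r k)"
    proof -
      have "y \<in> Sq x d" by (rule mem_Sq_norm) (simp add: d_def)
      then show ?thesis using rk r[of k] by (intro Sq_subset) (auto simp: k rS)
    qed
    then have 1: "norm (m y n - m x k) \<le> sqrt C * r k powr \<mu>"
      unfolding m_def using r[of n] r[of k] xy2
      by (intro mean_compare[OF g] C osc) (auto simp: k rS r1_def)
    have 2: "norm (m x k - G x) \<le> sqrt C * r k powr \<mu> / (1 - q)" by (rule Gn[OF xy2(1)])
    have 3: "norm (m y n - G y) \<le> sqrt C * r k powr \<mu> / (1 - q)"
    proof -
      have "r n powr \<mu> \<le> r k powr \<mu>" using r[of n] r[of k] \<mu> by (intro powr_mono2) (auto simp: k rS)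
      then have "sqrt C * r n powr \<mu> / (1 - q) \<le> sqrt C * r k powr \<mu> / (1 - q)"
        using q C by (intro divide_right_mono mult_left_mono) auto
      then show ?thesis using Gn[OF xy2(2), of n] by linarith
    qed
    have "norm (G x - G y) \<le> norm (m x k - G x) + norm (m y n - m x k) + norm (m y n - G y)"
    proof -
      have "G x - G y = (- (m x k - G x)) + (- (m y n - m x k)) + (m y n - G y)" by simp
      then show ?thesis by (metis norm_minus_cancel norm_triangle_ineq norm_triangle_le add_mono order_refl)
    qed
    also have "\<dots> \<le> (1 + 2 / (1 - q)) * sqrt C * r k powr \<mu>"
    proof -
      have "(1 + 2 / (1 - q)) * sqrt C * r k powr \<mu> = sqrt C * r k powr \<mu> + 2 * (sqrt C * r k powr \<mu> / (1 - q))"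
        by (simp add: distrib_right)
      then show ?thesis using 1 2 3 by linarith
    qed
    also have "\<dots> \<le> (1 + 2 / (1 - q)) * sqrt C * (4 * d) powr \<mu>"
      using rk r[of k] \<mu> q C by (intro mult_left_mono powr_mono2 mult_nonneg_nonneg) auto
    also have "(4 * d) powr \<mu> = 4 powr \<mu> * norm (x - y) powr \<mu>"
      using d by (simp add: powr_mult d_def norm_minus_commute)
    finally show ?thesis by (simp add: mult.assoc)
  qed
  let ?S = "Sq x0 (R / 32)"
  have "\<exists>h. \<forall>x\<in>?S. (\<lambda>n. mean (Sq x (r n)) W) \<longlonglongrightarrow> h x \<and> (h has_derivative dmap (G x)) (at x within ?S)"
  proof (rule has_derivative_sequence[OF convex_Sq])
    show "((\<lambda>x. mean (Sq x (r n)) W) has_derivative dmap (m x n)) (at x within ?S)" if "x \<in> ?S" for n x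
      unfolding m_def
    proof (rule has_derivative_at_withinI, rule has_derivative_mean[OF W g r(1)])
      have "Sq x (r n) \<subseteq> Sq x0 R" using r(2)[of n] R by (intro Sq_subset[OF that]) (simp add: r1_def)
      then show "AE z in lborel. z \<in> Sq x (r n) \<longrightarrow> (W has_derivative dmap (g z)) (at z)"
        using dW by (auto elim!: eventually_mono)
    qed
    show "\<forall>\<^sub>F n in sequentially. \<forall>x\<in>?S. \<forall>h. norm (dmap (m x n) h - dmap (G x) h) \<le> e * norm h" if "e > 0" for e
    proof -
      have "(\<lambda>n. sqrt C * r1 powr \<mu> / (1 - q) * q ^ n) \<longlonglongrightarrow> sqrt C * r1 powr \<mu> / (1 - q) * 0"
        using q by (intro tendsto_intros LIMSEQ_realpow_zero) auto
      then have "\<forall>\<^sub>F n in sequentially. sqrt C * r1 powr \<mu> / (1 - q) * q ^ n < e"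
        using that by (auto dest: order_tendstoD(2)[of _ _ _ e])
      then show ?thesis
      proof eventually_elim
        case (elim n)
        show ?case
        proof (intro ballI allI)
          fix x h assume "x \<in> ?S"
          then have "x \<in> Sq x0 (R / 2)" using R by (auto simp: mem_Sq)
          then have "norm (m x n - G x) \<le> e" using G(2)[of x n] elim by linarith
          then show "norm (dmap (m x n) h - dmap (G x) h) \<le> e * norm h"
            unfolding dmap_diff[symmetric] using norm_dmap_le[of "m x n - G x" h]
            by (metis mult.commute mult_left_mono norm_ge_zero order.trans)
        qed
      qed
    qed
    show "x0 \<in> ?S" using R by simp
    show "(\<lambda>n. mean (Sq x0 (r n)) W) \<longlonglongrightarrow> W x0" by (rule mean_Sq_tendsto[OF W r(1) r0])
  qed
  then obtain h where h: "\<And>x. x \<in> ?S \<Longrightarrow> (\<lambda>n. mean (Sq x (r n)) W) \<longlonglongrightarrow> h x"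
    "\<And>x. x \<in> ?S \<Longrightarrow> (h has_derivative dmap (G x)) (at x within ?S)" by blast
  have hW: "h x = W x" if "x \<in> ?S" for x
    using h(1)[OF that] mean_Sq_tendsto[OF W r(1) r0] by (rule LIMSEQ_unique)
  show ?thesis
  proof (intro exI[of _ G] conjI ballI)
    fix x assume x: "x \<in> Sq x0 (R / 64)"
    then have x': "x \<in> ?S" using R by (auto simp: mem_Sq)
    have "(W has_derivative dmap (G x)) (at x within ?S)"
      using h(2)[OF x'] by (rule has_derivative_transform[rotated 2]) (use hW x' in auto)
    moreover have "x \<in> interior ?S"
    proof (rule interiorI)
      show "open (ball x (R / 64))" by simp
      show "x \<in> ball x (R / 64)" using R by simp
      show "ball x (R / 64) \<subseteq> ?S"
      proof
        fix y assume "y \<in> ball x (R / 64)"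
        then have "norm (y - x) \<le> R / 64" by (simp add: dist_norm norm_minus_commute)
        then have y: "y \<in> Sq x (R / 64)" by (rule mem_Sq_norm)
        have "Sq x (R / 64) \<subseteq> ?S" by (rule Sq_subset[OF x]) simp
        then show "y \<in> ?S" using y by (rule subsetD)
      qed
    qed
    ultimately show "(W has_derivative dmap (G x)) (at x)" by (simp only: at_within_interior)
    fix y assume "y \<in> Sq x0 (R / 64)"
    then have "y \<in> ?S" using R by (auto simp: mem_Sq)
    then show "norm (G x - G y) \<le> (1 + 2 / (1 - 2 powr (-\<mu>))) * sqrt C * 4 powr \<mu> * norm (x - y) powr \<mu>"
      using hol[OF x'] by (simp add: q_def)
  qed
qed

end

section \<open>Interior estimate for the gradient\<close>

lemma AE_not_negligible:
  assumes "negligible Z" shows "AE x in lborel. x \<notin> Z"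
proof -
  have "Z \<in> null_sets lebesgue" using assms by (simp add: negligible_iff_null_sets)
  then have "AE x in lebesgue. x \<notin> Z" by (rule AE_not_in)
  then show ?thesis by (simp add: AE_completion_iff)
qed

text \<open>A Borel measurable version of the gradient: \<open>pd\<close> uses the junk value of \<open>lim\<close> where the derivative
  does not exist, and \<open>bgrad\<close> truncates it.\<close>

definition pd :: "(real^2 \<Rightarrow> 'b::euclidean_space) \<Rightarrow> real^2 \<Rightarrow> real^2 \<Rightarrow> 'b" where
  "pd W u x = lim (\<lambda>n. real (Suc n) *\<^sub>R (W (x + inverse (real (Suc n)) *\<^sub>R u) - W x))"

lemma measurable_pd:
  assumes "L-lipschitz_on UNIV W"
  shows "pd W u \<in> borel_measurable borel"
proof -
  have [measurable]: "W \<in> borel_measurable borel" using lbm_lipschitz[OF assms] by (rule lbm_measurable)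
  show ?thesis unfolding pd_def by measurable
qed

lemma pd_eq: "(W has_derivative dmap z) (at x) \<Longrightarrow> pd W u x = dmap z u"
  unfolding pd_def by (intro limI diff_quot_tendsto)

definition bgrad :: "(real^2 \<Rightarrow> 'b::euclidean_space) \<Rightarrow> real \<Rightarrow> real^2 \<Rightarrow> 'b \<times> 'b" where
  "bgrad W L x = (if norm (pd W e1 x, pd W e2 x) \<le> 2 * L then (pd W e1 x, pd W e2 x) else 0)"

lemma lbm_bgrad:
  assumes "L-lipschitz_on UNIV W" shows "lbm (bgrad W L)"
proof (rule lbm_bounded)
  note [measurable] = measurable_pd[OF assms]
  show "bgrad W L \<in> borel_measurable borel" unfolding bgrad_def[abs_def] by measurable
  show "norm (bgrad W L x) \<le> 2 * L" for x
    using lipschitz_on_nonneg[OF assms] by (simp add: bgrad_def)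
qed

text \<open>Each of the two partial derivatives is bounded by \<open>L\<close>. The resulting 2 L is
  the truncation level of \<open>bgrad\<close>, so truncation never affects a true
  derivative.\<close>

lemma norm_grad_le:
  assumes W: "L-lipschitz_on UNIV W" and d: "(W has_derivative dmap z) (at x)"
  shows "norm z \<le> 2 * L"
proof -
  have *: "norm (dmap z u) \<le> L * norm u" for u
  proof (rule LIMSEQ_le_const2)
    show "(\<lambda>n. norm (real (Suc n) *\<^sub>R (W (x + inverse (real (Suc n)) *\<^sub>R u) - W x))) \<longlonglongrightarrow> norm (dmap z u)"
      by (intro tendsto_norm diff_quot_tendsto d)
    show "\<exists>N. \<forall>n\<ge>N. norm (real (Suc n) *\<^sub>R (W (x + inverse (real (Suc n)) *\<^sub>R u) - W x)) \<le> L * norm u"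
      by (intro exI[of _ 0] allI impI lipschitz_quot_bound[OF W]) simp
  qed
  have "norm z \<le> norm (fst z) + norm (snd z)" by (cases z) (simp add: norm_Pair_le)
  then show ?thesis using *[of e1] *[of e2] by (simp add: norm_axis_1)
qed

lemma bgrad_eq:
  assumes W: "L-lipschitz_on UNIV W" and d: "(W has_derivative dmap z) (at x)"
  shows "bgrad W L x = z"
  using norm_grad_le[OF assms] by (simp add: bgrad_def pd_eq[OF d])

context null_form
begin

text \<open>The hypotheses are pointwise off a negligible set and assume no measurability of
  \<open>g\<close>, because the inclusion provides nothing more. As in \<open>osc_bound\<close>, the
  constant \<open>C\<close> must not depend on \<open>L\<close>.\<close>

definition interior_bound :: "nat \<Rightarrow> real \<Rightarrow> real \<Rightarrow> real \<Rightarrow> real \<Rightarrow> bool" where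
  "interior_bound N \<mu> K R C \<longleftrightarrow> (\<forall>W L g x0 Z. L-lipschitz_on (Sq x0 R) W \<and> negligible Z \<and>
      (\<forall>y\<in>Sq x0 R - Z. (W has_derivative dmap (g y)) (at y) \<and> Q (g y) \<ge> c * (norm (g y))\<^sup>2 - K) \<and>
      (\<forall>y\<in>Sq x0 R. norm (W y) \<le> K) \<and>
      (\<forall>x\<in>Sq x0 R - Z. \<forall>y\<in>Sq x0 R - Z. Q (g y - g x) \<ge> c * (norm (g y - g x))\<^sup>2
         - K * norm (y - x) powr (2 * (2 / (2 * real N + 1))) * ((norm (g x))\<^sup>2 + 1)) \<longrightarrow>
      (\<exists>G. (\<forall>x\<in>Sq x0 (R / 64). (W has_derivative dmap (G x)) (at x)) \<and>
        (\<forall>x\<in>Sq x0 (R / 64). \<forall>y\<in>Sq x0 (R / 64). norm (G x - G y) \<le> C * norm (x - y) powr \<mu>)))"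

text \<open>Two replacements lead to \<open>admissible\<close>: \<open>W\<close> is extended by
  composing it with the nearest-point projection onto the square, which preserves the Lipschitz
  constant, and \<open>g\<close> is exchanged for the Borel gradient of the extension, equal to it
  almost everywhere on the square.\<close>

theorem interior_estimate:
  assumes N: "N \<ge> 1"
  shows "\<exists>\<mu>. 0 < \<mu> \<and> \<mu> \<le> 1 / 2 \<and> (\<forall>K R. 0 \<le> K \<and> 0 < R \<and> R \<le> 1 \<longrightarrow> (\<exists>C\<ge>0. interior_bound N \<mu> K R C))"
proof -
  obtain \<mu> where \<mu>: "0 < \<mu>" "\<mu> \<le> 1 / 2" "\<And>K R. 0 \<le> K \<Longrightarrow> 0 < R \<Longrightarrow> R \<le> 1 \<Longrightarrow> \<exists>C\<ge>0. osc_bound N \<mu> K R C"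
    using campanato_bound[OF N] by blast
  show ?thesis
  proof (rule exI[of _ \<mu>], intro conjI allI impI \<mu>(1,2))
    fix K R :: real assume KR: "0 \<le> K \<and> 0 < R \<and> R \<le> 1"
    obtain C where C: "C \<ge> 0" "osc_bound N \<mu> K R C"
      using \<mu>(3)[of K R] KR by blast
    let ?C = "(1 + 2 / (1 - 2 powr (-\<mu>))) * sqrt C * 4 powr \<mu>"
    have C': "?C \<ge> 0" using C(1) \<mu> powr_less_cancel_iff[of 2 "-\<mu>" 0] by (intro mult_nonneg_nonneg) auto
    show "\<exists>C\<ge>0. interior_bound N \<mu> K R C"
      unfolding interior_bound_def
    proof (intro exI[of _ ?C] conjI allI impI C')
      fix W :: "real^2 \<Rightarrow> 'b" and L :: real and g :: "real^2 \<Rightarrow> 'b \<times> 'b" and x0 :: "real^2" and Z :: "(real^2) set"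
      let ?S = "Sq x0 R"
      assume "L-lipschitz_on ?S W \<and> negligible Z \<and>
      (\<forall>y\<in>?S - Z. (W has_derivative dmap (g y)) (at y) \<and> Q (g y) \<ge> c * (norm (g y))\<^sup>2 - K) \<and>
      (\<forall>y\<in>?S. norm (W y) \<le> K) \<and>
      (\<forall>x\<in>?S - Z. \<forall>y\<in>?S - Z. Q (g y - g x) \<ge> c * (norm (g y - g x))\<^sup>2
         - K * norm (y - x) powr (2 * (2 / (2 * real N + 1))) * ((norm (g x))\<^sup>2 + 1))"
      then have W: "L-lipschitz_on ?S W" and Z: "negligible Z"
        and d: "\<And>y. y \<in> ?S \<Longrightarrow> y \<notin> Z \<Longrightarrow> (W has_derivative dmap (g y)) (at y)"
        and h0: "\<And>y. y \<in> ?S \<Longrightarrow> y \<notin> Z \<Longrightarrow> Q (g y) \<ge> c * (norm (g y))\<^sup>2 - K"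
        and K: "\<And>y. y \<in> ?S \<Longrightarrow> norm (W y) \<le> K"
        and h: "\<And>x y. x \<in> ?S \<Longrightarrow> x \<notin> Z \<Longrightarrow> y \<in> ?S \<Longrightarrow> y \<notin> Z \<Longrightarrow> Q (g y - g x) \<ge> c * (norm (g y - g x))\<^sup>2
         - K * norm (y - x) powr (2 * (2 / (2 * real N + 1))) * ((norm (g x))\<^sup>2 + 1)" by blast+
      have "x0 \<in> ?S" using KR by simp
      then have S: "convex ?S" "closed ?S" "?S \<noteq> {}" by (auto simp: compact_imp_closed)
      define V where "V = (\<lambda>y. W (closest_point ?S y))"
      have V: "L-lipschitz_on UNIV V"
      proof (rule lipschitz_onI)
        fix x y
        have "dist (V x) (V y) \<le> L * dist (closest_point ?S x) (closest_point ?S y)"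
          unfolding V_def by (intro lipschitz_onD[OF W] closest_point_in_set S)
        also have "\<dots> \<le> L * dist x y"
          by (intro mult_left_mono closest_point_lipschitz S lipschitz_on_nonneg[OF W])
        finally show "dist (V x) (V y) \<le> L * dist x y" .
      qed (rule lipschitz_on_nonneg[OF W])
      have VW: "V y = W y" if "y \<in> ?S" for y using that by (simp add: V_def closest_point_self)
      have eq: "V w = W w" if "w \<in> interior ?S" for w using VW that interior_subset[of ?S] by (meson subsetD)
      have Vd: "(V has_derivative dmap z) (at y)" if "y \<in> interior ?S" "(W has_derivative dmap z) (at y)" for y z
        by (rule has_derivative_transform_within_open[OF that(2) open_interior that(1)]) (rule eq[symmetric])
      have Wd: "(W has_derivative dmap z) (at y)" if "y \<in> interior ?S" "(V has_derivative dmap z) (at y)" for y z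
        by (rule has_derivative_transform_within_open[OF that(2) open_interior that(1)]) (rule eq)
      define g' where "g' = bgrad V L"
      have g': "lbm g'" unfolding g'_def by (rule lbm_bgrad[OF V])
      \<comment> \<open>Extension and original agree on the square only, so their derivatives can be
        compared at interior points; the frontier of a convex set is negligible.\<close>
      have good: "AE y in lborel. y \<in> ?S \<longrightarrow> y \<notin> Z \<and> (V has_derivative dmap (g' y)) (at y) \<and> g' y = g y"
      proof -
        have "negligible (frontier ?S)" by (rule negligible_convex_frontier[OF S(1)])
        from AE_not_negligible[OF this] AE_not_negligible[OF Z] show ?thesis
        proof eventually_elim
          fix y assume y: "y \<notin> frontier ?S" "y \<notin> Z"
          show "y \<in> ?S \<longrightarrow> y \<notin> Z \<and> (V has_derivative dmap (g' y)) (at y) \<and> g' y = g y"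
          proof
            assume "y \<in> ?S"
            then have "y \<in> interior ?S" using y(1) closure_subset[of ?S] by (auto simp: frontier_def)
            from Vd[OF this d[OF \<open>y \<in> ?S\<close> y(2)]] have 1: "(V has_derivative dmap (g y)) (at y)" .
            then have "g' y = g y" unfolding g'_def by (rule bgrad_eq[OF V])
            then show "y \<notin> Z \<and> (V has_derivative dmap (g' y)) (at y) \<and> g' y = g y" using y 1 by simp
          qed
        qed
      qed
      have ad: "admissible V L g' ?S K (2 / (2 * real N + 1))"
        unfolding admissible_def
      proof (intro conjI allI V g')
        show "AE y in lborel. y \<in> ?S \<longrightarrow> (V has_derivative dmap (g' y)) (at y)"
          using good by eventually_elim auto
        fix s
        show "AE y in lborel. y \<in> ?S \<and> y + s \<in> ?S \<longrightarrow> Q (g' (y + s) - g' y) \<ge> c * (norm (g' (y + s) - g' y))\<^sup>2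
          - K * norm s powr (2 * (2 / (2 * real N + 1))) * ((norm (g' y))\<^sup>2 + 1)"
          using good AE_lborel_shift[OF good, of s]
        proof eventually_elim
          fix y assume *: "y \<in> ?S \<longrightarrow> y \<notin> Z \<and> (V has_derivative dmap (g' y)) (at y) \<and> g' y = g y"
            "y + s \<in> ?S \<longrightarrow> y + s \<notin> Z \<and> (V has_derivative dmap (g' (y + s))) (at (y + s)) \<and> g' (y + s) = g (y + s)"
          show "y \<in> ?S \<and> y + s \<in> ?S \<longrightarrow> Q (g' (y + s) - g' y) \<ge> c * (norm (g' (y + s) - g' y))\<^sup>2
          - K * norm s powr (2 * (2 / (2 * real N + 1))) * ((norm (g' y))\<^sup>2 + 1)"
            using * h[of y "y + s"] by auto
        qed
      qed
      have ae: "AE y in lborel. y \<in> ?S \<longrightarrow> Q (g' y) \<ge> c * (norm (g' y))\<^sup>2 - K"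
        using good by eventually_elim (use h0 in auto)
      have bd: "\<forall>y\<in>?S. norm (V y) \<le> K" using K VW by simp
      have osc: "osc g' x r \<le> C * r powr (2 + 2 * \<mu>)" if "x \<in> Sq x0 (R / 2)" "0 < r" "r \<le> R / 4" for x r
        using C(2) ad ae bd that unfolding osc_bound_def by blast
      have dV: "AE y in lborel. y \<in> ?S \<longrightarrow> (V has_derivative dmap (g' y)) (at y)"
        using good by eventually_elim auto
      have R0: "0 < R" using KR by simp
      from campanato[OF V g' R0 \<mu>(1) C(1) dV osc]
      obtain G where G: "\<And>x. x \<in> Sq x0 (R / 64) \<Longrightarrow> (V has_derivative dmap (G x)) (at x)"
        "\<And>x y. x \<in> Sq x0 (R / 64) \<Longrightarrow> y \<in> Sq x0 (R / 64) \<Longrightarrow> norm (G x - G y) \<le> ?C * norm (x - y) powr \<mu>"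
        by blast
      have int: "x \<in> interior ?S" if "x \<in> Sq x0 (R / 64)" for x
      proof (rule interiorI)
        show "open (ball x (R / 64))" by simp
        show "x \<in> ball x (R / 64)" using KR by simp
        have "ball x (R / 64) \<subseteq> Sq x (R / 64)"
          by (intro subsetI mem_Sq_norm) (simp add: dist_norm norm_minus_commute)
        also have "\<dots> \<subseteq> ?S" using KR by (intro Sq_subset[OF that]) simp
        finally show "ball x (R / 64) \<subseteq> ?S" .
      qed
      show "\<exists>G. (\<forall>x\<in>Sq x0 (R / 64). (W has_derivative dmap (G x)) (at x)) \<and>
        (\<forall>x\<in>Sq x0 (R / 64). \<forall>y\<in>Sq x0 (R / 64). norm (G x - G y) \<le> ?C * norm (x - y) powr \<mu>)"
        using G Wd int by blast
    qed
  qed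
qed

end

section \<open>Local Hoelder classes\<close>

text \<open>A neighbourhood version of Hoelder continuity, convenient for products and compositions;
  uniformity on compact sets is recovered in \<open>lhol_compact\<close>. Requiring the ball to lie
  in \<open>S\<close> builds the openness of \<open>S\<close> into the predicate.\<close>

definition lhol :: "real \<Rightarrow> 'a::euclidean_space set \<Rightarrow> ('a \<Rightarrow> 'b::real_normed_vector) \<Rightarrow> bool" where
  "lhol \<sigma> S g \<longleftrightarrow> (\<forall>x\<in>S. \<exists>r>0. \<exists>C\<ge>0. ball x r \<subseteq> S \<and>
    (\<forall>y\<in>ball x r. \<forall>z\<in>ball x r. norm (g y - g z) \<le> C * norm (y - z) powr \<sigma>))"

text \<open>The local class C^(m, \<sigma>). The innermost derivative is split off, so that
  inductions pass from a function to its partial derivatives; \<open>CH_iter_deriv\<close> links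
  this to iterated derivatives.\<close>

primrec CH :: "nat \<Rightarrow> real \<Rightarrow> 'a::euclidean_space set \<Rightarrow> ('a \<Rightarrow> 'b::real_normed_vector) \<Rightarrow> bool" where
  "CH 0 \<sigma> S g = lhol \<sigma> S g"
| "CH (Suc m) \<sigma> S g = ((\<forall>x\<in>S. g differentiable (at x)) \<and>
    (\<forall>b\<in>Basis. CH m \<sigma> S (\<lambda>x. frechet_derivative g (at x) b)))"

lemma lholD:
  assumes "lhol \<sigma> S g" "x \<in> S"
  obtains r C where "r > 0" "C \<ge> 0" "ball x r \<subseteq> S"
    "\<And>y z. y \<in> ball x r \<Longrightarrow> z \<in> ball x r \<Longrightarrow> norm (g y - g z) \<le> C * norm (y - z) powr \<sigma>"
  using assms unfolding lhol_def by blast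

lemma lhol_radius:
  assumes "lhol \<sigma> S g" "x \<in> S"
  obtains C r where "r > 0" "r \<le> 1" "C \<ge> 0" "ball x r \<subseteq> S"
    "\<And>y z. y \<in> ball x r \<Longrightarrow> z \<in> ball x r \<Longrightarrow> norm (g y - g z) \<le> C * norm (y - z) powr \<sigma>"
proof -
  obtain r C where "r > 0" "C \<ge> 0" "ball x r \<subseteq> S"
    "\<And>y z. y \<in> ball x r \<Longrightarrow> z \<in> ball x r \<Longrightarrow> norm (g y - g z) \<le> C * norm (y - z) powr \<sigma>"
    by (rule lholD[OF assms]) (rule that)
  then show ?thesis by (intro that[of "min r 1" C]) auto
qed

lemma lhol_open: "lhol \<sigma> S g \<Longrightarrow> open S"
  unfolding open_contains_ball by (meson lholD)

lemma lhol_const: "open S \<Longrightarrow> lhol \<sigma> S (\<lambda>x. c)"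
  unfolding lhol_def open_contains_ball by (metis diff_self mult_zero_left norm_zero order_refl)

lemma lhol_cong:
  assumes "lhol \<sigma> S f" "\<And>x. x \<in> S \<Longrightarrow> f x = g x" shows "lhol \<sigma> S g"
  unfolding lhol_def
proof
  fix x assume "x \<in> S"
  obtain r C where *: "r > 0" "C \<ge> 0" "ball x r \<subseteq> S"
    "\<And>y z. y \<in> ball x r \<Longrightarrow> z \<in> ball x r \<Longrightarrow> norm (f y - f z) \<le> C * norm (y - z) powr \<sigma>"
    by (rule lholD[OF assms(1) \<open>x \<in> S\<close>]) (rule that)
  have "norm (g y - g z) \<le> C * norm (y - z) powr \<sigma>" if "y \<in> ball x r" "z \<in> ball x r" for y z
    using *(4)[OF that] assms(2)[OF subsetD[OF *(3) that(1)]] assms(2)[OF subsetD[OF *(3) that(2)]] by simp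
  then show "\<exists>r>0. \<exists>C\<ge>0. ball x r \<subseteq> S \<and>
    (\<forall>y\<in>ball x r. \<forall>z\<in>ball x r. norm (g y - g z) \<le> C * norm (y - z) powr \<sigma>)" using * by blast
qed

lemma lhol_mono:
  assumes "lhol \<sigma> S f" "0 < \<tau>" "\<tau> \<le> \<sigma>" shows "lhol \<tau> S f"
  unfolding lhol_def
proof
  fix x assume "x \<in> S"
  obtain C r where *: "r > 0" "r \<le> 1" "C \<ge> 0" "ball x r \<subseteq> S"
    "\<And>y z. y \<in> ball x r \<Longrightarrow> z \<in> ball x r \<Longrightarrow> norm (f y - f z) \<le> C * norm (y - z) powr \<sigma>"
    by (rule lhol_radius[OF assms(1) \<open>x \<in> S\<close>]) (rule that)
  have "norm (f y - f z) \<le> C * norm (y - z) powr \<tau>" if "y \<in> ball x (r/2)" "z \<in> ball x (r/2)" for y z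
  proof -
    have "norm (y - z) \<le> 1" using that *(1,2) dist_triangle3[of y z x] by simp (simp add: dist_norm)
    then have "norm (y - z) powr \<sigma> \<le> norm (y - z) powr \<tau>" using assms by (intro powr_mono') auto
    moreover have "norm (f y - f z) \<le> C * norm (y - z) powr \<sigma>" using that *(1,2) by (intro *(5)) auto
    ultimately show ?thesis using *(3) by (meson mult_left_mono order.trans)
  qed
  moreover have "ball x (r/2) \<subseteq> S" using *(1) by (intro order.trans[OF subset_ball *(4)]) simp
  ultimately show "\<exists>r>0. \<exists>C\<ge>0. ball x r \<subseteq> S \<and>
    (\<forall>y\<in>ball x r. \<forall>z\<in>ball x r. norm (f y - f z) \<le> C * norm (y - z) powr \<tau>)"
    using *(1,3) by (intro exI[of _ "r/2"] exI[of _ C] conjI) auto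
qed

lemma lhol_bounded:
  assumes "lhol \<sigma> S f" "0 < \<sigma>" "x \<in> S"
  obtains r M C where "r > 0" "r \<le> 1" "M \<ge> 0" "C \<ge> 0" "ball x r \<subseteq> S" "\<And>y. y \<in> ball x r \<Longrightarrow> norm (f y) \<le> M"
    "\<And>y z. y \<in> ball x r \<Longrightarrow> z \<in> ball x r \<Longrightarrow> norm (f y - f z) \<le> C * norm (y - z) powr \<sigma>"
proof -
  obtain C r where *: "r > 0" "r \<le> 1" "C \<ge> 0" "ball x r \<subseteq> S"
    "\<And>y z. y \<in> ball x r \<Longrightarrow> z \<in> ball x r \<Longrightarrow> norm (f y - f z) \<le> C * norm (y - z) powr \<sigma>"
    by (rule lhol_radius[OF assms(1,3)]) (rule that)
  have "norm (f y) \<le> norm (f x) + C" if "y \<in> ball x r" for y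
  proof -
    have "norm (y - x) \<le> 1" using that *(2) by (simp add: dist_norm norm_minus_commute)
    then have "norm (y - x) powr \<sigma> \<le> 1" using assms(2) by (intro powr_le1) auto
    then have "C * norm (y - x) powr \<sigma> \<le> C" using *(3) by (rule mult_left_le)
    moreover have "norm (f y - f x) \<le> C * norm (y - x) powr \<sigma>" using that *(1,2) by (intro *(5)) auto
    ultimately show ?thesis using norm_triangle_ineq2[of "f y" "f x"] by linarith
  qed
  then show ?thesis using * by (intro that[of r "norm (f x) + C" C]) auto
qed

lemma lhol_continuous:
  assumes "lhol \<sigma> S f" "0 < \<sigma>" shows "continuous_on S f"
proof (rule continuous_at_imp_continuous_on, rule ballI)
  fix x assume "x \<in> S"
  obtain C r where *: "r > 0" "r \<le> 1" "C \<ge> 0" "ball x r \<subseteq> S"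
    "\<And>y z. y \<in> ball x r \<Longrightarrow> z \<in> ball x r \<Longrightarrow> norm (f y - f z) \<le> C * norm (y - z) powr \<sigma>"
    by (rule lhol_radius[OF assms(1) \<open>x \<in> S\<close>]) (rule that)
  have "((\<lambda>y. C * norm (y - x) powr \<sigma>) \<longlongrightarrow> 0) (at x)"
  proof (rule tendsto_mult_right_zero)
    have "((\<lambda>y. norm (y - x)) \<longlongrightarrow> 0) (at x)" by (rule tendsto_eq_intros refl | simp)+
    then show "((\<lambda>y. norm (y - x) powr \<sigma>) \<longlongrightarrow> 0) (at x)"
      using assms(2) by (intro tendsto_zero_powrI[where b=\<sigma>]) auto
  qed
  moreover have ev: "\<forall>\<^sub>F y in at x. norm (f y - f x) \<le> C * norm (y - x) powr \<sigma>"
    unfolding eventually_at using *(1) by (intro exI[of _ r] conjI ballI impI *(5)) (auto simp: dist_commute)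
  ultimately have "((\<lambda>y. f y - f x) \<longlongrightarrow> 0) (at x)" by (intro Lim_null_comparison[OF ev])
  then show "isCont f x" unfolding isCont_def by (rule LIM_zero_cancel)
qed

lemma lhol_bilinear:
  assumes h: "bounded_bilinear h" and f: "lhol \<sigma> S f" and g: "lhol \<sigma> S g" and \<sigma>: "0 < \<sigma>"
  shows "lhol \<sigma> S (\<lambda>x. h (f x) (g x))"
  unfolding lhol_def
proof
  interpret bounded_bilinear h by fact
  fix x assume "x \<in> S"
  obtain r M C where 1: "r > 0" "r \<le> 1" "M \<ge> 0" "C \<ge> 0" "ball x r \<subseteq> S" "\<And>y. y \<in> ball x r \<Longrightarrow> norm (f y) \<le> M"
    "\<And>y z. y \<in> ball x r \<Longrightarrow> z \<in> ball x r \<Longrightarrow> norm (f y - f z) \<le> C * norm (y - z) powr \<sigma>"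
    by (rule lhol_bounded[OF f \<sigma> \<open>x \<in> S\<close>]) (rule that)
  obtain r' M' C' where 2: "r' > 0" "r' \<le> 1" "M' \<ge> 0" "C' \<ge> 0" "ball x r' \<subseteq> S" "\<And>y. y \<in> ball x r' \<Longrightarrow> norm (g y) \<le> M'"
    "\<And>y z. y \<in> ball x r' \<Longrightarrow> z \<in> ball x r' \<Longrightarrow> norm (g y - g z) \<le> C' * norm (y - z) powr \<sigma>"
    by (rule lhol_bounded[OF g \<sigma> \<open>x \<in> S\<close>]) (rule that)
  obtain K where K: "K > 0" "\<And>a b. norm (h a b) \<le> norm a * norm b * K" using pos_bounded by blast
  let ?C = "C * M' * K + M * C' * K"
  have "norm (h (f y) (g y) - h (f z) (g z)) \<le> ?C * norm (y - z) powr \<sigma>"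
    if "y \<in> ball x (min r r')" "z \<in> ball x (min r r')" for y z
  proof -
    have y: "y \<in> ball x r" "y \<in> ball x r'" "z \<in> ball x r" "z \<in> ball x r'" using that by auto
    have "h (f y) (g y) - h (f z) (g z) = h (f y - f z) (g y) + h (f z) (g y - g z)"
      by (simp add: diff_left diff_right)
    then have "norm (h (f y) (g y) - h (f z) (g z)) \<le> norm (f y - f z) * norm (g y) * K + norm (f z) * norm (g y - g z) * K"
      by (metis K(2) add_mono norm_triangle_le)
    also have "\<dots> \<le> (C * norm (y - z) powr \<sigma>) * M' * K + M * (C' * norm (y - z) powr \<sigma>) * K"
      using y K(1) 1 2 by (intro add_mono mult_right_mono mult_mono 1(6,7) 2(6,7)) auto
    finally show ?thesis by (simp add: algebra_simps)
  qed
  moreover have "ball x (min r r') \<subseteq> S" using 1(5) by auto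
  moreover have "?C \<ge> 0" using 1 2 K by simp
  moreover have "min r r' > 0" using 1 2 by simp
  ultimately show "\<exists>r>0. \<exists>C\<ge>0. ball x r \<subseteq> S \<and>
    (\<forall>y\<in>ball x r. \<forall>z\<in>ball x r. norm (h (f y) (g y) - h (f z) (g z)) \<le> C * norm (y - z) powr \<sigma>)" by blast
qed

lemma lhol_linear:
  assumes h: "bounded_linear h" and f: "lhol \<sigma> S f"
  shows "lhol \<sigma> S (\<lambda>x. h (f x))"
  unfolding lhol_def
proof
  interpret bounded_linear h by fact
  fix x assume "x \<in> S"
  obtain C r where *: "r > 0" "r \<le> 1" "C \<ge> 0" "ball x r \<subseteq> S"
    "\<And>y z. y \<in> ball x r \<Longrightarrow> z \<in> ball x r \<Longrightarrow> norm (f y - f z) \<le> C * norm (y - z) powr \<sigma>"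
    by (rule lhol_radius[OF f \<open>x \<in> S\<close>]) (rule that)
  obtain K where K: "K > 0" "\<And>a. norm (h a) \<le> norm a * K" using pos_bounded by blast
  have "norm (h (f y) - h (f z)) \<le> (C * K) * norm (y - z) powr \<sigma>" if "y \<in> ball x r" "z \<in> ball x r" for y z
  proof -
    have "norm (h (f y) - h (f z)) \<le> norm (f y - f z) * K" using K(2)[of "f y - f z"] by (simp add: diff)
    also have "\<dots> \<le> (C * norm (y - z) powr \<sigma>) * K" using *(5)[OF that] K by (intro mult_right_mono) auto
    finally show ?thesis by (simp add: mult_ac)
  qed
  then show "\<exists>r>0. \<exists>C\<ge>0. ball x r \<subseteq> S \<and>
    (\<forall>y\<in>ball x r. \<forall>z\<in>ball x r. norm (h (f y) - h (f z)) \<le> C * norm (y - z) powr \<sigma>)"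
    using * K by (intro exI[of _ r] exI[of _ "C * K"] conjI) auto
qed

lemma lhol_add:
  assumes f: "lhol \<sigma> S f" and g: "lhol \<sigma> S g"
  shows "lhol \<sigma> S (\<lambda>x. f x + g x)"
  unfolding lhol_def
proof
  fix x assume "x \<in> S"
  obtain C r where 1: "r > 0" "r \<le> 1" "C \<ge> 0" "ball x r \<subseteq> S"
    "\<And>y z. y \<in> ball x r \<Longrightarrow> z \<in> ball x r \<Longrightarrow> norm (f y - f z) \<le> C * norm (y - z) powr \<sigma>"
    by (rule lhol_radius[OF f \<open>x \<in> S\<close>]) (rule that)
  obtain C' r' where 2: "r' > 0" "r' \<le> 1" "C' \<ge> 0" "ball x r' \<subseteq> S"
    "\<And>y z. y \<in> ball x r' \<Longrightarrow> z \<in> ball x r' \<Longrightarrow> norm (g y - g z) \<le> C' * norm (y - z) powr \<sigma>"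
    by (rule lhol_radius[OF g \<open>x \<in> S\<close>]) (rule that)
  have "norm (f y + g y - (f z + g z)) \<le> (C + C') * norm (y - z) powr \<sigma>" if "y \<in> ball x (min r r')" "z \<in> ball x (min r r')" for y z
    using 1(5)[of y z] 2(5)[of y z] that norm_triangle_ineq[of "f y - f z" "g y - g z"]
    by (simp add: algebra_simps)
  moreover have "ball x (min r r') \<subseteq> S" using 1(4) by auto
  moreover have "min r r' > 0" using 1 2 by simp
  moreover have "C + C' \<ge> 0" using 1 2 by simp
  ultimately show "\<exists>r>0. \<exists>C\<ge>0. ball x r \<subseteq> S \<and>
    (\<forall>y\<in>ball x r. \<forall>z\<in>ball x r. norm (f y + g y - (f z + g z)) \<le> C * norm (y - z) powr \<sigma>)" by blast
qed

lemma norm_linear_Basis_bound: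
  fixes T :: "'a::euclidean_space \<Rightarrow> 'b::real_normed_vector"
  assumes "linear T" "\<And>b. b \<in> Basis \<Longrightarrow> norm (T b) \<le> M"
  shows "norm (T v) \<le> real DIM('a) * M * norm v"
proof -
  have "T v = T (\<Sum>b\<in>Basis. (v \<bullet> b) *\<^sub>R b)" by (simp add: euclidean_representation)
  also have "\<dots> = (\<Sum>b\<in>Basis. (v \<bullet> b) *\<^sub>R T b)" by (simp add: linear_sum[OF assms(1)] linear_cmul[OF assms(1)])
  also have "norm \<dots> \<le> (\<Sum>b\<in>(Basis::'a set). norm v * M)"
    using assms(2) by (intro sum_norm_le) (auto intro!: mult_mono Basis_le_norm)
  finally show ?thesis by (simp add: mult_ac)
qed

text \<open>Continuous partial derivatives are bounded on a small closed ball, and the mean value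
  inequality gives exponent 1. In \<open>CH_imp_lhol\<close> this carries Hoelder continuity from
  the top derivatives down to the function.\<close>

lemma lhol_of_derivative:
  fixes f :: "'a::euclidean_space \<Rightarrow> 'b::real_normed_vector"
  assumes S: "open S" and d: "\<And>x. x \<in> S \<Longrightarrow> f differentiable (at x)"
    and c: "\<And>b. b \<in> Basis \<Longrightarrow> continuous_on S (\<lambda>x. frechet_derivative f (at x) b)"
  shows "lhol 1 S f"
  unfolding lhol_def
proof
  fix x assume x: "x \<in> S"
  obtain r where r: "r > 0" "cball x r \<subseteq> S" using S x by (meson open_contains_cball)
  have "\<exists>M. \<forall>y\<in>cball x r. norm (frechet_derivative f (at y) b) \<le> M" if "b \<in> Basis" for b
  proof -
    have "compact ((\<lambda>y. frechet_derivative f (at y) b) ` cball x r)"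
      by (intro compact_continuous_image continuous_on_subset[OF c[OF that] r(2)]) simp
    from compact_imp_bounded[OF this] obtain M where "\<forall>z\<in>(\<lambda>y. frechet_derivative f (at y) b) ` cball x r. norm z \<le> M"
      unfolding bounded_iff ..
    then show ?thesis by (intro exI[of _ M]) simp
  qed
  then obtain M where M: "\<And>b y. b \<in> Basis \<Longrightarrow> y \<in> cball x r \<Longrightarrow> norm (frechet_derivative f (at y) b) \<le> M b" by metis
  define K where "K = real DIM('a) * Max (insert 0 (M ` Basis))"
  have K0: "K \<ge> 0" by (simp add: K_def)
  have "norm (f y - f z) \<le> K * norm (y - z)" if "y \<in> cball x r" "z \<in> cball x r" for y z
  proof (rule differentiable_bound[OF convex_cball _ _ that])
    fix w assume w: "w \<in> cball x r"
    then have "(f has_derivative frechet_derivative f (at w)) (at w)"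
      using d r(2) frechet_derivative_works by blast
    then show d': "(f has_derivative frechet_derivative f (at w)) (at w within cball x r)" by (rule has_derivative_at_withinI)
    have "norm (frechet_derivative f (at w) b) \<le> Max (insert 0 (M ` Basis))" if "b \<in> Basis" for b
      using M[OF that w] that by (intro order.trans[OF _ Max_ge]) auto
    from norm_linear_Basis_bound[OF has_derivative_linear[OF d'] this]
    show "onorm (frechet_derivative f (at w)) \<le> K" unfolding K_def by (intro onorm_le) auto
  qed
  moreover have "norm (y - z) powr 1 = norm (y - z)" for y z :: 'a by simp
  ultimately show "\<exists>r>0. \<exists>C\<ge>0. ball x r \<subseteq> S \<and> (\<forall>y\<in>ball x r. \<forall>z\<in>ball x r. norm (f y - f z) \<le> C * norm (y - z) powr 1)"
    using r K0 by (intro exI[of _ r] exI[of _ K] conjI) (auto intro: subset_trans[OF ball_subset_cball])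
qed

lemma frechet_cong:
  assumes "open S" "x \<in> S" "\<And>x. x \<in> S \<Longrightarrow> f x = g x"
  shows "frechet_derivative f (at x) = frechet_derivative g (at x)"
    and "f differentiable (at x) \<longleftrightarrow> g differentiable (at x)"
proof -
  have *: "(f has_derivative D) (at x) \<longleftrightarrow> (g has_derivative D) (at x)" for D
    using has_derivative_transform_within_open[OF _ assms(1,2), of f D UNIV g]
      has_derivative_transform_within_open[OF _ assms(1,2), of g D UNIV f] assms(3) by auto
  show "frechet_derivative f (at x) = frechet_derivative g (at x)"
    unfolding frechet_derivative_def * ..
  show "f differentiable (at x) \<longleftrightarrow> g differentiable (at x)" unfolding differentiable_def * ..
qed

section \<open>Calculus in the classes \<open>CH\<close>\<close>

lemma CH_open:
  fixes g :: "'a::euclidean_space \<Rightarrow> 'b::real_normed_vector"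
  shows "CH m \<sigma> S g \<Longrightarrow> open S"
proof (induction m arbitrary: g)
  case (Suc m) then show ?case using nonempty_Basis by fastforce
qed (simp add: lhol_open)

lemma CH_cong:
  fixes f g :: "'a::euclidean_space \<Rightarrow> 'b::real_normed_vector"
  assumes "CH m \<sigma> S f" "\<And>x. x \<in> S \<Longrightarrow> f x = g x" shows "CH m \<sigma> S g"
  using assms
proof (induction m arbitrary: f g)
  case 0
  then have "lhol \<sigma> S f" by simp
  then show ?case unfolding CH.simps by (rule lhol_cong) (rule 0(2))
next
  case (Suc m)
  have S: "open S" by (rule CH_open[OF Suc(2)])
  show ?case unfolding CH.simps
  proof (intro conjI ballI)
    show "g differentiable (at x)" if "x \<in> S" for x
    proof -
      have "f differentiable (at x) \<longleftrightarrow> g differentiable (at x)" by (rule frechet_cong(2)[OF S that]) (rule Suc(3))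
      then show ?thesis using Suc(2) that by simp
    qed
    show "CH m \<sigma> S (\<lambda>x. frechet_derivative g (at x) b)" if "b \<in> Basis" for b
    proof (rule Suc(1))
      show "CH m \<sigma> S (\<lambda>x. frechet_derivative f (at x) b)" using Suc(2) that by simp
      show "frechet_derivative f (at x) b = frechet_derivative g (at x) b" if "x \<in> S" for x
      proof -
        have "frechet_derivative f (at x) = frechet_derivative g (at x)" by (rule frechet_cong(1)[OF S that]) (rule Suc(3))
        then show ?thesis by simp
      qed
    qed
  qed
qed

lemma CH_imp_lhol:
  fixes f :: "'a::euclidean_space \<Rightarrow> 'b::real_normed_vector"
  assumes "CH m \<sigma> S f" "0 < \<sigma>" "\<sigma> \<le> 1" shows "lhol \<sigma> S f"
  using assms(1)
proof (induction m arbitrary: f)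
  case (Suc m)
  have S: "open S" by (rule CH_open[OF Suc(2)])
  have "lhol \<sigma> S (\<lambda>x. frechet_derivative f (at x) b)" if "b \<in> Basis" for b using Suc that by simp
  then have "lhol 1 S f" using Suc(2) assms by (intro lhol_of_derivative S) (auto intro: lhol_continuous)
  then show ?case using assms(2,3) by (rule lhol_mono)
qed simp

lemma CH_Suc_imp_CH:
  fixes f :: "'a::euclidean_space \<Rightarrow> 'b::real_normed_vector"
  assumes "CH (Suc m) \<sigma> S f" "0 < \<sigma>" "\<sigma> \<le> 1" shows "CH m \<sigma> S f"
  using assms(1)
proof (induction m arbitrary: f)
  case 0 then show ?case using CH_imp_lhol[OF _ assms(2,3), of "Suc 0"] by simp
next
  case (Suc m) then show ?case by simp
qed

lemma CH_le:
  fixes f :: "'a::euclidean_space \<Rightarrow> 'b::real_normed_vector"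
  assumes "CH m \<sigma> S f" "0 < \<sigma>" "\<sigma> \<le> 1" "n \<le> m" shows "CH n \<sigma> S f"
  using assms(4,1) by (induction n rule: inc_induct) (auto simp del: CH.simps intro: CH_Suc_imp_CH[OF _ assms(2,3)])

lemma CH_mono:
  fixes f :: "'a::euclidean_space \<Rightarrow> 'b::real_normed_vector"
  assumes "CH m \<sigma> S f" "0 < \<tau>" "\<tau> \<le> \<sigma>" shows "CH m \<tau> S f"
  using assms(1) by (induction m arbitrary: f) (auto intro: lhol_mono[OF _ assms(2,3)])

lemma frechetI: "(f has_derivative D) (at x) \<Longrightarrow> frechet_derivative f (at x) b = D b"
  using frechet_derivative_at by metis

lemma frechetD: "f differentiable (at x) \<Longrightarrow> (f has_derivative frechet_derivative f (at x)) (at x)"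
  by (simp add: frechet_derivative_works[symmetric])

lemma CH_const: "open S \<Longrightarrow> CH m \<sigma> S (\<lambda>x. c)"
proof (induction m arbitrary: c)
  case (Suc m)
  have "frechet_derivative (\<lambda>x. c) (at x) b = 0" for x b :: 'a by (rule frechetI) (rule has_derivative_const)
  then show ?case using Suc by simp
qed (simp add: lhol_const)

lemma CH_SucI:
  fixes f :: "'a::euclidean_space \<Rightarrow> 'b::real_normed_vector"
  assumes "\<And>x. x \<in> S \<Longrightarrow> (f has_derivative D x) (at x)" "\<And>b. b \<in> Basis \<Longrightarrow> CH m \<sigma> S (\<lambda>x. D x b)"
  shows "CH (Suc m) \<sigma> S f"
proof (unfold CH.simps, intro conjI ballI)
  show "f differentiable (at x)" if "x \<in> S" for x using assms(1)[OF that] differentiable_def by blast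
  show "CH m \<sigma> S (\<lambda>x. frechet_derivative f (at x) b)" if "b \<in> Basis" for b
    by (rule CH_cong[OF assms(2)[OF that]]) (simp add: frechetI[OF assms(1)])
qed

lemma CH_add:
  fixes f g :: "'a::euclidean_space \<Rightarrow> 'b::real_normed_vector"
  assumes "CH m \<sigma> S f" "CH m \<sigma> S g" shows "CH m \<sigma> S (\<lambda>x. f x + g x)"
  using assms
proof (induction m arbitrary: f g)
  case 0 then show ?case by (simp add: lhol_add)
next
  case (Suc m)
  show ?case
  proof (rule CH_SucI)
    show "((\<lambda>x. f x + g x) has_derivative (\<lambda>v. frechet_derivative f (at x) v + frechet_derivative g (at x) v)) (at x)" if "x \<in> S" for x
      using Suc(2,3) that by (intro has_derivative_add frechetD) auto
  qed (use Suc in auto)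
qed

lemma CH_linear:
  fixes f :: "'a::euclidean_space \<Rightarrow> 'b::real_normed_vector"
  assumes h: "bounded_linear h" and "CH m \<sigma> S f" shows "CH m \<sigma> S (\<lambda>x. h (f x))"
  using assms(2)
proof (induction m arbitrary: f)
  case 0 then show ?case by (simp add: lhol_linear[OF h])
next
  case (Suc m)
  show ?case
  proof (rule CH_SucI)
    show "((\<lambda>x. h (f x)) has_derivative (\<lambda>v. h (frechet_derivative f (at x) v))) (at x)" if "x \<in> S" for x
      using Suc(2) that by (intro bounded_linear.has_derivative[OF h] frechetD) auto
  qed (use Suc in auto)
qed

lemma CH_bilinear:
  fixes f :: "'a::euclidean_space \<Rightarrow> 'b::real_normed_vector" and g :: "'a \<Rightarrow> 'c::real_normed_vector"
  assumes h: "bounded_bilinear h" and \<sigma>: "0 < \<sigma>" "\<sigma> \<le> 1" and "CH m \<sigma> S f" "CH m \<sigma> S g"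
  shows "CH m \<sigma> S (\<lambda>x. h (f x) (g x))"
  using assms(4,5)
proof (induction m arbitrary: f g)
  case 0 then show ?case by (simp add: lhol_bilinear[OF h _ _ \<sigma>(1)])
next
  case (Suc m)
  note 1 = CH_Suc_imp_CH[OF Suc(2) \<sigma>] CH_Suc_imp_CH[OF Suc(3) \<sigma>]
  show ?case
  proof (rule CH_SucI)
    show "((\<lambda>x. h (f x) (g x)) has_derivative (\<lambda>v. h (f x) (frechet_derivative g (at x) v) + h (frechet_derivative f (at x) v) (g x))) (at x)" if "x \<in> S" for x
      using Suc(2,3) that by (intro bounded_bilinear.FDERIV[OF h] frechetD) auto
    show "CH m \<sigma> S (\<lambda>x. h (f x) (frechet_derivative g (at x) b) + h (frechet_derivative f (at x) b) (g x))" if "b \<in> Basis" for b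
      using Suc(2,3) that by (intro CH_add Suc(1) 1) auto
  qed
qed

lemma CH_sum:
  fixes f :: "'i \<Rightarrow> 'a::euclidean_space \<Rightarrow> 'b::real_normed_vector"
  assumes "open S" "finite I" "\<And>i. i \<in> I \<Longrightarrow> CH m \<sigma> S (f i)" shows "CH m \<sigma> S (\<lambda>x. \<Sum>i\<in>I. f i x)"
  using assms(2,3) by (induction I) (auto intro: CH_add CH_const[OF assms(1)])

lemma lhol_compose:
  fixes F :: "'c::euclidean_space \<Rightarrow> 'd::real_normed_vector" and Y :: "'a::euclidean_space \<Rightarrow> 'c"
  assumes F: "lhol 1 UNIV F" and Y: "lhol \<sigma> S Y" and \<sigma>: "0 < \<sigma>"
  shows "lhol \<sigma> S (\<lambda>x. F (Y x))"
  unfolding lhol_def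
proof
  fix x assume x: "x \<in> S"
  obtain C r where 1: "r > 0" "r \<le> 1" "C \<ge> 0" "ball (Y x) r \<subseteq> UNIV"
    "\<And>y z. y \<in> ball (Y x) r \<Longrightarrow> z \<in> ball (Y x) r \<Longrightarrow> norm (F y - F z) \<le> C * norm (y - z) powr 1"
    by (rule lhol_radius[OF F UNIV_I[of "Y x"]]) (rule that)
  obtain C' r' where 2: "r' > 0" "r' \<le> 1" "C' \<ge> 0" "ball x r' \<subseteq> S"
    "\<And>y z. y \<in> ball x r' \<Longrightarrow> z \<in> ball x r' \<Longrightarrow> norm (Y y - Y z) \<le> C' * norm (y - z) powr \<sigma>"
    by (rule lhol_radius[OF Y x]) (rule that)
  have "continuous (at x) Y" using lhol_continuous[OF Y \<sigma>] lhol_open[OF Y] x by (simp add: continuous_on_eq_continuous_at)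
  then obtain d where d: "d > 0" "\<And>y. dist y x < d \<Longrightarrow> dist (Y y) (Y x) < r"
    unfolding continuous_at_eps_delta using 1(1) by (metis dist_norm)
  have "norm (F (Y y) - F (Y z)) \<le> (C * C') * norm (y - z) powr \<sigma>" if "y \<in> ball x (min r' d)" "z \<in> ball x (min r' d)" for y z
  proof -
    have "norm (F (Y y) - F (Y z)) \<le> C * norm (Y y - Y z) powr 1"
      using that d(2)[of y] d(2)[of z] by (intro 1(5)) (auto simp: dist_commute)
    also have "\<dots> \<le> C * (C' * norm (y - z) powr \<sigma>)" using that 2(5)[of y z] 1(3) by (intro mult_left_mono) auto
    finally show ?thesis by (simp add: mult.assoc)
  qed
  moreover have "ball x (min r' d) \<subseteq> S" using 2(4) by auto
  moreover have "min r' d > 0" "C * C' \<ge> 0" using 1 2 d by auto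
  ultimately show "\<exists>r>0. \<exists>C\<ge>0. ball x r \<subseteq> S \<and>
    (\<forall>y\<in>ball x r. \<forall>z\<in>ball x r. norm (F (Y y) - F (Y z)) \<le> C * norm (y - z) powr \<sigma>)" by blast
qed

text \<open>The outer function has exponent 1, since exponents multiply under composition. The chain
  rule is written in a basis, so that the induction hypothesis applies to each partial derivative of
  \<open>F\<close> and the product rule to each summand.\<close>

lemma CH_compose:
  fixes F :: "'c::euclidean_space \<Rightarrow> 'd::real_normed_vector" and Y :: "'a::euclidean_space \<Rightarrow> 'c"
  assumes \<sigma>: "0 < \<sigma>" "\<sigma> \<le> 1" and "CH m 1 UNIV F" "CH m \<sigma> S Y"
  shows "CH m \<sigma> S (\<lambda>x. F (Y x))"
  using assms(3,4)
proof (induction m arbitrary: F)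
  case 0 then show ?case by (simp add: lhol_compose[OF _ _ \<sigma>(1)])
next
  case (Suc m)
  have Y: "CH m \<sigma> S Y" by (rule CH_Suc_imp_CH[OF Suc(3) \<sigma>])
  have S: "open S" by (rule CH_open[OF Y])
  show ?case
  proof (rule CH_SucI)
    fix x assume "x \<in> S"
    have F: "(F has_derivative frechet_derivative F (at y)) (at y)" for y using Suc(2) by (intro frechetD) simp
    have Y: "(Y has_derivative frechet_derivative Y (at x)) (at x)" using Suc(3) \<open>x \<in> S\<close> by (intro frechetD) simp
    have comp: "((\<lambda>x. F (Y x)) has_derivative (\<lambda>v. frechet_derivative F (at (Y x)) (frechet_derivative Y (at x) v))) (at x)"
      by (rule has_derivative_compose[OF Y F])
    have eq: "frechet_derivative F (at (Y x)) w = (\<Sum>b\<in>Basis. (w \<bullet> b) *\<^sub>R frechet_derivative F (at (Y x)) b)" for w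
      using linear_sum[OF has_derivative_linear[OF F], of _ "\<lambda>b. (w \<bullet> b) *\<^sub>R b" Basis]
        linear_cmul[OF has_derivative_linear[OF F]] by (simp add: euclidean_representation)
    show "((\<lambda>x. F (Y x)) has_derivative (\<lambda>v. \<Sum>b\<in>Basis. (frechet_derivative Y (at x) v \<bullet> b) *\<^sub>R frechet_derivative F (at (Y x)) b)) (at x)"
      by (rule has_derivative_eq_rhs[OF comp]) (rule ext, rule eq)
  next
    fix e :: 'a assume e: "e \<in> Basis"
    show "CH m \<sigma> S (\<lambda>x. \<Sum>b\<in>Basis. (frechet_derivative Y (at x) e \<bullet> b) *\<^sub>R frechet_derivative F (at (Y x)) b)"
    proof (intro CH_sum S CH_bilinear[OF bounded_bilinear_scaleR \<sigma>] finite_Basis)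
      fix b :: 'c assume b: "b \<in> Basis"
      show "CH m \<sigma> S (\<lambda>x. frechet_derivative Y (at x) e \<bullet> b)"
        using Suc(3) e by (intro CH_linear[OF bounded_linear_inner_left]) simp
      show "CH m \<sigma> S (\<lambda>x. frechet_derivative F (at (Y x)) b)"
        using Suc(2) b by (intro Suc(1)[of "\<lambda>y. frechet_derivative F (at y) b"] Y) simp
    qed
  qed
qed

section \<open>Hoelder continuity of the gradient\<close>

definition grad :: "(real^2 \<Rightarrow> 'b::euclidean_space) \<Rightarrow> real^2 \<Rightarrow> 'b \<times> 'b" where
  "grad Z x = (frechet_derivative Z (at x) e1, frechet_derivative Z (at x) e2)"

lemma Basis_real2: "(Basis :: (real^2) set) = {e1, e2}"
  by (auto simp: Basis_vec_def UNIV_2)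

lemma e_Basis [simp]: "e1 \<in> Basis" "e2 \<in> Basis"
  by (auto simp: Basis_real2)

lemma has_derivative_grad: "Z differentiable (at x) \<Longrightarrow> (Z has_derivative dmap (grad Z x)) (at x)"
  using linear_eq_dmap[OF has_derivative_linear[OF frechetD]] frechetD by (metis grad_def)

lemma grad_eq: "(Z has_derivative dmap z) (at x) \<Longrightarrow> grad Z x = z"
  by (simp add: grad_def frechetI[where D="dmap z"])

lemma dmap_grad: "Z differentiable (at x) \<Longrightarrow> dmap (grad Z x) b = frechet_derivative Z (at x) b"
  using frechetI[OF has_derivative_grad] by metis

lemma CH_Pair:
  fixes f :: "'a::euclidean_space \<Rightarrow> 'b::real_normed_vector" and g :: "'a \<Rightarrow> 'c::real_normed_vector"
  assumes "CH m \<sigma> S f" "CH m \<sigma> S g" shows "CH m \<sigma> S (\<lambda>x. (f x, g x))"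
proof -
  have "bounded_linear (\<lambda>a::'b. (a, 0::'c))" "bounded_linear (\<lambda>b::'c. (0::'b, b))"
    by (auto intro!: bounded_linear_Pair bounded_linear_ident bounded_linear_zero)
  from CH_add[OF CH_linear[OF this(1) assms(1)] CH_linear[OF this(2) assms(2)]] show ?thesis by simp
qed

lemma CH_Suc_grad:
  "CH (Suc m) \<sigma> S Z \<longleftrightarrow> (\<forall>x\<in>S. Z differentiable (at x)) \<and> CH m \<sigma> S (grad Z)"
proof
  assume "CH (Suc m) \<sigma> S Z"
  then show "(\<forall>x\<in>S. Z differentiable (at x)) \<and> CH m \<sigma> S (grad Z)"
    unfolding grad_def[abs_def] by (auto intro!: CH_Pair)
next
  assume *: "(\<forall>x\<in>S. Z differentiable (at x)) \<and> CH m \<sigma> S (grad Z)"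
  have "CH m \<sigma> S (\<lambda>x. fst (grad Z x))" "CH m \<sigma> S (\<lambda>x. snd (grad Z x))"
    using * by (auto intro: CH_linear[OF bounded_linear_fst] CH_linear[OF bounded_linear_snd])
  then show "CH (Suc m) \<sigma> S Z" using * by (simp add: Basis_real2 grad_def)
qed

lemma Sq_in_open:
  assumes "open S" "x \<in> S"
  obtains r where "r > 0" "r \<le> 1" "Sq x r \<subseteq> S"
proof -
  obtain d where d: "d > 0" "ball x d \<subseteq> S" using assms by (meson open_contains_ball)
  have "Sq x (min 1 (d / 4)) \<subseteq> S"
  proof
    fix y assume "y \<in> Sq x (min 1 (d / 4))"
    from norm_le_Sq[OF this] have "norm (y - x) < d" using d(1) by linarith
    then show "y \<in> S" using d(2) by (auto simp: dist_norm norm_minus_commute)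
  qed
  then show ?thesis using d by (intro that[of "min 1 (d / 4)"]) auto
qed

lemma ball_Sq: "ball x r \<subseteq> Sq x r"
  by (intro subsetI mem_Sq_norm) (simp add: dist_norm norm_minus_commute)

lemma interior_Sq: "x \<in> Sq x0 r \<Longrightarrow> r < s \<Longrightarrow> x \<in> interior (Sq x0 s)"
proof (rule interiorI)
  assume x: "x \<in> Sq x0 r" "r < s"
  show "ball x (s - r) \<subseteq> Sq x0 s"
    by (rule order.trans[OF ball_Sq Sq_subset[OF x(1)]]) simp
qed auto

section \<open>Mean value estimates for difference quotients\<close>

lemma dq_mean_value:
  fixes F :: "'a::euclidean_space \<Rightarrow> 'b::euclidean_space"
  assumes h: "h > 0" and d: "\<And>\<tau>. 0 \<le> \<tau> \<Longrightarrow> \<tau> \<le> h \<Longrightarrow> (f has_derivative (\<lambda>t. t *\<^sub>R f' \<tau>)) (at \<tau>)"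
    and b: "\<And>\<tau>. 0 \<le> \<tau> \<Longrightarrow> \<tau> \<le> h \<Longrightarrow> norm (f' \<tau> :: 'b) \<le> K"
  shows "norm ((1 / h) *\<^sub>R (f h - f (0::real))) \<le> K"
proof -
  have "norm (f h - f 0) \<le> K * norm (h - 0)"
  proof (rule differentiable_bound[of "{0..h}" f "\<lambda>\<tau> t. t *\<^sub>R f' \<tau>"])
    fix \<tau> assume \<tau>: "\<tau> \<in> {0..h}"
    show "(f has_derivative (\<lambda>t. t *\<^sub>R f' \<tau>)) (at \<tau> within {0..h})" using d[of \<tau>] \<tau> by (auto intro: has_derivative_at_withinI)
    show "onorm (\<lambda>t. t *\<^sub>R f' \<tau>) \<le> K" using b[of \<tau>] \<tau>
      by (intro onorm_le) (simp add: mult.commute[of K] mult_left_mono)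
  qed (use h in auto)
  then have "norm (f h - f 0) / h \<le> K" using h by (simp add: pos_divide_le_eq)
  then show ?thesis using h by simp
qed

lemma has_derivative_line:
  assumes "(F has_derivative D) (at (x + \<tau> *\<^sub>R e))"
  shows "((\<lambda>\<tau>. F (x + \<tau> *\<^sub>R e)) has_derivative (\<lambda>t. t *\<^sub>R D e)) (at \<tau>)"
proof -
  have "((\<lambda>\<tau>. x + \<tau> *\<^sub>R e) has_derivative (\<lambda>t. t *\<^sub>R e)) (at \<tau>)" by (auto intro!: derivative_eq_intros)
  from has_derivative_compose[OF this assms] have "((\<lambda>\<tau>. F (x + \<tau> *\<^sub>R e)) has_derivative (\<lambda>t. D (t *\<^sub>R e))) (at \<tau>)" .
  moreover have "D (t *\<^sub>R e) = t *\<^sub>R D e" for t using linear_cmul[OF has_derivative_linear[OF assms]] by simp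
  ultimately show ?thesis by simp
qed

lemma dq_est:
  fixes F :: "'a::euclidean_space \<Rightarrow> 'b::euclidean_space"
  assumes h: "h > 0" and S: "\<And>\<tau>. 0 \<le> \<tau> \<Longrightarrow> \<tau> \<le> h \<Longrightarrow> (F has_derivative D (x + \<tau> *\<^sub>R e)) (at (x + \<tau> *\<^sub>R e))"
    and b: "\<And>\<tau>. 0 \<le> \<tau> \<Longrightarrow> \<tau> \<le> h \<Longrightarrow> norm (D (x + \<tau> *\<^sub>R e) e - v) \<le> K"
  shows "norm ((1 / h) *\<^sub>R (F (x + h *\<^sub>R e) - F x) - v) \<le> K"
proof -
  have "norm ((1 / h) *\<^sub>R ((F (x + h *\<^sub>R e) - h *\<^sub>R v) - (F (x + 0 *\<^sub>R e) - 0 *\<^sub>R v))) \<le> K"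
  proof (rule dq_mean_value[OF h _ b])
    show "((\<lambda>\<tau>. F (x + \<tau> *\<^sub>R e) - \<tau> *\<^sub>R v) has_derivative (\<lambda>t. t *\<^sub>R (D (x + \<tau> *\<^sub>R e) e - v))) (at \<tau>)"
      if "0 \<le> \<tau>" "\<tau> \<le> h" for \<tau>
      using has_derivative_line[OF S[OF that]] unfolding scaleR_diff_right
      by (intro has_derivative_diff) (auto intro!: derivative_eq_intros)
  qed
  moreover have "(1 / h) *\<^sub>R ((F (x + h *\<^sub>R e) - h *\<^sub>R v) - (F (x + 0 *\<^sub>R e) - 0 *\<^sub>R v)) = (1 / h) *\<^sub>R (F (x + h *\<^sub>R e) - F x) - v"
    using h by (simp add: algebra_simps)
  ultimately show ?thesis by (simp only:)
qed

text \<open>The mean value inequality is applied to F(y + \<tau> e) - F(x + \<tau> e), so that the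
  modulus of continuity of the derivative enters and not its size; the bound is uniform in
  h.\<close>

lemma dq_diff_est:
  fixes F :: "'a::euclidean_space \<Rightarrow> 'b::euclidean_space"
  assumes h: "h > 0"
    and S: "\<And>\<tau>. 0 \<le> \<tau> \<Longrightarrow> \<tau> \<le> h \<Longrightarrow> (F has_derivative D (x + \<tau> *\<^sub>R e)) (at (x + \<tau> *\<^sub>R e))"
      "\<And>\<tau>. 0 \<le> \<tau> \<Longrightarrow> \<tau> \<le> h \<Longrightarrow> (F has_derivative D (y + \<tau> *\<^sub>R e)) (at (y + \<tau> *\<^sub>R e))"
    and b: "\<And>\<tau>. 0 \<le> \<tau> \<Longrightarrow> \<tau> \<le> h \<Longrightarrow> norm (D (y + \<tau> *\<^sub>R e) e - D (x + \<tau> *\<^sub>R e) e) \<le> K"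
  shows "norm ((1 / h) *\<^sub>R (F (y + h *\<^sub>R e) - F y) - (1 / h) *\<^sub>R (F (x + h *\<^sub>R e) - F x)) \<le> K"
proof -
  have "norm ((1 / h) *\<^sub>R ((F (y + h *\<^sub>R e) - F (x + h *\<^sub>R e)) - (F (y + 0 *\<^sub>R e) - F (x + 0 *\<^sub>R e)))) \<le> K"
  proof (rule dq_mean_value[OF h _ b])
    show "((\<lambda>\<tau>. F (y + \<tau> *\<^sub>R e) - F (x + \<tau> *\<^sub>R e)) has_derivative (\<lambda>t. t *\<^sub>R (D (y + \<tau> *\<^sub>R e) e - D (x + \<tau> *\<^sub>R e) e))) (at \<tau>)"
      if "0 \<le> \<tau>" "\<tau> \<le> h" for \<tau>
      unfolding scaleR_diff_right by (intro has_derivative_diff has_derivative_line S that)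
  qed
  then show ?thesis by (simp add: algebra_simps)
qed

lemma norm_dmap_pair_le:
  assumes "norm (dmap v e1) \<le> a" "norm (dmap v e2) \<le> a" shows "norm v \<le> 2 * a"
proof -
  have "norm v \<le> norm (fst v) + norm (snd v)" by (cases v) (simp add: norm_Pair_le)
  then show ?thesis using assms by simp
qed

text \<open>Transfers the estimates, which are uniform in \<open>h\<close>, from difference quotients to the derivative.\<close>

lemma C1_holder_uniform_limit:
  fixes f :: "nat \<Rightarrow> real^2 \<Rightarrow> 'b::euclidean_space"
  assumes r: "r > 0" and \<mu>: "\<mu> > 0" and C: "C \<ge> 0"
    and d: "\<And>n x. x \<in> Sq x0 r \<Longrightarrow> (f n has_derivative dmap (g n x)) (at x)"
    and hol: "\<And>n x y. x \<in> Sq x0 r \<Longrightarrow> y \<in> Sq x0 r \<Longrightarrow> norm (g n x - g n y) \<le> C * norm (x - y) powr \<mu>"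
    and unif: "\<And>\<epsilon>. \<epsilon> > 0 \<Longrightarrow> \<exists>M. \<forall>n\<ge>M. \<forall>x\<in>Sq x0 r. norm (f n x - F x) \<le> \<epsilon>"
  shows "\<exists>G. (\<forall>x\<in>Sq x0 (r / 4). (F has_derivative dmap (G x)) (at x)) \<and>
    (\<forall>x\<in>Sq x0 (r / 4). \<forall>y\<in>Sq x0 (r / 4). norm (G x - G y) \<le> C * norm (x - y) powr \<mu>)"
proof -
  let ?S = "Sq x0 (r / 2)"
  \<comment> \<open>Interpolation: a directional derivative of f n - f m is its difference quotient
    with step t, at most 2 \<epsilon> / t, up to the Hoelder remainder 2 C t^\<mu>; passing from
    directions to the pair doubles both terms.\<close>
  have diffbd: "norm (g n x - g m x) \<le> 4 * \<epsilon> / t + 4 * C * t powr \<mu>"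
    if x: "x \<in> ?S" and t: "0 < t" "t \<le> r / 2" and e: "\<And>y. y \<in> Sq x0 r \<Longrightarrow> norm (f n y - f m y) \<le> \<epsilon>" for x t \<epsilon> n m
  proof -
    let ?V = "\<lambda>y. f n y - f m y" and ?v = "\<lambda>y. g n y - g m y"
    have "norm (dmap (?v x) e) \<le> 2 * \<epsilon> / t + 2 * C * t powr \<mu>" if e': "norm e = 1" for e
    proof -
      have inS: "x + \<tau> *\<^sub>R e \<in> Sq x0 r" if "0 \<le> \<tau>" "\<tau> \<le> t" for \<tau>
      proof -
        have "x + \<tau> *\<^sub>R e \<in> Sq x (r / 2)" using that t e' by (intro mem_Sq_norm) simp
        moreover have "Sq x (r / 2) \<subseteq> Sq x0 r" by (rule Sq_subset[OF x]) simp
        ultimately show ?thesis by blast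
      qed
      have x1: "x \<in> Sq x0 r" using inS[of 0] t by simp
      have "norm ((1 / t) *\<^sub>R (?V (x + t *\<^sub>R e) - ?V x) - dmap (?v x) e) \<le> 2 * C * t powr \<mu>"
      proof (rule dq_est[OF t(1)])
        fix \<tau> assume \<tau>: "0 \<le> \<tau>" "\<tau> \<le> t"
        show "(?V has_derivative dmap (?v (x + \<tau> *\<^sub>R e))) (at (x + \<tau> *\<^sub>R e))"
          unfolding dmap_diff[abs_def] by (intro has_derivative_diff d inS \<tau>)
        have "norm (dmap (?v (x + \<tau> *\<^sub>R e)) e - dmap (?v x) e) \<le> norm (?v (x + \<tau> *\<^sub>R e) - ?v x)"
          using norm_dmap_le[of "?v (x + \<tau> *\<^sub>R e) - ?v x" e] e' unfolding dmap_diff[symmetric] by simp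
        also have "\<dots> \<le> norm (g n (x + \<tau> *\<^sub>R e) - g n x) + norm (g m (x + \<tau> *\<^sub>R e) - g m x)"
          using norm_triangle_ineq4[of "g n (x + \<tau> *\<^sub>R e) - g n x" "g m (x + \<tau> *\<^sub>R e) - g m x"] by (simp add: algebra_simps)
        also have "\<dots> \<le> C * norm (x + \<tau> *\<^sub>R e - x) powr \<mu> + C * norm (x + \<tau> *\<^sub>R e - x) powr \<mu>"
          by (intro add_mono hol inS \<tau> x1)
        also have "\<dots> \<le> 2 * C * t powr \<mu>"
        proof -
          have "norm (x + \<tau> *\<^sub>R e - x) = \<tau>" using \<tau> e' by simp
          moreover have "\<tau> powr \<mu> \<le> t powr \<mu>" using \<tau> \<mu> by (intro powr_mono2) auto
          ultimately show ?thesis using mult_left_mono[of "\<tau> powr \<mu>" "t powr \<mu>" "2 * C"] C by simp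
        qed
        finally show "norm (dmap (?v (x + \<tau> *\<^sub>R e)) e - dmap (?v x) e) \<le> 2 * C * t powr \<mu>" .
      qed
      moreover have "norm ((1 / t) *\<^sub>R (?V (x + t *\<^sub>R e) - ?V x)) \<le> 2 * \<epsilon> / t"
      proof -
        have "norm (?V (x + t *\<^sub>R e) - ?V x) \<le> \<epsilon> + \<epsilon>"
          using t by (intro order.trans[OF norm_triangle_ineq4] add_mono e inS x1) auto
        then show ?thesis using t by (simp add: divide_right_mono)
      qed
      ultimately show ?thesis
        using norm_triangle_ineq4[of "(1 / t) *\<^sub>R (?V (x + t *\<^sub>R e) - ?V x)" "(1 / t) *\<^sub>R (?V (x + t *\<^sub>R e) - ?V x) - dmap (?v x) e"]
        by simp
    qed
    note * = this
    have "norm (?v x) \<le> 2 * (2 * \<epsilon> / t + 2 * C * t powr \<mu>)"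
      by (intro norm_dmap_pair_le *) (simp_all only: norm_axis_1)
    then show ?thesis by (simp add: algebra_simps)
  qed
  have "uniformly_Cauchy_on ?S g"
    unfolding uniformly_Cauchy_on_def
  proof (intro allI impI)
    fix \<eta> :: real assume "\<eta> > 0"
    have "((\<lambda>t. 4 * C * t powr \<mu>) \<longlongrightarrow> 4 * C * 0) (at_right 0)"
      by (intro tendsto_intros tendsto_zero_powrI[where b=\<mu>] \<mu>) (auto simp: eventually_at_right_less intro: eventually_at_rightI[of 0 1])
    then have "\<forall>\<^sub>F t in at_right 0. 4 * C * t powr \<mu> < \<eta> / 4"
      using \<open>\<eta> > 0\<close> by (auto dest: order_tendstoD(2)[of _ _ _ "\<eta> / 4"])
    then obtain b where b: "b > 0" "\<And>t. 0 < t \<Longrightarrow> t < b \<Longrightarrow> 4 * C * t powr \<mu> < \<eta> / 4"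
      unfolding eventually_at_right_field by auto
    \<comment> \<open>The step t is fixed first, to make the Hoelder remainder small; afterwards
      \<epsilon> = t \<eta> / 32 makes the remaining term 8 \<epsilon> / t equal to \<eta> /
      4.\<close>
    define t where "t = min (b / 2) (r / 2)"
    have t: "0 < t" "t \<le> r / 2" "t < b" using b r by (auto simp: t_def)
    define \<epsilon> where "\<epsilon> = t * \<eta> / 32"
    have "\<epsilon> > 0" using t \<open>\<eta> > 0\<close> by (simp add: \<epsilon>_def)
    then obtain M where M: "\<And>n x. n \<ge> M \<Longrightarrow> x \<in> Sq x0 r \<Longrightarrow> norm (f n x - F x) \<le> \<epsilon>" using unif by blast
    have "dist (g m x) (g n x) < \<eta>" if "x \<in> ?S" "m \<ge> M" "n \<ge> M" for x m n
    proof -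
      have "norm (g m x - g n x) \<le> 4 * (2 * \<epsilon>) / t + 4 * C * t powr \<mu>"
      proof (rule diffbd[OF that(1) t(1,2)])
        fix y assume "y \<in> Sq x0 r"
        then show "norm (f m y - f n y) \<le> 2 * \<epsilon>"
          using M[OF that(2)] M[OF that(3)] norm_triangle_ineq4[of "f m y - F y" "f n y - F y"] by fastforce
      qed
      also have "\<dots> < \<eta>" using b(2)[OF t(1,3)] t(1) \<open>\<eta> > 0\<close> by (simp add: \<epsilon>_def)
      finally show ?thesis by (simp add: dist_norm)
    qed
    then show "\<exists>M. \<forall>x\<in>?S. \<forall>m\<ge>M. \<forall>n\<ge>M. dist (g m x) (g n x) < \<eta>" by blast
  qed
  then have "uniformly_convergent_on ?S g" by (rule Cauchy_uniformly_convergent)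
  then obtain G where G: "uniform_limit ?S g G sequentially" unfolding uniformly_convergent_on_def by blast
  have Glim: "(\<lambda>n. g n x) \<longlonglongrightarrow> G x" if "x \<in> ?S" for x using tendsto_uniform_limitI[OF G that] .
  have fF: "(\<lambda>n. f n x) \<longlonglongrightarrow> F x" if "x \<in> Sq x0 r" for x
  proof (rule metric_LIMSEQ_I)
    fix \<epsilon> :: real assume "\<epsilon> > 0"
    then obtain M where "\<forall>n\<ge>M. \<forall>x\<in>Sq x0 r. norm (f n x - F x) \<le> \<epsilon> / 2" using unif[of "\<epsilon> / 2"] by auto
    then show "\<exists>M. \<forall>n\<ge>M. dist (f n x) (F x) < \<epsilon>" using that \<open>\<epsilon> > 0\<close> by (intro exI[of _ M]) (force simp: dist_norm)
  qed
  have sub: "?S \<subseteq> Sq x0 r" using r by (intro Sq_mono) simp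
  have "\<exists>k. \<forall>x\<in>?S. (\<lambda>n. f n x) \<longlonglongrightarrow> k x \<and> (k has_derivative dmap (G x)) (at x within ?S)"
  proof (rule has_derivative_sequence[OF convex_Sq])
    show "(f n has_derivative dmap (g n x)) (at x within ?S)" if "x \<in> ?S" for n x
      using d that sub by (blast intro: has_derivative_at_withinI)
    show "\<forall>\<^sub>F n in sequentially. \<forall>x\<in>?S. \<forall>h. norm (dmap (g n x) h - dmap (G x) h) \<le> e * norm h" if "e > 0" for e
      using uniform_limitD[OF G that]
    proof eventually_elim
      case (elim n)
      show ?case
      proof (intro ballI allI)
        fix x h assume "x \<in> ?S"
        then have "norm (g n x - G x) \<le> e" using elim by (force simp: dist_norm)
        then show "norm (dmap (g n x) h - dmap (G x) h) \<le> e * norm h"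
          unfolding dmap_diff[symmetric] using norm_dmap_le[of "g n x - G x" h]
          by (metis mult.commute mult_left_mono norm_ge_zero order.trans)
      qed
    qed
    show "x0 \<in> ?S" using r by simp
    show "(\<lambda>n. f n x0) \<longlonglongrightarrow> F x0" using r by (intro fF) simp
  qed
  then obtain k where k: "\<And>x. x \<in> ?S \<Longrightarrow> (\<lambda>n. f n x) \<longlonglongrightarrow> k x"
    "\<And>x. x \<in> ?S \<Longrightarrow> (k has_derivative dmap (G x)) (at x within ?S)" by blast
  have kF: "k x = F x" if "x \<in> ?S" for x
    using k(1)[OF that] fF[OF subsetD[OF sub that]] by (rule LIMSEQ_unique)
  show ?thesis
  proof (intro exI[of _ G] conjI ballI)
    fix x assume x: "x \<in> Sq x0 (r / 4)"
    have x': "x \<in> ?S" using x Sq_mono[of "r / 4" "r / 2" x0] r by auto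
    have "(F has_derivative dmap (G x)) (at x within ?S)"
      using k(2)[OF x'] by (rule has_derivative_transform[rotated 2]) (use kF x' in auto)
    moreover have "x \<in> interior ?S" using r by (intro interior_Sq[OF x]) simp
    ultimately show "(F has_derivative dmap (G x)) (at x)" by (simp only: at_within_interior)
    fix y assume y: "y \<in> Sq x0 (r / 4)"
    have y': "y \<in> ?S" using y Sq_mono[of "r / 4" "r / 2" x0] r by auto
    show "norm (G x - G y) \<le> C * norm (x - y) powr \<mu>"
    proof (rule LIMSEQ_le_const2)
      show "(\<lambda>n. norm (g n x - g n y)) \<longlonglongrightarrow> norm (G x - G y)"
        by (intro tendsto_intros Glim x' y')
      show "\<exists>N. \<forall>n\<ge>N. norm (g n x - g n y) \<le> C * norm (x - y) powr \<mu>"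
        using hol[OF subsetD[OF sub x'] subsetD[OF sub y']] by blast
    qed
  qed
qed

lemma CH1_local:
  assumes S: "open S" and \<mu>: "\<mu> > 0"
    and *: "\<And>x0. x0 \<in> S \<Longrightarrow> \<exists>r>0. \<exists>C\<ge>0. \<exists>G. (\<forall>x\<in>Sq x0 r. (F has_derivative dmap (G x)) (at x)) \<and>
      (\<forall>x\<in>Sq x0 r. \<forall>y\<in>Sq x0 r. norm (G x - G y) \<le> C * norm (x - y) powr \<mu>)"
  shows "CH (Suc 0) \<mu> S F"
  unfolding CH_Suc_grad CH.simps
proof
  show "\<forall>x\<in>S. F differentiable (at x)"
  proof
    fix x assume "x \<in> S"
    from *[OF this] obtain r G where "r > 0" "\<forall>y\<in>Sq x r. (F has_derivative dmap (G y)) (at y)" by blast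
    then show "F differentiable (at x)" by (meson center_Sq differentiable_def less_imp_le)
  qed
  show "lhol \<mu> S (grad F)" unfolding lhol_def
  proof
    fix x assume x: "x \<in> S"
    from *[OF this] obtain r C G where G: "r > 0" "C \<ge> 0" "\<forall>y\<in>Sq x r. (F has_derivative dmap (G y)) (at y)"
      "\<forall>y\<in>Sq x r. \<forall>z\<in>Sq x r. norm (G y - G z) \<le> C * norm (y - z) powr \<mu>" by blast
    obtain d where d: "d > 0" "ball x d \<subseteq> S" using S x by (meson open_contains_ball)
    have "grad F y = G y" if "y \<in> Sq x r" for y using G(3) that by (intro grad_eq) blast
    moreover have "ball x (min r d) \<subseteq> Sq x r" using ball_Sq[of x r] by auto
    ultimately show "\<exists>r>0. \<exists>C\<ge>0. ball x r \<subseteq> S \<and>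
        (\<forall>y\<in>ball x r. \<forall>z\<in>ball x r. norm (grad F y - grad F z) \<le> C * norm (y - z) powr \<mu>)"
      using G d by (intro exI[of _ "min r d"] exI[of _ C] conjI) (auto simp: subset_eq)
  qed
qed

text \<open>Absorbing perturbations through \<open>Q_perturb\<close> costs half of the coercivity;
  the interior estimate is then that of the same form with c / 2.\<close>

lemma null_form_half: assumes "null_form B c" shows "null_form B (c / 2)"
proof -
  interpret null_form B c by fact
  have "c / 2 > 0" using c_pos by simp
  with bil anti show ?thesis by (rule null_form.intro)
qed

text \<open>The interior estimate is available for the exponents 2 / (2 N + 1) only, but lowering a
  Hoelder exponent is free.\<close>

lemma small_powr_index:
  assumes "0 < \<sigma>" shows "\<exists>N::nat. N \<ge> 1 \<and> 2 / (2 * real N + 1) \<le> \<sigma>"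
proof -
  obtain N :: nat where N: "real N > 2 / \<sigma>" using reals_Archimedean2 by blast
  have "N \<ge> 1" using N assms by (cases N) (auto simp: divide_simps)
  moreover have "2 / (2 * real N + 1) \<le> \<sigma>"
  proof -
    have "2 < real N * \<sigma>" using N assms by (simp add: pos_divide_less_eq)
    also have "\<dots> \<le> (2 * real N + 1) * \<sigma>" using assms by (intro mult_right_mono) auto
    finally show ?thesis by (simp add: pos_divide_le_eq mult.commute)
  qed
  ultimately show ?thesis by blast
qed

context null_form
begin

lemma Q_abs: "\<bar>Q z\<bar> \<le> \<beta> * (norm z)\<^sup>2"
proof -
  have n: "norm (fst z) \<le> norm z" "norm (snd z) \<le> norm z"
    by (metis norm_fst_le prod.collapse) (metis norm_snd_le prod.collapse)
  have "\<bar>Q z\<bar> \<le> \<beta> * norm (fst z) * norm (snd z)" unfolding Q_def by (rule beta(2))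
  also have "\<dots> \<le> \<beta> * norm z * norm z" using beta(1) n by (intro mult_mono) auto
  finally show ?thesis by (simp add: power2_eq_square)
qed

lemma Q_add_ge: "Q (a + e) \<ge> Q a - 2 * \<beta> * norm a * norm e - \<beta> * (norm e)\<^sup>2"
proof -
  have n: "norm (fst z) \<le> norm z" "norm (snd z) \<le> norm z" for z :: "'b \<times> 'b"
    by (metis norm_fst_le prod.collapse) (metis norm_snd_le prod.collapse)
  have "\<bar>B (fst a) (snd e)\<bar> \<le> \<beta> * norm a * norm e" "\<bar>B (fst e) (snd a)\<bar> \<le> \<beta> * norm e * norm a"
    using beta(1) n(1)[of a] n(2)[of a] n(1)[of e] n(2)[of e] by (auto intro!: order.trans[OF beta(2)] mult_mono)
  moreover have "Q (a + e) = Q a + B (fst a) (snd e) + B (fst e) (snd a) + Q e"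
    by (simp add: Q_def B.add_left B.add_right)
  ultimately show ?thesis using Q_abs[of e] by (simp add: mult_ac) 
qed

text \<open>The perturbation may contain a small multiple of the whole vector a + e, the very
  quantity to be estimated; such a term arises when a nonlinear inclusion is linearised. The
  remaining part k goes quadratically into the error.\<close>

lemma Q_perturb:
  "\<exists>\<epsilon>>0. \<exists>K'\<ge>0. \<forall>a e k. k \<ge> 0 \<and> Q a \<ge> c * (norm a)\<^sup>2 \<and> norm e \<le> \<epsilon> * norm (a + e) + k \<longrightarrow>
    Q (a + e) \<ge> c / 2 * (norm (a + e))\<^sup>2 - K' * k\<^sup>2"
proof -
  \<comment> \<open>\<open>m\<close> is the coefficient of the mixed term 2 s t. The terms with
    \<epsilon> s^2 add up to 8 m \<epsilon> s^2, which 32 m \<epsilon> <= c turns into a quarter of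
    c s^2; Young's inequality for s k spends another quarter.\<close>
  define m where "m = c + \<beta>"
  have m: "m > 0" using c_pos beta(1) by (simp add: m_def)
  define \<epsilon> where "\<epsilon> = min 1 (c / (32 * m))"
  have e: "\<epsilon> > 0" "\<epsilon> \<le> 1" "32 * m * \<epsilon> \<le> c"
  proof -
    have "m * \<epsilon> \<le> m * (c / (32 * m))" using m by (intro mult_left_mono) (auto simp: \<epsilon>_def)
    then show "32 * m * \<epsilon> \<le> c" using m by simp
  qed (use m c_pos in \<open>auto simp: \<epsilon>_def\<close>)
  define K' where "K' = 4 * m\<^sup>2 / c + 6 * m"
  show ?thesis
  proof (rule exI[of _ \<epsilon>], rule conjI, rule e, rule exI[of _ K'], intro conjI allI impI)
    show "K' \<ge> 0" using m c_pos by (simp add: K'_def)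
    fix a e' k assume *: "k \<ge> 0 \<and> Q a \<ge> c * (norm a)\<^sup>2 \<and> norm e' \<le> \<epsilon> * norm (a + e') + k"
    define s where "s = norm (a + e')"
    define t where "t = norm e'"
    have s0: "s \<ge> 0" "t \<ge> 0" by (auto simp: s_def t_def)
    have t: "t \<le> \<epsilon> * s + k" using * by (simp add: s_def t_def)
    have a1: "norm a \<le> s + t" using norm_triangle_ineq4[of "a + e'" e'] by (simp add: s_def t_def)
    have a2: "s \<le> norm a + t" using norm_triangle_ineq[of a e'] by (simp add: s_def t_def)
    have "(norm a)\<^sup>2 \<ge> s\<^sup>2 - 2 * s * t"
    proof (cases "s \<ge> t")
      case True
      then have "(s - t)\<^sup>2 \<le> (norm a)\<^sup>2" using a2 by (intro power_mono) auto
      then have "s\<^sup>2 + t\<^sup>2 - 2 * s * t \<le> (norm a)\<^sup>2" by (simp add: power2_diff)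
      then show ?thesis using zero_le_power2[of t] by linarith
    next
      case False
      then have "s\<^sup>2 \<le> s * t" using s0 by (simp add: power2_eq_square mult_left_mono)
      then show ?thesis using mult_nonneg_nonneg[OF s0] zero_le_power2[of "norm a"] by linarith
    qed
    then have "c * (norm a)\<^sup>2 \<ge> c * (s\<^sup>2 - 2 * s * t)" using c_pos by (intro mult_left_mono) auto
    moreover have "2 * \<beta> * norm a * t \<le> 2 * \<beta> * (s + t) * t"
      using a1 beta(1) s0 by (intro mult_right_mono mult_left_mono) auto
    moreover have "Q (a + e') \<ge> Q a - 2 * \<beta> * norm a * t - \<beta> * t\<^sup>2"
      unfolding t_def by (rule Q_add_ge)
    ultimately have "Q (a + e') \<ge> c * (s\<^sup>2 - 2 * s * t) - 2 * \<beta> * (s + t) * t - \<beta> * t\<^sup>2"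
      using * by linarith
    also have "c * (s\<^sup>2 - 2 * s * t) - 2 * \<beta> * (s + t) * t - \<beta> * t\<^sup>2 = c * s\<^sup>2 - 2 * m * s * t - 3 * \<beta> * t\<^sup>2"
      by (simp add: m_def power2_eq_square algebra_simps)
    finally have 1: "Q (a + e') \<ge> c * s\<^sup>2 - 2 * m * s * t - 3 * \<beta> * t\<^sup>2" .
    have t2: "t\<^sup>2 \<le> 2 * \<epsilon> * s\<^sup>2 + 2 * k\<^sup>2"
    proof -
      have "t\<^sup>2 \<le> (\<epsilon> * s + k)\<^sup>2" using t s0 by (intro power_mono) auto
      also have "\<dots> \<le> 2 * (\<epsilon> * s)\<^sup>2 + 2 * k\<^sup>2"
        using sum_squares_bound[of "\<epsilon> * s" k] by (simp add: power2_sum)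
      also have "(\<epsilon> * s)\<^sup>2 \<le> \<epsilon> * s\<^sup>2"
        using e s0 by (simp add: power2_eq_square mult_left_le_one_le mult_left_mono mult.assoc)
      finally show ?thesis by simp
    qed
    have st: "2 * m * s * t \<le> 2 * m * \<epsilon> * s\<^sup>2 + (c / 4 * s\<^sup>2 + 4 * m\<^sup>2 / c * k\<^sup>2)"
    proof -
      have "2 * m * s * t \<le> 2 * m * s * (\<epsilon> * s + k)" using t m s0 by (intro mult_left_mono) auto
      also have "\<dots> = 2 * m * \<epsilon> * s\<^sup>2 + 2 * m * s * k" by (simp add: power2_eq_square algebra_simps)
      also have "2 * m * s * k \<le> c / 4 * s\<^sup>2 + 4 * m\<^sup>2 / c * k\<^sup>2"
      proof -
        have "0 \<le> (c * s - 4 * m * k)\<^sup>2 / (4 * c)" using c_pos by simp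
        also have "\<dots> = c / 4 * s\<^sup>2 + 4 * m\<^sup>2 / c * k\<^sup>2 - 2 * m * s * k"
          using c_pos by (simp add: power2_eq_square field_simps)
        finally show ?thesis by simp
      qed
      finally show ?thesis by simp
    qed
    have "3 * \<beta> * t\<^sup>2 \<le> 3 * m * t\<^sup>2" using c_pos by (intro mult_right_mono) (auto simp: m_def)
    also have "\<dots> \<le> 3 * m * (2 * \<epsilon> * s\<^sup>2 + 2 * k\<^sup>2)" using t2 m by (intro mult_left_mono) auto
    finally have 3: "3 * \<beta> * t\<^sup>2 \<le> 6 * m * \<epsilon> * s\<^sup>2 + 6 * m * k\<^sup>2" by (simp add: algebra_simps)
    have 4: "8 * m * \<epsilon> * s\<^sup>2 \<le> c / 4 * s\<^sup>2" using e(3) by (intro mult_right_mono) auto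
    have "Q (a + e') \<ge> c * s\<^sup>2 - (c / 4 * s\<^sup>2 + 4 * m\<^sup>2 / c * k\<^sup>2) - 6 * m * k\<^sup>2 - c / 4 * s\<^sup>2"
      using 1 st 3 4 by linarith
    also have "c * s\<^sup>2 - (c / 4 * s\<^sup>2 + 4 * m\<^sup>2 / c * k\<^sup>2) - 6 * m * k\<^sup>2 - c / 4 * s\<^sup>2 = c / 2 * s\<^sup>2 - K' * k\<^sup>2"
      by (simp add: K'_def algebra_simps)
    finally show "Q (a + e') \<ge> c / 2 * (norm (a + e'))\<^sup>2 - K' * k\<^sup>2" by (simp add: s_def)
  qed
qed

text \<open>Coercivity of the increments is exact here, so the error term only has to be nonnegative
  and N = 1 serves. Coercivity of \<open>g\<close> itself up to a constant is trivial, as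
  \<open>g\<close> is bounded by \<open>r0\<close>; the same constant bounds \<open>U\<close> on the
  square.\<close>

theorem base_regularity:
  assumes O: "open \<Omega>" and U: "L-lipschitz_on \<Omega> U" and Z: "negligible Z"
    and d: "\<And>y. y \<in> \<Omega> \<Longrightarrow> y \<notin> Z \<Longrightarrow> (U has_derivative dmap (g y)) (at y)"
    and bd: "\<And>y. y \<in> \<Omega> \<Longrightarrow> y \<notin> Z \<Longrightarrow> norm (g y) \<le> r0"
    and mon: "\<And>x y. x \<in> \<Omega> \<Longrightarrow> x \<notin> Z \<Longrightarrow> y \<in> \<Omega> \<Longrightarrow> y \<notin> Z \<Longrightarrow> Q (g y - g x) \<ge> c * (norm (g y - g x))\<^sup>2"
  shows "\<exists>\<mu>>0. \<mu> \<le> 1 / 2 \<and> CH (Suc 0) \<mu> \<Omega> U"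
proof -
  obtain \<mu> where \<mu>: "0 < \<mu>" "\<mu> \<le> 1 / 2" "\<And>K R. 0 \<le> K \<Longrightarrow> 0 < R \<Longrightarrow> R \<le> 1 \<Longrightarrow> \<exists>C\<ge>0. interior_bound 1 \<mu> K R C"
    using interior_estimate[of 1] by auto
  have "CH (Suc 0) \<mu> \<Omega> U"
  proof (rule CH1_local[OF O \<mu>(1)])
    fix x0 assume x0: "x0 \<in> \<Omega>"
    obtain R where R: "R > 0" "R \<le> 1" "Sq x0 R \<subseteq> \<Omega>" using Sq_in_open[OF O x0] .
    define K where "K = max (norm (U x0) + L * 2) (\<beta> * r0\<^sup>2 + c * r0\<^sup>2)"
    have L0: "L \<ge> 0" using U by (rule lipschitz_on_nonneg)
    have K0: "K \<ge> 0" using beta(1) c_pos by (simp add: K_def le_max_iff_disj)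
    obtain C where C: "C \<ge> 0" "interior_bound 1 \<mu> K R C" using \<mu>(3)[OF K0 R(1,2)] by blast
    have 1: "L-lipschitz_on (Sq x0 R) U" using U R(3) by (rule lipschitz_on_subset)
    have 2: "(U has_derivative dmap (g y)) (at y) \<and> Q (g y) \<ge> c * (norm (g y))\<^sup>2 - K" if "y \<in> Sq x0 R - Z" for y
    proof
      have y: "y \<in> \<Omega>" "y \<notin> Z" using that R by auto
      show "(U has_derivative dmap (g y)) (at y)" by (rule d[OF y])
      have "(norm (g y))\<^sup>2 \<le> r0\<^sup>2" using bd[OF y] by (intro power_mono) auto
      then have "\<beta> * (norm (g y))\<^sup>2 \<le> \<beta> * r0\<^sup>2" "c * (norm (g y))\<^sup>2 \<le> c * r0\<^sup>2"
        using beta(1) c_pos by (auto intro: mult_left_mono)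
      moreover have "\<beta> * r0\<^sup>2 + c * r0\<^sup>2 \<le> K" by (simp add: K_def)
      ultimately show "Q (g y) \<ge> c * (norm (g y))\<^sup>2 - K" using Q_abs[of "g y"] by linarith
    qed
    have 3: "norm (U y) \<le> K" if "y \<in> Sq x0 R" for y
    proof -
      have "norm (y - x0) \<le> 2" using norm_le_Sq[OF that] R by simp
      moreover have "dist (U y) (U x0) \<le> L * dist y x0" using that R(3) x0 by (intro lipschitz_onD[OF U]) auto
      ultimately have "norm (U y - U x0) \<le> L * 2" using L0 by (metis dist_norm mult_left_mono order.trans)
      then show ?thesis using norm_triangle_ineq2[of "U y" "U x0"] by (simp add: K_def)
    qed
    have 4: "Q (g y - g x) \<ge> c * (norm (g y - g x))\<^sup>2
         - K * norm (y - x) powr (2 * (2 / (2 * real 1 + 1))) * ((norm (g x))\<^sup>2 + 1)"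
      if "x \<in> Sq x0 R - Z" "y \<in> Sq x0 R - Z" for x y
    proof -
      have "0 \<le> K * norm (y - x) powr (2 * (2 / (2 * real 1 + 1))) * ((norm (g x))\<^sup>2 + 1)" using K0 by simp
      moreover have "Q (g y - g x) \<ge> c * (norm (g y - g x))\<^sup>2" using that R(3) by (intro mon) auto
      ultimately show ?thesis by linarith
    qed
    have "\<exists>G. (\<forall>x\<in>Sq x0 (R / 64). (U has_derivative dmap (G x)) (at x)) \<and>
        (\<forall>x\<in>Sq x0 (R / 64). \<forall>y\<in>Sq x0 (R / 64). norm (G x - G y) \<le> C * norm (x - y) powr \<mu>)"
      using C(2)[unfolded interior_bound_def, rule_format, of L x0 U Z g] 1 2 3 4 Z by blast
    then show "\<exists>r>0. \<exists>C\<ge>0. \<exists>G. (\<forall>x\<in>Sq x0 r. (U has_derivative dmap (G x)) (at x)) \<and>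
      (\<forall>x\<in>Sq x0 r. \<forall>y\<in>Sq x0 r. norm (G x - G y) \<le> C * norm (x - y) powr \<mu>)"
      using R C(1) by (intro exI[of _ "R / 64"] conjI exI[of _ C]) auto
  qed
  then show ?thesis using \<mu> by blast
qed

end

section \<open>Second derivatives by difference quotients\<close>

definition dq :: "('a::real_normed_vector \<Rightarrow> 'b::real_normed_vector) \<Rightarrow> 'a \<Rightarrow> real \<Rightarrow> 'a \<Rightarrow> 'b" where
  "dq f e h x = (1 / h) *\<^sub>R (f (x + h *\<^sub>R e) - f x)"

lemma Sq_step_ball:
  assumes "x \<in> Sq x0 R" "R \<le> r / 8" "0 \<le> \<tau>" "\<tau> \<le> r / 8" "e \<in> Basis" "r > 0"
  shows "x + \<tau> *\<^sub>R (e::real^2) \<in> ball x0 r"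
proof -
  have "norm (x - x0) \<le> 2 * R" by (rule norm_le_Sq[OF assms(1)])
  moreover have "norm (x + \<tau> *\<^sub>R e - x0) \<le> norm (x - x0) + \<tau>"
    using norm_triangle_ineq[of "x - x0" "\<tau> *\<^sub>R e"] assms by (simp add: algebra_simps)
  ultimately show ?thesis using assms by (simp add: dist_norm norm_minus_commute)
qed

context null_form
begin

text \<open>The vector \<open>a\<close> is the principal part of the linearised equation satisfied by a difference quotient \<open>g\<close>;
  it is coercive, and what remains is absorbed by \<open>Q_perturb\<close>.\<close>

definition diff_hyp :: "real \<Rightarrow> real \<Rightarrow> real \<Rightarrow> (real^2) set \<Rightarrow> (real^2 \<Rightarrow> 'b \<times> 'b) \<Rightarrow> bool" where
  "diff_hyp \<epsilon> K \<sigma> S g \<longleftrightarrow>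
    (\<forall>x\<in>S. \<exists>a. Q a \<ge> c * (norm a)\<^sup>2 \<and> norm (g x - a) \<le> \<epsilon> * norm (g x) + K) \<and>
    (\<forall>x\<in>S. \<forall>y\<in>S. \<exists>a. Q a \<ge> c * (norm a)\<^sup>2 \<and>
      norm (g y - g x - a) \<le> \<epsilon> * norm (g y - g x) + K * norm (y - x) powr \<sigma> * (norm (g x) + 1))"

definition locally_diff_hyp :: "real \<Rightarrow> real \<Rightarrow> real \<Rightarrow> (real^2 \<Rightarrow> 'b) \<Rightarrow> real^2 \<Rightarrow> real \<Rightarrow> real \<Rightarrow> bool" where
  "locally_diff_hyp \<epsilon> K \<sigma> Z x0 R h0 \<longleftrightarrow> R > 0 \<and> h0 > 0 \<and> K \<ge> 0 \<and>
    (\<forall>e\<in>Basis. \<forall>h. 0 < h \<and> h < h0 \<longrightarrow> diff_hyp \<epsilon> K \<sigma> (Sq x0 R) (dq (grad Z) e h))"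

text \<open>The interior estimate is applied to the difference quotients of \<open>Z\<close>. Their
  gradients are coercive up to the errors in \<open>diff_hyp\<close>, hence satisfy its hypotheses
  with c / 2 and with constants independent of h, and the limit gives Hoelder continuous second
  derivatives. \<epsilon> depends on \<open>B\<close> and \<open>c\<close> only and is chosen before
  \<open>Z\<close>, so that it can be reached later by shrinking the squares.\<close>

theorem raise_step:
  assumes N: "N \<ge> 1"
  defines "\<sigma> \<equiv> 2 / (2 * real N + 1)"
  shows "\<exists>\<epsilon>>0. \<exists>\<mu>>0. \<mu> \<le> 1 / 2 \<and> (\<forall>\<Omega> Z. CH (Suc 0) \<sigma> \<Omega> Z \<and>
    (\<forall>x0\<in>\<Omega>. \<exists>R h0 K. locally_diff_hyp \<epsilon> K \<sigma> Z x0 R h0)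
    \<longrightarrow> CH (Suc (Suc 0)) \<mu> \<Omega> Z)"
proof -
  interpret H: null_form B "c / 2" by (rule null_form_half) unfold_locales
  obtain \<epsilon> K' where \<epsilon>: "\<epsilon> > 0" and K': "K' \<ge> 0"
    "\<And>a e k. k \<ge> 0 \<Longrightarrow> Q a \<ge> c * (norm a)\<^sup>2 \<Longrightarrow> norm e \<le> \<epsilon> * norm (a + e) + k \<Longrightarrow>
    Q (a + e) \<ge> c / 2 * (norm (a + e))\<^sup>2 - K' * k\<^sup>2"
    using Q_perturb by blast
  obtain \<mu> where \<mu>: "0 < \<mu>" "\<mu> \<le> 1 / 2" "\<And>K R. 0 \<le> K \<Longrightarrow> 0 < R \<Longrightarrow> R \<le> 1 \<Longrightarrow> \<exists>C\<ge>0. H.interior_bound N \<mu> K R C"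
    using H.interior_estimate[OF N] by blast
  have \<sigma>: "0 < \<sigma>" "\<sigma> \<le> 1" using N by (auto simp: \<sigma>_def divide_simps)
  have "CH (Suc (Suc 0)) \<mu> \<Omega> Z"
    if Z: "CH (Suc 0) \<sigma> \<Omega> Z"
      and hyp: "\<forall>x0\<in>\<Omega>. \<exists>R h0 K. locally_diff_hyp \<epsilon> K \<sigma> Z x0 R h0"
    for \<Omega> Z
  proof -
    have O: "open \<Omega>" by (rule CH_open[OF Z])
    have Zd: "Z differentiable (at x)" if "x \<in> \<Omega>" for x using Z that by simp
    have gZ: "lhol \<sigma> \<Omega> (grad Z)" using Z unfolding CH_Suc_grad CH.simps by blast
    have "CH (Suc 0) \<mu> \<Omega> (\<lambda>x. frechet_derivative Z (at x) e)" if e: "e \<in> Basis" for e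
    proof (rule CH1_local[OF O \<mu>(1)])
      have ne: "norm e = 1" using e by simp
      fix x0 assume x0: "x0 \<in> \<Omega>"
      obtain R' h0 K where R': "R' > 0" "h0 > 0" "K \<ge> 0"
        "\<And>h. 0 < h \<Longrightarrow> h < h0 \<Longrightarrow> diff_hyp \<epsilon> K \<sigma> (Sq x0 R') (dq (grad Z) e h)"
      proof -
        from hyp x0 have "\<exists>R h0 K. locally_diff_hyp \<epsilon> K \<sigma> Z x0 R h0" by (rule bspec)
        then obtain R h0 K where *: "locally_diff_hyp \<epsilon> K \<sigma> Z x0 R h0" by (elim exE)
        show ?thesis by (rule that[of R h0 K]) (use * e in \<open>auto simp: locally_diff_hyp_def\<close>)
      qed
      obtain r M C0 where r: "r > 0" "r \<le> 1" "M \<ge> 0" "C0 \<ge> 0" "ball x0 r \<subseteq> \<Omega>" "\<And>y. y \<in> ball x0 r \<Longrightarrow> norm (grad Z y) \<le> M"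
        "\<And>y z. y \<in> ball x0 r \<Longrightarrow> z \<in> ball x0 r \<Longrightarrow> norm (grad Z y - grad Z z) \<le> C0 * norm (y - z) powr \<sigma>"
        by (rule lhol_bounded[OF gZ \<sigma>(1) x0]) (rule that)
      define R where "R = min R' (r / 8)"
      define h1 where "h1 = min h0 (r / 8)"
      have R: "0 < R" "R \<le> 1" "R \<le> r / 8" "R \<le> R'" using R' r by (auto simp: R_def)
      have h1: "0 < h1" "h1 \<le> h0" "h1 \<le> r / 8" using R' r by (auto simp: h1_def)
      have inb: "x + \<tau> *\<^sub>R e \<in> ball x0 r" if "x \<in> Sq x0 R" "0 \<le> \<tau>" "\<tau> \<le> h1" for x \<tau>
        using that h1 r by (intro Sq_step_ball[OF that(1) R(3) that(2) _ e]) auto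
      have inb0: "x \<in> ball x0 r" if "x \<in> Sq x0 R" for x using inb[OF that, of 0] h1 by simp
      have Zder: "(Z has_derivative dmap (grad Z x)) (at x)" if "x \<in> ball x0 r" for x
        using that r(5) by (intro has_derivative_grad Zd) auto
      have Zlip: "norm (Z x - Z y) \<le> M * norm (x - y)" if "x \<in> ball x0 r" "y \<in> ball x0 r" for x y
      proof (rule differentiable_bound[OF convex_ball _ _ that])
        fix w assume w: "w \<in> ball x0 r"
        show "(Z has_derivative dmap (grad Z w)) (at w within ball x0 r)" by (rule has_derivative_at_withinI[OF Zder[OF w]])
        show "onorm (dmap (grad Z w)) \<le> M"
          using r(6)[OF w] by (intro onorm_le order.trans[OF norm_dmap_le]) (simp add: mult.commute[of M] mult_left_mono)
      qed
      define KK where "KK = M + K' * K\<^sup>2 + 2 * K' * K\<^sup>2"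
      have KK: "KK \<ge> 0" "M \<le> KK" "K' * K\<^sup>2 \<le> KK" "2 * K' * K\<^sup>2 \<le> KK" using r(3) K'(1) by (auto simp: KK_def)
      obtain C where C: "C \<ge> 0" "H.interior_bound N \<mu> KK R C" using \<mu>(3)[OF KK(1) R(1,2)] by blast
      let ?d = "\<lambda>h. dq (grad Z) e h"
      let ?S = "Sq x0 (R / 64)"
      have sub: "?S \<subseteq> Sq x0 R" using R by (intro Sq_mono) simp
      have Wd: "(dq Z e h has_derivative dmap (?d h x)) (at x)" if "x \<in> Sq x0 R" "0 < h" "h < h1" for h x
      proof -
        have "(Z has_derivative dmap (grad Z (x + h *\<^sub>R e))) (at (x + h *\<^sub>R e))"
          by (rule Zder[OF inb]) (use that in auto)
        from has_derivative_scaleR_right[OF has_derivative_shift_diff[OF this Zder[OF inb0[OF that(1)]], of 0], of "1 / h"]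
        show ?thesis by (simp add: dq_def[abs_def] dmap_scaleR[abs_def])
      qed
      have hol: "norm (?d h x - ?d h y) \<le> C * norm (x - y) powr \<mu>"
        if xy: "x \<in> ?S" "y \<in> ?S" and h: "0 < h" "h < h1" for h x y
      proof -
        have dh: "diff_hyp \<epsilon> K \<sigma> (Sq x0 R) (?d h)"
          using R'(4)[OF h(1)] h(2) h1(2) Sq_mono[OF R(4), of x0] unfolding diff_hyp_def by (meson less_le_trans subset_iff)
        \<comment> \<open>This constant blows up as h tends to 0, which is harmless because
          \<open>C\<close> in \<open>interior_bound\<close> does not depend on it.\<close>
        have lip: "(2 * M / h)-lipschitz_on (Sq x0 R) (dq Z e h)"
        proof (rule lipschitz_onI)
          fix x y assume x: "x \<in> Sq x0 R" and y: "y \<in> Sq x0 R"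
          have i: "x + h *\<^sub>R e \<in> ball x0 r" "y + h *\<^sub>R e \<in> ball x0 r" using inb x y h by auto
          have "dist (dq Z e h x) (dq Z e h y) = norm ((1 / h) *\<^sub>R ((Z (x + h *\<^sub>R e) - Z (y + h *\<^sub>R e)) - (Z x - Z y)))"
            by (simp add: dq_def dist_norm algebra_simps)
          also have "\<dots> = 1 / h * norm ((Z (x + h *\<^sub>R e) - Z (y + h *\<^sub>R e)) - (Z x - Z y))" using h by simp
          also have "\<dots> \<le> 1 / h * (M * norm (x + h *\<^sub>R e - (y + h *\<^sub>R e)) + M * norm (x - y))"
            using h by (intro mult_left_mono order.trans[OF norm_triangle_ineq4] add_mono Zlip i inb0 x y) auto
          finally show "dist (dq Z e h x) (dq Z e h y) \<le> 2 * M / h * dist x y" by (simp add: dist_norm)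
        qed (use r h in simp)
        have a1: "(dq Z e h has_derivative dmap (?d h y)) (at y) \<and> Q (?d h y) \<ge> c / 2 * (norm (?d h y))\<^sup>2 - KK"
          if "y \<in> Sq x0 R - {}" for y
        proof
          have y: "y \<in> Sq x0 R" using that by simp
          show "(dq Z e h has_derivative dmap (?d h y)) (at y)" by (rule Wd[OF y h])
          obtain a where a: "Q a \<ge> c * (norm a)\<^sup>2" "norm (?d h y - a) \<le> \<epsilon> * norm (?d h y) + K"
            using dh y unfolding diff_hyp_def by blast
          have "Q (a + (?d h y - a)) \<ge> c / 2 * (norm (a + (?d h y - a)))\<^sup>2 - K' * K\<^sup>2"
            by (rule K'(2)[OF R'(3) a(1)]) (use a(2) in simp)
          then show "Q (?d h y) \<ge> c / 2 * (norm (?d h y))\<^sup>2 - KK" using KK(3) by simp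
        qed
        have a2: "norm (dq Z e h y) \<le> KK" if "y \<in> Sq x0 R" for y
        proof -
          have "norm (Z (y + h *\<^sub>R e) - Z y) \<le> M * norm (y + h *\<^sub>R e - y)" using inb[OF that] inb0[OF that] h by (intro Zlip) auto
          then have "norm (Z (y + h *\<^sub>R e) - Z y) \<le> M * h" using h ne by simp
          then have "norm (dq Z e h y) \<le> M" using h by (simp add: dq_def pos_divide_le_eq)
          then show ?thesis using KK by linarith
        qed
        have a3: "Q (?d h y - ?d h x) \<ge> c / 2 * (norm (?d h y - ?d h x))\<^sup>2
         - KK * norm (y - x) powr (2 * (2 / (2 * real N + 1))) * ((norm (?d h x))\<^sup>2 + 1)"
          if xy: "x \<in> Sq x0 R - {}" "y \<in> Sq x0 R - {}" for x y
        proof -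
          define k where "k = K * norm (y - x) powr \<sigma> * (norm (?d h x) + 1)"
          have k: "k \<ge> 0" using R'(3) by (simp add: k_def)
          obtain a where a: "Q a \<ge> c * (norm a)\<^sup>2" "norm (?d h y - ?d h x - a) \<le> \<epsilon> * norm (?d h y - ?d h x) + k"
            using dh xy unfolding diff_hyp_def k_def by blast
          have "Q (a + (?d h y - ?d h x - a)) \<ge> c / 2 * (norm (a + (?d h y - ?d h x - a)))\<^sup>2 - K' * k\<^sup>2"
            by (rule K'(2)[OF k a(1)]) (use a(2) in simp)
          then have 1: "Q (?d h y - ?d h x) \<ge> c / 2 * (norm (?d h y - ?d h x))\<^sup>2 - K' * k\<^sup>2" by simp
          have "k\<^sup>2 = K\<^sup>2 * norm (y - x) powr (2 * \<sigma>) * (norm (?d h x) + 1)\<^sup>2"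
          proof -
            have "(t powr \<sigma>)\<^sup>2 = t powr (2 * \<sigma>)" for t :: real
              by (simp add: power2_eq_square powr_add[symmetric])
            then show ?thesis by (simp add: k_def power_mult_distrib)
          qed
          also have "\<dots> \<le> K\<^sup>2 * norm (y - x) powr (2 * \<sigma>) * (2 * ((norm (?d h x))\<^sup>2 + 1))"
            using sum_squares_bound[of "norm (?d h x)" 1] by (intro mult_left_mono) (auto simp: power2_sum)
          finally have "K' * k\<^sup>2 \<le> K' * (K\<^sup>2 * norm (y - x) powr (2 * \<sigma>) * (2 * ((norm (?d h x))\<^sup>2 + 1)))"
            using K'(1) by (rule mult_left_mono)
          also have "\<dots> = 2 * K' * K\<^sup>2 * norm (y - x) powr (2 * \<sigma>) * ((norm (?d h x))\<^sup>2 + 1)" by simp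
          also have "\<dots> \<le> KK * norm (y - x) powr (2 * \<sigma>) * ((norm (?d h x))\<^sup>2 + 1)"
            using KK(4) by (intro mult_right_mono) auto
          finally show ?thesis using 1 unfolding \<sigma>_def by linarith
        qed
        have "\<exists>G. (\<forall>x\<in>?S. (dq Z e h has_derivative dmap (G x)) (at x)) \<and>
            (\<forall>x\<in>?S. \<forall>y\<in>?S. norm (G x - G y) \<le> C * norm (x - y) powr \<mu>)"
          using C(2)[unfolded H.interior_bound_def, rule_format, of "2 * M / h" x0 "dq Z e h" "{}" "?d h"] lip a1 a2 a3 by blast
        then obtain G where G: "\<And>x. x \<in> ?S \<Longrightarrow> (dq Z e h has_derivative dmap (G x)) (at x)"
            "\<And>x y. x \<in> ?S \<Longrightarrow> y \<in> ?S \<Longrightarrow> norm (G x - G y) \<le> C * norm (x - y) powr \<mu>" by blast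
        \<comment> \<open>The \<open>G\<close> of the estimate is the difference quotient of the
          gradient, by uniqueness of derivatives; so the Hoelder bound holds for that quotient,
          uniformly in h.\<close>
        have "?d h x = G x" if "x \<in> ?S" for x
          using has_derivative_unique[OF Wd[OF subsetD[OF sub that] h] G(1)[OF that]] by (rule dmap_inj)
        then show ?thesis using G(2)[OF xy] xy by simp
      qed
      have un: "norm (dq Z e h x - frechet_derivative Z (at x) e) \<le> C0 * h powr \<sigma>" if x: "x \<in> Sq x0 R" and h: "0 < h" "h < h1" for h x
        unfolding dq_def
      proof (rule dq_est[OF h(1), where D="\<lambda>y. dmap (grad Z y)"])
        fix \<tau> assume \<tau>: "0 \<le> \<tau>" "\<tau> \<le> h"
        have i: "x + \<tau> *\<^sub>R e \<in> ball x0 r" by (rule inb[OF x]) (use \<tau> h in auto)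
        show "(Z has_derivative dmap (grad Z (x + \<tau> *\<^sub>R e))) (at (x + \<tau> *\<^sub>R e))" by (rule Zder[OF i])
        have "dmap (grad Z x) e = frechet_derivative Z (at x) e" using inb0[OF x] r(5) by (intro dmap_grad Zd) auto
        then have "norm (dmap (grad Z (x + \<tau> *\<^sub>R e)) e - frechet_derivative Z (at x) e) = norm (dmap (grad Z (x + \<tau> *\<^sub>R e) - grad Z x) e)"
          by (simp add: dmap_diff)
        also have "\<dots> \<le> norm (grad Z (x + \<tau> *\<^sub>R e) - grad Z x)" using norm_dmap_le[of _ e] ne by (metis mult_1)
        also have "\<dots> \<le> C0 * norm (x + \<tau> *\<^sub>R e - x) powr \<sigma>" by (rule r(7)[OF i inb0[OF x]])
        also have "\<dots> \<le> C0 * h powr \<sigma>" using \<tau> ne r(4) \<sigma> by (intro mult_left_mono powr_mono2) auto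
        finally show "norm (dmap (grad Z (x + \<tau> *\<^sub>R e)) e - frechet_derivative Z (at x) e) \<le> C0 * h powr \<sigma>" .
      qed
      \<comment> \<open>With n + 2 instead of n + 1 already the value at n = 0 is strictly below
        \<open>h1\<close>.\<close>
      define hn where "hn n = h1 / (real n + 2)" for n
      have hn: "0 < hn n" "hn n < h1" for n using h1(1) by (auto simp: hn_def divide_simps)
      have hn0: "hn \<longlonglongrightarrow> 0"
      proof -
        have "(\<lambda>n. h1 / real (n + 2)) \<longlonglongrightarrow> 0" by (rule LIMSEQ_ignore_initial_segment[OF lim_const_over_n, of h1 2])
        then show ?thesis by (simp add: hn_def[abs_def] add.commute)
      qed
      have "\<exists>G. (\<forall>x\<in>Sq x0 (R / 64 / 4). ((\<lambda>x. frechet_derivative Z (at x) e) has_derivative dmap (G x)) (at x)) \<and>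
        (\<forall>x\<in>Sq x0 (R / 64 / 4). \<forall>y\<in>Sq x0 (R / 64 / 4). norm (G x - G y) \<le> C * norm (x - y) powr \<mu>)"
      proof (rule C1_holder_uniform_limit[OF _ \<mu>(1) C(1)])
        show "R / 64 > 0" using R by simp
        show "(dq Z e (hn n) has_derivative dmap (?d (hn n) x)) (at x)" if "x \<in> ?S" for n x
          by (rule Wd[OF subsetD[OF sub that] hn])
        show "norm (?d (hn n) x - ?d (hn n) y) \<le> C * norm (x - y) powr \<mu>" if "x \<in> ?S" "y \<in> ?S" for n x y
          by (rule hol[OF that hn])
        fix \<eta> :: real assume "\<eta> > 0"
        have "(\<lambda>n. C0 * hn n powr \<sigma>) \<longlonglongrightarrow> 0"
        proof (rule tendsto_mult_right_zero)
          show "(\<lambda>n. hn n powr \<sigma>) \<longlonglongrightarrow> 0"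
            using hn(1) \<sigma>(1) by (intro tendsto_zero_powrI[OF hn0 tendsto_const]) (auto intro: less_imp_le always_eventually)
        qed
        then have "\<forall>\<^sub>F n in sequentially. C0 * hn n powr \<sigma> < \<eta>" using \<open>\<eta> > 0\<close> by (rule order_tendstoD(2))
        then obtain M' where "\<And>n. n \<ge> M' \<Longrightarrow> C0 * hn n powr \<sigma> < \<eta>" unfolding eventually_sequentially by blast
        then show "\<exists>M. \<forall>n\<ge>M. \<forall>x\<in>?S. norm (dq Z e (hn n) x - frechet_derivative Z (at x) e) \<le> \<eta>"
          using un[OF subsetD[OF sub] hn] by (meson less_imp_le order.trans)
      qed
      moreover have "R / 64 / 4 > 0" using R by simp
      ultimately show "\<exists>r>0. \<exists>C\<ge>0. \<exists>G. (\<forall>x\<in>Sq x0 r. ((\<lambda>x. frechet_derivative Z (at x) e) has_derivative dmap (G x)) (at x)) \<and>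
        (\<forall>x\<in>Sq x0 r. \<forall>y\<in>Sq x0 r. norm (G x - G y) \<le> C * norm (x - y) powr \<mu>)"
        using C(1) by blast
    qed
    then show ?thesis using Zd unfolding CH.simps(2)[of "Suc 0"] by blast
  qed
  then show ?thesis using \<epsilon> \<mu>(1,2) by blast
qed

end

lemma finite_uniform:
  assumes "finite I" "\<And>i. i \<in> I \<Longrightarrow> \<exists>r>0. \<exists>C\<ge>0. P i r C"
    and mono: "\<And>i r C r' C'. P i r C \<Longrightarrow> 0 < r' \<Longrightarrow> r' \<le> r \<Longrightarrow> C \<le> C' \<Longrightarrow> P i r' (C'::real)"
  shows "\<exists>r>0::real. \<exists>C\<ge>0. \<forall>i\<in>I. P i r C"
  using assms(1,2)
proof (induction I)
  case empty
  show ?case by (intro exI[of _ 1] conjI exI[of _ 0]) auto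
next
  case (insert i I)
  obtain r C where 1: "r > 0" "C \<ge> 0" "\<forall>i\<in>I. P i r C" using insert by auto
  obtain r' C' where 2: "r' > 0" "C' \<ge> 0" "P i r' C'" using insert(4)[of i] by auto
  have "P j (min r r') (max C C')" if "j \<in> insert i I" for j
  proof (cases "j = i")
    case True
    have "P i (min r r') (max C C')" by (rule mono[OF 2(3)]) (use 1(1) 2(1) in auto)
    then show ?thesis using True by simp
  next
    case False
    then have "P j r C" using 1 that by auto
    then show ?thesis by (rule mono) (use 1(1) 2(1) in auto)
  qed
  then show ?case using 1 2 by (intro exI[of _ "min r r'"] conjI exI[of _ "max C C'"]) auto
qed

text \<open>One constant for the size and the Hoelder modulus of \<open>f\<close> and, uniformly in
  h, of its difference quotients: what a coefficient has to provide when a linear equation is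
  differenced.\<close>

definition locdata :: "(real^2 \<Rightarrow> 'c::euclidean_space) \<Rightarrow> real^2 \<Rightarrow> real \<Rightarrow> real \<Rightarrow> real \<Rightarrow> bool" where
  "locdata f x0 \<sigma> r C \<longleftrightarrow> (\<forall>x\<in>ball x0 r. norm (f x) \<le> C) \<and>
    (\<forall>x\<in>ball x0 r. \<forall>y\<in>ball x0 r. norm (f y - f x) \<le> C * norm (y - x) powr \<sigma>) \<and>
    (\<forall>e\<in>Basis. \<forall>h. 0 < h \<and> h < r \<longrightarrow> (\<forall>x\<in>ball x0 r. norm (dq f e h x) \<le> C) \<and>
      (\<forall>x\<in>ball x0 r. \<forall>y\<in>ball x0 r. norm (dq f e h y - dq f e h x) \<le> C * norm (y - x) powr \<sigma>))"

lemma locdata_mono: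
  assumes "locdata f x0 \<sigma> r C" "r' \<le> r" "C \<le> C'" shows "locdata f x0 \<sigma> r' C'"
proof -
  have b: "ball x0 r' \<subseteq> ball x0 r" using assms(2) by (rule subset_ball)
  have m: "C * norm (y - x) powr \<sigma> \<le> C' * norm (y - x) powr \<sigma>" for x y :: "real^2"
    using assms(3) by (rule mult_right_mono) simp
  show ?thesis unfolding locdata_def
  proof (intro conjI ballI allI impI)
    fix x assume x: "x \<in> ball x0 r'"
    then have x': "x \<in> ball x0 r" using b by blast
    show "norm (f x) \<le> C'" using assms(1,3) x' unfolding locdata_def by fastforce
    fix y assume "y \<in> ball x0 r'"
    then have "y \<in> ball x0 r" using b by blast
    then show "norm (f y - f x) \<le> C' * norm (y - x) powr \<sigma>"
      using assms(1) x' m[of y x] unfolding locdata_def by (meson order.trans)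
  next
    fix e h x assume e: "e \<in> (Basis::(real^2) set)" "0 < h \<and> h < r'" and x: "x \<in> ball x0 r'"
    then have x': "x \<in> ball x0 r" and h: "0 < h \<and> h < r" using b assms(2) by auto
    show "norm (dq f e h x) \<le> C'" using assms(1,3) x' e h unfolding locdata_def by fastforce
    fix y assume "y \<in> ball x0 r'"
    then have "y \<in> ball x0 r" using b by blast
    then show "norm (dq f e h y - dq f e h x) \<le> C' * norm (y - x) powr \<sigma>"
      using assms(1) x' e h m[of y x] unfolding locdata_def by (meson order.trans)
  qed
qed

lemma CH1_locdata:
  fixes f :: "real^2 \<Rightarrow> 'c::euclidean_space"
  assumes f: "CH (Suc 0) \<sigma> \<Omega> f" and \<sigma>: "0 < \<sigma>" "\<sigma> \<le> 1" and x0: "x0 \<in> \<Omega>"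
  shows "\<exists>r>0. \<exists>C\<ge>0. locdata f x0 \<sigma> r C"
proof -
  have gf: "lhol \<sigma> \<Omega> (grad f)" and fd: "\<And>x. x \<in> \<Omega> \<Longrightarrow> f differentiable (at x)"
    using f unfolding CH_Suc_grad CH.simps by blast+
  obtain r M C where r: "r > 0" "r \<le> 1" "M \<ge> 0" "C \<ge> 0" "ball x0 r \<subseteq> \<Omega>" "\<And>y. y \<in> ball x0 r \<Longrightarrow> norm (grad f y) \<le> M"
    "\<And>y z. y \<in> ball x0 r \<Longrightarrow> z \<in> ball x0 r \<Longrightarrow> norm (grad f y - grad f z) \<le> C * norm (y - z) powr \<sigma>"
    by (rule lhol_bounded[OF gf \<sigma>(1) x0]) (rule that)
  obtain r' M' C' where r': "r' > 0" "r' \<le> 1" "M' \<ge> 0" "C' \<ge> 0" "ball x0 r' \<subseteq> \<Omega>" "\<And>y. y \<in> ball x0 r' \<Longrightarrow> norm (f y) \<le> M'"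
    "\<And>y z. y \<in> ball x0 r' \<Longrightarrow> z \<in> ball x0 r' \<Longrightarrow> norm (f y - f z) \<le> C' * norm (y - z) powr \<sigma>"
    by (rule lhol_bounded[OF CH_imp_lhol[OF f \<sigma>] \<sigma>(1) x0]) (rule that)
  define s where "s = min r' (r / 2)"
  define K where "K = max (max M C) (max M' C')"
  have s: "s > 0" "s \<le> r'" "s \<le> r / 2" using r r' by (auto simp: s_def)
  have K: "M \<le> K" "C \<le> K" "M' \<le> K" "C' \<le> K" "K \<ge> 0" using r by (auto simp: K_def)
  have inb: "x + \<tau> *\<^sub>R e \<in> ball x0 r" if "x \<in> ball x0 s" "0 \<le> \<tau>" "\<tau> \<le> h" "h < s" "e \<in> Basis" for x \<tau> h e
    using that s norm_triangle_ineq[of "x - x0" "\<tau> *\<^sub>R e"] by (simp add: dist_norm norm_minus_commute algebra_simps)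
  have der: "(f has_derivative dmap (grad f x)) (at x)" if "x \<in> ball x0 r" for x
    using that r(5) by (intro has_derivative_grad fd) auto
  have "locdata f x0 \<sigma> s K" unfolding locdata_def
  proof (intro conjI ballI allI impI)
    fix x assume x: "x \<in> ball x0 s"
    then have x': "x \<in> ball x0 r'" using s by auto
    show "norm (f x) \<le> K" using r'(6)[OF x'] K by linarith
    fix y assume y: "y \<in> ball x0 s"
    then have y': "y \<in> ball x0 r'" using s by auto
    show "norm (f y - f x) \<le> K * norm (y - x) powr \<sigma>"
      using r'(7)[OF y' x'] K(4) by (meson mult_right_mono order.trans powr_ge_zero)
  next
    fix e h x assume e: "e \<in> (Basis::(real^2) set)" and h: "0 < h \<and> h < s" and x: "x \<in> ball x0 s"
    have ne: "norm e = 1" using e by simp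
    have h0: "0 < h" using h by simp
    have i: "x + \<tau> *\<^sub>R e \<in> ball x0 r" if "0 \<le> \<tau>" "\<tau> \<le> h" for \<tau> using inb[OF x that] h e by simp
    have "norm ((1 / h) *\<^sub>R (f (x + h *\<^sub>R e) - f x) - 0) \<le> M"
    proof (rule dq_est[OF h0, where D="\<lambda>y. dmap (grad f y)"])
      fix \<tau> assume \<tau>: "0 \<le> \<tau>" "\<tau> \<le> h"
      show "(f has_derivative dmap (grad f (x + \<tau> *\<^sub>R e))) (at (x + \<tau> *\<^sub>R e))" by (rule der[OF i[OF \<tau>]])
      show "norm (dmap (grad f (x + \<tau> *\<^sub>R e)) e - 0) \<le> M"
        using norm_dmap_le[of "grad f (x + \<tau> *\<^sub>R e)" e] r(6)[OF i[OF \<tau>]] ne by simp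
    qed
    then show "norm (dq f e h x) \<le> K" using K(1) by (simp add: dq_def)
    fix y assume y: "y \<in> ball x0 s"
    have j: "y + \<tau> *\<^sub>R e \<in> ball x0 r" if "0 \<le> \<tau>" "\<tau> \<le> h" for \<tau> using inb[OF y that] h e by simp
    show "norm (dq f e h y - dq f e h x) \<le> K * norm (y - x) powr \<sigma>"
      unfolding dq_def
    proof (rule dq_diff_est[OF h0, where D="\<lambda>y. dmap (grad f y)"])
      fix \<tau> assume \<tau>: "0 \<le> \<tau>" "\<tau> \<le> h"
      show "(f has_derivative dmap (grad f (x + \<tau> *\<^sub>R e))) (at (x + \<tau> *\<^sub>R e))" by (rule der[OF i[OF \<tau>]])
      show "(f has_derivative dmap (grad f (y + \<tau> *\<^sub>R e))) (at (y + \<tau> *\<^sub>R e))" by (rule der[OF j[OF \<tau>]])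
      have "norm (dmap (grad f (y + \<tau> *\<^sub>R e)) e - dmap (grad f (x + \<tau> *\<^sub>R e)) e) \<le> norm (grad f (y + \<tau> *\<^sub>R e) - grad f (x + \<tau> *\<^sub>R e))"
        using norm_dmap_le[of "grad f (y + \<tau> *\<^sub>R e) - grad f (x + \<tau> *\<^sub>R e)" e] ne by (simp add: dmap_diff)
      also have "\<dots> \<le> C * norm (y - x) powr \<sigma>" using r(7)[OF j[OF \<tau>] i[OF \<tau>]] by simp
      also have "\<dots> \<le> K * norm (y - x) powr \<sigma>" using K(2) by (intro mult_right_mono) auto
      finally show "norm (dmap (grad f (y + \<tau> *\<^sub>R e)) e - dmap (grad f (x + \<tau> *\<^sub>R e)) e) \<le> K * norm (y - x) powr \<sigma>" .
    qed
  qed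
  then show ?thesis using s K by blast
qed

text \<open>The linear map whose columns are the \<open>t b x\<close>. Keeping the columns as
  separate functions expresses the regularity of the coefficients by \<open>CH\<close>, without a
  normed space of linear maps.\<close>

definition lapp :: "('g::euclidean_space \<Rightarrow> 'a \<Rightarrow> 'g) \<Rightarrow> 'a \<Rightarrow> 'g \<Rightarrow> 'g" where
  "lapp t x z = (\<Sum>b\<in>Basis. (z \<bullet> b) *\<^sub>R t b x)"

lemma lapp_linear: "lapp t x (y - z) = lapp t x y - lapp t x z" "lapp t x (s *\<^sub>R z) = s *\<^sub>R lapp t x z"
  by (auto simp: lapp_def inner_diff_left scaleR_diff_left sum_subtractf scaleR_sum_right)

section \<open>Second derivatives for the linear equation\<close>

context null_form
begin

text \<open>Differencing the equation gives d = T(x) d + N for the quotient d of the gradient; N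
  consists of the quotients of the coefficients, applied to the shifted gradient, and of the
  quotient of \<open>G\<close>, all bounded and Hoelder continuous. The principal part lies in the
  range of T, where \<open>Q\<close> is coercive, and the hypothesis of \<open>raise_step\<close>
  holds with whatever \<epsilon> it prescribes.\<close>

theorem linear_step:
  fixes t :: "'b \<times> 'b \<Rightarrow> real^2 \<Rightarrow> 'b \<times> 'b" and G :: "real^2 \<Rightarrow> 'b \<times> 'b"
  assumes \<sigma>0: "0 < \<sigma>0" "\<sigma>0 \<le> 1"
    and t: "\<And>b. b \<in> Basis \<Longrightarrow> CH (Suc 0) \<sigma>0 \<Omega> (t b)" and G: "CH (Suc 0) \<sigma>0 \<Omega> G" and Z: "CH (Suc 0) \<sigma>0 \<Omega> Z"
    and eq: "\<And>x. x \<in> \<Omega> \<Longrightarrow> grad Z x = lapp t x (grad Z x) + G x"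
    and co: "\<And>x z. x \<in> \<Omega> \<Longrightarrow> Q (lapp t x z) \<ge> c * (norm (lapp t x z))\<^sup>2"
  shows "\<exists>\<mu>>0. \<mu> \<le> 1 / 2 \<and> CH (Suc (Suc 0)) \<mu> \<Omega> Z"
proof -
  obtain N where N: "N \<ge> 1" "2 / (2 * real N + 1) \<le> \<sigma>0" using small_powr_index[OF \<sigma>0(1)] by blast
  define \<sigma> where "\<sigma> = 2 / (2 * real N + 1)"
  have \<sigma>: "0 < \<sigma>" "\<sigma> \<le> 1" "\<sigma> \<le> \<sigma>0" using N \<sigma>0 by (auto simp: \<sigma>_def)
  obtain \<epsilon> \<mu> where \<epsilon>: "\<epsilon> > 0" and \<mu>: "\<mu> > 0" "\<mu> \<le> 1 / 2" and step:
    "\<And>\<Omega> Z. CH (Suc 0) \<sigma> \<Omega> Z \<Longrightarrow> \<forall>x0\<in>\<Omega>. \<exists>R h0 K. locally_diff_hyp \<epsilon> K \<sigma> Z x0 R h0 \<Longrightarrow> CH (Suc (Suc 0)) \<mu> \<Omega> Z"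
    using raise_step[OF N(1)] unfolding \<sigma>_def by blast
  have Z': "CH (Suc 0) \<sigma> \<Omega> Z" by (rule CH_mono[OF Z \<sigma>(1,3)])
  have O: "open \<Omega>" by (rule CH_open[OF Z])
  have gZ: "lhol \<sigma> \<Omega> (grad Z)" using Z' unfolding CH_Suc_grad CH.simps by blast
  have "\<exists>R h0 K. locally_diff_hyp \<epsilon> K \<sigma> Z x0 R h0" if x0: "x0 \<in> \<Omega>" for x0
  proof -
    have "\<exists>r>0. \<exists>C\<ge>0. \<forall>b\<in>Basis. locdata (t b) x0 \<sigma> r C"
    proof (rule finite_uniform[OF finite_Basis])
      show "\<exists>r>0. \<exists>C\<ge>0. locdata (t b) x0 \<sigma> r C" if "b \<in> Basis" for b
        by (rule CH1_locdata[OF CH_mono[OF t[OF that] \<sigma>(1,3)] \<sigma>(1,2) x0])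
    qed (rule locdata_mono)
    then obtain r1 C1 where 1: "r1 > 0" "C1 \<ge> 0" "\<And>b. b \<in> Basis \<Longrightarrow> locdata (t b) x0 \<sigma> r1 C1" by blast
    obtain r2 C2 where 2: "r2 > 0" "C2 \<ge> 0" "locdata G x0 \<sigma> r2 C2"
      using CH1_locdata[OF CH_mono[OF G \<sigma>(1,3)] \<sigma>(1,2) x0] by blast
    obtain r3 M C3 where 3: "r3 > 0" "r3 \<le> 1" "M \<ge> 0" "C3 \<ge> 0" "ball x0 r3 \<subseteq> \<Omega>" "\<And>y. y \<in> ball x0 r3 \<Longrightarrow> norm (grad Z y) \<le> M"
      "\<And>y z. y \<in> ball x0 r3 \<Longrightarrow> z \<in> ball x0 r3 \<Longrightarrow> norm (grad Z y - grad Z z) \<le> C3 * norm (y - z) powr \<sigma>"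
      by (rule lhol_bounded[OF gZ \<sigma>(1) x0]) (rule that)
    define r where "r = min r1 (min r2 r3)"
    have r: "r > 0" "r \<le> r1" "r \<le> r2" "r \<le> r3" using 1 2 3 by (auto simp: r_def)
    define D where "D = real DIM('b \<times> 'b)"
    define K where "K = D * (M * C1 + C3 * C1 + C1) + C2"
    have D: "D \<ge> 0" by (simp add: D_def)
    have K: "K \<ge> 0" using D 1 2 3 by (simp add: K_def)
    have "locally_diff_hyp \<epsilon> K \<sigma> Z x0 (r / 8) (r / 8)"
      unfolding locally_diff_hyp_def
    proof (intro conjI ballI allI impI K)
      show "r / 8 > 0" "r / 8 > 0" using r by auto
      fix e h assume e: "e \<in> (Basis::(real^2) set)" and h: "0 < h \<and> h < r / 8"
      let ?S = "Sq x0 (r / 8)"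
      have inb: "x + \<tau> *\<^sub>R e \<in> ball x0 r" if "x \<in> ?S" "0 \<le> \<tau>" "\<tau> \<le> h" for x \<tau>
        using that h r by (intro Sq_step_ball[OF that(1) _ that(2) _ e]) auto
      have ib: "x \<in> ball x0 r1" "x \<in> ball x0 r2" "x \<in> ball x0 r3" "x + h *\<^sub>R e \<in> ball x0 r3" "x \<in> \<Omega>" "x + h *\<^sub>R e \<in> \<Omega>" if "x \<in> ?S" for x
        using inb[OF that, of 0] inb[OF that, of h] h r 3(5) by auto
      have hh: "0 < h \<and> h < r1" "0 < h \<and> h < r2" using h r by auto
      define d where "d = dq (grad Z) e h"
      define Nx where "Nx x = (\<Sum>b\<in>Basis. (grad Z (x + h *\<^sub>R e) \<bullet> b) *\<^sub>R dq (t b) e h x) + dq G e h x" for x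
      have deq: "d x = lapp t x (d x) + Nx x" if x: "x \<in> ?S" for x
      proof -
        have "d x = (1 / h) *\<^sub>R ((lapp t (x + h *\<^sub>R e) (grad Z (x + h *\<^sub>R e)) + G (x + h *\<^sub>R e)) - (lapp t x (grad Z x) + G x))"
          unfolding d_def dq_def using eq[OF ib(5)[OF x]] eq[OF ib(6)[OF x]] by simp
        also have "\<dots> = (1 / h) *\<^sub>R lapp t x (grad Z (x + h *\<^sub>R e) - grad Z x)
            + (1 / h) *\<^sub>R (lapp t (x + h *\<^sub>R e) (grad Z (x + h *\<^sub>R e)) - lapp t x (grad Z (x + h *\<^sub>R e))) + dq G e h x"
          by (simp add: lapp_linear dq_def scaleR_add_right scaleR_diff_right)
        also have "(1 / h) *\<^sub>R lapp t x (grad Z (x + h *\<^sub>R e) - grad Z x) = lapp t x (d x)"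
          by (simp only: d_def dq_def lapp_linear)
        also have "(1 / h) *\<^sub>R (lapp t (x + h *\<^sub>R e) (grad Z (x + h *\<^sub>R e)) - lapp t x (grad Z (x + h *\<^sub>R e)))
            = (\<Sum>b\<in>Basis. (grad Z (x + h *\<^sub>R e) \<bullet> b) *\<^sub>R dq (t b) e h x)"
          unfolding lapp_def dq_def sum_subtractf[symmetric] scaleR_sum_right
          by (intro sum.cong) (auto simp: algebra_simps)
        finally show ?thesis by (simp add: Nx_def add.assoc)
      qed
      have bb: "\<bar>z \<bullet> b\<bar> \<le> norm z" if "b \<in> Basis" for z b :: "'b \<times> 'b" using that by (rule Basis_le_norm)
      have Nb: "norm (Nx x) \<le> K" if x: "x \<in> ?S" for x
      proof -
        have "norm (\<Sum>b\<in>Basis. (grad Z (x + h *\<^sub>R e) \<bullet> b) *\<^sub>R dq (t b) e h x) \<le> (\<Sum>b\<in>(Basis::('b\<times>'b) set). M * C1)"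
        proof (rule sum_norm_le)
          fix b :: "'b \<times> 'b" assume b: "b \<in> Basis"
          have "norm (dq (t b) e h x) \<le> C1" using 1(3)[OF b] e hh(1) ib(1)[OF x] unfolding locdata_def by blast
          moreover have "\<bar>grad Z (x + h *\<^sub>R e) \<bullet> b\<bar> \<le> M" using bb[OF b] 3(6)[OF ib(4)[OF x]] by (rule order.trans)
          ultimately show "norm ((grad Z (x + h *\<^sub>R e) \<bullet> b) *\<^sub>R dq (t b) e h x) \<le> M * C1"
            using 3(3) by (simp add: mult_mono)
        qed
        also have "\<dots> = D * (M * C1)" by (simp add: D_def)
        finally have "norm (\<Sum>b\<in>Basis. (grad Z (x + h *\<^sub>R e) \<bullet> b) *\<^sub>R dq (t b) e h x) \<le> D * (M * C1)" .
        moreover have "norm (dq G e h x) \<le> C2" using 2(3) e hh(2) ib(2)[OF x] unfolding locdata_def by blast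
        ultimately have "norm (Nx x) \<le> D * (M * C1) + C2" unfolding Nx_def by (rule order.trans[OF norm_triangle_ineq add_mono])
        also have "\<dots> \<le> K" unfolding K_def using D 1(2) 3(4) by (intro add_right_mono mult_left_mono) auto
        finally show ?thesis .
      qed
      show "diff_hyp \<epsilon> K \<sigma> ?S (dq (grad Z) e h)"
        unfolding diff_hyp_def d_def[symmetric]
      proof (intro conjI ballI)
        fix x assume x: "x \<in> ?S"
        show "\<exists>a. c * (norm a)\<^sup>2 \<le> Q a \<and> norm (d x - a) \<le> \<epsilon> * norm (d x) + K"
        proof (intro exI[of _ "lapp t x (d x)"] conjI co ib(5)[OF x])
          have "norm (d x - lapp t x (d x)) = norm (Nx x)" using deq[OF x] by (metis add_diff_cancel_left')
          then show "norm (d x - lapp t x (d x)) \<le> \<epsilon> * norm (d x) + K" using Nb[OF x] \<epsilon> by (simp add: add_increasing)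
        qed
        fix y assume y: "y \<in> ?S"
        let ?p = "norm (y - x) powr \<sigma>"
        \<comment> \<open>The witness takes T at \<open>y\<close>: the variation of the coefficients
          then multiplies \<open>d x\<close>, the vector that appears in the error term of
          \<open>diff_hyp\<close>.\<close>
        show "\<exists>a. c * (norm a)\<^sup>2 \<le> Q a \<and> norm (d y - d x - a) \<le> \<epsilon> * norm (d y - d x) + K * ?p * (norm (d x) + 1)"
        proof (intro exI[of _ "lapp t y (d y - d x)"] conjI co ib(5)[OF y])
          have e1: "d y - d x - lapp t y (d y - d x) = (lapp t y (d x) - lapp t x (d x)) + (Nx y - Nx x)"
          proof -
            have "d y - d x = (lapp t y (d y) + Nx y) - (lapp t x (d x) + Nx x)" using deq[OF x] deq[OF y] by simp
            moreover have "lapp t y (d y - d x) = lapp t y (d y) - lapp t y (d x)" by (rule lapp_linear)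
            ultimately show ?thesis by (simp only:) simp
          qed
          have n1: "norm (lapp t y (d x) - lapp t x (d x)) \<le> D * (norm (d x) * (C1 * ?p))"
          proof -
            have "lapp t y (d x) - lapp t x (d x) = (\<Sum>b\<in>Basis. (d x \<bullet> b) *\<^sub>R (t b y - t b x))"
              by (simp add: lapp_def sum_subtractf scaleR_diff_right)
            also have "norm \<dots> \<le> (\<Sum>b\<in>(Basis::('b\<times>'b) set). norm (d x) * (C1 * ?p))"
            proof (rule sum_norm_le)
              fix b :: "'b \<times> 'b" assume b: "b \<in> Basis"
              have "norm (t b y - t b x) \<le> C1 * ?p" using 1(3)[OF b] ib(1)[OF x] ib(1)[OF y] unfolding locdata_def by blast
              then show "norm ((d x \<bullet> b) *\<^sub>R (t b y - t b x)) \<le> norm (d x) * (C1 * ?p)"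
                using bb[OF b, of "d x"] by (simp add: mult_mono)
            qed
            finally show ?thesis by (simp add: D_def)
          qed
          have n2: "norm (Nx y - Nx x) \<le> D * (M * (C1 * ?p) + C3 * ?p * C1) + C2 * ?p"
          proof -
            define A where "A = (\<Sum>b\<in>Basis. (grad Z (y + h *\<^sub>R e) \<bullet> b) *\<^sub>R (dq (t b) e h y - dq (t b) e h x)
                + ((grad Z (y + h *\<^sub>R e) - grad Z (x + h *\<^sub>R e)) \<bullet> b) *\<^sub>R dq (t b) e h x)"
            have eqA: "Nx y - Nx x = A + (dq G e h y - dq G e h x)"
              unfolding Nx_def A_def by (simp add: sum_subtractf sum.distrib inner_diff_left scaleR_diff_right scaleR_diff_left)
            have nG: "norm (dq G e h y - dq G e h x) \<le> C2 * ?p"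
              using 2(3) e hh(2) ib(2)[OF x] ib(2)[OF y] unfolding locdata_def by blast
            have "norm A \<le> (\<Sum>b\<in>(Basis::('b\<times>'b) set). M * (C1 * ?p) + C3 * ?p * C1)"
              unfolding A_def
            proof (rule sum_norm_le)
              fix b :: "'b \<times> 'b" assume b: "b \<in> Basis"
              have "norm (dq (t b) e h y - dq (t b) e h x) \<le> C1 * ?p"
                using 1(3)[OF b] e hh(1) ib(1)[OF x] ib(1)[OF y] unfolding locdata_def by blast
              moreover have "norm (dq (t b) e h x) \<le> C1" using 1(3)[OF b] e hh(1) ib(1)[OF x] unfolding locdata_def by blast
              moreover have "\<bar>grad Z (y + h *\<^sub>R e) \<bullet> b\<bar> \<le> M" using bb[OF b] 3(6)[OF ib(4)[OF y]] by (rule order.trans)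
              moreover have "\<bar>(grad Z (y + h *\<^sub>R e) - grad Z (x + h *\<^sub>R e)) \<bullet> b\<bar> \<le> C3 * ?p"
                using 3(7)[OF ib(4)[OF y] ib(4)[OF x]] by (intro order.trans[OF bb[OF b]]) simp
              ultimately show "norm ((grad Z (y + h *\<^sub>R e) \<bullet> b) *\<^sub>R (dq (t b) e h y - dq (t b) e h x)
                + ((grad Z (y + h *\<^sub>R e) - grad Z (x + h *\<^sub>R e)) \<bullet> b) *\<^sub>R dq (t b) e h x) \<le> M * (C1 * ?p) + C3 * ?p * C1"
                using 3(3,4) by (intro order.trans[OF norm_triangle_ineq add_mono]) (auto intro!: mult_mono)
            qed
            then have nA: "norm A \<le> D * (M * (C1 * ?p) + C3 * ?p * C1)" by (simp only: sum_constant D_def)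
            show ?thesis unfolding eqA by (rule order.trans[OF norm_triangle_ineq add_mono[OF nA nG]])
          qed
          have "norm (d y - d x - lapp t y (d y - d x)) \<le> D * (norm (d x) * (C1 * ?p)) + (D * (M * (C1 * ?p) + C3 * ?p * C1) + C2 * ?p)"
            unfolding e1 using n1 n2 by (rule order.trans[OF norm_triangle_ineq add_mono])
          also have "\<dots> = (D * C1 * norm (d x) + (D * (M * C1 + C3 * C1) + C2)) * ?p" by (simp add: algebra_simps)
          also have "\<dots> \<le> (K * (norm (d x) + 1)) * ?p"
          proof (rule mult_right_mono)
            have "D * C1 \<le> K" "D * (M * C1 + C3 * C1) + C2 \<le> K"
              unfolding K_def using D 1(2) 2(2) 3(3,4) by (auto simp: distrib_left intro!: add_nonneg_nonneg)
            then have "D * C1 * norm (d x) + (D * (M * C1 + C3 * C1) + C2) \<le> K * norm (d x) + K"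
              by (intro add_mono mult_right_mono) auto
            then show "D * C1 * norm (d x) + (D * (M * C1 + C3 * C1) + C2) \<le> K * (norm (d x) + 1)" by (simp add: algebra_simps)
          qed simp
          also have "\<dots> = K * ?p * (norm (d x) + 1)" by simp
          also have "\<dots> \<le> \<epsilon> * norm (d y - d x) + K * ?p * (norm (d x) + 1)" using \<epsilon> by simp
          finally show "norm (d y - d x - lapp t y (d y - d x)) \<le> \<epsilon> * norm (d y - d x) + K * ?p * (norm (d x) + 1)" .
        qed
      qed
    qed
    then show ?thesis by blast
  qed
  then have "CH (Suc (Suc 0)) \<mu> \<Omega> Z" by (intro step Z') blast
  then show ?thesis using \<mu> by blast
qed

end

section \<open>Second derivatives for the nonlinear inclusion\<close>

lemma frechet_lapp:
  fixes \<Phi> :: "'g::euclidean_space \<Rightarrow> 'g"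
  assumes "\<Phi> differentiable (at z)"
  shows "frechet_derivative \<Phi> (at z) w = lapp (\<lambda>b z. frechet_derivative \<Phi> (at z) b) z w"
proof -
  have l: "linear (frechet_derivative \<Phi> (at z))" using frechetD[OF assms] by (rule has_derivative_linear)
  have "frechet_derivative \<Phi> (at z) (\<Sum>b\<in>Basis. (w \<bullet> b) *\<^sub>R b) = lapp (\<lambda>b z. frechet_derivative \<Phi> (at z) b) z w"
    unfolding lapp_def by (simp add: linear_sum[OF l] linear_cmul[OF l])
  then show ?thesis by (simp add: euclidean_representation)
qed

lemma derivative_lipschitz:
  fixes \<Phi> :: "'g::euclidean_space \<Rightarrow> 'g"
  assumes "CH (Suc 0) 1 UNIV \<Phi>"
  shows "\<exists>r>0. \<exists>M\<ge>0. \<forall>y\<in>ball z0 r. \<forall>z\<in>ball z0 r. \<forall>w.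
    norm (frechet_derivative \<Phi> (at y) w - frechet_derivative \<Phi> (at z) w) \<le> M * norm (y - z) * norm w"
proof -
  have "\<exists>r>0. \<exists>C\<ge>0. \<forall>b\<in>(Basis::'g set). \<forall>y\<in>ball z0 r. \<forall>z\<in>ball z0 r.
    norm (frechet_derivative \<Phi> (at y) b - frechet_derivative \<Phi> (at z) b) \<le> C * norm (y - z)"
  proof (rule finite_uniform[OF finite_Basis])
    fix b :: 'g assume "b \<in> Basis"
    then have l: "lhol 1 UNIV (\<lambda>z. frechet_derivative \<Phi> (at z) b)" using assms by simp
    obtain r C where "r > 0" "C \<ge> 0" "ball z0 r \<subseteq> UNIV"
      "\<And>y z. y \<in> ball z0 r \<Longrightarrow> z \<in> ball z0 r \<Longrightarrow>
       norm (frechet_derivative \<Phi> (at y) b - frechet_derivative \<Phi> (at z) b) \<le> C * norm (y - z) powr 1"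
      by (rule lholD[OF l UNIV_I]) (rule that)
    then show "\<exists>r>0. \<exists>C\<ge>0. \<forall>y\<in>ball z0 r. \<forall>z\<in>ball z0 r.
      norm (frechet_derivative \<Phi> (at y) b - frechet_derivative \<Phi> (at z) b) \<le> C * norm (y - z)"
      by (intro exI[of _ r] conjI exI[of _ C]) auto
  next
    fix b :: 'g and r C r' C' :: real
    assume *: "\<forall>y\<in>ball z0 r. \<forall>z\<in>ball z0 r. norm (frechet_derivative \<Phi> (at y) b - frechet_derivative \<Phi> (at z) b) \<le> C * norm (y - z)"
      "r' \<le> r" "C \<le> C'"
    show "\<forall>y\<in>ball z0 r'. \<forall>z\<in>ball z0 r'. norm (frechet_derivative \<Phi> (at y) b - frechet_derivative \<Phi> (at z) b) \<le> C' * norm (y - z)"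
    proof (intro ballI)
      fix y z assume "y \<in> ball z0 r'" "z \<in> ball z0 r'"
      then have "y \<in> ball z0 r" "z \<in> ball z0 r" using *(2) by auto
      then have "norm (frechet_derivative \<Phi> (at y) b - frechet_derivative \<Phi> (at z) b) \<le> C * norm (y - z)" using *(1) by blast
      also have "\<dots> \<le> C' * norm (y - z)" using *(3) by (rule mult_right_mono) simp
      finally show "norm (frechet_derivative \<Phi> (at y) b - frechet_derivative \<Phi> (at z) b) \<le> C' * norm (y - z)" .
    qed
  qed
  then obtain r C where r: "r > 0" "C \<ge> 0" and C: "\<And>b y z. b \<in> Basis \<Longrightarrow> y \<in> ball z0 r \<Longrightarrow> z \<in> ball z0 r \<Longrightarrow>
    norm (frechet_derivative \<Phi> (at y) b - frechet_derivative \<Phi> (at z) b) \<le> C * norm (y - z)" by blast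
  have d: "\<Phi> differentiable (at y)" for y using assms by simp
  have "norm (frechet_derivative \<Phi> (at y) w - frechet_derivative \<Phi> (at z) w) \<le> (real DIM('g) * C) * norm (y - z) * norm w"
    if "y \<in> ball z0 r" "z \<in> ball z0 r" for y z w
  proof -
    have "linear (\<lambda>w. frechet_derivative \<Phi> (at y) w - frechet_derivative \<Phi> (at z) w)"
      by (intro linear_compose_sub has_derivative_linear[OF frechetD[OF d]])
    from norm_linear_Basis_bound[OF this C[OF _ that]] show ?thesis by (simp add: mult.assoc)
  qed
  then show ?thesis using r by (intro exI[of _ r] conjI exI[of _ "real DIM('g) * C"]) auto
qed

lemma dq_has_derivative:
  assumes "Z differentiable (at x)" "Z differentiable (at (x + h *\<^sub>R e))"
  shows "(dq Z e h has_derivative dmap (dq (grad Z) e h x)) (at x)"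
proof -
  from has_derivative_scaleR_right[OF has_derivative_shift_diff[OF has_derivative_grad[OF assms(2)] has_derivative_grad[OF assms(1)], of 0], of "1 / h"]
  show ?thesis by (simp add: dq_def[abs_def] dmap_scaleR[abs_def])
qed

lemma dq_converges:
  fixes F :: "real^2 \<Rightarrow> 'c::euclidean_space"
  assumes F: "CH (Suc 0) \<sigma> \<Omega> F" and \<sigma>: "0 < \<sigma>" "\<sigma> \<le> 1" and x0: "x0 \<in> \<Omega>"
  shows "\<exists>r>0. \<exists>C\<ge>0. \<forall>e\<in>Basis. \<forall>h x. 0 < h \<and> h < r \<and> x \<in> Sq x0 r \<longrightarrow>
    x \<in> \<Omega> \<and> x + h *\<^sub>R e \<in> \<Omega> \<and> norm (dq F e h x - frechet_derivative F (at x) e) \<le> C * h powr \<sigma>"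
proof -
  have gF: "lhol \<sigma> \<Omega> (grad F)" and Fd: "\<And>x. x \<in> \<Omega> \<Longrightarrow> F differentiable (at x)"
    using F unfolding CH_Suc_grad CH.simps by blast+
  obtain r M C where r: "r > 0" "r \<le> 1" "M \<ge> 0" "C \<ge> 0" "ball x0 r \<subseteq> \<Omega>" "\<And>y. y \<in> ball x0 r \<Longrightarrow> norm (grad F y) \<le> M"
    "\<And>y z. y \<in> ball x0 r \<Longrightarrow> z \<in> ball x0 r \<Longrightarrow> norm (grad F y - grad F z) \<le> C * norm (y - z) powr \<sigma>"
    by (rule lhol_bounded[OF gF \<sigma>(1) x0]) (rule that)
  show ?thesis
  proof (rule exI[of _ "r / 8"], rule conjI, use r in \<open>simp\<close>, rule exI[of _ C], intro conjI ballI allI impI)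
    show "C \<ge> 0" by (rule r)
    fix e h x assume e: "e \<in> (Basis::(real^2) set)" and hx: "0 < h \<and> h < r / 8 \<and> x \<in> Sq x0 (r / 8)"
    have h: "0 < h" and x: "x \<in> Sq x0 (r / 8)" using hx by auto
    have ne: "norm e = 1" using e by simp
    have i: "x + \<tau> *\<^sub>R e \<in> ball x0 r" if "0 \<le> \<tau>" "\<tau> \<le> h" for \<tau>
      using that hx r e by (intro Sq_step_ball[OF x]) auto
    have i0: "x \<in> ball x0 r" using i[of 0] h by simp
    show "x \<in> \<Omega>" using i0 r(5) by blast
    show "x + h *\<^sub>R e \<in> \<Omega>" using i[of h] h r(5) by auto
    have der: "(F has_derivative dmap (grad F y)) (at y)" if "y \<in> ball x0 r" for y
      using that r(5) by (intro has_derivative_grad Fd) auto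
    show "norm (dq F e h x - frechet_derivative F (at x) e) \<le> C * h powr \<sigma>"
      unfolding dq_def
    proof (rule dq_est[OF h, where D="\<lambda>y. dmap (grad F y)"])
      fix \<tau> assume \<tau>: "0 \<le> \<tau>" "\<tau> \<le> h"
      show "(F has_derivative dmap (grad F (x + \<tau> *\<^sub>R e))) (at (x + \<tau> *\<^sub>R e))" by (rule der[OF i[OF \<tau>]])
      have "dmap (grad F x) e = frechet_derivative F (at x) e" using \<open>x \<in> \<Omega>\<close> by (intro dmap_grad Fd)
      then have "norm (dmap (grad F (x + \<tau> *\<^sub>R e)) e - frechet_derivative F (at x) e) = norm (dmap (grad F (x + \<tau> *\<^sub>R e) - grad F x) e)"
        by (simp add: dmap_diff)
      also have "\<dots> \<le> norm (grad F (x + \<tau> *\<^sub>R e) - grad F x)" using norm_dmap_le[of _ e] ne by (metis mult_1)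
      also have "\<dots> \<le> C * norm (x + \<tau> *\<^sub>R e - x) powr \<sigma>" by (rule r(7)[OF i[OF \<tau>] i0])
      also have "\<dots> \<le> C * h powr \<sigma>" using \<tau> ne r(4) \<sigma> by (intro mult_left_mono powr_mono2) auto
      finally show "norm (dmap (grad F (x + \<tau> *\<^sub>R e)) e - frechet_derivative F (at x) e) \<le> C * h powr \<sigma>" .
    qed
  qed
qed

text \<open>Symmetry of second derivatives: \<open>dq Z e h\<close> has gradient
  \<open>dq (grad Z) e h\<close>. Both converge as h tends to 0, the gradients uniformly, so the
  limits stand in the same relation.\<close>

lemma CH2_symmetric:
  fixes Z :: "real^2 \<Rightarrow> 'b::euclidean_space"
  assumes Z: "CH (Suc (Suc 0)) \<sigma> \<Omega> Z" and \<sigma>: "0 < \<sigma>" "\<sigma> \<le> 1" and x0: "x0 \<in> \<Omega>" and e: "e \<in> Basis"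
  shows "grad (\<lambda>x. frechet_derivative Z (at x) e) x0 = frechet_derivative (grad Z) (at x0) e"
proof -
  have gZ: "CH (Suc 0) \<sigma> \<Omega> (grad Z)" and Zd: "\<And>x. x \<in> \<Omega> \<Longrightarrow> Z differentiable (at x)"
    using Z unfolding CH_Suc_grad[of "Suc 0"] by blast+
  obtain r1 C1 where 1: "r1 > 0" "C1 \<ge> 0" "\<And>h x. 0 < h \<Longrightarrow> h < r1 \<Longrightarrow> x \<in> Sq x0 r1 \<Longrightarrow>
    x \<in> \<Omega> \<and> x + h *\<^sub>R e \<in> \<Omega> \<and> norm (dq (grad Z) e h x - frechet_derivative (grad Z) (at x) e) \<le> C1 * h powr \<sigma>"
    using dq_converges[OF gZ \<sigma> x0] e by blast
  obtain r2 C2 where 2: "r2 > 0" "C2 \<ge> 0" "\<And>h x. 0 < h \<Longrightarrow> h < r2 \<Longrightarrow> x \<in> Sq x0 r2 \<Longrightarrow>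
    x \<in> \<Omega> \<and> x + h *\<^sub>R e \<in> \<Omega> \<and> norm (dq Z e h x - frechet_derivative Z (at x) e) \<le> C2 * h powr \<sigma>"
    using dq_converges[OF CH_Suc_imp_CH[OF Z \<sigma>] \<sigma> x0] e by blast
  define r where "r = min r1 r2"
  have r: "r > 0" "r \<le> r1" "r \<le> r2" using 1 2 by (auto simp: r_def)
  let ?S = "Sq x0 r"
  have sub: "?S \<subseteq> Sq x0 r1" "?S \<subseteq> Sq x0 r2" using r by (auto intro!: Sq_mono)
  define hn where "hn n = r / (real n + 2)" for n
  have hn: "0 < hn n" "hn n < r" for n using r(1) by (auto simp: hn_def divide_simps)
  have hn0: "hn \<longlonglongrightarrow> 0"
  proof -
    have "(\<lambda>n. r / real (n + 2)) \<longlonglongrightarrow> 0" by (rule LIMSEQ_ignore_initial_segment[OF lim_const_over_n, of r 2])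
    then show ?thesis by (simp add: hn_def[abs_def] add.commute)
  qed
  have pw: "(\<lambda>n. C * hn n powr \<sigma>) \<longlonglongrightarrow> 0" for C
  proof (rule tendsto_mult_right_zero)
    show "(\<lambda>n. hn n powr \<sigma>) \<longlonglongrightarrow> 0"
      using hn(1) \<sigma>(1) by (intro tendsto_zero_powrI[OF hn0 tendsto_const]) (auto intro: less_imp_le always_eventually)
  qed
  have lim: "(\<lambda>n. dq Z e (hn n) x) \<longlonglongrightarrow> frechet_derivative Z (at x) e" if "x \<in> ?S" for x
  proof (rule LIM_zero_cancel, rule Lim_null_comparison[OF _ pw[of C2]])
    show "\<forall>\<^sub>F n in sequentially. norm (dq Z e (hn n) x - frechet_derivative Z (at x) e) \<le> C2 * hn n powr \<sigma>"
      using 2(3)[OF hn(1) order.strict_trans2[OF hn(2) r(3)] subsetD[OF sub(2) that]] by (intro always_eventually allI) blast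
  qed
  have "\<exists>k. \<forall>x\<in>?S. (\<lambda>n. dq Z e (hn n) x) \<longlonglongrightarrow> k x \<and> (k has_derivative dmap (frechet_derivative (grad Z) (at x) e)) (at x within ?S)"
  proof (rule has_derivative_sequence[OF convex_Sq])
    show "(dq Z e (hn n) has_derivative dmap (dq (grad Z) e (hn n) x)) (at x within ?S)" if "x \<in> ?S" for n x
    proof (rule has_derivative_at_withinI[OF dq_has_derivative])
      have "x \<in> \<Omega> \<and> x + hn n *\<^sub>R e \<in> \<Omega>"
        using 2(3)[OF hn(1) order.strict_trans2[OF hn(2) r(3)] subsetD[OF sub(2) that]] by blast
      then show "Z differentiable (at x)" "Z differentiable (at (x + hn n *\<^sub>R e))" using Zd by auto
    qed
    show "\<forall>\<^sub>F n in sequentially. \<forall>x\<in>?S. \<forall>h. norm (dmap (dq (grad Z) e (hn n) x) h - dmap (frechet_derivative (grad Z) (at x) e) h) \<le> \<eta> * norm h"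
      if "\<eta> > 0" for \<eta>
      using order_tendstoD(2)[OF pw[of C1] that]
    proof eventually_elim
      case (elim n)
      show ?case
      proof (intro ballI allI)
        fix x h :: "real^2" assume "x \<in> ?S"
        then have "norm (dq (grad Z) e (hn n) x - frechet_derivative (grad Z) (at x) e) \<le> \<eta>"
          using 1(3)[OF hn(1) order.strict_trans2[OF hn(2) r(2)] subsetD[OF sub(1)]] elim by (meson less_imp_le order.trans)
        then have "norm h * norm (dq (grad Z) e (hn n) x - frechet_derivative (grad Z) (at x) e) \<le> norm h * \<eta>"
          by (rule mult_left_mono) simp
        then show "norm (dmap (dq (grad Z) e (hn n) x) h - dmap (frechet_derivative (grad Z) (at x) e) h) \<le> \<eta> * norm h"
          unfolding dmap_diff[symmetric] mult.commute[of \<eta>] by (rule order.trans[OF norm_dmap_le])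
      qed
    qed
    show "x0 \<in> ?S" using r by simp
    then show "(\<lambda>n. dq Z e (hn n) x0) \<longlonglongrightarrow> frechet_derivative Z (at x0) e" by (rule lim)
  qed
  then obtain k where k: "\<And>x. x \<in> ?S \<Longrightarrow> (\<lambda>n. dq Z e (hn n) x) \<longlonglongrightarrow> k x"
    "\<And>x. x \<in> ?S \<Longrightarrow> (k has_derivative dmap (frechet_derivative (grad Z) (at x) e)) (at x within ?S)" by blast
  have kF: "k x = frechet_derivative Z (at x) e" if "x \<in> ?S" for x
    using k(1)[OF that] lim[OF that] by (rule LIMSEQ_unique)
  have x0S: "x0 \<in> ?S" using r by simp
  have "((\<lambda>x. frechet_derivative Z (at x) e) has_derivative dmap (frechet_derivative (grad Z) (at x0) e)) (at x0 within ?S)"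
    using k(2)[OF x0S] by (rule has_derivative_transform[rotated 2]) (use kF x0S in auto)
  moreover have "x0 \<in> interior ?S" using r by (intro interior_Sq[of x0 x0 0]) auto
  ultimately have "((\<lambda>x. frechet_derivative Z (at x) e) has_derivative dmap (frechet_derivative (grad Z) (at x0) e)) (at x0)"
    by (simp only: at_within_interior)
  then show ?thesis by (rule grad_eq)
qed

context null_form
begin

text \<open>With p = h d the increment of the gradient, the inclusion reads p = \<Phi>(z + p) -
  \<Phi>(z), and its linear part D\<Phi>(z) p is coercive. The remainder is small only relative to
  p, since d is not known to be bounded uniformly in h; this is what the \<epsilon> in
  \<open>diff_hyp\<close> is for. Continuity of the gradient makes it small on a small
  square.\<close>

theorem nonlinear_step:
  fixes \<Phi> :: "'b \<times> 'b \<Rightarrow> 'b \<times> 'b"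
  assumes \<sigma>0: "0 < \<sigma>0" "\<sigma>0 \<le> 1" and \<Phi>: "CH (Suc 0) 1 UNIV \<Phi>" and U: "CH (Suc 0) \<sigma>0 \<Omega> U"
    and eq: "\<And>x. x \<in> \<Omega> \<Longrightarrow> grad U x = \<Phi> (grad U x)"
    and co: "\<And>x w. x \<in> \<Omega> \<Longrightarrow> Q (frechet_derivative \<Phi> (at (grad U x)) w) \<ge> c * (norm (frechet_derivative \<Phi> (at (grad U x)) w))\<^sup>2"
  shows "\<exists>\<mu>>0. \<mu> \<le> 1 / 2 \<and> CH (Suc (Suc 0)) \<mu> \<Omega> U"
proof -
  obtain N where N: "N \<ge> 1" "2 / (2 * real N + 1) \<le> \<sigma>0" using small_powr_index[OF \<sigma>0(1)] by blast
  define \<sigma> where "\<sigma> = 2 / (2 * real N + 1)"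
  have \<sigma>: "0 < \<sigma>" "\<sigma> \<le> 1" "\<sigma> \<le> \<sigma>0" using N \<sigma>0 by (auto simp: \<sigma>_def)
  obtain \<epsilon> \<mu> where \<epsilon>: "\<epsilon> > 0" and \<mu>: "\<mu> > 0" "\<mu> \<le> 1 / 2" and step:
    "\<And>\<Omega> Z. CH (Suc 0) \<sigma> \<Omega> Z \<Longrightarrow> \<forall>x0\<in>\<Omega>. \<exists>R h0 K. locally_diff_hyp \<epsilon> K \<sigma> Z x0 R h0 \<Longrightarrow> CH (Suc (Suc 0)) \<mu> \<Omega> Z"
    using raise_step[OF N(1)] unfolding \<sigma>_def by blast
  have U': "CH (Suc 0) \<sigma> \<Omega> U" by (rule CH_mono[OF U \<sigma>(1,3)])
  have gU: "lhol \<sigma> \<Omega> (grad U)" using U' unfolding CH_Suc_grad CH.simps by blast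
  let ?D = "\<lambda>z. frechet_derivative \<Phi> (at z)"
  have Pd: "(\<Phi> has_derivative ?D z) (at z)" for z using \<Phi> unfolding CH.simps by (intro frechetD) blast
  have Dlin: "linear (?D z)" for z by (rule has_derivative_linear[OF Pd])
  have "\<exists>R h0 K. locally_diff_hyp \<epsilon> K \<sigma> U x0 R h0" if x0: "x0 \<in> \<Omega>" for x0
  proof -
    obtain r1 M where 1: "r1 > 0" "M \<ge> 0" and M: "\<And>y z w. y \<in> ball (grad U x0) r1 \<Longrightarrow> z \<in> ball (grad U x0) r1 \<Longrightarrow>
      norm (?D y w - ?D z w) \<le> M * norm (y - z) * norm w"
      using derivative_lipschitz[OF \<Phi>, of "grad U x0"] by blast
    \<comment> \<open>On the ball of radius \<delta> around \<open>grad U x0\<close> the derivative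
      of \<Phi> varies by at most 2 \<delta> M, which is at most \<epsilon>.\<close>
    define \<delta> where "\<delta> = min r1 (\<epsilon> / (2 * (M + 1)))"
    have \<delta>: "\<delta> > 0" "\<delta> \<le> r1" "M * (2 * \<delta>) \<le> \<epsilon>"
    proof -
      have "\<delta> * (2 * (M + 1)) \<le> \<epsilon>" using 1 by (subst pos_le_divide_eq[symmetric]) (auto simp: \<delta>_def)
      moreover have "0 < \<delta>" using 1 \<epsilon> by (simp add: \<delta>_def)
      ultimately show "M * (2 * \<delta>) \<le> \<epsilon>" "\<delta> > 0" by (auto simp: algebra_simps)
    qed (simp add: \<delta>_def)
    obtain r2 M2 C where 2: "r2 > 0" "r2 \<le> 1" "M2 \<ge> 0" "C \<ge> 0" "ball x0 r2 \<subseteq> \<Omega>" "\<And>y. y \<in> ball x0 r2 \<Longrightarrow> norm (grad U y) \<le> M2"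
      "\<And>y z. y \<in> ball x0 r2 \<Longrightarrow> z \<in> ball x0 r2 \<Longrightarrow> norm (grad U y - grad U z) \<le> C * norm (y - z) powr \<sigma>"
      by (rule lhol_bounded[OF gU \<sigma>(1) x0]) (rule that)
    have "continuous (at x0) (grad U)" using lhol_continuous[OF gU \<sigma>(1)] lhol_open[OF gU] x0 by (simp add: continuous_on_eq_continuous_at)
    then obtain r3 where 3: "r3 > 0" "\<And>y. dist y x0 < r3 \<Longrightarrow> dist (grad U y) (grad U x0) < \<delta>"
      unfolding continuous_at_eps_delta using \<delta>(1) by (metis dist_norm)
    define r where "r = min r2 r3"
    have r: "r > 0" "r \<le> r2" "r \<le> r3" using 2 3 by (auto simp: r_def)
    define K where "K = M * C"
    have K: "K \<ge> 0" using 1 2 by (simp add: K_def)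
    have "locally_diff_hyp \<epsilon> K \<sigma> U x0 (r / 8) (r / 8)"
      unfolding locally_diff_hyp_def
    proof (intro conjI ballI allI impI K)
      show "r / 8 > 0" "r / 8 > 0" using r by auto
      fix e h assume e: "e \<in> (Basis::(real^2) set)" and h': "0 < h \<and> h < r / 8"
      then have h: "h > 0" by simp
      let ?S = "Sq x0 (r / 8)" and ?B = "ball (grad U x0) \<delta>"
      have inb: "x + \<tau> *\<^sub>R e \<in> ball x0 r" if "x \<in> ?S" "0 \<le> \<tau>" "\<tau> \<le> h" for x \<tau>
        using that h' r by (intro Sq_step_ball[OF that(1) _ that(2) _ e]) auto
      have i: "x \<in> ball x0 r2" "x + h *\<^sub>R e \<in> ball x0 r2" "grad U x \<in> ?B" "grad U (x + h *\<^sub>R e) \<in> ?B" "x \<in> \<Omega>" "x + h *\<^sub>R e \<in> \<Omega>"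
        if "x \<in> ?S" for x
        using inb[OF that, of 0] inb[OF that, of h] h r 2(5) 3(2)[of x] 3(2)[of "x + h *\<^sub>R e"] by (auto simp: dist_commute)
      define d where "d = dq (grad U) e h"
      have hd: "grad U (x + h *\<^sub>R e) - grad U x = h *\<^sub>R d x" for x using h by (simp add: d_def dq_def)
      have dP: "h *\<^sub>R d x = \<Phi> (grad U (x + h *\<^sub>R e)) - \<Phi> (grad U x)" if "x \<in> ?S" for x
        using hd[of x] eq[OF i(5)[OF that]] eq[OF i(6)[OF that]] by simp
      have B2: "norm (y - z) \<le> 2 * \<delta>" if "y \<in> ?B" "z \<in> ?B" for y z
        using that dist_triangle3[of y z "grad U x0"] by (simp add: dist_norm)
      have Br: "y \<in> ball (grad U x0) r1" if "y \<in> ?B" for y using that \<delta>(2) by auto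
      have DB: "norm (?D y w - ?D z w) \<le> \<epsilon> * norm w" if "y \<in> ?B" "z \<in> ?B" for y z w
      proof -
        have "norm (?D y w - ?D z w) \<le> M * norm (y - z) * norm w" by (rule M[OF Br[OF that(1)] Br[OF that(2)]])
        also have "\<dots> \<le> M * (2 * \<delta>) * norm w" using B2[OF that] 1(2) by (intro mult_right_mono mult_left_mono) auto
        also have "\<dots> \<le> \<epsilon> * norm w" using \<delta>(3) by (rule mult_right_mono) simp
        finally show ?thesis .
      qed
      have seg: "z + \<tau> *\<^sub>R (y - z) \<in> ?B" if "y \<in> ?B" "z \<in> ?B" "0 \<le> \<tau>" "\<tau> \<le> 1" for y z \<tau>
      proof -
        have "z + \<tau> *\<^sub>R (y - z) = (1 - \<tau>) *\<^sub>R z + \<tau> *\<^sub>R y" by (simp add: algebra_simps)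
        then show ?thesis using convexD_alt[OF convex_ball that(2,1,3,4)] by simp
      qed
      show "diff_hyp \<epsilon> K \<sigma> ?S (dq (grad U) e h)"
        unfolding diff_hyp_def d_def[symmetric]
      proof (intro conjI ballI)
        fix x assume x: "x \<in> ?S"
        define z1 where "z1 = grad U x"
        define p where "p = h *\<^sub>R d x"
        have z1: "z1 \<in> ?B" using i(3)[OF x] by (simp add: z1_def)
        have z2: "grad U (x + h *\<^sub>R e) = z1 + p" using hd[of x] by (simp add: z1_def p_def algebra_simps)
        have pB: "z1 + \<tau> *\<^sub>R p \<in> ?B" if "0 \<le> \<tau>" "\<tau> \<le> 1" for \<tau>
          using seg[OF i(4)[OF x] z1 that] unfolding z2 by simp
        have pP: "p = \<Phi> (z1 + p) - \<Phi> z1" using dP[OF x] z2 by (simp add: p_def z1_def)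
        show "\<exists>a. c * (norm a)\<^sup>2 \<le> Q a \<and> norm (d x - a) \<le> \<epsilon> * norm (d x) + K"
        proof (intro exI[of _ "?D z1 (d x)"] conjI)
          show "c * (norm (?D z1 (d x)))\<^sup>2 \<le> Q (?D z1 (d x))" unfolding z1_def by (rule co[OF i(5)[OF x]])
          have "norm ((1 / 1) *\<^sub>R ((\<Phi> (z1 + 1 *\<^sub>R p) - 1 *\<^sub>R ?D z1 p) - (\<Phi> (z1 + 0 *\<^sub>R p) - 0 *\<^sub>R ?D z1 p))) \<le> \<epsilon> * norm p"
          proof (rule dq_mean_value)
            fix \<tau> :: real assume \<tau>: "0 \<le> \<tau>" "\<tau> \<le> 1"
            show "((\<lambda>\<tau>. \<Phi> (z1 + \<tau> *\<^sub>R p) - \<tau> *\<^sub>R ?D z1 p) has_derivative (\<lambda>t. t *\<^sub>R (?D (z1 + \<tau> *\<^sub>R p) p - ?D z1 p))) (at \<tau>)"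
              unfolding scaleR_diff_right
              by (intro has_derivative_diff has_derivative_line Pd) (auto intro!: derivative_eq_intros)
            show "norm (?D (z1 + \<tau> *\<^sub>R p) p - ?D z1 p) \<le> \<epsilon> * norm p" by (rule DB[OF pB[OF \<tau>] z1])
          qed simp
          then have "norm ((\<Phi> (z1 + p) - \<Phi> z1) - ?D z1 p) \<le> \<epsilon> * norm p" by (simp add: algebra_simps)
          then have "norm (p - ?D z1 p) \<le> \<epsilon> * norm p" unfolding pP[symmetric] .
          then have "norm (h *\<^sub>R (d x - ?D z1 (d x))) \<le> \<epsilon> * norm (h *\<^sub>R d x)"
            by (simp only: p_def linear_cmul[OF Dlin] scaleR_diff_right)
          then have "h * norm (d x - ?D z1 (d x)) \<le> h * (\<epsilon> * norm (d x))" using h by (simp add: mult_ac)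
          then have "norm (d x - ?D z1 (d x)) \<le> \<epsilon> * norm (d x)" using h by (rule mult_left_le_imp_le)
          then show "norm (d x - ?D z1 (d x)) \<le> \<epsilon> * norm (d x) + K" using K by linarith
        qed
        fix y assume y: "y \<in> ?S"
        let ?p = "norm (y - x) powr \<sigma>"
        define z3 where "z3 = grad U y"
        define q where "q = h *\<^sub>R d y"
        have z3: "z3 \<in> ?B" using i(3)[OF y] by (simp add: z3_def)
        have z4: "grad U (y + h *\<^sub>R e) = z3 + q" using hd[of y] by (simp add: z3_def q_def algebra_simps)
        have qB: "z3 + \<tau> *\<^sub>R q \<in> ?B" if "0 \<le> \<tau>" "\<tau> \<le> 1" for \<tau>
          using seg[OF i(4)[OF y] z3 that] unfolding z4 by simp
        have qP: "q = \<Phi> (z3 + q) - \<Phi> z3" using dP[OF y] z4 by (simp add: q_def z3_def)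
        show "\<exists>a. c * (norm a)\<^sup>2 \<le> Q a \<and> norm (d y - d x - a) \<le> \<epsilon> * norm (d y - d x) + K * ?p * (norm (d x) + 1)"
        proof (intro exI[of _ "?D z1 (d y - d x)"] conjI)
          show "c * (norm (?D z1 (d y - d x)))\<^sup>2 \<le> Q (?D z1 (d y - d x))" unfolding z1_def by (rule co[OF i(5)[OF x]])
          have diff: "norm ((z3 + \<tau> *\<^sub>R q) - (z1 + \<tau> *\<^sub>R p)) \<le> C * ?p" if \<tau>: "0 \<le> \<tau>" "\<tau> \<le> 1" for \<tau>
          proof -
            have "(z3 + \<tau> *\<^sub>R q) - (z1 + \<tau> *\<^sub>R p) = (1 - \<tau>) *\<^sub>R (z3 - z1) + \<tau> *\<^sub>R ((z3 + q) - (z1 + p))"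
              by (simp add: algebra_simps)
            then have "norm ((z3 + \<tau> *\<^sub>R q) - (z1 + \<tau> *\<^sub>R p)) \<le> norm ((1 - \<tau>) *\<^sub>R (z3 - z1)) + norm (\<tau> *\<^sub>R ((z3 + q) - (z1 + p)))"
              by (simp only: norm_triangle_ineq)
            also have "\<dots> = (1 - \<tau>) * norm (z3 - z1) + \<tau> * norm ((z3 + q) - (z1 + p))" using \<tau> by simp
            also have "\<dots> \<le> (1 - \<tau>) * (C * ?p) + \<tau> * (C * ?p)"
            proof (intro add_mono mult_left_mono)
              show "norm (z3 - z1) \<le> C * ?p" unfolding z3_def z1_def by (rule 2(7)[OF i(1)[OF y] i(1)[OF x]])
              have "norm (grad U (y + h *\<^sub>R e) - grad U (x + h *\<^sub>R e)) \<le> C * norm ((y + h *\<^sub>R e) - (x + h *\<^sub>R e)) powr \<sigma>"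
                by (rule 2(7)[OF i(2)[OF y] i(2)[OF x]])
              then show "norm ((z3 + q) - (z1 + p)) \<le> C * ?p" unfolding z2 z4 by simp
            qed (use \<tau> in auto)
            also have "\<dots> = C * ?p" by (simp add: algebra_simps)
            finally show ?thesis .
          qed
          \<comment> \<open>Mean value inequality for the difference of \<Phi> along the segments z3
            + \<tau> q and z1 + \<tau> p. The derivative splits into a part small relative to q - p
            and the variation of D\<Phi> between the segments, applied to p; by convexity the
            segments stay within C |y - x|^\<sigma> of each other. All bounds are homogeneous in p
            and q, so h can be divided out.\<close>
          have "norm ((1 / 1) *\<^sub>R ((\<Phi> (z3 + 1 *\<^sub>R q) - \<Phi> (z1 + 1 *\<^sub>R p) - 1 *\<^sub>R ?D z1 (q - p))
            - (\<Phi> (z3 + 0 *\<^sub>R q) - \<Phi> (z1 + 0 *\<^sub>R p) - 0 *\<^sub>R ?D z1 (q - p)))) \<le> \<epsilon> * norm (q - p) + K * ?p * norm p"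
          proof (rule dq_mean_value)
            fix \<tau> :: real assume \<tau>: "0 \<le> \<tau>" "\<tau> \<le> 1"
            show "((\<lambda>\<tau>. \<Phi> (z3 + \<tau> *\<^sub>R q) - \<Phi> (z1 + \<tau> *\<^sub>R p) - \<tau> *\<^sub>R ?D z1 (q - p)) has_derivative
              (\<lambda>t. t *\<^sub>R (?D (z3 + \<tau> *\<^sub>R q) q - ?D (z1 + \<tau> *\<^sub>R p) p - ?D z1 (q - p)))) (at \<tau>)"
              unfolding scaleR_diff_right
              by (intro has_derivative_diff has_derivative_line Pd) (auto intro!: derivative_eq_intros)
            let ?a = "z3 + \<tau> *\<^sub>R q" and ?b = "z1 + \<tau> *\<^sub>R p"
            have "?D ?a q - ?D ?b p - ?D z1 (q - p) = (?D ?a (q - p) - ?D z1 (q - p)) + (?D ?a p - ?D ?b p)"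
              by (simp add: linear_diff[OF Dlin])
            then have "norm (?D ?a q - ?D ?b p - ?D z1 (q - p)) \<le> norm (?D ?a (q - p) - ?D z1 (q - p)) + norm (?D ?a p - ?D ?b p)"
              by (simp only: norm_triangle_ineq)
            also have "\<dots> \<le> \<epsilon> * norm (q - p) + M * (C * ?p) * norm p"
            proof (intro add_mono)
              show "norm (?D ?a (q - p) - ?D z1 (q - p)) \<le> \<epsilon> * norm (q - p)" by (rule DB[OF qB[OF \<tau>] z1])
              have "norm (?D ?a p - ?D ?b p) \<le> M * norm (?a - ?b) * norm p" by (rule M[OF Br[OF qB[OF \<tau>]] Br[OF pB[OF \<tau>]]])
              also have "\<dots> \<le> M * (C * ?p) * norm p" using diff[OF \<tau>] 1(2) by (intro mult_right_mono mult_left_mono) auto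
              finally show "norm (?D ?a p - ?D ?b p) \<le> M * (C * ?p) * norm p" .
            qed
            finally show "norm (?D ?a q - ?D ?b p - ?D z1 (q - p)) \<le> \<epsilon> * norm (q - p) + K * ?p * norm p"
              by (simp add: K_def mult.assoc)
          qed simp
          then have "norm ((\<Phi> (z3 + q) - \<Phi> z3) - (\<Phi> (z1 + p) - \<Phi> z1) - ?D z1 (q - p)) \<le> \<epsilon> * norm (q - p) + K * ?p * norm p"
            by (simp add: algebra_simps)
          then have "norm (q - p - ?D z1 (q - p)) \<le> \<epsilon> * norm (q - p) + K * ?p * norm p"
            unfolding pP[symmetric] qP[symmetric] .
          moreover have "q - p = h *\<^sub>R (d y - d x)" by (simp add: p_def q_def scaleR_diff_right)
          moreover have "?D z1 (h *\<^sub>R (d y - d x)) = h *\<^sub>R ?D z1 (d y - d x)" by (rule linear_cmul[OF Dlin])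
          ultimately have "norm (h *\<^sub>R (d y - d x - ?D z1 (d y - d x))) \<le> \<epsilon> * norm (h *\<^sub>R (d y - d x)) + K * ?p * norm (h *\<^sub>R d x)"
            by (simp only: p_def scaleR_diff_right)
          then have "h * norm (d y - d x - ?D z1 (d y - d x)) \<le> h * (\<epsilon> * norm (d y - d x) + K * ?p * norm (d x))"
            using h by (simp only: norm_scaleR) (simp add: algebra_simps)
          then have "norm (d y - d x - ?D z1 (d y - d x)) \<le> \<epsilon> * norm (d y - d x) + K * ?p * norm (d x)"
            using h by (rule mult_left_le_imp_le)
          also have "K * ?p * norm (d x) \<le> K * ?p * (norm (d x) + 1)" using K by (intro mult_left_mono) auto
          finally show "norm (d y - d x - ?D z1 (d y - d x)) \<le> \<epsilon> * norm (d y - d x) + K * ?p * (norm (d x) + 1)" by simp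
        qed
      qed
    qed
    then show ?thesis by blast
  qed
  then have "CH (Suc (Suc 0)) \<mu> \<Omega> U" by (intro step U') blast
  then show ?thesis using \<mu> by blast
qed

end

section \<open>Higher regularity\<close>

text \<open>The two directions may come with different exponents; the smaller one serves
  both.\<close>

lemma CH_Suc_min:
  fixes Z :: "real^2 \<Rightarrow> 'b::euclidean_space"
  assumes d: "\<And>x. x \<in> S \<Longrightarrow> Z differentiable (at x)"
    and e: "\<And>e. e \<in> Basis \<Longrightarrow> \<exists>\<mu>>0. \<mu> \<le> 1 \<and> CH m \<mu> S (\<lambda>x. frechet_derivative Z (at x) e)"
  shows "\<exists>\<mu>>0. \<mu> \<le> 1 \<and> CH (Suc m) \<mu> S Z"
proof -
  obtain a where a: "a > 0" "a \<le> 1" "CH m a S (\<lambda>x. frechet_derivative Z (at x) e1)" using e[OF e_Basis(1)] by blast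
  obtain b where b: "b > 0" "b \<le> 1" "CH m b S (\<lambda>x. frechet_derivative Z (at x) e2)" using e[OF e_Basis(2)] by blast
  have "CH m (min a b) S (\<lambda>x. frechet_derivative Z (at x) e1)" "CH m (min a b) S (\<lambda>x. frechet_derivative Z (at x) e2)"
    using a b by (auto intro: CH_mono[OF a(3)] CH_mono[OF b(3)])
  then have "CH (Suc m) (min a b) S Z" using d by (auto simp: Basis_real2)
  then show ?thesis using a b by (intro exI[of _ "min a b"]) auto
qed

text \<open>A nonempty open set is not negligible. This extends relations known almost everywhere to
  every point once the gradient is continuous.\<close>

lemma continuous_zero_off_negligible:
  fixes F :: "'a::euclidean_space \<Rightarrow> 'b::real_normed_vector"
  assumes O: "open \<Omega>" and c: "continuous_on \<Omega> F" and Z: "negligible Z"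
    and z: "\<And>y. y \<in> \<Omega> \<Longrightarrow> y \<notin> Z \<Longrightarrow> F y = 0" and x: "x \<in> \<Omega>"
  shows "F x = 0"
proof (rule ccontr)
  assume n: "F x \<noteq> 0"
  have "open (\<Omega> \<inter> F -` (- {0}))" by (rule continuous_open_preimage[OF c O]) auto
  then have "\<not> negligible (\<Omega> \<inter> F -` (- {0}))" using x n by (intro open_not_negligible) auto
  moreover have "\<Omega> \<inter> F -` (- {0}) \<subseteq> Z" using z by auto
  ultimately show False using negligible_subset[OF Z] by blast
qed

context null_form
begin

text \<open>Induction by differentiating the equation: a partial derivative of \<open>Z\<close>
  solves an equation with the same T and a right-hand side of one order less. Differentiation is
  legitimate by \<open>linear_step\<close>, and the induction hypothesis applied to \<open>Z\<close>
  itself supplies the regularity of \<open>grad Z\<close>, which enters the new right-hand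
  side.\<close>

lemma linear_regularity:
  fixes t :: "'b \<times> 'b \<Rightarrow> real^2 \<Rightarrow> 'b \<times> 'b"
  assumes \<sigma>: "0 < \<sigma>" "\<sigma> \<le> 1"
    and t: "\<And>b. b \<in> Basis \<Longrightarrow> CH j \<sigma> \<Omega> (t b)" and G: "CH j \<sigma> \<Omega> G" and Z: "CH (Suc 0) \<sigma> \<Omega> Z"
    and eq: "\<And>x. x \<in> \<Omega> \<Longrightarrow> grad Z x = lapp t x (grad Z x) + G x"
    and co: "\<And>x z. x \<in> \<Omega> \<Longrightarrow> Q (lapp t x z) \<ge> c * (norm (lapp t x z))\<^sup>2"
  shows "\<exists>\<mu>>0. \<mu> \<le> 1 \<and> CH (Suc j) \<mu> \<Omega> Z"
  using \<sigma> t G Z eq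
proof (induction j arbitrary: \<sigma> G Z)
  case 0
  then show ?case by blast
next
  case (Suc j)
  note \<sigma> = Suc.prems(1,2) and t = Suc.prems(3) and G = Suc.prems(4) and Z = Suc.prems(5) and eq = Suc.prems(6)
  have O: "open \<Omega>" by (rule CH_open[OF Z])
  obtain \<mu>1 where \<mu>1: "\<mu>1 > 0" "\<mu>1 \<le> 1 / 2" "CH (Suc (Suc 0)) \<mu>1 \<Omega> Z"
    using linear_step[OF \<sigma> CH_le[OF t \<sigma>] CH_le[OF G \<sigma>] Z eq co] by blast
  obtain \<mu>2 where \<mu>2: "\<mu>2 > 0" "\<mu>2 \<le> 1" "CH (Suc j) \<mu>2 \<Omega> Z"
    using Suc.IH[OF \<sigma> CH_Suc_imp_CH[OF t \<sigma>] CH_Suc_imp_CH[OF G \<sigma>] Z eq] by blast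
  define \<mu> where "\<mu> = min \<sigma> (min \<mu>1 \<mu>2)"
  have \<mu>: "\<mu> > 0" "\<mu> \<le> 1" "\<mu> \<le> \<sigma>" "\<mu> \<le> \<mu>1" "\<mu> \<le> \<mu>2" using \<sigma> \<mu>1 \<mu>2 by (auto simp: \<mu>_def)
  have t': "CH (Suc j) \<mu> \<Omega> (t b)" if "b \<in> Basis" for b by (rule CH_mono[OF t[OF that] \<mu>(1,3)])
  have G': "CH (Suc j) \<mu> \<Omega> G" by (rule CH_mono[OF G \<mu>(1,3)])
  have Z2: "CH (Suc (Suc 0)) \<mu> \<Omega> Z" by (rule CH_mono[OF \<mu>1(3) \<mu>(1,4)])
  have gZj: "CH j \<mu> \<Omega> (grad Z)" using CH_mono[OF \<mu>2(3) \<mu>(1,5)] unfolding CH_Suc_grad by blast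
  have Zd: "Z differentiable (at x)" if "x \<in> \<Omega>" for x using Z that by simp
  have gZd: "grad Z differentiable (at x)" if "x \<in> \<Omega>" for x
  proof -
    have "CH (Suc 0) \<mu> \<Omega> (grad Z)" using Z2 unfolding CH_Suc_grad[of "Suc 0"] by blast
    then show ?thesis using that by simp
  qed
  show ?case
  proof (rule CH_Suc_min[OF Zd])
    fix e :: "real^2" assume e: "e \<in> Basis"
    define Ze where "Ze = (\<lambda>x. frechet_derivative Z (at x) e)"
    \<comment> \<open>Product rule: the terms in which the coefficients are differentiated belong to
      the right-hand side; the others are T applied to the gradient of \<open>Ze\<close>, by
      symmetry of second derivatives.\<close>
    define Ge where "Ge = (\<lambda>x. (\<Sum>b\<in>Basis. (grad Z x \<bullet> b) *\<^sub>R frechet_derivative (t b) (at x) e) + frechet_derivative G (at x) e)"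
    have CZe: "CH (Suc 0) \<mu> \<Omega> Ze" using Z2 e unfolding Ze_def by simp
    have CGe: "CH j \<mu> \<Omega> Ge" unfolding Ge_def
    proof (intro CH_add CH_sum O finite_Basis)
      fix b :: "'b \<times> 'b" assume b: "b \<in> Basis"
      have "CH j \<mu> \<Omega> (\<lambda>x. frechet_derivative (t b) (at x) e)" using t'[OF b] e by simp
      with CH_linear[OF bounded_linear_inner_left gZj] show "CH j \<mu> \<Omega> (\<lambda>x. (grad Z x \<bullet> b) *\<^sub>R frechet_derivative (t b) (at x) e)"
        by (rule CH_bilinear[OF bounded_bilinear_scaleR \<mu>(1,2)])
    next
      show "CH j \<mu> \<Omega> (\<lambda>x. frechet_derivative G (at x) e)" using G' e by simp
    qed
    have eqe: "grad Ze x = lapp t x (grad Ze x) + Ge x" if x: "x \<in> \<Omega>" for x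
    proof -
      have gs: "grad Ze x = frechet_derivative (grad Z) (at x) e"
        unfolding Ze_def by (rule CH2_symmetric[OF Z2 \<mu>(1,2) x e])
      have td: "(t b has_derivative frechet_derivative (t b) (at x)) (at x)" if "b \<in> Basis" for b
        using t[OF that] x by (intro frechetD) simp
      have Gd: "(G has_derivative frechet_derivative G (at x)) (at x)" using G x by (intro frechetD) simp
      have "((\<lambda>x. lapp t x (grad Z x) + G x) has_derivative
        (\<lambda>v. (\<Sum>b\<in>Basis. (grad Z x \<bullet> b) *\<^sub>R frechet_derivative (t b) (at x) v + (frechet_derivative (grad Z) (at x) v \<bullet> b) *\<^sub>R t b x)
          + frechet_derivative G (at x) v)) (at x)"
        unfolding lapp_def
        by (intro has_derivative_add has_derivative_sum has_derivative_scaleR has_derivative_inner_left frechetD gZd x td Gd)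
      then have "frechet_derivative (\<lambda>x. lapp t x (grad Z x) + G x) (at x) e =
         (\<Sum>b\<in>Basis. (grad Z x \<bullet> b) *\<^sub>R frechet_derivative (t b) (at x) e + (frechet_derivative (grad Z) (at x) e \<bullet> b) *\<^sub>R t b x)
          + frechet_derivative G (at x) e" by (rule frechetI)
      moreover have "frechet_derivative (grad Z) (at x) = frechet_derivative (\<lambda>x. lapp t x (grad Z x) + G x) (at x)"
        by (rule frechet_cong(1)[OF O x eq])
      ultimately have W: "frechet_derivative (grad Z) (at x) e =
         (\<Sum>b\<in>Basis. (grad Z x \<bullet> b) *\<^sub>R frechet_derivative (t b) (at x) e + (frechet_derivative (grad Z) (at x) e \<bullet> b) *\<^sub>R t b x)
          + frechet_derivative G (at x) e" by (simp only:)
      show ?thesis unfolding gs Ge_def lapp_def by (subst W) (simp only: sum.distrib add_ac)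
    qed
    show "\<exists>\<mu>>0. \<mu> \<le> 1 \<and> CH (Suc j) \<mu> \<Omega> (\<lambda>x. frechet_derivative Z (at x) e)"
      using Suc.IH[OF \<mu>(1,2) CH_Suc_imp_CH[OF t' \<mu>(1,2)] CGe CZe eqe] unfolding Ze_def .
  qed
qed

text \<open>\<open>Q\<close> is homogeneous of degree 2, so coercivity passes to difference
  quotients of \<Phi> and to their limit. The strict bound on \<open>z\<close> keeps the nearby
  points inside the ball.\<close>

lemma derivative_coercive:
  assumes D: "(\<Phi> has_derivative D) (at z)" and z: "norm z < r"
    and mon: "\<And>y z. norm y < r \<Longrightarrow> norm z < r \<Longrightarrow> Q (\<Phi> y - \<Phi> z) \<ge> c * (norm (\<Phi> y - \<Phi> z))\<^sup>2"
  shows "Q (D w) \<ge> c * (norm (D w))\<^sup>2"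
proof -
  define q where "q h = (1 / h) *\<^sub>R (\<Phi> (z + h *\<^sub>R w) - \<Phi> z)" for h
  have D0: "(\<Phi> has_derivative D) (at (z + 0 *\<^sub>R w))" using D by simp
  have l: "linear D" by (rule has_derivative_linear[OF D])
  have "((\<lambda>h. (1 / norm h) *\<^sub>R (\<Phi> (z + h *\<^sub>R w) - \<Phi> z - h *\<^sub>R D w)) \<longlongrightarrow> 0) (at (0::real))"
    using has_derivative_line[OF D0] unfolding has_derivative_at2 by (simp add: diff_diff_eq)
  then have "((\<lambda>h. norm ((1 / norm h) *\<^sub>R (\<Phi> (z + h *\<^sub>R w) - \<Phi> z - h *\<^sub>R D w))) \<longlongrightarrow> 0) (at (0::real))"
    by (rule tendsto_norm_zero)
  moreover have "\<forall>\<^sub>F h in at (0::real). norm ((1 / norm h) *\<^sub>R (\<Phi> (z + h *\<^sub>R w) - \<Phi> z - h *\<^sub>R D w)) = norm (q h - D w)"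
  proof (rule eventually_at_filter[THEN iffD2], intro always_eventually allI impI)
    fix h :: real assume h: "h \<noteq> 0"
    have "q h - D w = (1 / h) *\<^sub>R (\<Phi> (z + h *\<^sub>R w) - \<Phi> z - h *\<^sub>R D w)" using h by (simp add: q_def scaleR_diff_right)
    then show "norm ((1 / norm h) *\<^sub>R (\<Phi> (z + h *\<^sub>R w) - \<Phi> z - h *\<^sub>R D w)) = norm (q h - D w)" by simp
  qed
  ultimately have "((\<lambda>h. norm (q h - D w)) \<longlongrightarrow> 0) (at 0)" by (rule Lim_transform_eventually)
  then have lim: "(q \<longlongrightarrow> D w) (at 0)" by (simp add: LIM_zero_iff tendsto_norm_zero_iff)
  have 1: "((\<lambda>h. Q (q h)) \<longlongrightarrow> Q (D w)) (at 0)" unfolding Q_def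
    by (intro B.tendsto tendsto_fst tendsto_snd lim)
  have 2: "((\<lambda>h. c * (norm (q h))\<^sup>2) \<longlongrightarrow> c * (norm (D w))\<^sup>2) (at 0)" by (intro tendsto_intros lim)
  have "((\<lambda>h. norm (z + h *\<^sub>R w)) \<longlongrightarrow> norm (z + 0 *\<^sub>R w)) (at (0::real))" by (intro tendsto_intros)
  then have "\<forall>\<^sub>F h in at (0::real). norm (z + h *\<^sub>R w) < r" using z by (intro order_tendstoD(2)) auto
  then have "\<forall>\<^sub>F h in at 0. c * (norm (q h))\<^sup>2 \<le> Q (q h)"
  proof eventually_elim
    case (elim h)
    have "c * (norm (\<Phi> (z + h *\<^sub>R w) - \<Phi> z))\<^sup>2 \<le> Q (\<Phi> (z + h *\<^sub>R w) - \<Phi> z)" by (rule mon[OF elim z])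
    then have "(1 / h)\<^sup>2 * (c * (norm (\<Phi> (z + h *\<^sub>R w) - \<Phi> z))\<^sup>2) \<le> (1 / h)\<^sup>2 * Q (\<Phi> (z + h *\<^sub>R w) - \<Phi> z)"
      by (rule mult_left_mono) simp
    moreover have "Q (q h) = (1 / h)\<^sup>2 * Q (\<Phi> (z + h *\<^sub>R w) - \<Phi> z)"
      by (simp add: q_def Q_def B.scaleR_left B.scaleR_right power2_eq_square)
    moreover have "c * (norm (q h))\<^sup>2 = (1 / h)\<^sup>2 * (c * (norm (\<Phi> (z + h *\<^sub>R w) - \<Phi> z))\<^sup>2)"
      by (simp add: q_def power_mult_distrib power_divide)
    ultimately show ?case by linarith
  qed
  with 1 2 show ?thesis by (intro tendsto_le[OF _ 1 2]) auto
qed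

text \<open>Once the gradient is continuous, inclusion and bound hold at every point.
  \<open>nonlinear_step\<close> permits differentiating the inclusion; each partial derivative then
  solves a linear equation with coefficients D\<Phi>(grad U), whose regularity grows with that of
  \<open>U\<close>, and \<open>linear_regularity\<close> raises the order by one.\<close>

theorem abstract_regularity:
  fixes \<Phi> :: "'b \<times> 'b \<Rightarrow> 'b \<times> 'b"
  assumes \<Phi>: "CH m 1 UNIV \<Phi>" and O: "open \<Omega>" and U: "L-lipschitz_on \<Omega> U" and N: "negligible N"
    and d: "\<And>y. y \<in> \<Omega> \<Longrightarrow> y \<notin> N \<Longrightarrow> U differentiable (at y)"
    and eq: "\<And>y. y \<in> \<Omega> \<Longrightarrow> y \<notin> N \<Longrightarrow> grad U y = \<Phi> (grad U y)"
    and bd: "\<And>y. y \<in> \<Omega> \<Longrightarrow> y \<notin> N \<Longrightarrow> norm (grad U y) \<le> r0" and r: "r0 < r1"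
    and mon: "\<And>y z. norm y < r1 \<Longrightarrow> norm z < r1 \<Longrightarrow> Q (\<Phi> y - \<Phi> z) \<ge> c * (norm (\<Phi> y - \<Phi> z))\<^sup>2"
  shows "\<exists>\<mu>>0. \<mu> < 1 \<and> CH (Suc m) \<mu> \<Omega> U"
proof -
  have "\<exists>\<mu>>0. \<mu> \<le> 1 / 2 \<and> CH (Suc 0) \<mu> \<Omega> U"
  proof (rule base_regularity[OF O U N, where g="grad U"])
    show "(U has_derivative dmap (grad U y)) (at y)" if "y \<in> \<Omega>" "y \<notin> N" for y by (rule has_derivative_grad[OF d[OF that]])
    show "norm (grad U y) \<le> r0" if "y \<in> \<Omega>" "y \<notin> N" for y by (rule bd[OF that])
    show "c * (norm (grad U y - grad U x))\<^sup>2 \<le> Q (grad U y - grad U x)" if "x \<in> \<Omega>" "x \<notin> N" "y \<in> \<Omega>" "y \<notin> N" for x y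
    proof -
      have n: "norm (grad U y) < r1" "norm (grad U x) < r1" using bd[OF that(1,2)] bd[OF that(3,4)] r by auto
      show ?thesis using mon[OF n] by (simp only: eq[OF that(1,2), symmetric] eq[OF that(3,4), symmetric])
    qed
  qed
  then obtain \<mu>0 where \<mu>0: "0 < \<mu>0" "\<mu>0 \<le> 1 / 2" and U1: "CH (Suc 0) \<mu>0 \<Omega> U" by blast
  have \<mu>01: "\<mu>0 \<le> 1" using \<mu>0 by simp
  have Ud: "U differentiable (at x)" if "x \<in> \<Omega>" for x using U1 that by simp
  have lU: "lhol \<mu>0 \<Omega> (grad U)" using U1 unfolding CH_Suc_grad CH.simps by blast
  have cU: "continuous_on \<Omega> (grad U)" by (rule lhol_continuous[OF lU \<mu>0(1)])
  have "lhol 1 UNIV \<Phi>" by (rule CH_imp_lhol[OF \<Phi>]) auto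
  then have cP: "continuous_on UNIV \<Phi>" by (rule lhol_continuous) simp
  have eq': "grad U x = \<Phi> (grad U x)" if x: "x \<in> \<Omega>" for x
  proof -
    have "grad U x - \<Phi> (grad U x) = 0"
    proof (rule continuous_zero_off_negligible[OF O _ N _ x, where F="\<lambda>x. grad U x - \<Phi> (grad U x)"])
      show "continuous_on \<Omega> (\<lambda>x. grad U x - \<Phi> (grad U x))"
        by (intro continuous_on_diff cU continuous_on_compose2[OF cP cU]) simp
      show "grad U y - \<Phi> (grad U y) = 0" if "y \<in> \<Omega>" "y \<notin> N" for y using eq[OF that] by simp
    qed
    then show ?thesis by simp
  qed
  \<comment> \<open>The bound by \<open>r0\<close> passes to every point by continuity; r0 < r1 then
    gives the strict inequality that \<open>derivative_coercive\<close> asks for.\<close>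
  have bd': "norm (grad U x) < r1" if x: "x \<in> \<Omega>" for x
  proof -
    have "max 0 (norm (grad U x) - r0) = 0"
    proof (rule continuous_zero_off_negligible[OF O _ N _ x, where F="\<lambda>x. max 0 (norm (grad U x) - r0)"])
      show "continuous_on \<Omega> (\<lambda>x. max 0 (norm (grad U x) - r0))"
        by (intro continuous_on_max continuous_intros cU)
      show "max 0 (norm (grad U y) - r0) = 0" if "y \<in> \<Omega>" "y \<notin> N" for y using bd[OF that] by simp
    qed
    then show ?thesis using r by linarith
  qed
  have "\<exists>\<mu>>0. \<mu> \<le> 1 \<and> CH (Suc i) \<mu> \<Omega> U" if "i \<le> m" for i
    using that
  proof (induction i)
    case 0
    show ?case using \<mu>0 \<mu>01 U1 by blast
  next
    case (Suc i)
    have \<Phi>i: "CH (Suc i) 1 UNIV \<Phi>" by (rule CH_le[OF \<Phi> _ _ Suc.prems]) auto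
    have \<Phi>1: "CH (Suc 0) 1 UNIV \<Phi>" by (rule CH_le[OF \<Phi>i]) auto
    have Pd: "(\<Phi> has_derivative frechet_derivative \<Phi> (at z)) (at z)" for z
      using \<Phi>1 unfolding CH.simps by (intro frechetD) blast
    have co: "c * (norm (frechet_derivative \<Phi> (at (grad U x)) w))\<^sup>2 \<le> Q (frechet_derivative \<Phi> (at (grad U x)) w)"
      if "x \<in> \<Omega>" for x w by (rule derivative_coercive[OF Pd bd'[OF that] mon])
    obtain \<mu>1 where \<mu>1: "\<mu>1 > 0" "\<mu>1 \<le> 1 / 2" "CH (Suc (Suc 0)) \<mu>1 \<Omega> U"
      using nonlinear_step[OF \<mu>0(1) \<mu>01 \<Phi>1 U1 eq' co] by blast
    obtain \<mu>2 where \<mu>2: "\<mu>2 > 0" "\<mu>2 \<le> 1" "CH (Suc i) \<mu>2 \<Omega> U" using Suc by auto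
    define \<mu> where "\<mu> = min \<mu>1 \<mu>2"
    have \<mu>: "\<mu> > 0" "\<mu> \<le> 1" "\<mu> \<le> \<mu>1" "\<mu> \<le> \<mu>2" using \<mu>1 \<mu>2 by (auto simp: \<mu>_def)
    have U2: "CH (Suc (Suc 0)) \<mu> \<Omega> U" by (rule CH_mono[OF \<mu>1(3) \<mu>(1,3)])
    have gUi: "CH i \<mu> \<Omega> (grad U)" using CH_mono[OF \<mu>2(3) \<mu>(1,4)] unfolding CH_Suc_grad by blast
    have gUd: "grad U differentiable (at x)" if "x \<in> \<Omega>" for x
    proof -
      have "CH (Suc 0) \<mu> \<Omega> (grad U)" using U2 unfolding CH_Suc_grad[of "Suc 0"] by blast
      then show ?thesis using that by simp
    qed
    define t where "t = (\<lambda>b x. frechet_derivative \<Phi> (at (grad U x)) b)"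
    have tw: "lapp t x w = frechet_derivative \<Phi> (at (grad U x)) w" for x w
      using frechet_lapp[OF differentiableI[OF Pd], of "grad U x" w, symmetric] by (simp only: lapp_def t_def)
    have Ct: "CH i \<mu> \<Omega> (t b)" if "b \<in> Basis" for b
      unfolding t_def using \<Phi>i that by (intro CH_compose[OF \<mu>(1,2) _ gUi]) (simp only: CH.simps)
    show ?case
    proof (rule CH_Suc_min[OF Ud])
      fix e :: "real^2" assume e: "e \<in> Basis"
      show "\<exists>\<mu>>0. \<mu> \<le> 1 \<and> CH (Suc i) \<mu> \<Omega> (\<lambda>x. frechet_derivative U (at x) e)"
      proof (rule linear_regularity[OF \<mu>(1,2) Ct CH_const[OF O, of i \<mu> 0]])
        show "CH (Suc 0) \<mu> \<Omega> (\<lambda>x. frechet_derivative U (at x) e)" using U2 e by simp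
        show "c * (norm (lapp t x z))\<^sup>2 \<le> Q (lapp t x z)" if "x \<in> \<Omega>" for x z unfolding tw by (rule co[OF that])
        show "grad (\<lambda>x. frechet_derivative U (at x) e) x = lapp t x (grad (\<lambda>x. frechet_derivative U (at x) e) x) + 0"
          if x: "x \<in> \<Omega>" for x
        proof -
          have "((\<lambda>x. \<Phi> (grad U x)) has_derivative (\<lambda>v. frechet_derivative \<Phi> (at (grad U x)) (frechet_derivative (grad U) (at x) v))) (at x)"
            by (rule has_derivative_compose[OF frechetD[OF gUd[OF x]] Pd])
          then have "frechet_derivative (\<lambda>x. \<Phi> (grad U x)) (at x) e = frechet_derivative \<Phi> (at (grad U x)) (frechet_derivative (grad U) (at x) e)"
            by (rule frechetI)
          moreover have "frechet_derivative (grad U) (at x) = frechet_derivative (\<lambda>x. \<Phi> (grad U x)) (at x)"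
            by (rule frechet_cong(1)[OF O x eq'])
          ultimately show ?thesis
            unfolding tw CH2_symmetric[OF U2 \<mu>(1,2) x e] by simp
        qed
      qed
    qed
  qed
  then obtain \<mu> where \<mu>: "\<mu> > 0" "CH (Suc m) \<mu> \<Omega> U" by blast
  \<comment> \<open>The exponent has to be strictly below 1.\<close>
  have "CH (Suc m) (min \<mu> (1 / 2)) \<Omega> U" by (rule CH_mono[OF \<mu>(2)]) (use \<mu> in auto)
  then show ?thesis using \<mu>(1) by (intro exI[of _ "min \<mu> (1 / 2)"]) auto
qed

end

section \<open>The area function\<close>

text \<open>Two distinct positive definite matrices of determinant 1 differ by a matrix of negative determinant;
  here this is quantified.\<close>

lemma sum_sq_diff_ge:
  fixes a b d a' b' d' T :: real
  assumes h: "a * d - b\<^sup>2 = 1" "a' * d' - b'\<^sup>2 = 1" and p: "0 < a" "0 < d" "0 < a'" "0 < d'"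
    and T: "a \<le> T" "d \<le> T" "a' \<le> T" "d' \<le> T"
  defines "D \<equiv> (b - b')\<^sup>2 - (a - a') * (d - d')"
  shows "(a - a')\<^sup>2 + (b - b')\<^sup>2 + (d - d')\<^sup>2 \<le> (3 * T\<^sup>2 + 1) * D"
proof -
  have key: "(a - a')\<^sup>2 \<le> T\<^sup>2 * ((b - b')\<^sup>2 - (a - a') * (d - d'))"
    if h: "a * d - b\<^sup>2 = 1" "a' * d' - b'\<^sup>2 = 1" and p: "0 < a" "0 < a'" "a \<le> T" "a' \<le> T" for a d a' d' :: real
  proof -
    let ?D = "(b - b')\<^sup>2 - (a - a') * (d - d')"
    \<comment> \<open>Multiplying by a a' and eliminating d and d' through the two determinants
      turns the expression into a sum of squares, which shows its sign and the bound at the same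
      time.\<close>
    have "a * a' * ?D = a * a' * (b - b')\<^sup>2 - (a - a') * (a' * (a * d) - a * (a' * d'))"
      by (simp add: algebra_simps)
    also have "\<dots> = a * a' * (b - b')\<^sup>2 - (a - a') * (a' * (1 + b\<^sup>2) - a * (1 + b'\<^sup>2))"
      using h by (simp add: algebra_simps)
    also have "\<dots> = (a - a')\<^sup>2 + (a * b' - a' * b)\<^sup>2" by (simp add: power2_eq_square algebra_simps)
    finally have e: "a * a' * ?D = (a - a')\<^sup>2 + (a * b' - a' * b)\<^sup>2" .
    have D0: "0 \<le> ?D"
    proof -
      have "0 \<le> a * a' * ?D" unfolding e by simp
      then show ?thesis using mult_pos_neg[OF mult_pos_pos[OF p(1,2)], of ?D] by (meson not_le)
    qed
    have "(a - a')\<^sup>2 \<le> a * a' * ?D" unfolding e by simp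
    also have "\<dots> \<le> T\<^sup>2 * ?D" unfolding power2_eq_square[of T] using p D0 by (intro mult_right_mono mult_mono) auto
    finally show ?thesis .
  qed
  have A: "(a - a')\<^sup>2 \<le> T\<^sup>2 * D" unfolding D_def by (rule key) (use h p T in auto)
  have "(d - d')\<^sup>2 \<le> T\<^sup>2 * ((b - b')\<^sup>2 - (d - d') * (a - a'))" by (rule key) (use h p T in \<open>auto simp: mult.commute\<close>)
  then have D: "(d - d')\<^sup>2 \<le> T\<^sup>2 * D" by (simp add: D_def mult.commute)
  have "2 * ((a - a') * (d - d')) \<le> (a - a')\<^sup>2 + (d - d')\<^sup>2" using sum_squares_bound[of "a - a'" "d - d'"] by (simp only: mult.assoc)
  then have "(b - b')\<^sup>2 \<le> D + T\<^sup>2 * D" using A D by (simp add: D_def)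
  then show ?thesis using A D by (simp add: algebra_simps)
qed

text \<open>Cayley-Hamilton for a symmetric matrix h of determinant 1: tr(h) h = I + h^2. So tr(h)
  times the quadratic form of h is |\<xi>|^2 + |\<eta>|^2 plus a sum of squares, and tr(h) is at
  most \<open>T\<close>.\<close>

lemma quadratic_ge:
  fixes \<xi> \<eta> :: "'v::real_inner" and a b d T :: real
  assumes h: "a * d - b\<^sup>2 = 1" and p: "0 < a" "0 < d" "a + d \<le> T"
  shows "(norm \<xi>)\<^sup>2 + (norm \<eta>)\<^sup>2 \<le> T * (a * (\<xi> \<bullet> \<xi>) + 2 * b * (\<xi> \<bullet> \<eta>) + d * (\<eta> \<bullet> \<eta>))"
proof -
  let ?q = "a * (\<xi> \<bullet> \<xi>) + 2 * b * (\<xi> \<bullet> \<eta>) + d * (\<eta> \<bullet> \<eta>)"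
  have ad: "a * d = 1 + b\<^sup>2" using h by simp
  have "(a + d) * ?q = a\<^sup>2 * (\<xi> \<bullet> \<xi>) + 2 * b * (a + d) * (\<xi> \<bullet> \<eta>) + d\<^sup>2 * (\<eta> \<bullet> \<eta>) + (a * d) * (\<xi> \<bullet> \<xi> + \<eta> \<bullet> \<eta>)"
    by (simp add: power2_eq_square algebra_simps)
  also have "\<dots> = (\<xi> \<bullet> \<xi> + \<eta> \<bullet> \<eta>) + ((a *\<^sub>R \<xi> + b *\<^sub>R \<eta>) \<bullet> (a *\<^sub>R \<xi> + b *\<^sub>R \<eta>) + (b *\<^sub>R \<xi> + d *\<^sub>R \<eta>) \<bullet> (b *\<^sub>R \<xi> + d *\<^sub>R \<eta>))"
    unfolding ad by (simp add: inner_add_left inner_add_right inner_commute[of \<eta> \<xi>] power2_eq_square algebra_simps)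
  finally have e: "(a + d) * ?q = (\<xi> \<bullet> \<xi> + \<eta> \<bullet> \<eta>) + ((a *\<^sub>R \<xi> + b *\<^sub>R \<eta>) \<bullet> (a *\<^sub>R \<xi> + b *\<^sub>R \<eta>) + (b *\<^sub>R \<xi> + d *\<^sub>R \<eta>) \<bullet> (b *\<^sub>R \<xi> + d *\<^sub>R \<eta>))" .
  have le: "\<xi> \<bullet> \<xi> + \<eta> \<bullet> \<eta> \<le> (a + d) * ?q" unfolding e by simp
  have "0 \<le> \<xi> \<bullet> \<xi> + \<eta> \<bullet> \<eta>" by simp
  then have "0 \<le> (a + d) * ?q" using le by linarith
  then have "0 \<le> ?q" using mult_pos_neg[OF add_pos_pos[OF p(1,2)], of ?q] by (meson not_le)
  then have "(a + d) * ?q \<le> T * ?q" using p by (intro mult_right_mono) auto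
  with le show ?thesis by (simp only: power2_norm_eq_inner)
qed

text \<open>The determinant term with a large coefficient absorbs the variation of the coefficient matrix.\<close>

lemma monotone_core:
  fixes x y x' y' :: "'v::real_inner" and a b d a' b' d' T r M :: real
  assumes h: "a * d - b\<^sup>2 = 1" "a' * d' - b'\<^sup>2 = 1" and p: "0 < a" "0 < d" "0 < a'" "0 < d'"
    and T: "a + d \<le> T" "a' + d' \<le> T" and r: "norm x' \<le> r" "norm y' \<le> r"
    and M: "M = 3 * (3 * T\<^sup>2 + 1) * (4 * T * r\<^sup>2 + 1)"
  defines "n \<equiv> norm (x - x') + norm (y - y')" and "s \<equiv> \<bar>a - a'\<bar> + \<bar>b - b'\<bar> + \<bar>d - d'\<bar>"
  shows "n\<^sup>2 / (4 * T) + s\<^sup>2 \<le>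
    (x - x') \<bullet> ((a *\<^sub>R x + b *\<^sub>R y) - (a' *\<^sub>R x' + b' *\<^sub>R y')) + (y - y') \<bullet> ((b *\<^sub>R x + d *\<^sub>R y) - (b' *\<^sub>R x' + d' *\<^sub>R y'))
    + M * ((b - b')\<^sup>2 - (a - a') * (d - d'))"
proof -
  define \<xi> where "\<xi> = x - x'"
  define \<eta> where "\<eta> = y - y'"
  define A where "A = a - a'"
  define B where "B = b - b'"
  define C where "C = d - d'"
  define D where "D = B\<^sup>2 - A * C"
  let ?q = "a * (\<xi> \<bullet> \<xi>) + 2 * b * (\<xi> \<bullet> \<eta>) + d * (\<eta> \<bullet> \<eta>)"
  let ?e = "A * (\<xi> \<bullet> x') + B * (\<xi> \<bullet> y') + B * (\<eta> \<bullet> x') + C * (\<eta> \<bullet> y')"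
  have T0: "T > 0" using p T by linarith
  have r0: "r \<ge> 0" using r(1) norm_ge_zero order.trans by blast
  have n: "n = norm \<xi> + norm \<eta>" "s = \<bar>A\<bar> + \<bar>B\<bar> + \<bar>C\<bar>" by (simp_all add: n_def s_def \<xi>_def \<eta>_def A_def B_def C_def)
  have n0: "n \<ge> 0" "s \<ge> 0" by (simp_all add: n)
  have X: "x = x' + \<xi>" "y = y' + \<eta>" "a' = a - A" "b' = b - B" "d' = d - C" by (simp_all add: \<xi>_def \<eta>_def A_def B_def C_def)
  \<comment> \<open>The increment of X h: h applied to the increment of X leads to the good term
    \<open>?q\<close>, the increment of h applied to the second point leads to \<open>?e\<close>,
    which has no sign.\<close>
  have "(a *\<^sub>R x + b *\<^sub>R y) - (a' *\<^sub>R x' + b' *\<^sub>R y') = a *\<^sub>R \<xi> + b *\<^sub>R \<eta> + A *\<^sub>R x' + B *\<^sub>R y'"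
    "(b *\<^sub>R x + d *\<^sub>R y) - (b' *\<^sub>R x' + d' *\<^sub>R y') = b *\<^sub>R \<xi> + d *\<^sub>R \<eta> + B *\<^sub>R x' + C *\<^sub>R y'"
    unfolding X by (simp_all add: algebra_simps)
  then have main: "(x - x') \<bullet> ((a *\<^sub>R x + b *\<^sub>R y) - (a' *\<^sub>R x' + b' *\<^sub>R y')) + (y - y') \<bullet> ((b *\<^sub>R x + d *\<^sub>R y) - (b' *\<^sub>R x' + d' *\<^sub>R y')) = ?q + ?e"
    unfolding \<xi>_def[symmetric] \<eta>_def[symmetric]
    by (simp add: inner_add_right inner_commute[of \<eta> \<xi>] algebra_simps)
  have "2 * (norm \<xi> * norm \<eta>) \<le> (norm \<xi>)\<^sup>2 + (norm \<eta>)\<^sup>2" using sum_squares_bound[of "norm \<xi>" "norm \<eta>"] by (simp only: mult.assoc)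
  then have "n\<^sup>2 \<le> 2 * ((norm \<xi>)\<^sup>2 + (norm \<eta>)\<^sup>2)" by (simp add: n power2_sum)
  also have "\<dots> \<le> 2 * (T * ?q)" using quadratic_ge[OF h(1) p(1,2) T(1), of \<xi> \<eta>] by simp
  finally have q: "n\<^sup>2 / (2 * T) \<le> ?q" using T0 by (simp add: divide_le_eq mult_ac)
  have tm: "\<bar>A' * (v \<bullet> w)\<bar> \<le> \<bar>A'\<bar> * norm v * r" if "norm w \<le> r" for A' and v w :: 'v
  proof -
    have "\<bar>v \<bullet> w\<bar> \<le> norm v * norm w" by (rule Cauchy_Schwarz_ineq2)
    also have "\<dots> \<le> norm v * r" using that by (rule mult_left_mono) simp
    finally show ?thesis by (simp add: abs_mult mult.assoc mult_left_mono)
  qed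
  have e1: "\<bar>?e\<bar> \<le> \<bar>A\<bar> * norm \<xi> * r + \<bar>B\<bar> * norm \<xi> * r + \<bar>B\<bar> * norm \<eta> * r + \<bar>C\<bar> * norm \<eta> * r"
    using tm[OF r(1), of A \<xi>] tm[OF r(2), of B \<xi>] tm[OF r(1), of B \<eta>] tm[OF r(2), of C \<eta>] by linarith
  have e2: "\<bar>A\<bar> * norm \<xi> * r + \<bar>B\<bar> * norm \<xi> * r + \<bar>B\<bar> * norm \<eta> * r + \<bar>C\<bar> * norm \<eta> * r \<le> s * n * r"
  proof -
    have "s * n * r - (\<bar>A\<bar> * norm \<xi> * r + \<bar>B\<bar> * norm \<xi> * r + \<bar>B\<bar> * norm \<eta> * r + \<bar>C\<bar> * norm \<eta> * r) = (\<bar>C\<bar> * norm \<xi> + \<bar>A\<bar> * norm \<eta>) * r"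
      by (simp add: n algebra_simps)
    also have "\<dots> \<ge> 0" using r0 by simp
    finally show ?thesis by simp
  qed
  have e: "\<bar>?e\<bar> \<le> s * n * r" by (rule order.trans[OF e1 e2])
  have y: "s * n * r \<le> n\<^sup>2 / (4 * T) + 4 * T * r\<^sup>2 * s\<^sup>2"
  proof -
    have "0 \<le> (n - 2 * T * (r * s))\<^sup>2 / (4 * T)" using T0 by simp
    also have "\<dots> = n\<^sup>2 / (4 * T) - s * n * r + T * r\<^sup>2 * s\<^sup>2" using T0 by (simp add: field_simps power2_eq_square)
    finally have "s * n * r \<le> n\<^sup>2 / (4 * T) + T * r\<^sup>2 * s\<^sup>2" by linarith
    moreover have "0 \<le> T * r\<^sup>2 * s\<^sup>2" using T0 by simp
    moreover have "4 * T * r\<^sup>2 * s\<^sup>2 = 4 * (T * r\<^sup>2 * s\<^sup>2)" by simp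
    ultimately show ?thesis by linarith
  qed
  have "s\<^sup>2 \<le> 3 * (A\<^sup>2 + B\<^sup>2 + C\<^sup>2)"
  proof -
    have "0 \<le> (\<bar>A\<bar> - \<bar>B\<bar>)\<^sup>2 + (\<bar>B\<bar> - \<bar>C\<bar>)\<^sup>2 + (\<bar>A\<bar> - \<bar>C\<bar>)\<^sup>2" by simp
    then show ?thesis unfolding n by (simp add: power2_eq_square algebra_simps)
  qed
  also have "\<dots> \<le> 3 * ((3 * T\<^sup>2 + 1) * D)"
    unfolding A_def B_def C_def D_def
    by (rule mult_left_mono[OF sum_sq_diff_ge[OF h p]]) (use p T in auto)
  \<comment> \<open>\<open>M\<close> is the product of the constants met here: M D pays for the 4 T
    r^2 s^2 left by Young's inequality and leaves s^2 to spare.\<close>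
  finally have "s\<^sup>2 * (4 * T * r\<^sup>2 + 1) \<le> 3 * ((3 * T\<^sup>2 + 1) * D) * (4 * T * r\<^sup>2 + 1)"
    using T0 by (intro mult_right_mono) auto
  then have "4 * T * r\<^sup>2 * s\<^sup>2 + s\<^sup>2 \<le> M * D" unfolding M by (simp add: algebra_simps)
  moreover have "n\<^sup>2 / (2 * T) = n\<^sup>2 / (4 * T) + n\<^sup>2 / (4 * T)" by simp
  ultimately show ?thesis unfolding main A_def[symmetric] B_def[symmetric] C_def[symmetric] D_def[symmetric]
    using q e y by linarith
qed


section \<open>The area as a Gram determinant, and its derivative\<close>

lemma bounded_linear_column: "bounded_linear (column j :: real^'m^'n \<Rightarrow> real^'n)"
  unfolding linear_conv_bounded_linear[symmetric] by (intro linearI) (auto simp: column_def vec_eq_iff)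

lemmas column_simps =
  linear_diff[OF bounded_linear.linear[OF bounded_linear_column]]
  linear_add[OF bounded_linear.linear[OF bounded_linear_column]]

lemma norm_columns: "(norm (X::real^2^'n))\<^sup>2 = (norm (column 1 X))\<^sup>2 + (norm (column 2 X))\<^sup>2"
  unfolding power2_norm_eq_inner
  by (simp add: inner_vec_def column_def UNIV_2 sum.distrib)

lemma norm_column_le: "norm (column j (X::real^2^'n)) \<le> norm X"
proof -
  have "j = 1 \<or> j = 2" by (rule exhaust_2)
  then have "(norm (column j X))\<^sup>2 \<le> (norm X)\<^sup>2" unfolding norm_columns by auto
  then show ?thesis by (rule power2_le_imp_le) simp
qed

text \<open>The determinant of I + X^T X in terms of the columns of X.\<close>

definition area_sq :: "real^2^'n \<Rightarrow> real" where
  "area_sq X = (1 + column 1 X \<bullet> column 1 X) * (1 + column 2 X \<bullet> column 2 X) - (column 1 X \<bullet> column 2 X)\<^sup>2"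

text \<open>Lagrange's identity: the squared 2 x 2 minors, summed over all ordered pairs of rows,
  give twice the Gram determinant of the columns. The squares are symmetric in a and b and vanish
  for a = b, so the sum over a <= b is half of that sum.\<close>

lemma area_eq: "area X = sqrt (area_sq (X :: real^2^'n::{finite,linorder}))"
proof -
  let ?x = "\<lambda>a. X $ a $ 1" and ?y = "\<lambda>a. X $ a $ 2"
  define q where "q a b = (?x a * ?y b - ?x b * ?y a)\<^sup>2" for a b
  have sym: "q a b = q b a" for a b unfolding q_def by (simp add: power2_commute mult.commute)
  have d0: "q a a = 0" for a by (simp add: q_def mult.commute)
  have det: "(det (row_pair X a b))\<^sup>2 = q a b" for a b
    by (simp add: det_2 row_pair_def q_def vector_2) (simp add: mult.commute power2_commute)
  let ?L = "{(a::'n, b). a \<le> b}" and ?L' = "{(a::'n, b). b < a}"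
  have "(\<Sum>(a, b)\<in>?L'. q a b) = (\<Sum>(a, b)\<in>{(a, b). a < b}. q a b)"
    by (rule sum.reindex_bij_witness[of _ "\<lambda>(a, b). (b, a)" "\<lambda>(a, b). (b, a)"]) (auto simp: sym)
  also have "\<dots> = (\<Sum>(a, b)\<in>?L. q a b)"
    by (rule sum.mono_neutral_left) (auto simp: d0 not_less order.order_iff_strict)
  finally have half: "(\<Sum>(a, b)\<in>?L'. q a b) = (\<Sum>(a, b)\<in>?L. q a b)" .
  have "(\<Sum>a\<in>UNIV. \<Sum>b\<in>UNIV. q a b) = (\<Sum>(a, b)\<in>UNIV. q a b)"
    by (simp add: sum.cartesian_product)
  also have "\<dots> = (\<Sum>(a, b)\<in>?L \<union> ?L'. q a b)" by (rule sum.cong) auto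
  also have "\<dots> = 2 * (\<Sum>(a, b)\<in>?L. q a b)" by (subst sum.union_disjoint) (auto simp: half)
  finally have "2 * (\<Sum>(a, b)\<in>?L. q a b) = (\<Sum>a\<in>UNIV. \<Sum>b\<in>UNIV. q a b)" by simp
  also have "\<dots> = (\<Sum>a\<in>UNIV. \<Sum>b\<in>UNIV. (?x a * ?x a) * (?y b * ?y b) + (?y a * ?y a) * (?x b * ?x b) - 2 * ((?x a * ?y a) * (?x b * ?y b)))"
    by (simp add: q_def power2_eq_square algebra_simps)
  also have "\<dots> = 2 * ((column 1 X \<bullet> column 1 X) * (column 2 X \<bullet> column 2 X) - (column 1 X \<bullet> column 2 X)\<^sup>2)"
    by (simp add: inner_vec_def column_def sum.distrib sum_subtractf sum_distrib_left[symmetric] sum_distrib_right[symmetric] power2_eq_square)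
  finally have "(\<Sum>(a, b)\<in>?L. q a b) = (column 1 X \<bullet> column 1 X) * (column 2 X \<bullet> column 2 X) - (column 1 X \<bullet> column 2 X)\<^sup>2"
    by simp
  then show ?thesis unfolding area_def det area_sq_def norm_columns power2_norm_eq_inner
    by (simp add: algebra_simps)
qed

lemma area_sq_ge: "area_sq X \<ge> 1"
proof -
  have "(column 1 X \<bullet> column 2 X)\<^sup>2 \<le> (column 1 X \<bullet> column 1 X) * (column 2 X \<bullet> column 2 X)"
    by (rule Cauchy_Schwarz_ineq)
  moreover have "0 \<le> column 1 X \<bullet> column 1 X" "0 \<le> column 2 X \<bullet> column 2 X" by simp_all
  ultimately show ?thesis unfolding area_sq_def distrib_left distrib_right by linarith
qed

lemma area_ge: "area X \<ge> 1" and area_power: "(area X)\<^sup>2 = area_sq X"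
  using area_sq_ge[of X] by (auto simp: area_eq)

text \<open>\<open>co_a\<close>, \<open>co_b\<close> and \<open>co_d\<close> are the entries of the
  symmetric matrix h = area * (I + X^T X)^(-1), that is, of the adjugate of I + X^T X divided by the
  area. The gradient of the area is X h.\<close>

definition co_a :: "real^2^('n::{finite,linorder}) \<Rightarrow> real" where "co_a X = (1 + column 2 X \<bullet> column 2 X) / area X"
definition co_b :: "real^2^('n::{finite,linorder}) \<Rightarrow> real" where "co_b X = - (column 1 X \<bullet> column 2 X) / area X"
definition co_d :: "real^2^('n::{finite,linorder}) \<Rightarrow> real" where "co_d X = (1 + column 1 X \<bullet> column 1 X) / area X"

lemma co_det: "co_a X * co_d X - (co_b X)\<^sup>2 = 1"
proof -
  have "co_a X * co_d X - (co_b X)\<^sup>2 = area_sq X / (area X)\<^sup>2"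
    by (simp add: co_a_def co_b_def co_d_def area_sq_def power2_eq_square diff_divide_distrib mult.commute)
  then show ?thesis using area_sq_ge[of X] by (simp add: area_power)
qed

lemma co_pos: "0 < co_a X" "0 < co_d X"
  using area_ge[of X] by (auto simp: co_a_def co_d_def intro!: divide_pos_pos add_pos_nonneg)

lemma co_le: "co_a X + co_d X \<le> 2 + (norm X)\<^sup>2"
proof -
  have "co_a X + co_d X = (2 + (norm X)\<^sup>2) / area X"
    unfolding norm_columns power2_norm_eq_inner by (simp add: co_a_def co_d_def add_divide_distrib)
  also have "\<dots> \<le> (2 + (norm X)\<^sup>2) / 1" using area_ge[of X] by (intro divide_left_mono) auto
  finally show ?thesis by simp
qed

lemma area_has_derivative:
  fixes X :: "real^2^'n::{finite,linorder}"
  shows "(area has_derivative (\<lambda>V. (co_a X *\<^sub>R column 1 X + co_b X *\<^sub>R column 2 X) \<bullet> column 1 V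
     + (co_b X *\<^sub>R column 1 X + co_d X *\<^sub>R column 2 X) \<bullet> column 2 V)) (at X)"
proof -
  have s: "area_sq X > 0" using area_sq_ge[of X] by simp
  have i: "((\<lambda>X. column i X \<bullet> column j X) has_derivative (\<lambda>V. column i X \<bullet> column j V + column i V \<bullet> column j X)) (at X)" for i j
    by (intro has_derivative_inner bounded_linear.has_derivative[OF bounded_linear_column] has_derivative_ident)
  have d: "(area_sq has_derivative (\<lambda>V. 2 * ((1 + column 2 X \<bullet> column 2 X) * (column 1 X \<bullet> column 1 V)
      + (1 + column 1 X \<bullet> column 1 X) * (column 2 X \<bullet> column 2 V)
      - (column 1 X \<bullet> column 2 X) * (column 1 X \<bullet> column 2 V + column 2 X \<bullet> column 1 V)))) (at X)"
    unfolding area_sq_def[abs_def] power2_eq_square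
  proof (rule has_derivative_eq_rhs[OF has_derivative_diff[OF has_derivative_mult[OF
      has_derivative_add[OF has_derivative_const i] has_derivative_add[OF has_derivative_const i]] has_derivative_mult[OF i i]]], rule ext)
    fix V :: "real^2^'n::{finite,linorder}"
    have c: "column 1 V \<bullet> column 1 X = column 1 X \<bullet> column 1 V" "column 2 V \<bullet> column 2 X = column 2 X \<bullet> column 2 V"
      "column 1 V \<bullet> column 2 X = column 2 X \<bullet> column 1 V" by (simp_all only: inner_commute)
    show "(1 + column 1 X \<bullet> column 1 X) * (0 + (column 2 X \<bullet> column 2 V + column 2 V \<bullet> column 2 X)) +
      (0 + (column 1 X \<bullet> column 1 V + column 1 V \<bullet> column 1 X)) * (1 + column 2 X \<bullet> column 2 X) -
      (column 1 X \<bullet> column 2 X * (column 1 X \<bullet> column 2 V + column 1 V \<bullet> column 2 X) +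
       (column 1 X \<bullet> column 2 V + column 1 V \<bullet> column 2 X) * (column 1 X \<bullet> column 2 X)) =
      2 * ((1 + column 2 X \<bullet> column 2 X) * (column 1 X \<bullet> column 1 V)
      + (1 + column 1 X \<bullet> column 1 X) * (column 2 X \<bullet> column 2 V)
      - (column 1 X \<bullet> column 2 X) * (column 1 X \<bullet> column 2 V + column 2 X \<bullet> column 1 V))"
      unfolding c by (simp add: algebra_simps)
  qed
  show ?thesis
    unfolding area_eq[abs_def]
  proof (rule has_derivative_eq_rhs[OF has_derivative_real_sqrt[OF s d]], rule ext)
    fix V :: "real^2^'n::{finite,linorder}"
    define A where "A = sqrt (area_sq X)"
    have A: "A > 0" using s by (simp add: A_def)
    show "2 * ((1 + column 2 X \<bullet> column 2 X) * (column 1 X \<bullet> column 1 V)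
      + (1 + column 1 X \<bullet> column 1 X) * (column 2 X \<bullet> column 2 V)
      - (column 1 X \<bullet> column 2 X) * (column 1 X \<bullet> column 2 V + column 2 X \<bullet> column 1 V)) * (inverse (sqrt (area_sq X)) / 2) =
      (co_a X *\<^sub>R column 1 X + co_b X *\<^sub>R column 2 X) \<bullet> column 1 V + (co_b X *\<^sub>R column 1 X + co_d X *\<^sub>R column 2 X) \<bullet> column 2 V"
      using A unfolding co_a_def co_b_def co_d_def area_eq A_def[symmetric] inner_add_left inner_scaleR_left
      by (simp add: divide_simps) (simp add: algebra_simps)
  qed
qed

section \<open>Monotonicity of the inclusion\<close>

text \<open>A column of the block matrix: two blocks of length n, followed by the two entries from
  the lowest block. \<open>cv1\<close> to \<open>cv4\<close> are the corresponding
  coordinates.\<close>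

definition colv :: "real^'n \<Rightarrow> real^'n \<Rightarrow> real \<Rightarrow> real \<Rightarrow> real^('n + 'n + 2)" where
  "colv x y a b = (\<chi> r. case r of Inl i \<Rightarrow> x $ i | Inr (Inl i) \<Rightarrow> y $ i | Inr (Inr j) \<Rightarrow> if j = 1 then a else b)"

definition cv1 :: "real^('n::finite + 'n + 2) \<Rightarrow> real^'n" where "cv1 p = (\<chi> i. p $ Inl i)"
definition cv2 :: "real^('n::finite + 'n + 2) \<Rightarrow> real^'n" where "cv2 p = (\<chi> i. p $ Inr (Inl i))"
definition cv3 :: "real^('n::finite + 'n + 2) \<Rightarrow> real" where "cv3 p = p $ Inr (Inr 1)"
definition cv4 :: "real^('n::finite + 'n + 2) \<Rightarrow> real" where "cv4 p = p $ Inr (Inr 2)"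

lemma cv_colv [simp]: "cv1 (colv x y a b) = x" "cv2 (colv x y a b) = y" "cv3 (colv x y a b) = a" "cv4 (colv x y a b) = b"
  by (simp_all add: cv1_def cv2_def cv3_def cv4_def colv_def vec_eq_iff)

lemma cv_linear:
  "cv1 (p + q) = cv1 p + cv1 q" "cv2 (p + q) = cv2 p + cv2 q" "cv3 (p + q) = cv3 p + cv3 q" "cv4 (p + q) = cv4 p + cv4 q"
  "cv1 (s *\<^sub>R p) = s *\<^sub>R cv1 p" "cv2 (s *\<^sub>R p) = s *\<^sub>R cv2 p" "cv3 (s *\<^sub>R p) = s * cv3 p" "cv4 (s *\<^sub>R p) = s * cv4 p"
  by (simp_all add: cv1_def cv2_def cv3_def cv4_def vec_eq_iff)

lemma colv_arith:
  "colv x y a b + colv x' y' a' b' = colv (x + x') (y + y') (a + a') (b + b')"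
  "colv x y a b - colv x' y' a' b' = colv (x - x') (y - y') (a - a') (b - b')"
  "s *\<^sub>R colv x y a b = colv (s *\<^sub>R x) (s *\<^sub>R y) (s * a) (s * b)"
  by (auto simp: colv_def vec_eq_iff split: sum.split)

lemma sum_UNIV_sum: "(\<Sum>r\<in>(UNIV :: ('a::finite + 'b::finite) set). f r) = (\<Sum>i\<in>UNIV. f (Inl i)) + (\<Sum>j\<in>UNIV. f (Inr j))"
  by (simp add: UNIV_Plus_UNIV[symmetric] sum.Plus del: UNIV_Plus_UNIV)

lemma norm_colv: "(norm (colv x y a b))\<^sup>2 = (norm x)\<^sup>2 + (norm y)\<^sup>2 + a\<^sup>2 + b\<^sup>2"
  unfolding power2_norm_eq_inner
  by (simp add: inner_vec_def sum_UNIV_sum colv_def UNIV_2 power2_eq_square)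

lemma norm_colv_le: "norm (colv x y a b) \<le> norm x + norm y + \<bar>a\<bar> + \<bar>b\<bar>"
proof (rule power2_le_imp_le)
  show "(norm (colv x y a b))\<^sup>2 \<le> (norm x + norm y + \<bar>a\<bar> + \<bar>b\<bar>)\<^sup>2"
    unfolding norm_colv by (simp add: power2_eq_square algebra_simps)
qed simp

lemma norm_le_colv: "norm x \<le> norm (colv x y a b)"
proof (rule power2_le_imp_le)
  show "(norm x)\<^sup>2 \<le> (norm (colv x y a b))\<^sup>2" unfolding norm_colv by simp
qed simp

text \<open>On a difference of two elements of \<open>C_set f\<close> the first two terms give the inner product of the
  increments of \<open>X\<close> and \<open>Df\<close>, and the last one a multiple of the determinant of the lowest block.\<close>

definition B_form :: "real \<Rightarrow> real^('n::finite + 'n + 2) \<Rightarrow> real^('n + 'n + 2) \<Rightarrow> real" where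
  "B_form M p q = cv1 p \<bullet> cv2 q - cv2 p \<bullet> cv1 q - M * (cv3 p * cv4 q - cv4 p * cv3 q)"

lemma bilinear_B_form: "bounded_bilinear (B_form M)"
  unfolding bilinear_conv_bounded_bilinear[symmetric] bilinear_def
  by (intro allI conjI linearI) (simp_all add: B_form_def cv_linear inner_add_left inner_add_right algebra_simps)

lemma null_form_B: "c > 0 \<Longrightarrow> null_form (B_form M) c"
  by (intro null_form.intro bilinear_B_form) (simp_all add: B_form_def inner_commute algebra_simps)

text \<open>The two columns of the block matrix formed from \<open>X\<close>, \<open>Y J\<close> and \<open>X\<^sup>T Y J - s J\<close>.\<close>

definition pack :: "real^2^'n \<Rightarrow> real^2^'n \<Rightarrow> real \<Rightarrow> (real^('n + 'n + 2)) \<times> (real^('n + 'n + 2))" where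
  "pack X Y s =
    (colv (column 1 X) (- column 2 Y) (- (column 1 X \<bullet> column 2 Y)) (s - column 2 X \<bullet> column 2 Y),
     colv (column 2 X) (column 1 Y) (column 1 X \<bullet> column 1 Y - s) (column 2 X \<bullet> column 1 Y))"

definition mcols :: "real^2^'m \<Rightarrow> (real^'m) \<times> (real^'m)" where "mcols A = (column 1 A, column 2 A)"

text \<open>Right multiplication by J takes the columns (Y1, Y2) to (- Y2, Y1). Since the columns of
  a Jacobian are the partial derivatives, membership in \<open>C_set f\<close> becomes an equation
  between pairs of partial derivatives.\<close>

lemma mcols_stack3:
  "mcols (stack3 X (Y ** J_mat) (transpose X ** Y ** J_mat - s *\<^sub>R J_mat)) = pack X Y s"
proof -
  have J: "J_mat $ 1 $ 1 = 0" "J_mat $ 1 $ 2 = 1" "J_mat $ 2 $ 1 = -1" "J_mat $ 2 $ 2 = 0" by (simp_all add: J_mat_def vector_2)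
  have t: "j = 1 \<or> j = 2" for j :: 2 by (rule exhaust_2)
  have n12: "(2::2) \<noteq> 1" by simp
  have "column 1 (stack3 X (Y ** J_mat) (transpose X ** Y ** J_mat - s *\<^sub>R J_mat)) $ r = fst (pack X Y s) $ r" for r
  proof (cases r)
    case (Inr r')
    then show ?thesis
    proof (cases r')
      case (Inr j)
      then show ?thesis using \<open>r = Inr r'\<close> t[of j] n12
        by (auto simp: column_def stack3_def pack_def colv_def matrix_matrix_mult_def sum_2 J inner_vec_def transpose_def)
    qed (simp add: column_def stack3_def pack_def colv_def matrix_matrix_mult_def sum_2 J)
  qed (simp add: column_def stack3_def pack_def colv_def)
  moreover have "column 2 (stack3 X (Y ** J_mat) (transpose X ** Y ** J_mat - s *\<^sub>R J_mat)) $ r = snd (pack X Y s) $ r" for r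
  proof (cases r)
    case (Inr r')
    then show ?thesis
    proof (cases r')
      case (Inr j)
      then show ?thesis using \<open>r = Inr r'\<close> t[of j] n12
        by (auto simp: column_def stack3_def pack_def colv_def matrix_matrix_mult_def sum_2 J inner_vec_def transpose_def)
    qed (simp add: column_def stack3_def pack_def colv_def matrix_matrix_mult_def sum_2 J)
  qed (simp add: column_def stack3_def pack_def colv_def)
  ultimately show ?thesis by (simp add: mcols_def prod_eq_iff vec_eq_iff)
qed

text \<open>Recovers X from \<open>pack X Y s\<close>, linearly. It makes the inclusion a fixed
  point equation for a map defined on all pairs, and as it does not increase the norm, a bound for
  the pair bounds X.\<close>

definition top_mat :: "(real^('n::finite + 'n + 2)) \<times> (real^('n + 'n + 2)) \<Rightarrow> real^2^'n" where
  "top_mat z = (\<chi> i j. if j = 1 then fst z $ Inl i else snd z $ Inl i)"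

lemma column_top_mat: "column 1 (top_mat z) = cv1 (fst z)" "column 2 (top_mat z) = cv1 (snd z)"
  by (simp_all add: column_def top_mat_def cv1_def)

lemma top_mat_pack: "top_mat (pack X Y s) = X"
proof -
  have "j = 1 \<or> j = 2" for j :: 2 by (rule exhaust_2)
  then show ?thesis by (auto simp: vec_eq_iff top_mat_def pack_def colv_def column_def)
qed

lemma bounded_linear_top_mat: "bounded_linear top_mat"
  unfolding linear_conv_bounded_linear[symmetric] by (intro linearI) (auto simp: top_mat_def vec_eq_iff)

lemma norm_cv1_le: "norm (cv1 p) \<le> norm p"
proof -
  have "p = colv (cv1 p) (cv2 p) (cv3 p) (cv4 p)"
  proof -
    have "j = 1 \<or> j = 2" for j :: 2 by (rule exhaust_2)
    then show ?thesis by (auto simp: vec_eq_iff colv_def cv1_def cv2_def cv3_def cv4_def split: sum.split)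
  qed
  then show ?thesis using norm_le_colv by metis
qed

lemma norm_top_mat: "norm (top_mat z) \<le> norm z"
proof (rule power2_le_imp_le)
  have "(norm (top_mat z))\<^sup>2 = (norm (cv1 (fst z)))\<^sup>2 + (norm (cv1 (snd z)))\<^sup>2" unfolding norm_columns column_top_mat ..
  also have "\<dots> \<le> (norm (fst z))\<^sup>2 + (norm (snd z))\<^sup>2" by (intro add_mono power_mono norm_cv1_le) auto
  also have "\<dots> = (norm z)\<^sup>2" by (simp add: norm_prod_def)
  finally show "(norm (top_mat z))\<^sup>2 \<le> (norm z)\<^sup>2" .
qed simp

lemma norm_mcols: "norm (mcols A) = norm A"
proof -
  have "(norm (mcols A))\<^sup>2 = (norm A)\<^sup>2" by (simp add: mcols_def norm_prod_def norm_columns)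
  then show ?thesis by (simp add: power2_eq_iff_nonneg)
qed

lemma column_axis: "column k (axis i (axis j c)) = (if k = j then axis i c else 0)"
  by (auto simp: vec_eq_iff column_def axis_def)

lemma mat_grad_columns:
  fixes f :: "real^2^'n \<Rightarrow> real"
  assumes "(f has_derivative (\<lambda>V. u \<bullet> column 1 V + v \<bullet> column 2 V)) (at X)"
  shows "column 1 (mat_grad f X) = u" "column 2 (mat_grad f X) = v"
proof -
  have "column j (mat_grad f X) $ i = u \<bullet> column 1 (axis i (axis j 1)) + v \<bullet> column 2 (axis i (axis j 1))" for i j
    using frechetI[OF assms] by (simp add: column_def mat_grad_def)
  then show "column 1 (mat_grad f X) = u" "column 2 (mat_grad f X) = v"
    by (auto simp: vec_eq_iff column_axis inner_axis)
qed

text \<open>From (I + X^T X) h = area * I follows X^T X h = area * I - h; so in the lowest block the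
  multiples of J by the area cancel and - h J remains.\<close>

lemma pack_area:
  fixes X :: "real^2^'n::{finite,linorder}"
  shows "pack X (mat_grad area X) (area X) =
    (colv (column 1 X) (- (co_b X *\<^sub>R column 1 X + co_d X *\<^sub>R column 2 X)) (co_b X) (co_d X),
     colv (column 2 X) (co_a X *\<^sub>R column 1 X + co_b X *\<^sub>R column 2 X) (- co_a X) (- co_b X))"
proof -
  note m = mat_grad_columns[OF area_has_derivative[of X]]
  define A where "A = area X"
  define p where "p = column 1 X \<bullet> column 1 X"
  define q where "q = column 2 X \<bullet> column 2 X"
  define s where "s = column 1 X \<bullet> column 2 X"
  have A: "A > 0" using area_ge[of X] by (simp add: A_def)
  have A2: "A * A = (1 + p) * (1 + q) - s * s" using area_power[of X] by (simp add: A_def p_def q_def s_def area_sq_def power2_eq_square)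
  have s': "column 2 X \<bullet> column 1 X = s" by (simp add: s_def inner_commute)
  have co: "co_a X = (1 + q) / A" "co_b X = - s / A" "co_d X = (1 + p) / A"
    by (simp_all add: co_a_def co_b_def co_d_def A_def p_def q_def s_def)
  have ip: "column 1 X \<bullet> (co_b X *\<^sub>R column 1 X + co_d X *\<^sub>R column 2 X) = - co_b X"
    "column 2 X \<bullet> (co_b X *\<^sub>R column 1 X + co_d X *\<^sub>R column 2 X) = A - co_d X"
    "column 1 X \<bullet> (co_a X *\<^sub>R column 1 X + co_b X *\<^sub>R column 2 X) = A - co_a X"
    "column 2 X \<bullet> (co_a X *\<^sub>R column 1 X + co_b X *\<^sub>R column 2 X) = - co_b X"
    unfolding inner_add_right inner_scaleR_right s' s_def[symmetric] p_def[symmetric] q_def[symmetric] co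
    using A A2 by (simp_all add: divide_simps) (simp_all add: algebra_simps)
  show ?thesis unfolding pack_def m ip A_def[symmetric] by simp
qed

text \<open>\<open>monotone_core\<close> controls the increments of X and of h, here n and s. On a
  bounded set these control all of z, whose remaining entries are increments of X h.\<close>

lemma area_monotone:
  assumes r: "r > 0"
  shows "\<exists>M. \<exists>c>0. \<forall>X X' :: real^2^'n::{finite,linorder}. norm X < r \<longrightarrow> norm X' < r \<longrightarrow>
    (let z = pack X (mat_grad area X) (area X) - pack X' (mat_grad area X') (area X') in
     B_form M (fst z) (snd z) \<ge> c * (norm z)\<^sup>2)"
proof -
  \<comment> \<open>\<open>T\<close> bounds the trace of h on the ball of radius r, hence all its
    entries, as h is positive definite. \<open>K\<close> is such that |z| <= 2 K (n + s).\<close>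
  define T where "T = 2 + r\<^sup>2"
  define M where "M = 3 * (3 * T\<^sup>2 + 1) * (4 * T * r\<^sup>2 + 1)"
  define K where "K = 2 * T + 2 * r + 3"
  have T: "T \<ge> 2" by (simp add: T_def)
  have K: "K > 0" using T r by (simp add: K_def)
  have main: "1 / (32 * T * K\<^sup>2) * (norm z)\<^sup>2 \<le> B_form M (fst z) (snd z)"
    if X: "norm X < r" and X': "norm X' < r"
      and z: "z = pack X (mat_grad area X) (area X) - pack X' (mat_grad area X') (area X')"
    for X X' :: "real^2^'n::{finite,linorder}" and z
  proof -
    define x y x' y' where xy: "x = column 1 X" "y = column 2 X" "x' = column 1 X'" "y' = column 2 X'"
    define a b d a' b' d' where abd: "a = co_a X" "b = co_b X" "d = co_d X" "a' = co_a X'" "b' = co_b X'" "d' = co_d X'"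
    define u v where uv: "u = (a *\<^sub>R x + b *\<^sub>R y) - (a' *\<^sub>R x' + b' *\<^sub>R y')" "v = (b *\<^sub>R x + d *\<^sub>R y) - (b' *\<^sub>R x' + d' *\<^sub>R y')"
    define n where "n = norm (x - x') + norm (y - y')"
    define s where "s = \<bar>a - a'\<bar> + \<bar>b - b'\<bar> + \<bar>d - d'\<bar>"
    have z': "z = (colv (x - x') (- v) (b - b') (d - d'), colv (y - y') u (- (a - a')) (- (b - b')))"
      unfolding z pack_area xy abd uv by (simp add: colv_arith algebra_simps)
    have h: "a * d - b\<^sup>2 = 1" "a' * d' - b'\<^sup>2 = 1" unfolding abd by (rule co_det)+
    have p: "0 < a" "0 < d" "0 < a'" "0 < d'" unfolding abd by (rule co_pos)+
    have "(norm X)\<^sup>2 \<le> r\<^sup>2" "(norm X')\<^sup>2 \<le> r\<^sup>2" using X X' by (auto intro!: power_mono)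
    then have aT: "a + d \<le> T" "a' + d' \<le> T"
      using co_le[of X] co_le[of X'] unfolding abd T_def by linarith+
    have nr: "norm x' \<le> r" "norm y' \<le> r"
      unfolding xy by (rule order.trans[OF norm_column_le less_imp_le[OF X']])+
    have core: "n\<^sup>2 / (4 * T) + s\<^sup>2 \<le> (x - x') \<bullet> u + (y - y') \<bullet> v + M * ((b - b')\<^sup>2 - (a - a') * (d - d'))"
      unfolding n_def s_def uv by (rule monotone_core[OF h p aT nr M_def])
    have Bz: "B_form M (fst z) (snd z) = (x - x') \<bullet> u + (y - y') \<bullet> v + M * ((b - b')\<^sup>2 - (a - a') * (d - d'))"
      unfolding z' B_form_def fst_conv snd_conv cv_colv
      by (simp add: inner_commute[of v] power2_eq_square algebra_simps)
    have b: "\<bar>b\<bar> \<le> T"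
    proof (rule power2_le_imp_le)
      have "\<bar>b\<bar>\<^sup>2 \<le> a * d" using h by simp
      also have "\<dots> \<le> T * T" using p aT T by (intro mult_mono) auto
      finally show "\<bar>b\<bar>\<^sup>2 \<le> T\<^sup>2" by (simp add: power2_eq_square)
    qed (use T in simp)
    have ad: "\<bar>a\<bar> \<le> T" "\<bar>d\<bar> \<le> T" using p aT by auto
    have s1: "\<bar>a - a'\<bar> \<le> s" "\<bar>b - b'\<bar> \<le> s" "\<bar>d - d'\<bar> \<le> s" "\<bar>a - a'\<bar> + \<bar>b - b'\<bar> \<le> s" "\<bar>b - b'\<bar> + \<bar>d - d'\<bar> \<le> s"
      by (auto simp: s_def)
    have s0: "s \<ge> 0" "n \<ge> 0" by (simp_all add: s_def n_def)
    have lin: "norm ((k *\<^sub>R x + l *\<^sub>R y) - (k' *\<^sub>R x' + l' *\<^sub>R y')) \<le> T * n + r * s"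
      if "\<bar>k\<bar> \<le> T" "\<bar>l\<bar> \<le> T" "\<bar>k - k'\<bar> + \<bar>l - l'\<bar> \<le> s" for k l k' l' :: real
    proof -
      have "(k *\<^sub>R x + l *\<^sub>R y) - (k' *\<^sub>R x' + l' *\<^sub>R y') = (k *\<^sub>R (x - x') + l *\<^sub>R (y - y')) + ((k - k') *\<^sub>R x' + (l - l') *\<^sub>R y')"
        by (simp add: algebra_simps)
      then have "norm ((k *\<^sub>R x + l *\<^sub>R y) - (k' *\<^sub>R x' + l' *\<^sub>R y')) \<le>
        (norm (k *\<^sub>R (x - x')) + norm (l *\<^sub>R (y - y'))) + (norm ((k - k') *\<^sub>R x') + norm ((l - l') *\<^sub>R y'))"
        by (simp only:) (intro norm_triangle_le add_mono norm_triangle_ineq)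
      also have "\<dots> \<le> (T * norm (x - x') + T * norm (y - y')) + (\<bar>k - k'\<bar> * r + \<bar>l - l'\<bar> * r)"
        using that nr unfolding norm_scaleR by (intro add_mono mult_mono) auto
      also have "\<dots> = T * n + r * (\<bar>k - k'\<bar> + \<bar>l - l'\<bar>)" by (simp add: n_def algebra_simps)
      also have "\<dots> \<le> T * n + r * s" using that(3) r by (intro add_left_mono mult_left_mono) auto
      finally show ?thesis .
    qed
    have uv_le: "norm u \<le> T * n + r * s" "norm v \<le> T * n + r * s"
      unfolding uv by (rule lin[OF ad(1) b s1(4)], rule lin[OF b ad(2) s1(5)])
    have "norm z \<le> norm (fst z) + norm (snd z)" by (metis norm_Pair_le prod.collapse)
    also have "\<dots> \<le> (norm (x - x') + norm v + s + s) + (norm (y - y') + norm u + s + s)"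
      unfolding z' fst_conv snd_conv
      using norm_colv_le[of "x - x'" "- v" "b - b'" "d - d'"] norm_colv_le[of "y - y'" u "- (a - a')" "- (b - b')"] s1(1,2,3)
      by simp
    also have "\<dots> \<le> n + 2 * (T * n + r * s) + 4 * s" using uv_le by (simp add: n_def)
    also have "\<dots> \<le> 2 * K * (n + s)" 
    proof -
      have "2 * K * (n + s) - (n + 2 * (T * n + r * s) + 4 * s) = (2 * T + 4 * r + 5) * n + (4 * T + 2 * r + 2) * s"
        by (simp add: K_def algebra_simps)
      also have "\<dots> \<ge> 0" using s0 T r by simp
      finally show ?thesis by simp
    qed
    finally have "norm z \<le> 2 * K * (n + s)" .
    then have "(norm z)\<^sup>2 \<le> (2 * K * (n + s))\<^sup>2" by (intro power_mono) auto
    also have "\<dots> = 4 * K\<^sup>2 * (n + s)\<^sup>2" by (simp add: power_mult_distrib)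

    also have "\<dots> \<le> 4 * K\<^sup>2 * (8 * T * (n\<^sup>2 / (4 * T) + s\<^sup>2))"
    proof (rule mult_left_mono)
      have "0 \<le> (n - s)\<^sup>2" by simp
      then have "(n + s)\<^sup>2 \<le> 2 * n\<^sup>2 + 2 * s\<^sup>2" by (simp add: power2_eq_square algebra_simps)
      also have "\<dots> \<le> 2 * n\<^sup>2 + 8 * T * s\<^sup>2" using T by (intro add_left_mono mult_right_mono) auto
      also have "\<dots> = 8 * T * (n\<^sup>2 / (4 * T) + s\<^sup>2)" using T by (simp add: field_simps)
      finally show "(n + s)\<^sup>2 \<le> 8 * T * (n\<^sup>2 / (4 * T) + s\<^sup>2)" .
    qed simp
    also have "\<dots> = 32 * T * K\<^sup>2 * (n\<^sup>2 / (4 * T) + s\<^sup>2)" by simp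
    also have "\<dots> \<le> 32 * T * K\<^sup>2 * B_form M (fst z) (snd z)"
      unfolding Bz using T by (intro mult_left_mono core) auto
    finally show ?thesis using T K by (simp add: divide_le_eq mult_ac)
  qed
  show ?thesis
    unfolding Let_def using T K by (intro exI[of _ M] exI[of _ "1 / (32 * T * K\<^sup>2)"] conjI allI impI main) auto
qed

section \<open>Stability under C^2 perturbations\<close>

lemma area_differentiable: "area differentiable (at X)"
  using area_has_derivative by (rule differentiableI)

lemma area_derivative_differentiable:
  fixes X :: "real^2^'n::{finite,linorder}"
  shows "(\<lambda>X. frechet_derivative area (at X) V) differentiable (at X)"
proof -
  have c: "(\<lambda>X::real^2^'n::{finite,linorder}. column j X) differentiable (at X)" for j
    by (rule bounded_linear_imp_differentiable[OF bounded_linear_column])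
  have i: "(\<lambda>X::real^2^'n::{finite,linorder}. column j X \<bullet> column k X) differentiable (at X)" for j k
    using has_derivative_inner[OF frechetD[OF c] frechetD[OF c]] by (rule differentiableI)
  have a0: "area X \<noteq> 0" using area_ge[of X] by simp
  note dv = differentiable_divide[OF _ area_differentiable a0]
  have co: "co_a differentiable (at X)" "co_b differentiable (at X)" "co_d differentiable (at X)"
    unfolding co_a_def[abs_def] co_b_def[abs_def] co_d_def[abs_def]
    by (intro dv differentiable_add differentiable_minus differentiable_const i)+
  have "(\<lambda>X. (co_a X *\<^sub>R column 1 X + co_b X *\<^sub>R column 2 X) \<bullet> column 1 V
     + (co_b X *\<^sub>R column 1 X + co_d X *\<^sub>R column 2 X) \<bullet> column 2 V) differentiable (at X)"
    by (intro differentiable_add differentiable_inner differentiable_const differentiable_scaleR co c)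
  then show ?thesis by (simp only: frechetI[OF area_has_derivative])
qed

lemma Basis_lipschitz:
  fixes g :: "'a::euclidean_space \<Rightarrow> 'b::real_normed_vector"
  assumes S: "convex S" and d: "\<And>x. x \<in> S \<Longrightarrow> g differentiable (at x)"
    and b: "\<And>x b. x \<in> S \<Longrightarrow> b \<in> Basis \<Longrightarrow> norm (frechet_derivative g (at x) b) \<le> \<alpha>" and xy: "x \<in> S" "y \<in> S"
  shows "norm (g x - g y) \<le> real DIM('a) * \<alpha> * norm (x - y)"
proof (rule differentiable_bound[OF S _ _ xy])
  fix x assume x: "x \<in> S"
  show "(g has_derivative frechet_derivative g (at x)) (at x within S)"
    by (rule has_derivative_at_withinI[OF frechetD[OF d[OF x]]])
  show "onorm (frechet_derivative g (at x)) \<le> real DIM('a) * \<alpha>"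
    by (rule onorm_le[OF norm_linear_Basis_bound[OF has_derivative_linear[OF frechetD[OF d[OF x]]] b[OF x]]])
qed

lemma inner_mat_grad:
  assumes "b \<in> Basis" shows "mat_grad f X \<bullet> b = frechet_derivative f (at X) b"
proof -
  obtain i j where b: "b = axis i (axis j 1)" using assms by (auto simp: Basis_vec_def)
  show ?thesis unfolding b by (simp add: inner_axis mat_grad_def)
qed

text \<open>The form in which the C^2 bound enters: by the mean value inequality, the increments of
  f - area and of its gradient on the ball are at most a multiple of \<alpha> |X - X'|.\<close>

definition C2_close :: "real \<Rightarrow> real \<Rightarrow> (real^2^'n::{finite,linorder} \<Rightarrow> real) \<Rightarrow> bool" where
  "C2_close \<rho> \<alpha> f \<longleftrightarrow> (\<forall>X. f differentiable (at X)) \<and> (\<forall>b\<in>Basis. \<forall>X. (\<lambda>X. frechet_derivative f (at X) b) differentiable (at X)) \<and>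
    (\<forall>X\<in>ball 0 \<rho>. \<forall>b\<in>Basis. \<bar>frechet_derivative (\<lambda>X. f X - area X) (at X) b\<bar> \<le> \<alpha> \<and>
      (\<forall>b'\<in>Basis. \<bar>frechet_derivative (\<lambda>X. frechet_derivative (\<lambda>X. f X - area X) (at X) b) (at X) b'\<bar> \<le> \<alpha>))"

lemma inner_diff_bound:
  fixes x z x' z' :: "'v::real_inner"
  shows "\<bar>x \<bullet> z - x' \<bullet> z'\<bar> \<le> norm (x - x') * norm z + norm x' * norm (z - z')"
proof -
  have "x \<bullet> z - x' \<bullet> z' = (x - x') \<bullet> z + x' \<bullet> (z - z')" by (simp add: inner_diff_left inner_diff_right)
  then show ?thesis
    using Cauchy_Schwarz_ineq2[of "x - x'" z] Cauchy_Schwarz_ineq2[of x' "z - z'"] by linarith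
qed

text \<open>For fixed X, \<open>pack\<close> is affine in its other two arguments, so the difference
  of the two increments involves f - area only and has first block 0. Its entries are increments of
  f - area, of the gradient of f - area, or of inner products of that gradient with columns of X,
  each of size \<alpha> |X - X'|.\<close>

lemma pack_perturbation:
  fixes f :: "real^2^'n::{finite,linorder} \<Rightarrow> real"
  assumes f: "C2_close \<rho> \<alpha> f" and \<alpha>: "\<alpha> \<ge> 0" and X: "norm X < \<rho>" "norm X' < \<rho>"
  defines "N \<equiv> real DIM(real^2^'n::{finite,linorder})"
  shows "norm ((pack X (mat_grad f X) (f X) - pack X' (mat_grad f X') (f X'))
    - (pack X (mat_grad area X) (area X) - pack X' (mat_grad area X') (area X')))
    \<le> (2 * N * N + 4 * (N + \<rho> * N * N) + 2 * N) * \<alpha> * norm (X - X')"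
proof -
  define g where "g = (\<lambda>X. f X - area X)"
  define Z where "Z = mat_grad g"
  let ?n = "norm (X - X')"
  have fd: "f differentiable (at X)" and fd2: "b \<in> Basis \<Longrightarrow> (\<lambda>X. frechet_derivative f (at X) b) differentiable (at X)" for X b
    using f unfolding C2_close_def by blast+
  have b1: "norm (frechet_derivative g (at X) b) \<le> \<alpha>"
    and b2: "b' \<in> Basis \<Longrightarrow> norm (frechet_derivative (\<lambda>X. frechet_derivative g (at X) b) (at X) b') \<le> \<alpha>"
    if "X \<in> ball 0 \<rho>" "b \<in> Basis" for X b b'
    using f that unfolding C2_close_def g_def real_norm_def by blast+
  have fg: "frechet_derivative g (at X) b = frechet_derivative f (at X) b - frechet_derivative area (at X) b" for X b
    unfolding g_def by (rule frechetI[OF has_derivative_diff[OF frechetD[OF fd] frechetD[OF area_differentiable]]])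
  have gd: "g differentiable (at X)" for X unfolding g_def by (intro differentiable_diff fd area_differentiable)
  have gd2: "(\<lambda>X. frechet_derivative g (at X) b) differentiable (at X)" if "b \<in> Basis" for X b
    unfolding fg by (intro differentiable_diff fd2 that area_derivative_differentiable)
  have Zf: "Z X = mat_grad f X - mat_grad area X" for X by (simp add: Z_def mat_grad_def fg vec_eq_iff)
  have N: "N \<ge> 0" by (simp add: N_def)
  have \<rho>: "\<rho> > 0" using X(1) norm_ge_zero[of X] by linarith
  have in_ball: "X \<in> ball 0 \<rho>" "X' \<in> ball 0 \<rho>" using X by auto
  have dg: "\<bar>g X - g X'\<bar> \<le> N * \<alpha> * ?n"
    unfolding N_def real_norm_def[symmetric] by (rule Basis_lipschitz[OF convex_ball gd b1 in_ball])
  have Zb: "norm (Z X) \<le> N * \<alpha>"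
  proof -
    have "norm (Z X) \<le> (\<Sum>b\<in>Basis. \<bar>Z X \<bullet> b\<bar>)" by (rule norm_le_l1)
    also have "\<dots> \<le> (\<Sum>b\<in>(Basis::(real^2^'n::{finite,linorder}) set). \<alpha>)"
      by (intro sum_mono) (simp only: Z_def inner_mat_grad real_norm_def[symmetric] b1[OF in_ball(1)])
    finally show ?thesis by (simp add: N_def)
  qed
  have dZ: "norm (Z X - Z X') \<le> N * N * \<alpha> * ?n"
  proof -
    have "norm (Z X - Z X') \<le> (\<Sum>b\<in>Basis. \<bar>(Z X - Z X') \<bullet> b\<bar>)" by (rule norm_le_l1)
    also have "\<dots> \<le> (\<Sum>b\<in>(Basis::(real^2^'n::{finite,linorder}) set). N * \<alpha> * ?n)"
    proof (rule sum_mono)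
      fix b :: "real^2^'n::{finite,linorder}" assume b: "b \<in> Basis"
      show "\<bar>(Z X - Z X') \<bullet> b\<bar> \<le> N * \<alpha> * ?n"
        unfolding inner_diff_left Z_def inner_mat_grad[OF b] N_def real_norm_def[symmetric]
        by (rule Basis_lipschitz[OF convex_ball gd2[OF b] b2[OF _ b] in_ball])
    qed
    finally show ?thesis by (simp add: N_def mult_ac)
  qed
  have ip: "\<bar>column i X \<bullet> column j (Z X) - column i X' \<bullet> column j (Z X')\<bar> \<le> (N + \<rho> * N * N) * \<alpha> * ?n" for i j
  proof -
    have "\<bar>column i X \<bullet> column j (Z X) - column i X' \<bullet> column j (Z X')\<bar> \<le>
      norm (column i (X - X')) * norm (column j (Z X)) + norm (column i X') * norm (column j (Z X - Z X'))"
      unfolding column_simps by (rule inner_diff_bound)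
    also have "\<dots> \<le> ?n * (N * \<alpha>) + \<rho> * (N * N * \<alpha> * ?n)"
    proof (intro add_mono mult_mono)
      show "norm (column i X') \<le> \<rho>" by (rule order.trans[OF norm_column_le less_imp_le[OF X(2)]])
    qed (use \<rho> in \<open>auto intro: order.trans[OF norm_column_le] Zb dZ norm_column_le\<close>)
    finally show ?thesis by (simp add: algebra_simps)
  qed
  let ?dZ = "Z X - Z X'" and ?ip = "\<lambda>i j. column i X \<bullet> column j (Z X) - column i X' \<bullet> column j (Z X')"
  have eq: "(pack X (mat_grad f X) (f X) - pack X' (mat_grad f X') (f X')) - (pack X (mat_grad area X) (area X) - pack X' (mat_grad area X') (area X'))
    = (colv 0 (- column 2 ?dZ) (- ?ip 1 2) ((g X - g X') - ?ip 2 2), colv 0 (column 1 ?dZ) (?ip 1 1 - (g X - g X')) (?ip 2 1))"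
    unfolding Zf g_def pack_def by (simp add: colv_arith column_simps inner_diff_right algebra_simps)
  have "norm (colv 0 (- column 2 ?dZ) (- ?ip 1 2) ((g X - g X') - ?ip 2 2)) \<le> norm ?dZ + \<bar>?ip 1 2\<bar> + (\<bar>g X - g X'\<bar> + \<bar>?ip 2 2\<bar>)"
    using norm_colv_le[of 0 "- column 2 ?dZ" "- ?ip 1 2" "(g X - g X') - ?ip 2 2"] norm_column_le[of 2 ?dZ]
      abs_triangle_ineq4[of "g X - g X'" "?ip 2 2"]
    unfolding norm_minus_cancel abs_minus_cancel norm_zero by linarith
  moreover have "norm (colv 0 (column 1 ?dZ) (?ip 1 1 - (g X - g X')) (?ip 2 1)) \<le> norm ?dZ + (\<bar>?ip 1 1\<bar> + \<bar>g X - g X'\<bar>) + \<bar>?ip 2 1\<bar>"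
    using norm_colv_le[of 0 "column 1 ?dZ" "?ip 1 1 - (g X - g X')" "?ip 2 1"] norm_column_le[of 1 ?dZ]
      abs_triangle_ineq4[of "?ip 1 1" "g X - g X'"]
    unfolding norm_zero by linarith
  ultimately have "norm (colv 0 (- column 2 ?dZ) (- ?ip 1 2) ((g X - g X') - ?ip 2 2)) + norm (colv 0 (column 1 ?dZ) (?ip 1 1 - (g X - g X')) (?ip 2 1))
    \<le> 2 * (N * N * \<alpha> * ?n) + 4 * ((N + \<rho> * N * N) * \<alpha> * ?n) + 2 * (N * \<alpha> * ?n)"
    using dZ dg ip[of 1 2] ip[of 2 2] ip[of 1 1] ip[of 2 1] by linarith
  also have "\<dots> = (2 * N * N + 4 * (N + \<rho> * N * N) + 2 * N) * \<alpha> * ?n" by (simp only: distrib_right mult.assoc)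
  finally show ?thesis unfolding eq by (rule order.trans[OF norm_Pair_le])
qed

lemma monotone_perturbed:
  assumes \<rho>: "\<rho> > 0"
  shows "\<exists>M c \<alpha>. c > 0 \<and> \<alpha> > 0 \<and> (\<forall>(f :: real^2^'n::{finite,linorder} \<Rightarrow> real) X X'. C2_close \<rho> \<alpha> f \<longrightarrow> norm X < \<rho> \<longrightarrow> norm X' < \<rho> \<longrightarrow>
    (let z = pack X (mat_grad f X) (f X) - pack X' (mat_grad f X') (f X') in B_form M (fst z) (snd z) \<ge> c * (norm z)\<^sup>2))"
proof -
  obtain M c where c: "c > 0" and mon: "\<And>X X' :: real^2^'n::{finite,linorder}. norm X < \<rho> \<Longrightarrow> norm X' < \<rho> \<Longrightarrow>
    (let z = pack X (mat_grad area X) (area X) - pack X' (mat_grad area X') (area X') in B_form M (fst z) (snd z) \<ge> c * (norm z)\<^sup>2)"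
    using area_monotone[OF \<rho>] by blast
  interpret null_form "B_form M :: real^('n + 'n + 2) \<Rightarrow> _" c by (rule null_form_B[OF c])
  define N where "N = real DIM(real^2^'n::{finite,linorder})"
  define C where "C = 2 * N * N + 4 * (N + \<rho> * N * N) + 2 * N"
  have C: "C \<ge> 0" using \<rho> by (simp add: C_def N_def)
  \<comment> \<open>With |e| <= \<delta> |a| <= |a| the mixed and the quadratic error terms are
    together at most 3 \<beta> \<delta> |a|^2, half of the coercivity. What remains is c / 2 *
    |a|^2, and |z| <= 2 |a| makes the final constant c / 8.\<close>
  define \<delta> where "\<delta> = min 1 (c / (6 * \<beta>))"
  have \<delta>: "\<delta> > 0" "\<delta> \<le> 1" "3 * \<beta> * \<delta> \<le> c / 2"
  proof -
    have "\<delta> * (6 * \<beta>) \<le> c" using beta(1) by (subst pos_le_divide_eq[symmetric]) (auto simp: \<delta>_def)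
    then show "3 * \<beta> * \<delta> \<le> c / 2" by (simp add: mult_ac)
  qed (use c beta(1) in \<open>auto simp: \<delta>_def\<close>)
  define \<alpha> where "\<alpha> = \<delta> / (C + 1)"
  have \<alpha>: "\<alpha> > 0" "C * \<alpha> \<le> \<delta>" using \<delta>(1) C by (auto simp: \<alpha>_def field_simps)
  have main: "c / 8 * (norm z)\<^sup>2 \<le> B_form M (fst z) (snd z)"
    if f: "C2_close \<rho> \<alpha> f" and X: "norm X < \<rho>" "norm X' < \<rho>" and z: "z = pack X (mat_grad f X) (f X) - pack X' (mat_grad f X') (f X')"
    for f X X' and z :: "(real^('n + 'n + 2)) \<times> (real^('n + 'n + 2))"
  proof -
    define a where "a = pack X (mat_grad area X) (area X) - pack X' (mat_grad area X') (area X')"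
    define e where "e = z - a"
    have Qa: "c * (norm a)\<^sup>2 \<le> Q a" using mon[OF X] unfolding Let_def Q_def a_def .
    have "top_mat a = X - X'"
      unfolding a_def by (simp only: linear_diff[OF bounded_linear.linear[OF bounded_linear_top_mat]] top_mat_pack)
    then have Xa: "norm (X - X') \<le> norm a" using norm_top_mat[of a] by simp
    have "norm e \<le> C * \<alpha> * norm (X - X')"
      unfolding e_def z a_def C_def N_def by (rule pack_perturbation[OF f less_imp_le[OF \<alpha>(1)] X])
    also have "\<dots> \<le> \<delta> * norm a" using \<alpha>(2) Xa \<delta>(1) by (intro mult_mono) auto
    finally have e: "norm e \<le> \<delta> * norm a" .
    also have "\<dots> \<le> norm a" using \<delta>(2) mult_right_mono[of \<delta> 1 "norm a"] by simp
    finally have e1: "norm e \<le> norm a" .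
    have z': "z = a + e" by (simp add: e_def)
    have "\<beta> * (norm a * norm e) \<le> \<beta> * (norm a * (\<delta> * norm a))" using beta(1) e by (intro mult_left_mono) auto
    moreover have "\<beta> * (norm e * norm e) \<le> \<beta> * (norm a * (\<delta> * norm a))" using beta(1) e e1 by (intro mult_left_mono mult_mono) auto
    moreover have "3 * \<beta> * \<delta> * (norm a)\<^sup>2 \<le> c / 2 * (norm a)\<^sup>2" using \<delta>(3) by (rule mult_right_mono) simp
    moreover have "3 * \<beta> * \<delta> * (norm a)\<^sup>2 = 3 * (\<beta> * (norm a * (\<delta> * norm a)))" by (simp add: power2_eq_square)
    moreover have "Q z \<ge> Q a - 2 * (\<beta> * (norm a * norm e)) - \<beta> * (norm e * norm e)"
      using Q_add_ge[of a e] by (simp add: z' power2_eq_square mult.assoc)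
    moreover have "c * (norm a)\<^sup>2 = c / 2 * (norm a)\<^sup>2 + c / 2 * (norm a)\<^sup>2" by simp
    ultimately have "c / 2 * (norm a)\<^sup>2 \<le> Q z" using Qa by linarith
    moreover have "(norm z)\<^sup>2 \<le> (2 * norm a)\<^sup>2"
      unfolding z' using norm_triangle_ineq[of a e] e1 by (intro power_mono) auto
    then have "c / 8 * (norm z)\<^sup>2 \<le> c / 8 * (2 * norm a)\<^sup>2" using c by (intro mult_left_mono) auto
    moreover have "c / 8 * (2 * norm a)\<^sup>2 = c / 2 * (norm a)\<^sup>2" by (simp add: power_mult_distrib)
    ultimately show ?thesis unfolding Q_def by linarith
  qed
  show ?thesis
    unfolding Let_def using c \<alpha>(1) by (intro exI[of _ M] exI[of _ "c / 8"] exI[of _ \<alpha>] conjI allI impI main) auto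
qed

section \<open>Regularity of solutions of the inclusion\<close>

text \<open>The last list entry is differentiated first, so splitting the list at its end exposes
  the innermost derivative, the one that \<open>CH\<close> splits off.\<close>

lemma iter_deriv_append: "iter_deriv g (vs @ [b]) = iter_deriv (\<lambda>x. frechet_derivative g (at x) b) vs"
  by (induction vs) simp_all

lemma Ck_on_derivative:
  assumes g: "Ck_on (Suc k) S g" and b: "b \<in> Basis"
  shows "Ck_on k S (\<lambda>x. frechet_derivative g (at x) b)"
  unfolding Ck_on_def
proof (intro conjI allI impI)
  fix vs :: "'a list"
  assume "set vs \<subseteq> Basis \<and> length vs < k"
  then have "set (vs @ [b]) \<subseteq> Basis \<and> length (vs @ [b]) < Suc k" using b by auto
  then show "\<forall>x\<in>S. iter_deriv (\<lambda>x. frechet_derivative g (at x) b) vs differentiable (at x)"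
    using g unfolding Ck_on_def iter_deriv_append[symmetric] by blast
next
  fix vs :: "'a list"
  assume "set vs \<subseteq> Basis \<and> length vs \<le> k"
  then have "set (vs @ [b]) \<subseteq> Basis \<and> length (vs @ [b]) \<le> Suc k" using b by auto
  then show "continuous_on S (iter_deriv (\<lambda>x. frechet_derivative g (at x) b) vs)"
    using g unfolding Ck_on_def iter_deriv_append[symmetric] by blast
qed

lemma Ck_on_differentiable: "Ck_on (Suc k) S g \<Longrightarrow> x \<in> S \<Longrightarrow> g differentiable (at x)"
  unfolding Ck_on_def by (drule conjunct1, drule spec[of _ "[]"]) simp

text \<open>One order of differentiability is traded for exponent 1: continuous derivatives of order
  m + 1 make those of order m locally Lipschitz.\<close>

lemma Ck_on_imp_CH:
  fixes g :: "'a::euclidean_space \<Rightarrow> 'b::real_normed_vector"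
  assumes S: "open S" shows "Ck_on (Suc m) S g \<Longrightarrow> CH m 1 S g"
proof (induction m arbitrary: g)
  case 0
  have "lhol 1 S g"
  proof (rule lhol_of_derivative[OF S])
    show "g differentiable (at x)" if "x \<in> S" for x by (rule Ck_on_differentiable[OF 0 that])
    show "continuous_on S (\<lambda>x. frechet_derivative g (at x) b)" if "b \<in> Basis" for b
    proof -
      have "set [b] \<subseteq> Basis \<and> length [b] \<le> Suc 0" using that by simp
      then have "continuous_on S (iter_deriv g [b])" using 0 unfolding Ck_on_def by blast
      then show ?thesis by simp
    qed
  qed
  then show ?case by simp
next
  case (Suc m)
  then show ?case using Ck_on_differentiable[OF Suc.prems] Ck_on_derivative[OF Suc.prems] by simp
qed

lemma CH_iter_deriv:
  fixes g :: "'a::euclidean_space \<Rightarrow> 'b::real_normed_vector"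
  shows "CH m \<sigma> S g \<Longrightarrow> set vs \<subseteq> Basis \<Longrightarrow> length vs \<le> m \<Longrightarrow> CH (m - length vs) \<sigma> S (iter_deriv g vs)"
proof (induction vs arbitrary: g m rule: rev_induct)
  case (snoc b vs)
  then obtain m' where m: "m = Suc m'" by (cases m) auto
  have "CH m' \<sigma> S (\<lambda>x. frechet_derivative g (at x) b)" using snoc.prems unfolding m by simp
  then show ?case using snoc.IH[of m' "\<lambda>x. frechet_derivative g (at x) b"] snoc.prems by (simp add: iter_deriv_append m)
qed simp

text \<open>Points of \<open>K\<close> closer than a Lebesgue number \<delta> of a finite cover lie
  in a common ball; for all other pairs a bound of \<open>h\<close> on \<open>K\<close>, divided by
  \<delta>^\<sigma>, suffices.\<close>

lemma lhol_compact:
  fixes h :: "'a::euclidean_space \<Rightarrow> 'b::real_normed_vector"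
  assumes h: "lhol \<sigma> S h" and \<sigma>: "0 < \<sigma>" and K: "compact K" "K \<subseteq> S"
  shows "\<exists>C. \<forall>x\<in>K. \<forall>y\<in>K. norm (h x - h y) \<le> C * dist x y powr \<sigma>"
proof -
  have "\<forall>x\<in>K. \<exists>p. fst p > 0 \<and> snd p \<ge> 0 \<and> (\<forall>y\<in>ball x (2 * fst p). \<forall>z\<in>ball x (2 * fst p). norm (h y - h z) \<le> snd p * norm (y - z) powr \<sigma>)"
  proof
    fix x assume "x \<in> K"
    then obtain r C where "r > 0" "C \<ge> 0" "ball x r \<subseteq> S" "\<And>y z. y \<in> ball x r \<Longrightarrow> z \<in> ball x r \<Longrightarrow> norm (h y - h z) \<le> C * norm (y - z) powr \<sigma>"
      using lholD[OF h subsetD[OF K(2)]] by metis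
    then show "\<exists>p. fst p > 0 \<and> snd p \<ge> 0 \<and> (\<forall>y\<in>ball x (2 * fst p). \<forall>z\<in>ball x (2 * fst p). norm (h y - h z) \<le> snd p * norm (y - z) powr \<sigma>)"
      by (intro exI[of _ "(r / 2, C)"]) auto
  qed
  then obtain p where p: "\<And>x. x \<in> K \<Longrightarrow> fst (p x) > 0" "\<And>x. x \<in> K \<Longrightarrow> snd (p x) \<ge> 0"
    "\<And>x y z. x \<in> K \<Longrightarrow> y \<in> ball x (2 * fst (p x)) \<Longrightarrow> z \<in> ball x (2 * fst (p x)) \<Longrightarrow> norm (h y - h z) \<le> snd (p x) * norm (y - z) powr \<sigma>"
    unfolding bchoice_iff by blast
  obtain D where D: "D \<subseteq> K" "finite D" "K \<subseteq> (\<Union>x\<in>D. ball x (fst (p x)))"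
  proof (rule compactE_image[OF K(1), of K "\<lambda>x. ball x (fst (p x))"])
    show "K \<subseteq> (\<Union>x\<in>K. ball x (fst (p x)))" using p(1) by (auto intro!: bexI)
  qed auto
  define \<delta> where "\<delta> = Min (insert 1 ((\<lambda>x. fst (p x)) ` D))"
  have \<delta>: "\<delta> > 0" "\<And>x. x \<in> D \<Longrightarrow> \<delta> \<le> fst (p x)" using D p(1) unfolding \<delta>_def by (auto intro!: Min_le)
  define C where "C = (\<Sum>x\<in>D. snd (p x))"
  have C: "snd (p x) \<le> C" if "x \<in> D" for x unfolding C_def using D p(2) that by (intro member_le_sum) auto
  have C0: "C \<ge> 0" unfolding C_def using D p(2) by (intro sum_nonneg) auto
  have "continuous_on K h" by (rule continuous_on_subset[OF lhol_continuous[OF h \<sigma>] K(2)])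
  then have "bounded (h ` K)" by (intro compact_imp_bounded compact_continuous_image K(1))
  then obtain B where B: "B > 0" "\<And>x. x \<in> K \<Longrightarrow> norm (h x) \<le> B" unfolding bounded_pos by auto
  have pd: "\<delta> powr \<sigma> > 0" using \<delta>(1) by simp
  show ?thesis
  proof (rule exI[of _ "C + 2 * B / \<delta> powr \<sigma>"], intro ballI)
    fix x y assume xy: "x \<in> K" "y \<in> K"
    have e: "(C + 2 * B / \<delta> powr \<sigma>) * dist x y powr \<sigma> = C * dist x y powr \<sigma> + 2 * B / \<delta> powr \<sigma> * dist x y powr \<sigma>"
      by (rule distrib_right)
    have n: "0 \<le> C * dist x y powr \<sigma>" "0 \<le> 2 * B / \<delta> powr \<sigma> * dist x y powr \<sigma>" using C0 B(1) pd by simp_all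
    show "norm (h x - h y) \<le> (C + 2 * B / \<delta> powr \<sigma>) * dist x y powr \<sigma>"
    proof (cases "dist x y < \<delta>")
      case True
      obtain w where w: "w \<in> D" "x \<in> ball w (fst (p w))" using D(3) xy(1) by auto
      have wK: "w \<in> K" using w(1) D(1) by auto
      have "x \<in> ball w (2 * fst (p w))" using w(2) p(1)[OF wK] by simp
      moreover have "y \<in> ball w (2 * fst (p w))"
        using w(2) \<delta>(2)[OF w(1)] True dist_triangle[of w y x] by simp
      ultimately have "norm (h x - h y) \<le> snd (p w) * dist x y powr \<sigma>" unfolding dist_norm by (rule p(3)[OF wK])
      also have "\<dots> \<le> C * dist x y powr \<sigma>" by (rule mult_right_mono[OF C[OF w(1)]]) simp
      finally show ?thesis using n e by linarith
    next
      case False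
      have "norm (h x - h y) \<le> 2 * B" using norm_triangle_ineq4[of "h x" "h y"] B(2)[OF xy(1)] B(2)[OF xy(2)] by linarith
      also have "\<dots> = 2 * B / \<delta> powr \<sigma> * \<delta> powr \<sigma>" using pd by simp
      also have "\<dots> \<le> 2 * B / \<delta> powr \<sigma> * dist x y powr \<sigma>"
        using False \<delta>(1) \<sigma> B(1) pd by (intro mult_left_mono powr_mono2) auto
      finally show ?thesis using n e by linarith
    qed
  qed
qed

lemma CH_imp_Ck_holder_loc:
  fixes g :: "'a::euclidean_space \<Rightarrow> 'b::real_normed_vector"
  assumes g: "CH m \<sigma> S g" and \<sigma>: "0 < \<sigma>" "\<sigma> \<le> 1"
  shows "Ck_holder_loc m \<sigma> S g"
  unfolding Ck_holder_loc_def Ck_on_def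
proof (intro conjI allI impI ballI)
  fix vs :: "'a list" and x assume vs: "set vs \<subseteq> Basis \<and> length vs < m" and x: "x \<in> S"
  then obtain j where j: "m - length vs = Suc j" by (metis Suc_diff_Suc)
  have "CH (Suc j) \<sigma> S (iter_deriv g vs)" using CH_iter_deriv[OF g, of vs] vs unfolding j by simp
  then show "iter_deriv g vs differentiable (at x)" using x by simp
next
  fix vs :: "'a list" assume "set vs \<subseteq> Basis \<and> length vs \<le> m"
  then have "CH (m - length vs) \<sigma> S (iter_deriv g vs)" by (intro CH_iter_deriv[OF g]) auto
  then show "continuous_on S (iter_deriv g vs)" by (rule lhol_continuous[OF CH_imp_lhol[OF _ \<sigma>] \<sigma>(1)])
next
  fix K and vs :: "'a list" assume K: "compact K \<and> K \<subseteq> S \<and> set vs \<subseteq> Basis \<and> length vs = m"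
  then have "CH (m - length vs) \<sigma> S (iter_deriv g vs)" by (intro CH_iter_deriv[OF g]) auto
  from lhol_compact[OF CH_imp_lhol[OF this \<sigma>] \<sigma>(1)] K
  show "\<exists>C. \<forall>x\<in>K. \<forall>y\<in>K. norm (iter_deriv g vs x - iter_deriv g vs y) \<le> C * dist x y powr \<sigma>" by blast
qed

section \<open>Regularity of the map defining the inclusion\<close>

lemma CH_ident:
  assumes S: "open S" shows "CH m 1 S (\<lambda>x::'a::euclidean_space. x)"
proof (cases m)
  case 0
  have "lhol 1 S (\<lambda>x. x)" unfolding lhol_def
  proof
    fix x assume "x \<in> S"
    then obtain r where "r > 0" "ball x r \<subseteq> S" using S open_contains_ball by blast
    then show "\<exists>r>0. \<exists>C\<ge>0. ball x r \<subseteq> S \<and> (\<forall>y\<in>ball x r. \<forall>z\<in>ball x r. norm (y - z) \<le> C * norm (y - z) powr 1)"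
      by (intro exI[of _ r] conjI exI[of _ 1]) auto
  qed
  then show ?thesis using 0 by simp
next
  case (Suc j)
  show ?thesis unfolding Suc by (rule CH_SucI[OF has_derivative_ident CH_const[OF S]])
qed

lemma CH_colv:
  fixes x y :: "'c::euclidean_space \<Rightarrow> real^'n" and a b :: "'c \<Rightarrow> real"
  assumes "CH m \<sigma> S x" "CH m \<sigma> S y" "CH m \<sigma> S a" "CH m \<sigma> S b"
  shows "CH m \<sigma> S (\<lambda>t. colv (x t) (y t) (a t) (b t))"
proof -
  have l: "bounded_linear (\<lambda>x::real^'n. colv x 0 0 0)" "bounded_linear (\<lambda>y::real^'n. colv 0 y 0 0)"
    "bounded_linear (\<lambda>a. colv (0::real^'n) 0 a 0)" "bounded_linear (\<lambda>b. colv (0::real^'n) 0 0 b)"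
    unfolding linear_conv_bounded_linear[symmetric] by (auto intro!: linearI simp: colv_arith)
  from CH_add[OF CH_add[OF CH_linear[OF l(1) assms(1)] CH_linear[OF l(2) assms(2)]] CH_add[OF CH_linear[OF l(3) assms(3)] CH_linear[OF l(4) assms(4)]]]
  show ?thesis by (simp add: colv_arith)
qed

lemma CH_pack:
  fixes X Y :: "'c::euclidean_space \<Rightarrow> real^2^'n"
  assumes \<sigma>: "0 < \<sigma>" "\<sigma> \<le> 1" and "CH m \<sigma> S X" "CH m \<sigma> S Y" "CH m \<sigma> S s"
  shows "CH m \<sigma> S (\<lambda>t. pack (X t) (Y t) (s t))"
proof -
  have c: "CH m \<sigma> S (\<lambda>t. column j (X t))" "CH m \<sigma> S (\<lambda>t. column j (Y t))" for j
    by (rule CH_linear[OF bounded_linear_column assms(3)], rule CH_linear[OF bounded_linear_column assms(4)])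
  have i: "CH m \<sigma> S (\<lambda>t. column j (X t) \<bullet> column k (Y t))" for j k
    by (rule CH_bilinear[OF bounded_bilinear_inner \<sigma> c])
  have neg: "CH m \<sigma> S (\<lambda>t. - f t)" if "CH m \<sigma> S f" for f :: "'c \<Rightarrow> 'd::real_normed_vector"
    by (rule CH_linear[OF bounded_linear_minus[OF bounded_linear_ident] that])
  have diff: "CH m \<sigma> S (\<lambda>t. f t - g t)" if "CH m \<sigma> S f" "CH m \<sigma> S g" for f g :: "'c \<Rightarrow> real"
    using CH_add[OF that(1) neg[OF that(2)]] by simp
  show ?thesis unfolding pack_def by (intro CH_Pair CH_colv c i neg diff assms(5))
qed

lemma CH_mat_grad:
  fixes f :: "real^2^'n \<Rightarrow> real"
  assumes "CH (Suc m) \<sigma> S f" shows "CH m \<sigma> S (mat_grad f)"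
proof -
  have "mat_grad f = (\<lambda>X. \<Sum>b\<in>Basis. frechet_derivative f (at X) b *\<^sub>R b)"
  proof
    fix X
    have "mat_grad f X = (\<Sum>b\<in>Basis. (mat_grad f X \<bullet> b) *\<^sub>R b)" by (rule euclidean_representation[symmetric])
    then show "mat_grad f X = (\<Sum>b\<in>Basis. frechet_derivative f (at X) b *\<^sub>R b)" by (simp add: inner_mat_grad)
  qed
  moreover have "CH m \<sigma> S (\<lambda>X. \<Sum>b\<in>Basis. frechet_derivative f (at X) b *\<^sub>R b)"
    using assms by (intro CH_sum[OF CH_open[OF assms] finite_Basis] CH_linear[OF bounded_linear_scaleR_left]) simp
  ultimately show ?thesis by simp
qed

section \<open>Translation of norm bounds and almost everywhere hypotheses\<close>

lemma Ck_norm_bound: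
  assumes "Ck_norm k S g \<le> ennreal \<alpha>" "\<alpha> \<ge> 0" "set vs \<subseteq> Basis" "length vs \<le> k" "x \<in> S"
  shows "norm (iter_deriv g vs x) \<le> \<alpha>"
proof -
  have "ennreal (norm (iter_deriv g vs x)) \<le> Ck_norm k S g" unfolding Ck_norm_def
    using assms(3,4) by (intro SUP_upper2[of vs] SUP_upper2[OF assms(5)]) auto
  then show ?thesis using assms(1,2) by (metis order.trans ennreal_le_iff)
qed

lemma C2_close_of_Ck_norm:
  fixes f :: "real^2^'n::{finite,linorder} \<Rightarrow> real"
  assumes f: "Ck_on (Suc (Suc m)) UNIV f" and n: "Ck_norm 2 (ball 0 \<rho>) (\<lambda>X. f X - area X) \<le> ennreal \<alpha>" and \<alpha>: "\<alpha> > 0"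
  shows "C2_close \<rho> \<alpha> f"
  unfolding C2_close_def
proof (intro conjI allI ballI)
  show "f differentiable (at X)" for X by (rule Ck_on_differentiable[OF f UNIV_I])
  show "(\<lambda>X. frechet_derivative f (at X) b) differentiable (at X)" if "b \<in> Basis" for b X
    by (rule Ck_on_differentiable[OF Ck_on_derivative[OF f that] UNIV_I])
  fix X b b' :: "real^2^'n::{finite,linorder}" assume X: "X \<in> ball 0 \<rho>" and b: "b \<in> Basis"
  show "\<bar>frechet_derivative (\<lambda>X. f X - area X) (at X) b\<bar> \<le> \<alpha>"
    using Ck_norm_bound[OF n less_imp_le[OF \<alpha>], of "[b]" X] b X by simp
  assume b': "b' \<in> Basis"
  show "\<bar>frechet_derivative (\<lambda>X. frechet_derivative (\<lambda>X. f X - area X) (at X) b) (at X) b'\<bar> \<le> \<alpha>"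
    using Ck_norm_bound[OF n less_imp_le[OF \<alpha>], of "[b', b]" X] b b' X by simp
qed

lemma grad_jacobian: "grad U x = mcols (jacobian U (at x))"
  by (simp add: grad_def mcols_def jacobian_def matrix_def column_def vec_eq_iff)

lemma AE_lebesgue_on_negligible:
  fixes S :: "'a::euclidean_space set"
  assumes "AE x in lebesgue_on S. P x" and S: "S \<in> sets lebesgue"
  obtains N where "negligible N" "\<And>x. x \<in> S \<Longrightarrow> x \<notin> N \<Longrightarrow> P x"
proof -
  obtain N where N: "{x \<in> space (lebesgue_on S). \<not> P x} \<subseteq> N" "emeasure (lebesgue_on S) N = 0" "N \<in> sets (lebesgue_on S)"
    using AE_E[OF assms(1)] by blast
  then have "N \<in> null_sets (lebesgue_on S)" by auto
  then have "N \<in> null_sets lebesgue" using S by (simp add: null_sets_restrict_space)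
  then have "negligible N" by (simp add: negligible_iff_null_sets)
  then show ?thesis using N(1) by (intro that[of N]) auto
qed

theorem theorem6p10:
  fixes R :: real
  assumes "R > 0"
  shows "\<exists>\<alpha>>0. \<forall>(\<Omega> :: (real^2) set) (k::nat)
            (f :: real^2^('n::{finite,linorder}) \<Rightarrow> real) (U :: real^2 \<Rightarrow> real^('n + 'n + 2)).
           bounded \<Omega> \<and> convex \<Omega> \<and> open \<Omega> \<and>
           k \<ge> 2 \<and> Ck_on k UNIV f \<and>
           Ck_norm 2 (ball 0 (2 * R)) (\<lambda>X. f X - area X) \<le> ennreal \<alpha> \<and>
           (\<exists>L. L-lipschitz_on \<Omega> U) \<and>
           Linf_norm \<Omega> (\<lambda>x. jacobian U (at x)) \<le> ereal R \<and>
           (AE x in lebesgue_on \<Omega>. U differentiable (at x) \<and> jacobian U (at x) \<in> C_set f) \<longrightarrow>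
           (\<exists>\<rho>. 0 < \<rho> \<and> \<rho> < 1 \<and> Ck_holder_loc (k - 1) \<rho> \<Omega> U)"
proof -
  \<comment> \<open>Coercivity is secured on the ball of radius 2 R, while the gradients stay within
    R: this is the margin r0 < r1 of \<open>abstract_regularity\<close>. The constant \<alpha> is
    fixed here, before k and f.\<close>
  have R2: "2 * R > 0" using assms by simp
  obtain M c \<alpha> where c: "c > 0" and \<alpha>: "\<alpha> > 0" and mon: "\<And>(f :: real^2^('n::{finite,linorder}) \<Rightarrow> real) X X'.
      C2_close (2 * R) \<alpha> f \<Longrightarrow> norm X < 2 * R \<Longrightarrow> norm X' < 2 * R \<Longrightarrow>
      (let z = pack X (mat_grad f X) (f X) - pack X' (mat_grad f X') (f X') in B_form M (fst z) (snd z) \<ge> c * (norm z)\<^sup>2)"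
    using monotone_perturbed[OF R2] by blast
  interpret null_form "B_form M :: real^('n + 'n + 2) \<Rightarrow> _" c by (rule null_form_B[OF c])
  have main: "\<exists>\<rho>. 0 < \<rho> \<and> \<rho> < 1 \<and> Ck_holder_loc (k - 1) \<rho> \<Omega> U"
    if O: "open \<Omega>" and k: "k \<ge> 2" and f: "Ck_on k UNIV f"
      and close: "Ck_norm 2 (ball 0 (2 * R)) (\<lambda>X. f X - area X) \<le> ennreal \<alpha>"
      and L: "L-lipschitz_on \<Omega> U" and bd: "Linf_norm \<Omega> (\<lambda>x. jacobian U (at x)) \<le> ereal R"
      and incl: "AE x in lebesgue_on \<Omega>. U differentiable (at x) \<and> jacobian U (at x) \<in> C_set f"
    for \<Omega> k L and f :: "real^2^('n::{finite,linorder}) \<Rightarrow> real" and U :: "real^2 \<Rightarrow> real^('n + 'n + 2)"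
  proof -
    \<comment> \<open>With k = m + 2, the gradient of f is of class C^(m, 1), hence so is \<Phi>,
      and the solution gains one order: m + 1 = k - 1.\<close>
    obtain m where m: "k = Suc (Suc m)" using k by (metis Suc_le_D numeral_2_eq_2 Suc_le_mono)
    have f2: "Ck_on (Suc (Suc m)) UNIV f" using f m by simp
    have C2: "C2_close (2 * R) \<alpha> f" by (rule C2_close_of_Ck_norm[OF f2 close \<alpha>])
    define \<Phi> where "\<Phi> = (\<lambda>z. pack (top_mat z) (mat_grad f (top_mat z)) (f (top_mat z)))"
    have fCH: "CH (Suc m) 1 UNIV f" by (rule Ck_on_imp_CH[OF open_UNIV f2])
    have tCH: "CH m 1 UNIV (top_mat :: _ \<Rightarrow> real^2^'n::{finite,linorder})"
      by (rule CH_linear[OF bounded_linear_top_mat CH_ident[OF open_UNIV]])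
    have \<Phi>: "CH m 1 UNIV \<Phi>"
      unfolding \<Phi>_def
      by (intro CH_pack tCH CH_compose[OF _ _ CH_mat_grad[OF fCH] tCH] CH_compose[OF _ _ CH_Suc_imp_CH[OF fCH] tCH]) auto
    have "AE x in lebesgue_on \<Omega>. ereal (norm (jacobian U (at x))) \<le> Linf_norm \<Omega> (\<lambda>x. jacobian U (at x))"
      unfolding Linf_norm_def by (rule esssup_AE)
    with incl have "AE x in lebesgue_on \<Omega>. U differentiable (at x) \<and> jacobian U (at x) \<in> C_set f \<and> norm (jacobian U (at x)) \<le> R"
    proof eventually_elim
      case (elim x)
      have "ereal (norm (jacobian U (at x))) \<le> ereal R" using elim(2) bd by (rule order.trans)
      then show ?case using elim(1) by simp
    qed
    then obtain N where N: "negligible N" "\<And>x. x \<in> \<Omega> \<Longrightarrow> x \<notin> N \<Longrightarrow>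
        U differentiable (at x) \<and> jacobian U (at x) \<in> C_set f \<and> norm (jacobian U (at x)) \<le> R"
      by (rule AE_lebesgue_on_negligible) (use O in auto)
    have "\<exists>\<mu>>0. \<mu> < 1 \<and> CH (Suc m) \<mu> \<Omega> U"
    proof (rule abstract_regularity[OF \<Phi> O L N(1)])
      show "U differentiable (at x)" if "x \<in> \<Omega>" "x \<notin> N" for x using N(2)[OF that] by blast
      show "norm (grad U x) \<le> R" if "x \<in> \<Omega>" "x \<notin> N" for x
        using N(2)[OF that] by (simp add: grad_jacobian norm_mcols)
      show "R < 2 * R" using assms by simp
      show "grad U x = \<Phi> (grad U x)" if x: "x \<in> \<Omega>" "x \<notin> N" for x
      proof -
        obtain X where "jacobian U (at x) = stack3 X (mat_grad f X ** J_mat) (transpose X ** mat_grad f X ** J_mat - f X *\<^sub>R J_mat)"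
          using N(2)[OF x] unfolding C_set_def by blast
        then have "grad U x = pack X (mat_grad f X) (f X)" by (simp only: grad_jacobian mcols_stack3)
        then show ?thesis by (simp only: \<Phi>_def top_mat_pack)
      qed
      show "c * (norm (\<Phi> y - \<Phi> z))\<^sup>2 \<le> Q (\<Phi> y - \<Phi> z)" if "norm y < 2 * R" "norm z < 2 * R" for y z
        using mon[OF C2 order.strict_trans1[OF norm_top_mat that(1)] order.strict_trans1[OF norm_top_mat that(2)]]
        unfolding Let_def Q_def \<Phi>_def .
    qed
    then obtain \<mu> where \<mu>: "\<mu> > 0" "\<mu> < 1" "CH (Suc m) \<mu> \<Omega> U" by blast
    have "Ck_holder_loc (Suc m) \<mu> \<Omega> U" by (rule CH_imp_Ck_holder_loc[OF \<mu>(3,1) less_imp_le[OF \<mu>(2)]])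
    then show ?thesis using \<mu>(1,2) m by (intro exI[of _ \<mu>]) simp
  qed
  show ?thesis
    by (rule exI[of _ \<alpha>], intro conjI[OF \<alpha>] allI impI, elim conjE exE) (rule main)
qed

end
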